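(* Let $R$ be a commutative ring with unit, let $X$ and $Y$ be topological spaces, let $f:X\to Y$ be a continuous map, let $\mathcal{U}=\{U_\alpha\}_{\alpha\in A}$ be an open cover of $Y$ such that $f^{-1}\mathcal{U}=\{f^{-1}(U_\alpha)\}_{\alpha\in A}$ is a locally finite cover of $X$, and let $X=K_0\supseteq K_1\supseteq\cdots\supseteq K_N=\emptyset$ be a filtration of $X$ by subspaces. Then there is a (first-quadrant, cohomological) spectral sequence of graded $R[t]$-modules converging to the persistent cohomology $PH^\ast(X)$ of the filtered space $X$, whose second page is $$E_2^{p,q}\cong H_\delta^p\big(\mathcal{U},\,PH^q(f^{-1}\mathcal{U})\big),$$ the Čech cohomology of the cover $\mathcal{U}$ with values in the presheaf $U\mapsto PH^q(f^{-1}(U))$ of persistent cohomology modules on $Y$.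
   Context: Cohomology $H^q(-)$ is singular cohomology with coefficients in $R$. The filtration is extended to all $i\in\mathbb{Z}$ by $K_i=X$ for $i\le 0$ and $K_i=\emptyset$ for $i\ge N$. Persistence modules: a persistence module over $R$ is a family of $R$-modules $\{M_i\}_{i\in\mathbb{Z}}$ with homomorphisms $\varphi_i:M_i\to M_{i+1}$. It is regarded as the graded $R[t]$-module $\alpha(\{M_i,\varphi_i\})=\bigoplus_{i\in\mathbb{Z}}M_i$ ($R[t]$ with its standard grading, $\deg t=1$), where $t\cdot m=\varphi_i(m)\in M_{i+1}$ for $m\in M_i$. Persistent cohomology: for the filtered space $X$, $PH^q(X)=\bigoplus_{i\in\mathbb{Z}}H^q(K_i)$, with $t$ acting by the restriction maps $H^q(K_i)\to H^q(K_{i+1})$ induced by the inclusions $K_{i+1}\subseteq K_i$. For an open set $U\subseteq Y$, the space $f^{-1}(U)$ is filtered by the subspaces $K_i\cap f^{-1}(U)$, so that $PH^q(f^{-1}(U))=\bigoplus_{i\in\mathbb{Z}}H^q(K_i\cap f^{-1}(U))$, with $t$ again acting by restriction. The assignment $U\mapsto PH^q(f^{-1}(U))$, with restriction maps induced by inclusions of open sets, is a presheaf of graded $R[t]$-modules on $Y$, denoted $PH^q(f^{-1}\mathcal{U})$. Čech cohomology: fix a total order on $A$ and write $U_{\alpha_0\dots\alpha_p}=U_{\alpha_0}\cap\dots\cap U_{\alpha_p}$. For a presheaf $\mathscr{F}$ of graded $R[t]$-modules on $Y$, $H_\delta^p(\mathcal{U},\mathscr{F})$ is the $p$-th cohomology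 of the complex $$C^p(\mathcal{U},\mathscr{F})=\prod_{\alpha_0<\dots<\alpha_p}\mathscr{F}(U_{\alpha_0\dots\alpha_p}),\qquad (\delta\omega)_{\alpha_0\dots\alpha_{p+1}}=\sum_{j=0}^{p+1}(-1)^j\,\omega_{\alpha_0\dots\widehat{\alpha_j}\dots\alpha_{p+1}}\big|_{U_{\alpha_0\dots\alpha_{p+1}}},$$ where products are taken in the category of graded $R[t]$-modules (i.e. separately in each degree $i$). Convergence: the spectral sequence consists of pages $E_r^{p,q}$ ($r\ge 2$, nonzero only for $p,q\ge 0$) of graded $R[t]$-modules with differentials $d_r:E_r^{p,q}\to E_r^{p+r,q-r+1}$ that are degree-preserving $R[t]$-linear maps. It converges to $PH^\ast(X)$ if for each $n$ there is a finite decreasing filtration $PH^n(X)=F^0\supseteq F^1\supseteq\dots\supseteq F^{n+1}=0$ by graded $R[t]$-submodules with $F^p/F^{p+1}\cong E_\infty^{p,n-p}$ as graded $R[t]$-modules for $0\le p\le n$. *)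

theory Defs
  imports "HOL-Homology.Homology" "HOL-Algebra.UnivPoly"
begin

section \<open>Quotient modules\<close>

text \<open>The fields \<open>mult\<close> and \<open>one\<close>, which the library's \<open>module\<close> record inherits from \<open>ring\<close>,
  play no role for modules and are left unspecified throughout.\<close>

definition quot_mod :: "('s, 'm, 'z) module_scheme \<Rightarrow> 'm set \<Rightarrow> ('s, 'm set) module" where
  "quot_mod M N =
    \<lparr>carrier = a_rcosets\<^bsub>M\<^esub> N, mult = undefined, one = undefined,
     zero = N, add = (\<lambda>C D. C <+>\<^bsub>M\<^esub> D),
     smult = (\<lambda>s C. \<Union>c\<in>C. N +>\<^bsub>M\<^esub> (s \<odot>\<^bsub>M\<^esub> c))\<rparr>"


section \<open>Singular cohomology with coefficients in a ring\<close>

text \<open>The \<open>R\<close>-module of \<open>q\<close>-cochains of \<open>T\<close> is \<open>Hom(C\<^sub>q(T), R)\<close>. A homomorphism is made a unique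
  function by being undefined off the singular chains of \<open>T\<close>.\<close>

definition cochain_mod ::
    "('r, 'z) ring_scheme \<Rightarrow> nat \<Rightarrow> 'x topology \<Rightarrow> ('r, 'x chain \<Rightarrow> 'r) module" where
  "cochain_mod R q T =
    \<lparr>carrier = hom (chain_group q T) (add_monoid R) \<inter> extensional (singular_chain_set q T),
     mult = undefined, one = undefined,
     zero = (\<lambda>c\<in>singular_chain_set q T. \<zero>\<^bsub>R\<^esub>),
     add = (\<lambda>u v. \<lambda>c\<in>singular_chain_set q T. u c \<oplus>\<^bsub>R\<^esub> v c),
     smult = (\<lambda>a u. \<lambda>c\<in>singular_chain_set q T. a \<otimes>\<^bsub>R\<^esub> u c)\<rparr>"

definition coboundary_map ::
    "nat \<Rightarrow> 'x topology \<Rightarrow> ('x chain \<Rightarrow> 'r) \<Rightarrow> ('x chain \<Rightarrow> 'r)" where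
  "coboundary_map q T u = (\<lambda>c\<in>singular_chain_set (Suc q) T. u (chain_boundary (Suc q) c))"

definition cocycles ::
    "('r, 'z) ring_scheme \<Rightarrow> nat \<Rightarrow> 'x topology \<Rightarrow> ('x chain \<Rightarrow> 'r) set" where
  "cocycles R q T =
    {u \<in> carrier (cochain_mod R q T). coboundary_map q T u = \<zero>\<^bsub>cochain_mod R (Suc q) T\<^esub>}"

definition coboundaries ::
    "('r, 'z) ring_scheme \<Rightarrow> nat \<Rightarrow> 'x topology \<Rightarrow> ('x chain \<Rightarrow> 'r) set" where
  "coboundaries R q T =
    (case q of 0 \<Rightarrow> {\<zero>\<^bsub>cochain_mod R 0 T\<^esub>}
     | Suc k \<Rightarrow> coboundary_map k T ` carrier (cochain_mod R k T))"

definition cohom ::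
    "('r, 'z) ring_scheme \<Rightarrow> nat \<Rightarrow> 'x topology \<Rightarrow> ('r, ('x chain \<Rightarrow> 'r) set) module" where
  "cohom R q T =
    quot_mod ((cochain_mod R q T)\<lparr>carrier := cocycles R q T\<rparr>) (coboundaries R q T)"

text \<open>The map \<open>H\<^sup>q(T) \<rightarrow> H\<^sup>q(S)\<close> induced by the inclusion of a subspace \<open>S\<close> of \<open>T\<close>:
  the class of \<open>u\<close> goes to the class of the restriction of \<open>u\<close> to chains in \<open>S\<close>.\<close>

definition cohom_restr ::
    "('r, 'z) ring_scheme \<Rightarrow> nat \<Rightarrow> 'x topology \<Rightarrow> ('x chain \<Rightarrow> 'r) set \<Rightarrow> ('x chain \<Rightarrow> 'r) set" where
  "cohom_restr R q S C =
    (\<Union>u\<in>C. coboundaries R q S +>\<^bsub>cochain_mod R q S\<^esub> restrict u (singular_chain_set q S))"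


section \<open>Graded \<open>R[t]\<close>-modules\<close>

text \<open>A graded \<open>R[t]\<close>-module is a module over \<open>UP R\<close> that is the internal direct sum of
  subgroups \<open>gr M i\<close>, for integers \<open>i\<close>, compatibly with \<open>deg t = 1\<close>.\<close>

record ('s, 'm) gmodule = "('s, 'm) module" +
  gr :: "int \<Rightarrow> 'm set"

definition graded_module ::
    "('r, 'z) ring_scheme \<Rightarrow> (nat \<Rightarrow> 'r, 'm) gmodule \<Rightarrow> bool" where
  "graded_module R M \<longleftrightarrow>
    module (UP R) M \<and>
    (\<forall>i. subgroup (gr M i) (add_monoid M)) \<and>
    (\<forall>i k. \<forall>a\<in>carrier R. \<forall>m\<in>gr M i. monom (UP R) a k \<odot>\<^bsub>M\<^esub> m \<in> gr M (i + int k)) \<and>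
    (\<forall>m\<in>carrier M. \<exists>!h. (\<forall>i. h i \<in> gr M i) \<and> finite {i. h i \<noteq> \<zero>\<^bsub>M\<^esub>} \<and>
       m = (\<Oplus>\<^bsub>M\<^esub>i\<in>{i. h i \<noteq> \<zero>\<^bsub>M\<^esub>}. h i))"

definition gmod_hom ::
    "('r, 'z) ring_scheme \<Rightarrow> (nat \<Rightarrow> 'r, 'm) gmodule \<Rightarrow> (nat \<Rightarrow> 'r, 'n) gmodule \<Rightarrow> ('m \<Rightarrow> 'n) set" where
  "gmod_hom R M N =
    {h \<in> hom (add_monoid M) (add_monoid N).
       (\<forall>s\<in>carrier (UP R). \<forall>m\<in>carrier M. h (s \<odot>\<^bsub>M\<^esub> m) = s \<odot>\<^bsub>N\<^esub> h m) \<and>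
       (\<forall>i. h ` gr M i \<subseteq> gr N i)}"

definition gmod_iso ::
    "('r, 'z) ring_scheme \<Rightarrow> (nat \<Rightarrow> 'r, 'm) gmodule \<Rightarrow> (nat \<Rightarrow> 'r, 'n) gmodule \<Rightarrow> bool" where
  "gmod_iso R M N \<longleftrightarrow>
    (\<exists>h\<in>gmod_hom R M N. bij_betw h (carrier M) (carrier N) \<and> (\<forall>i. h ` gr M i = gr N i))"

definition gsub :: "('s, 'm) gmodule \<Rightarrow> 'm set \<Rightarrow> ('s, 'm) gmodule" where
  "gsub M N = M\<lparr>carrier := N, gr := (\<lambda>i. gr M i \<inter> N)\<rparr>"

definition gquot :: "('s, 'm) gmodule \<Rightarrow> 'm set \<Rightarrow> ('s, 'm set) gmodule" where
  "gquot M N =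
    module.extend (quot_mod M N) (gmodule.fields (\<lambda>i. (\<lambda>m. N +>\<^bsub>M\<^esub> m) ` gr M i))"

definition graded_submodule ::
    "('r, 'z) ring_scheme \<Rightarrow> 'm set \<Rightarrow> (nat \<Rightarrow> 'r, 'm) gmodule \<Rightarrow> bool" where
  "graded_submodule R N M \<longleftrightarrow> submodule N (UP R) M \<and> graded_module R (gsub M N)"

definition gker :: "('s, 'm) gmodule \<Rightarrow> ('s, 'n) gmodule \<Rightarrow> ('m \<Rightarrow> 'n) \<Rightarrow> 'm set" where
  "gker M N h = {m \<in> carrier M. h m = \<zero>\<^bsub>N\<^esub>}"

text \<open>Products in the category of graded modules are formed degreewise: the homogeneous parts
  are the full products, and a general element is a finite sum of homogeneous families, that is,
  a family whose members have their components in a common finite set \<open>D\<close> of degrees.\<close>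

definition gprod :: "'i set \<Rightarrow> ('i \<Rightarrow> ('s, 'm) gmodule) \<Rightarrow> ('s, 'i \<Rightarrow> 'm) gmodule" where
  "gprod I M =
    \<lparr>carrier = {w \<in> extensional I. \<exists>D. finite D \<and>
        (\<forall>i\<in>I. \<exists>h. (\<forall>n\<in>D. h n \<in> gr (M i) n) \<and> w i = (\<Oplus>\<^bsub>M i\<^esub>n\<in>D. h n))},
     mult = undefined, one = undefined,
     zero = (\<lambda>i\<in>I. \<zero>\<^bsub>M i\<^esub>),
     add = (\<lambda>v w. \<lambda>i\<in>I. v i \<oplus>\<^bsub>M i\<^esub> w i),
     smult = (\<lambda>s w. \<lambda>i\<in>I. s \<odot>\<^bsub>M i\<^esub> w i),
     gr = (\<lambda>n. \<Pi>\<^sub>E i\<in>I. gr (M i) n)\<rparr>"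


section \<open>Persistence modules as graded \<open>R[t]\<close>-modules\<close>

text \<open>\<open>iter_map \<phi> i k\<close> is the composite \<open>M i \<rightarrow> M (i + k)\<close>, through which \<open>t^k\<close> acts on \<open>M i\<close>.\<close>

fun iter_map :: "(int \<Rightarrow> 'm \<Rightarrow> 'm) \<Rightarrow> int \<Rightarrow> nat \<Rightarrow> 'm \<Rightarrow> 'm" where
  "iter_map \<phi> i 0 m = m"
| "iter_map \<phi> i (Suc k) m = \<phi> (i + int k) (iter_map \<phi> i k m)"

text \<open>The direct sum of the \<open>M i\<close>, as the finitely supported families, with \<open>t\<close> acting by \<open>\<phi>\<close>.\<close>

definition pers_gmodule ::
    "('r, 'z) ring_scheme \<Rightarrow> (int \<Rightarrow> ('r, 'm) module) \<Rightarrow> (int \<Rightarrow> 'm \<Rightarrow> 'm) \<Rightarrow>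
     (nat \<Rightarrow> 'r, int \<Rightarrow> 'm) gmodule" where
  "pers_gmodule R M \<phi> =
    \<lparr>carrier = {m. (\<forall>i. m i \<in> carrier (M i)) \<and> finite {i. m i \<noteq> \<zero>\<^bsub>M i\<^esub>}},
     mult = undefined, one = undefined,
     zero = (\<lambda>i. \<zero>\<^bsub>M i\<^esub>),
     add = (\<lambda>m n i. m i \<oplus>\<^bsub>M i\<^esub> n i),
     smult = (\<lambda>p m j. \<Oplus>\<^bsub>M j\<^esub>k\<in>{..deg R p}.
        coeff (UP R) p k \<odot>\<^bsub>M j\<^esub> iter_map \<phi> (j - int k) k (m (j - int k))),
     gr = (\<lambda>i. {m. m i \<in> carrier (M i) \<and> (\<forall>j. j \<noteq> i \<longrightarrow> m j = \<zero>\<^bsub>M j\<^esub>)})\<rparr>"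

text \<open>Persistent cohomology of a decreasing family \<open>K\<close> of subspaces of \<open>X\<close>.\<close>

definition pers_cohom ::
    "('r, 'z) ring_scheme \<Rightarrow> nat \<Rightarrow> 'x topology \<Rightarrow> (int \<Rightarrow> 'x set) \<Rightarrow>
     (nat \<Rightarrow> 'r, int \<Rightarrow> ('x chain \<Rightarrow> 'r) set) gmodule" where
  "pers_cohom R q X K =
    pers_gmodule R (\<lambda>i. cohom R q (subtopology X (K i)))
      (\<lambda>i. cohom_restr R q (subtopology X (K (i + 1))))"

definition filt_ext :: "'x topology \<Rightarrow> (nat \<Rightarrow> 'x set) \<Rightarrow> nat \<Rightarrow> int \<Rightarrow> 'x set" where
  "filt_ext X K N i =
    (if i \<le> 0 then topspace X else if int N \<le> i then {} else K (nat i))"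


section \<open>Cech cohomology with values in a presheaf of graded modules\<close>

text \<open>\<open>res F U V\<close> is the restriction from the sections over \<open>U\<close> to those over \<open>V \<subseteq> U\<close>.\<close>

record ('s, 'y, 'm) gpresheaf =
  sec :: "'y set \<Rightarrow> ('s, 'm) gmodule"
  res :: "'y set \<Rightarrow> 'y set \<Rightarrow> 'm \<Rightarrow> 'm"

definition pers_presheaf ::
    "('r, 'z) ring_scheme \<Rightarrow> nat \<Rightarrow> 'x topology \<Rightarrow> (int \<Rightarrow> 'x set) \<Rightarrow> ('x \<Rightarrow> 'y) \<Rightarrow>
     (nat \<Rightarrow> 'r, 'y, int \<Rightarrow> ('x chain \<Rightarrow> 'r) set) gpresheaf" where
  "pers_presheaf R q X K f =
    \<lparr>sec = (\<lambda>U. pers_cohom R q X (\<lambda>i. K i \<inter> f -` U)),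
     res = (\<lambda>U V m i. cohom_restr R q (subtopology X (K i \<inter> f -` V)) (m i))\<rparr>"

text \<open>The tuples \<open>\<alpha>\<^sub>0 < \<dots> < \<alpha>\<^sub>p\<close> in \<open>A\<close>, for the total order \<open>L\<close> on \<open>A\<close>.\<close>

definition incr_tuples :: "('a \<times> 'a) set \<Rightarrow> 'a set \<Rightarrow> nat \<Rightarrow> 'a list set" where
  "incr_tuples L A p =
    {xs. length xs = Suc p \<and> set xs \<subseteq> A \<and> sorted_wrt (\<lambda>a b. (a, b) \<in> L \<and> a \<noteq> b) xs}"

definition cover_int :: "('a \<Rightarrow> 'y set) \<Rightarrow> 'a list \<Rightarrow> 'y set" where
  "cover_int U xs = (\<Inter>a\<in>set xs. U a)"

definition omit_nth :: "nat \<Rightarrow> 'a list \<Rightarrow> 'a list" where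
  "omit_nth j xs = take j xs @ drop (Suc j) xs"

definition cech_cochains ::
    "('a \<times> 'a) set \<Rightarrow> 'a set \<Rightarrow> ('a \<Rightarrow> 'y set) \<Rightarrow> ('s, 'y, 'm) gpresheaf \<Rightarrow> nat \<Rightarrow>
     ('s, 'a list \<Rightarrow> 'm) gmodule" where
  "cech_cochains L A U F p = gprod (incr_tuples L A p) (\<lambda>xs. sec F (cover_int U xs))"

definition cech_diff ::
    "('a \<times> 'a) set \<Rightarrow> 'a set \<Rightarrow> ('a \<Rightarrow> 'y set) \<Rightarrow> ('s, 'y, 'm) gpresheaf \<Rightarrow> nat \<Rightarrow>
     ('a list \<Rightarrow> 'm) \<Rightarrow> ('a list \<Rightarrow> 'm)" where
  "cech_diff L A U F p w =
    (\<lambda>xs\<in>incr_tuples L A (Suc p).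
       let M = sec F (cover_int U xs);
           \<rho> = (\<lambda>j. res F (cover_int U (omit_nth j xs)) (cover_int U xs) (w (omit_nth j xs)))
       in \<Oplus>\<^bsub>M\<^esub>j\<in>{..Suc p}. if even j then \<rho> j else \<ominus>\<^bsub>M\<^esub> \<rho> j)"

definition cech_cohom ::
    "('a \<times> 'a) set \<Rightarrow> 'a set \<Rightarrow> ('a \<Rightarrow> 'y set) \<Rightarrow> ('s, 'y, 'm) gpresheaf \<Rightarrow> nat \<Rightarrow>
     ('s, ('a list \<Rightarrow> 'm) set) gmodule" where
  "cech_cohom L A U F p =
    gquot
      (gsub (cech_cochains L A U F p)
        (gker (cech_cochains L A U F p) (cech_cochains L A U F (Suc p)) (cech_diff L A U F p)))
      (case p of 0 \<Rightarrow> {\<zero>\<^bsub>cech_cochains L A U F 0\<^esub>}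
       | Suc k \<Rightarrow> cech_diff L A U F k ` carrier (cech_cochains L A U F k))"


section \<open>Spectral sequences of graded \<open>R[t]\<close>-modules\<close>

text \<open>\<open>E r p q\<close> and \<open>d r p q : E r p q \<rightarrow> E r (p + r) (q - r + 1)\<close> are only meaningful for \<open>r \<ge> 2\<close>.
  All pages share one carrier type \<open>'m\<close>, so an existence claim has to choose it. The type
  \<open>int \<Rightarrow> (nat \<Rightarrow> 'a list \<Rightarrow> 'x chain \<Rightarrow> 'r) set\<close> holds, in each degree, the cosets of a subquotient of
  the total complex of the Cech double complex of singular cochains: a total cochain gives, for
  each \<open>p\<close> and each increasing \<open>(p + 1)\<close>-tuple of indices, a singular cochain.\<close>

definition spectral_sequence ::
    "('r, 'z) ring_scheme \<Rightarrow> (nat \<Rightarrow> int \<Rightarrow> int \<Rightarrow> (nat \<Rightarrow> 'r, 'm) gmodule) \<Rightarrow>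
     (nat \<Rightarrow> int \<Rightarrow> int \<Rightarrow> 'm \<Rightarrow> 'm) \<Rightarrow> bool" where
  "spectral_sequence R E d \<longleftrightarrow>
    (\<forall>r\<ge>2. \<forall>p q.
       graded_module R (E r p q) \<and>
       (p < 0 \<or> q < 0 \<longrightarrow> carrier (E r p q) = {\<zero>\<^bsub>E r p q\<^esub>}) \<and>
       d r p q \<in> gmod_hom R (E r p q) (E r (p + int r) (q - int r + 1)) \<and>
       (\<forall>x\<in>carrier (E r p q). d r (p + int r) (q - int r + 1) (d r p q x) =
          \<zero>\<^bsub>E r (p + 2 * int r) (q - 2 * int r + 2)\<^esub>) \<and>
       gmod_iso R (E (Suc r) p q)
         (gquot
           (gsub (E r p q) (gker (E r p q) (E r (p + int r) (q - int r + 1)) (d r p q)))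
           (d r (p - int r) (q + int r - 1) ` carrier (E r (p - int r) (q + int r - 1)))))"

text \<open>In position \<open>(p, q)\<close> of a first-quadrant spectral sequence every differential into
  page \<open>r\<close> vanishes once \<open>r > p\<close>, and every differential out of it once \<open>r > q + 1\<close>.
  So from page \<open>max (p + 1) (q + 2)\<close> on, consecutive pages are isomorphic at \<open>(p, q)\<close>.\<close>

definition E_infinity ::
    "(nat \<Rightarrow> int \<Rightarrow> int \<Rightarrow> 'g) \<Rightarrow> nat \<Rightarrow> nat \<Rightarrow> 'g" where
  "E_infinity E p q = E (max (p + 1) (q + 2)) (int p) (int q)"

definition converges_to ::
    "('r, 'z) ring_scheme \<Rightarrow> (nat \<Rightarrow> int \<Rightarrow> int \<Rightarrow> (nat \<Rightarrow> 'r, 'm) gmodule) \<Rightarrow>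
     (nat \<Rightarrow> (nat \<Rightarrow> 'r, 'n) gmodule) \<Rightarrow> bool" where
  "converges_to R E H \<longleftrightarrow>
    (\<forall>n. \<exists>F :: nat \<Rightarrow> 'n set.
       F 0 = carrier (H n) \<and> F (Suc n) = {\<zero>\<^bsub>H n\<^esub>} \<and>
       (\<forall>p\<le>Suc n. graded_submodule R (F p) (H n)) \<and>
       (\<forall>p\<le>n. F (Suc p) \<subseteq> F p \<and>
          gmod_iso R (gquot (gsub (H n) (F p)) (F (Suc p))) (E_infinity E p (n - p))))"


section \<open>Covers\<close>

text \<open>Local finiteness is that of an indexed family; \<open>locally_finite_in\<close>
  only sees the set of its members and ignores repetitions.\<close>

definition locally_finite_family :: "'x topology \<Rightarrow> 'a set \<Rightarrow> ('a \<Rightarrow> 'x set) \<Rightarrow> bool" where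
  "locally_finite_family X A B \<longleftrightarrow>
    (\<forall>a\<in>A. B a \<subseteq> topspace X) \<and>
    (\<forall>x\<in>topspace X. \<exists>V. openin X V \<and> x \<in> V \<and> finite {a \<in> A. B a \<inter> V \<noteq> {}})"

end

theory Submission imports Defs begin

text \<open>In each filtration degree \<open>i\<close>, the singular cochains of the intersections
  \<open>K i \<inter> f -` cover_int U xs\<close> form a double complex. Its rows are exact: a cochain only has to be known on
  single simplices, so choosing for every simplex a member of the cover that contains its image
  gives a contraction, and no local finiteness is involved. The rows are augmented by the singular
  cochains of \<open>K i\<close>; the kernel of the augmentation consists of the cochains that vanish on small
  simplices, and it is acyclic by iterated subdivision. Hence the total complex computes the
  cohomology of \<open>K i\<close>, and filtering it by columns gives a spectral sequence whose second page is
  the Cech cohomology of the vertical cohomology.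

  Everything is natural in \<open>i\<close>. The pages are subquotients \<open>Z\<^sub>r / B\<^sub>r\<close> of the total complex, taken
  in each degree \<open>i\<close>, and a graded \<open>R[t]\<close>-module isomorphism between subquotients is obtained from
  surjections out of a common persistence module with the same kernel.\<close>

text \<open>The obstacle is the interplay of products with gradings. A Cech cochain with values in
  persistent cohomology has all its members in one common finite set of degrees, so it is not an
  arbitrary family of elements of the graded modules. Working degree by degree absorbs this: a
  finitely supported family, indexed by \<open>i\<close>, of cochains of the double complex in
  degree \<open>i\<close> becomes exactly such a bounded cochain once classes are taken. What
  remains is that preimages and primitives, which are found in each degree separately by choice, can
  be taken finitely supported; they can, because zero may be chosen over zero. The augmentation is
  not injective, since a singular cochain is not determined by its values on small simplices. The
  comparison with the cohomology of \<open>K i\<close> therefore corrects cochains by elements of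
  the acyclic kernel. All pages must also share one type. An iterated quotient of quotients would
  change the type from page to page, so every page is a set of cosets of total cochains, with the
  classical numerators and denominators, and only afterwards compared with the homology of the page
  before.\<close>

section \<open>Homomorphisms and submodules of modules over a commutative ring\<close>

definition mod_hom ::
    "('r, 'z) ring_scheme \<Rightarrow> ('r, 'm, 'u) module_scheme \<Rightarrow> ('r, 'n, 'v) module_scheme \<Rightarrow> ('m \<Rightarrow> 'n) \<Rightarrow> bool" where
  "mod_hom R M N h \<longleftrightarrow>
    h \<in> carrier M \<rightarrow> carrier N \<and>
    (\<forall>x\<in>carrier M. \<forall>y\<in>carrier M. h (x \<oplus>\<^bsub>M\<^esub> y) = h x \<oplus>\<^bsub>N\<^esub> h y) \<and>
    (\<forall>a\<in>carrier R. \<forall>x\<in>carrier M. h (a \<odot>\<^bsub>M\<^esub> x) = a \<odot>\<^bsub>N\<^esub> h x)"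

lemma mod_homI:
  assumes "\<And>x. x \<in> carrier M \<Longrightarrow> h x \<in> carrier N"
    and "\<And>x y. x \<in> carrier M \<Longrightarrow> y \<in> carrier M \<Longrightarrow> h (x \<oplus>\<^bsub>M\<^esub> y) = h x \<oplus>\<^bsub>N\<^esub> h y"
    and "\<And>a x. a \<in> carrier R \<Longrightarrow> x \<in> carrier M \<Longrightarrow> h (a \<odot>\<^bsub>M\<^esub> x) = a \<odot>\<^bsub>N\<^esub> h x"
  shows "mod_hom R M N h"
  using assms by (auto simp: mod_hom_def)

lemma mod_hom_closed: "mod_hom R M N h \<Longrightarrow> x \<in> carrier M \<Longrightarrow> h x \<in> carrier N"
  and mod_hom_add: "mod_hom R M N h \<Longrightarrow> x \<in> carrier M \<Longrightarrow> y \<in> carrier M \<Longrightarrow>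
        h (x \<oplus>\<^bsub>M\<^esub> y) = h x \<oplus>\<^bsub>N\<^esub> h y"
  and mod_hom_smult: "mod_hom R M N h \<Longrightarrow> a \<in> carrier R \<Longrightarrow> x \<in> carrier M \<Longrightarrow>
        h (a \<odot>\<^bsub>M\<^esub> x) = a \<odot>\<^bsub>N\<^esub> h x"
  by (auto simp: mod_hom_def)

lemma (in abelian_group) a_inv_zero [simp]: "\<ominus> \<zero> = \<zero>"
  by (intro minus_equality) auto

lemma mod_hom_zero:
  assumes "module R M" "module R N" "mod_hom R M N h"
  shows "h \<zero>\<^bsub>M\<^esub> = \<zero>\<^bsub>N\<^esub>"
proof -
  interpret M: module R M by fact
  interpret N: module R N by fact
  have "h \<zero>\<^bsub>M\<^esub> = h (\<zero>\<^bsub>R\<^esub> \<odot>\<^bsub>M\<^esub> \<zero>\<^bsub>M\<^esub>)" by simp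
  also have "\<dots> = \<zero>\<^bsub>R\<^esub> \<odot>\<^bsub>N\<^esub> h \<zero>\<^bsub>M\<^esub>" using assms(3) by (intro mod_hom_smult) auto
  also have "\<dots> = \<zero>\<^bsub>N\<^esub>" using mod_hom_closed[OF assms(3)] by simp
  finally show ?thesis .
qed

lemma mod_hom_neg:
  assumes "module R M" "module R N" "mod_hom R M N h" "x \<in> carrier M"
  shows "h (\<ominus>\<^bsub>M\<^esub> x) = \<ominus>\<^bsub>N\<^esub> h x"
proof -
  interpret M: module R M by fact
  interpret N: module R N by fact
  have "h (\<ominus>\<^bsub>M\<^esub> x) \<oplus>\<^bsub>N\<^esub> h x = h (\<ominus>\<^bsub>M\<^esub> x \<oplus>\<^bsub>M\<^esub> x)"
    using assms by (simp add: mod_hom_add[OF assms(3)])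
  also have "\<dots> = \<zero>\<^bsub>N\<^esub>" using assms by (simp add: M.l_neg mod_hom_zero[OF assms(1-3)])
  finally show ?thesis
    using assms(4) mod_hom_closed[OF assms(3)] by (simp add: N.minus_equality)
qed

lemma mod_hom_diff:
  assumes "module R M" "module R N" "mod_hom R M N h" "x \<in> carrier M" "y \<in> carrier M"
  shows "h (x \<ominus>\<^bsub>M\<^esub> y) = h x \<ominus>\<^bsub>N\<^esub> h y"
proof -
  interpret M: module R M by fact
  interpret N: module R N by fact
  show ?thesis using assms by (simp add: a_minus_def mod_hom_add[OF assms(3)] mod_hom_neg[OF assms(1-3)])
qed

lemma mod_hom_finsum:
  assumes "module R M" "module R N" "mod_hom R M N h" "f \<in> A \<rightarrow> carrier M"
  shows "h (\<Oplus>\<^bsub>M\<^esub>a\<in>A. f a) = (\<Oplus>\<^bsub>N\<^esub>a\<in>A. h (f a))"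
proof -
  interpret M: module R M by fact
  interpret N: module R N by fact
  show ?thesis
  proof (cases "finite A")
    case True
    then show ?thesis using assms(4)
    proof (induction A)
      case empty
      then show ?case using assms by (simp add: mod_hom_zero[OF assms(1-3)])
    next
      case (insert a A)
      then have "f \<in> A \<rightarrow> carrier M" "f a \<in> carrier M" by auto
      then show ?case
        using insert assms(3) mod_hom_closed[OF assms(3)]
        by (simp add: mod_hom_add[OF assms(3)] Pi_iff)
    qed
  next
    \<comment> \<open>A \<open>finsum\<close> over an infinite set is zero by convention, so both
      sides are zero.\<close>
    case False
    then show ?thesis using assms by (simp add: finsum_def finprod_def mod_hom_zero[OF assms(1-3)])
  qed
qed

lemma mod_hom_comp:
  "mod_hom R M N h \<Longrightarrow> mod_hom R N P k \<Longrightarrow> mod_hom R M P (\<lambda>x. k (h x))"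
  by (simp add: mod_hom_def Pi_iff)

lemma mod_hom_restrict:
  "mod_hom R M N h \<Longrightarrow> Z \<subseteq> carrier M \<Longrightarrow> h ` Z \<subseteq> W \<Longrightarrow>
    mod_hom R (M\<lparr>carrier := Z\<rparr>) (N\<lparr>carrier := W\<rparr>) h"
  by (simp add: mod_hom_def Pi_iff subset_iff image_subset_iff)

lemma mod_hom_restrict_dom:
  "mod_hom R M N h \<Longrightarrow> Z \<subseteq> carrier M \<Longrightarrow> mod_hom R (M\<lparr>carrier := Z\<rparr>) N h"
  by (simp add: mod_hom_def Pi_iff subset_iff)

text \<open>Being a module is an equational property, apart from the existence of inverses.\<close>

lemma module_image:
  assumes "module R M" and h: "h ` carrier M = carrier N"
    and add: "\<And>x y. x \<in> carrier M \<Longrightarrow> y \<in> carrier M \<Longrightarrow> h (x \<oplus>\<^bsub>M\<^esub> y) = h x \<oplus>\<^bsub>N\<^esub> h y"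
    and smult: "\<And>a x. a \<in> carrier R \<Longrightarrow> x \<in> carrier M \<Longrightarrow> h (a \<odot>\<^bsub>M\<^esub> x) = a \<odot>\<^bsub>N\<^esub> h x"
    and zero: "h \<zero>\<^bsub>M\<^esub> = \<zero>\<^bsub>N\<^esub>"
  shows "module R N"
proof -
  interpret M: module R M by fact
  have N: "\<exists>x\<in>carrier M. y = h x" if "y \<in> carrier N" for y using that h by auto
  have hc: "h x \<in> carrier N" if "x \<in> carrier M" for x using that h by auto
  show ?thesis
  proof (intro moduleI abelian_groupI)
    fix x y assume "x \<in> carrier N" "y \<in> carrier N"
    then obtain x' y' where "x' \<in> carrier M" "x = h x'" "y' \<in> carrier M" "y = h y'" using N by blast
    then show "x \<oplus>\<^bsub>N\<^esub> y \<in> carrier N" "x \<oplus>\<^bsub>N\<^esub> y = y \<oplus>\<^bsub>N\<^esub> x"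
      by (simp_all add: add[symmetric] hc M.a_comm)
    fix z assume "z \<in> carrier N"
    then obtain z' where "z' \<in> carrier M" "z = h z'" using N by blast
    then show "x \<oplus>\<^bsub>N\<^esub> y \<oplus>\<^bsub>N\<^esub> z = x \<oplus>\<^bsub>N\<^esub> (y \<oplus>\<^bsub>N\<^esub> z)"
      using \<open>x = h x'\<close> \<open>x' \<in> _\<close> \<open>y = h y'\<close> \<open>y' \<in> _\<close> by (simp add: add[symmetric] M.a_assoc)
  next
    fix x assume "x \<in> carrier N"
    then obtain x' where x: "x' \<in> carrier M" "x = h x'" using N by blast
    then show "\<zero>\<^bsub>N\<^esub> \<oplus>\<^bsub>N\<^esub> x = x" by (simp add: add[symmetric] zero[symmetric])
    show "\<exists>y\<in>carrier N. y \<oplus>\<^bsub>N\<^esub> x = \<zero>\<^bsub>N\<^esub>"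
      using x by (intro bexI[of _ "h (\<ominus>\<^bsub>M\<^esub> x')"]) (simp_all add: add[symmetric] zero[symmetric] hc M.l_neg)
    show "\<one>\<^bsub>R\<^esub> \<odot>\<^bsub>N\<^esub> x = x" using x by (simp add: smult[symmetric])
  next
    fix a x assume "a \<in> carrier R" "x \<in> carrier N"
    then obtain x' where x: "x' \<in> carrier M" "x = h x'" "a \<in> carrier R" using N by blast
    then show "a \<odot>\<^bsub>N\<^esub> x \<in> carrier N" by (simp add: smult[symmetric] hc)
  next
    fix a b x assume "a \<in> carrier R" "b \<in> carrier R" "x \<in> carrier N"
    then obtain x' where x: "x' \<in> carrier M" "x = h x'" "a \<in> carrier R" "b \<in> carrier R" using N by blast
    then show "(a \<oplus>\<^bsub>R\<^esub> b) \<odot>\<^bsub>N\<^esub> x = (a \<odot>\<^bsub>N\<^esub> x) \<oplus>\<^bsub>N\<^esub> (b \<odot>\<^bsub>N\<^esub> x)"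
      "(a \<otimes>\<^bsub>R\<^esub> b) \<odot>\<^bsub>N\<^esub> x = a \<odot>\<^bsub>N\<^esub> (b \<odot>\<^bsub>N\<^esub> x)"
      by (simp_all add: smult[symmetric] add[symmetric] M.smult_l_distr M.smult_assoc1)
  next
    fix a x y assume "a \<in> carrier R" "x \<in> carrier N" "y \<in> carrier N"
    then obtain x' y' where "x' \<in> carrier M" "x = h x'" "y' \<in> carrier M" "y = h y'" "a \<in> carrier R"
      using N by blast
    then show "a \<odot>\<^bsub>N\<^esub> (x \<oplus>\<^bsub>N\<^esub> y) = (a \<odot>\<^bsub>N\<^esub> x) \<oplus>\<^bsub>N\<^esub> (a \<odot>\<^bsub>N\<^esub> y)"
      by (simp add: smult[symmetric] add[symmetric] M.smult_r_distr)
  next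
    show "\<zero>\<^bsub>N\<^esub> \<in> carrier N" using hc[OF M.zero_closed] zero by simp
  qed (rule M.R.is_cring)
qed

lemma submodule_subset: "submodule Z R M \<Longrightarrow> Z \<subseteq> carrier M"
  and submodule_zero: "submodule Z R M \<Longrightarrow> \<zero>\<^bsub>M\<^esub> \<in> Z"
  and submodule_add: "submodule Z R M \<Longrightarrow> x \<in> Z \<Longrightarrow> y \<in> Z \<Longrightarrow> x \<oplus>\<^bsub>M\<^esub> y \<in> Z"
  and submodule_neg: "submodule Z R M \<Longrightarrow> x \<in> Z \<Longrightarrow> \<ominus>\<^bsub>M\<^esub> x \<in> Z"
  and submodule_smult: "submodule Z R M \<Longrightarrow> a \<in> carrier R \<Longrightarrow> x \<in> Z \<Longrightarrow> a \<odot>\<^bsub>M\<^esub> x \<in> Z"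
  unfolding submodule_def submodule_axioms_def
  using subgroup.subset[of Z "add_monoid M"] subgroup.one_closed[of Z "add_monoid M"]
    subgroup.m_closed[of Z "add_monoid M"] subgroup.m_inv_closed[of Z "add_monoid M"]
  by (auto simp: a_inv_def)

lemma submodule_diff: "submodule Z R M \<Longrightarrow> x \<in> Z \<Longrightarrow> y \<in> Z \<Longrightarrow> x \<ominus>\<^bsub>M\<^esub> y \<in> Z"
  by (simp add: a_minus_def submodule_add submodule_neg)

lemma module_restrict: "submodule Z R M \<Longrightarrow> module R M \<Longrightarrow> module R (M\<lparr>carrier := Z\<rparr>)"
  by (rule submodule.submodule_is_module)

text \<open>The additive inverse is defined through the carrier of the record, so shrinking the
  carrier changes the term. Uniqueness of inverses in the restricted module identifies the
  two.\<close>

lemma a_inv_restrict: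
  assumes "module R M" "submodule Z R M" "x \<in> Z"
  shows "\<ominus>\<^bsub>M\<lparr>carrier := Z\<rparr>\<^esub> x = \<ominus>\<^bsub>M\<^esub> x"
proof -
  interpret M: module R M by fact
  interpret Z: module R "M\<lparr>carrier := Z\<rparr>" using assms module_restrict by blast
  show ?thesis
    using assms submodule_subset[OF assms(2)] submodule_neg[OF assms(2)] M.l_neg[of x]
    by (intro Z.minus_equality) auto
qed

lemma a_minus_restrict:
  assumes "module R M" "submodule Z R M" "x \<in> Z" "y \<in> Z"
  shows "x \<ominus>\<^bsub>M\<lparr>carrier := Z\<rparr>\<^esub> y = x \<ominus>\<^bsub>M\<^esub> y"
  using assms by (simp add: a_minus_def a_inv_restrict)

lemma submodule_restrict:
  assumes "module R M" "submodule Z R M" "submodule B R M" "B \<subseteq> Z"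
  shows "submodule B R (M\<lparr>carrier := Z\<rparr>)"
proof -
  interpret Z: module R "M\<lparr>carrier := Z\<rparr>" using assms module_restrict by blast
  have "\<ominus>\<^bsub>M\<lparr>carrier := Z\<rparr>\<^esub> b \<in> B" if "b \<in> B" for b
    using that assms by (subst a_inv_restrict[OF assms(1,2)]) (auto intro: submodule_neg)
  with assms show ?thesis
    by (intro Z.submoduleI) (auto intro: submodule_zero submodule_add submodule_smult)
qed

lemma submodule_image:
  assumes "module R M" "module R N" "mod_hom R M N h" "submodule Z R M"
  shows "submodule (h ` Z) R N"
proof -
  interpret M: module R M by fact
  interpret N: module R N by fact
  have Z: "z \<in> carrier M" if "z \<in> Z" for z using that submodule_subset[OF assms(4)] by auto
  show ?thesis
  proof (intro N.submoduleI)
    show "h ` Z \<subseteq> carrier N" using Z mod_hom_closed[OF assms(3)] by auto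
    show "\<zero>\<^bsub>N\<^esub> \<in> h ` Z"
      using submodule_zero[OF assms(4)] mod_hom_zero[OF assms(1-3), symmetric] by blast
  next
    fix a assume "a \<in> h ` Z" then show "\<ominus>\<^bsub>N\<^esub> a \<in> h ` Z"
      using Z assms submodule_neg[OF assms(4)] by (auto simp: mod_hom_neg[OF assms(1-3), symmetric])
  next
    fix a b assume "a \<in> h ` Z" "b \<in> h ` Z" then show "a \<oplus>\<^bsub>N\<^esub> b \<in> h ` Z"
      using Z assms submodule_add[OF assms(4)]
      by (auto simp: mod_hom_add[OF assms(3), symmetric])
  next
    fix a b assume "a \<in> carrier R" "b \<in> h ` Z" then show "a \<odot>\<^bsub>N\<^esub> b \<in> h ` Z"
      using Z assms submodule_smult[OF assms(4)]
      by (auto simp: mod_hom_smult[OF assms(3), symmetric])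
  qed
qed

text \<open>Stated relative to \<open>Z\<close> because the approximate cycles of a filtered complex
  have this form: elements of one filtration step whose boundary lies in another.\<close>

lemma submodule_vimage:
  assumes "module R M" "module R N" "mod_hom R M N h" "submodule Z R M" "submodule W R N"
  shows "submodule {x \<in> Z. h x \<in> W} R M"
proof -
  interpret M: module R M by fact
  have Z: "z \<in> carrier M" if "z \<in> Z" for z using that submodule_subset[OF assms(4)] by auto
  show ?thesis
    using assms Z
    by (intro M.submoduleI)
       (auto simp: mod_hom_zero[OF assms(1-3)] mod_hom_neg[OF assms(1-3)] mod_hom_add[OF assms(3)] mod_hom_smult[OF assms(3)]
         intro: submodule_zero submodule_add submodule_neg submodule_smult)
qed

text \<open>The denominators of the pages of a filtered complex are sums of two submodules; this is
  where their closure properties come from.\<close>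

lemma submodule_sum:
  assumes "module R M" "submodule Z R M" "submodule W R M"
  shows "submodule {z \<oplus>\<^bsub>M\<^esub> w | z w. z \<in> Z \<and> w \<in> W} R M"
proof -
  interpret M: module R M by fact
  have Z: "z \<in> carrier M" if "z \<in> Z" for z using that submodule_subset[OF assms(2)] by auto
  have W: "z \<in> carrier M" if "z \<in> W" for z using that submodule_subset[OF assms(3)] by auto
  show ?thesis
  proof (intro M.submoduleI; clarsimp)
    show "z \<oplus>\<^bsub>M\<^esub> w \<in> carrier M" if "z \<in> Z" "w \<in> W" for z w using that Z W by auto
    show "\<exists>z w. \<zero>\<^bsub>M\<^esub> = z \<oplus>\<^bsub>M\<^esub> w \<and> z \<in> Z \<and> w \<in> W"
      using submodule_zero[OF assms(2)] submodule_zero[OF assms(3)]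
      by (intro exI[of _ "\<zero>\<^bsub>M\<^esub>"]) simp
    show "\<exists>z' w'. \<ominus>\<^bsub>M\<^esub> (z \<oplus>\<^bsub>M\<^esub> w) = z' \<oplus>\<^bsub>M\<^esub> w' \<and> z' \<in> Z \<and> w' \<in> W" if "z \<in> Z" "w \<in> W" for z w
      using that Z W submodule_neg[OF assms(2)] submodule_neg[OF assms(3)]
      by (intro exI[of _ "\<ominus>\<^bsub>M\<^esub> z"] exI[of _ "\<ominus>\<^bsub>M\<^esub> w"]) (simp add: M.minus_add)
    show "\<exists>u v. z \<oplus>\<^bsub>M\<^esub> w \<oplus>\<^bsub>M\<^esub> (z' \<oplus>\<^bsub>M\<^esub> w') = u \<oplus>\<^bsub>M\<^esub> v \<and> u \<in> Z \<and> v \<in> W"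
      if "z \<in> Z" "w \<in> W" "z' \<in> Z" "w' \<in> W" for z w z' w'
      using that Z W assms
      by (intro exI[of _ "z \<oplus>\<^bsub>M\<^esub> z'"] exI[of _ "w \<oplus>\<^bsub>M\<^esub> w'"])
         (simp add: M.a_ac submodule_add[OF assms(2)] submodule_add[OF assms(3)])
    show "\<exists>u v. a \<odot>\<^bsub>M\<^esub> (z \<oplus>\<^bsub>M\<^esub> w) = u \<oplus>\<^bsub>M\<^esub> v \<and> u \<in> Z \<and> v \<in> W"
      if "a \<in> carrier R" "z \<in> Z" "w \<in> W" for a z w
      using that Z W submodule_smult[OF assms(2)] submodule_smult[OF assms(3)]
      by (intro exI[of _ "a \<odot>\<^bsub>M\<^esub> z"] exI[of _ "a \<odot>\<^bsub>M\<^esub> w"]) (simp add: M.smult_r_distr)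
  qed
qed

lemma mod_hom_const_zero:
  assumes "module R M" "module R N" shows "mod_hom R M N (\<lambda>_. \<zero>\<^bsub>N\<^esub>)"
proof -
  interpret N: module R N by fact
  show ?thesis by (intro mod_homI) auto
qed

lemma mod_hom_plus:
  assumes "module R M" "module R N" "mod_hom R M N h" "mod_hom R M N k"
  shows "mod_hom R M N (\<lambda>x. h x \<oplus>\<^bsub>N\<^esub> k x)"
proof -
  interpret M: module R M by fact
  interpret N: module R N by fact
  note [simp] = mod_hom_closed[OF assms(3)] mod_hom_closed[OF assms(4)]
  show ?thesis
    by (intro mod_homI) (auto simp: mod_hom_add[OF assms(3)] mod_hom_add[OF assms(4)] N.a_ac
      mod_hom_smult[OF assms(3)] mod_hom_smult[OF assms(4)] N.smult_r_distr)
qed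

lemma mod_hom_uminus:
  assumes "module R M" "module R N" "mod_hom R M N h"
  shows "mod_hom R M N (\<lambda>x. \<ominus>\<^bsub>N\<^esub> h x)"
proof -
  interpret M: module R M by fact
  interpret N: module R N by fact
  note [simp] = mod_hom_closed[OF assms(3)]
  show ?thesis
    by (intro mod_homI) (auto simp: mod_hom_add[OF assms(3)] N.minus_add
      mod_hom_smult[OF assms(3)] N.smult_r_minus)
qed

lemma mod_hom_sum:
  assumes "module R M" "module R N" "\<And>j. j \<in> J \<Longrightarrow> mod_hom R M N (h j)"
  shows "mod_hom R M N (\<lambda>x. \<Oplus>\<^bsub>N\<^esub>j\<in>J. h j x)"
proof (cases "finite J")
  case True
  interpret M: module R M by fact
  interpret N: module R N by fact
  from True assms(3) show ?thesis
  proof (induction J)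
    case empty
    show ?case using assms by (simp add: mod_hom_const_zero)
  next
    case (insert j J)
    have "(\<Oplus>\<^bsub>N\<^esub>i\<in>insert j J. h i x) = h j x \<oplus>\<^bsub>N\<^esub> (\<Oplus>\<^bsub>N\<^esub>i\<in>J. h i x)" if "x \<in> carrier M" for x
      using insert that by (intro N.finsum_insert) (auto intro: mod_hom_closed)
    moreover have "mod_hom R M N (\<lambda>x. h j x \<oplus>\<^bsub>N\<^esub> (\<Oplus>\<^bsub>N\<^esub>i\<in>J. h i x))"
      using insert assms by (intro mod_hom_plus) auto
    \<comment> \<open>The two functions agree only on \<open>carrier M\<close>, which is all that
      \<open>mod_hom\<close> looks at.\<close>
    ultimately show ?case by (simp add: mod_hom_def Pi_iff M.a_closed M.smult_closed)
  qed
next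
  case False
  then show ?thesis using assms by (simp add: finsum_def finprod_def mod_hom_const_zero)
qed

section \<open>Quotients\<close>

lemma a_r_coset_mem: "y \<in> N +>\<^bsub>M\<^esub> x \<longleftrightarrow> (\<exists>n\<in>N. y = n \<oplus>\<^bsub>M\<^esub> x)"
  by (auto simp: a_r_coset_def r_coset_def)

text \<open>A coset depends on the addition only and not on the carrier. Hence the elements of a
  subquotient Z/B are written as cosets in the ambient module throughout.\<close>

lemma a_r_coset_cong: "add M = add M' \<Longrightarrow> N +>\<^bsub>M\<^esub> x = N +>\<^bsub>M'\<^esub> x"
  by (simp add: a_r_coset_def r_coset_def)

lemma a_r_coset_restrict [simp]: "N +>\<^bsub>M\<lparr>carrier := Z\<rparr>\<^esub> x = N +>\<^bsub>M\<^esub> x"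
  by (rule a_r_coset_cong) simp

text \<open>The map induced on cosets, as a union over all representatives, so that none has to be
  chosen. Scalar multiplication in \<open>quot_mod\<close> and the restriction
  \<open>cohom_restr\<close> are instances.\<close>

definition coset_map :: "('m, 'u) ring_scheme \<Rightarrow> 'm set \<Rightarrow> ('k \<Rightarrow> 'm) \<Rightarrow> 'k set \<Rightarrow> 'm set" where
  "coset_map M N h C = (\<Union>c\<in>C. N +>\<^bsub>M\<^esub> h c)"

lemma coset_self: "module R M \<Longrightarrow> submodule N R M \<Longrightarrow> x \<in> carrier M \<Longrightarrow> x \<in> N +>\<^bsub>M\<^esub> x"
proof -
  assume a: "module R M" "submodule N R M" "x \<in> carrier M"
  interpret module R M by fact
  show ?thesis
    using a submodule_zero[OF a(2)] unfolding a_r_coset_mem by (intro bexI[of _ "\<zero>\<^bsub>M\<^esub>"]) auto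
qed

lemma coset_eq_iff:
  assumes "module R M" "submodule N R M" "x \<in> carrier M" "y \<in> carrier M"
  shows "N +>\<^bsub>M\<^esub> x = N +>\<^bsub>M\<^esub> y \<longleftrightarrow> x \<ominus>\<^bsub>M\<^esub> y \<in> N"
proof -
  interpret M: module R M by fact
  have sub: "n \<in> carrier M" if "n \<in> N" for n using that submodule_subset[OF assms(2)] by auto
  have le: "N +>\<^bsub>M\<^esub> x \<subseteq> N +>\<^bsub>M\<^esub> y" if xy: "x \<in> carrier M" "y \<in> carrier M" "x \<ominus>\<^bsub>M\<^esub> y \<in> N" for x y
  proof
    fix z assume "z \<in> N +>\<^bsub>M\<^esub> x"
    then obtain n where n: "n \<in> N" "z = n \<oplus>\<^bsub>M\<^esub> x" by (auto simp: a_r_coset_mem)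
    then have "z = (n \<oplus>\<^bsub>M\<^esub> (x \<ominus>\<^bsub>M\<^esub> y)) \<oplus>\<^bsub>M\<^esub> y"
      using xy sub by (simp add: a_minus_def M.a_assoc M.l_neg)
    then show "z \<in> N +>\<^bsub>M\<^esub> y"
      using n xy submodule_add[OF assms(2)] by (auto simp: a_r_coset_mem)
  qed
  show ?thesis
  proof
    assume "N +>\<^bsub>M\<^esub> x = N +>\<^bsub>M\<^esub> y"
    with coset_self[OF assms(1-3)] obtain n where n: "n \<in> N" "x = n \<oplus>\<^bsub>M\<^esub> y" by (auto simp: a_r_coset_mem)
    then have "x \<ominus>\<^bsub>M\<^esub> y = n" using assms sub by (simp add: a_minus_def M.a_assoc M.r_neg)
    with n show "x \<ominus>\<^bsub>M\<^esub> y \<in> N" by simp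
  next
    assume d: "x \<ominus>\<^bsub>M\<^esub> y \<in> N"
    moreover have "y \<ominus>\<^bsub>M\<^esub> x = \<ominus>\<^bsub>M\<^esub> (x \<ominus>\<^bsub>M\<^esub> y)"
      using assms by (simp add: a_minus_def M.minus_add M.a_comm)
    ultimately have "y \<ominus>\<^bsub>M\<^esub> x \<in> N" using submodule_neg[OF assms(2)] by simp
    with d show "N +>\<^bsub>M\<^esub> x = N +>\<^bsub>M\<^esub> y" using le assms by blast
  qed
qed

lemma coset_zero:
  assumes "module R M" "submodule N R M"
  shows "N +>\<^bsub>M\<^esub> \<zero>\<^bsub>M\<^esub> = N"
proof -
  interpret M: module R M by fact
  have "n \<oplus>\<^bsub>M\<^esub> \<zero>\<^bsub>M\<^esub> = n" if "n \<in> N" for n using that submodule_subset[OF assms(2)] by auto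
  then show ?thesis by (force simp: a_r_coset_mem)
qed

lemma coset_eq_zero_iff:
  assumes "module R M" "submodule N R M" "x \<in> carrier M"
  shows "N +>\<^bsub>M\<^esub> x = N \<longleftrightarrow> x \<in> N"
proof -
  interpret M: module R M by fact
  show ?thesis
    using coset_eq_iff[OF assms(1,2,3) M.zero_closed] coset_zero[OF assms(1,2)] assms(3)
    by (simp add: a_minus_def)
qed

lemma coset_add:
  assumes "module R M" "submodule N R M" "x \<in> carrier M" "y \<in> carrier M"
  shows "(N +>\<^bsub>M\<^esub> x) <+>\<^bsub>M\<^esub> (N +>\<^bsub>M\<^esub> y) = N +>\<^bsub>M\<^esub> (x \<oplus>\<^bsub>M\<^esub> y)"
proof -
  interpret M: module R M by fact
  have sub: "n \<in> carrier M" if "n \<in> N" for n using that submodule_subset[OF assms(2)] by auto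
  show ?thesis
  proof safe
    fix z assume "z \<in> (N +>\<^bsub>M\<^esub> x) <+>\<^bsub>M\<^esub> (N +>\<^bsub>M\<^esub> y)"
    then obtain n n' where "n \<in> N" "n' \<in> N" "z = n \<oplus>\<^bsub>M\<^esub> x \<oplus>\<^bsub>M\<^esub> (n' \<oplus>\<^bsub>M\<^esub> y)"
      by (auto simp: set_add_def set_mult_def a_r_coset_mem)
    then have "n \<oplus>\<^bsub>M\<^esub> n' \<in> N" "z = n \<oplus>\<^bsub>M\<^esub> n' \<oplus>\<^bsub>M\<^esub> (x \<oplus>\<^bsub>M\<^esub> y)"
      using sub assms submodule_add[OF assms(2)] by (simp_all add: M.a_ac)
    then show "z \<in> N +>\<^bsub>M\<^esub> (x \<oplus>\<^bsub>M\<^esub> y)" by (auto simp: a_r_coset_mem)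
  next
    fix z assume "z \<in> N +>\<^bsub>M\<^esub> (x \<oplus>\<^bsub>M\<^esub> y)"
    then obtain n where n: "n \<in> N" "z = n \<oplus>\<^bsub>M\<^esub> (x \<oplus>\<^bsub>M\<^esub> y)" by (auto simp: a_r_coset_mem)
    then have "z = n \<oplus>\<^bsub>M\<^esub> x \<oplus>\<^bsub>M\<^esub> y" using sub assms by (simp add: M.a_assoc)
    moreover have "n \<oplus>\<^bsub>M\<^esub> x \<in> N +>\<^bsub>M\<^esub> x" using n by (auto simp: a_r_coset_mem)
    ultimately show "z \<in> (N +>\<^bsub>M\<^esub> x) <+>\<^bsub>M\<^esub> (N +>\<^bsub>M\<^esub> y)"
      using coset_self[OF assms(1,2,4)] by (auto simp: set_add_def set_mult_def)
  qed
qed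

text \<open>All sets in the union coincide: representatives differ by elements of \<open>N\<close>,
  which \<open>h\<close> sends into \<open>N'\<close>. The union is over a nonempty set, so it is
  this common coset.\<close>

lemma coset_map_coset:
  assumes M: "module R M" "submodule N R M" and M': "module R M'" "submodule N' R M'"
    and h: "mod_hom R M M' h" "h ` N \<subseteq> N'" and x: "x \<in> carrier M"
  shows "coset_map M' N' h (N +>\<^bsub>M\<^esub> x) = N' +>\<^bsub>M'\<^esub> h x"
proof -
  interpret M: module R M by fact
  interpret M': module R M' by fact
  have sub: "n \<in> carrier M" if "n \<in> N" for n using that submodule_subset[OF assms(2)] by auto
  have "N' +>\<^bsub>M'\<^esub> h c = N' +>\<^bsub>M'\<^esub> h x" if "c \<in> N +>\<^bsub>M\<^esub> x" for c
  proof -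
    from that obtain n where n: "n \<in> N" "c = n \<oplus>\<^bsub>M\<^esub> x" by (auto simp: a_r_coset_mem)
    then have "h c \<ominus>\<^bsub>M'\<^esub> h x = h n"
      using sub x mod_hom_closed[OF h(1)] mod_hom_add[OF h(1)]
      by (simp add: a_minus_def M'.a_assoc M'.r_neg)
    then show ?thesis
      using coset_eq_iff[OF M', of "h c" "h x"] n h sub x mod_hom_closed[OF h(1)] by auto
  qed
  then have "coset_map M' N' h (N +>\<^bsub>M\<^esub> x) = (\<Union>c\<in>N +>\<^bsub>M\<^esub> x. N' +>\<^bsub>M'\<^esub> h x)"
    unfolding coset_map_def by (rule SUP_cong[OF refl])
  with coset_self[OF M x] show ?thesis by blast
qed

lemma quot_mod_simps:
  "zero (quot_mod M N) = N" "add (quot_mod M N) C D = C <+>\<^bsub>M\<^esub> D"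
  "smult (quot_mod M N) s = coset_map M N (\<lambda>c. s \<odot>\<^bsub>M\<^esub> c)"
  by (auto simp: quot_mod_def coset_map_def fun_eq_iff)

lemma quot_mod_carrier: "carrier (quot_mod M N) = (\<lambda>x. N +>\<^bsub>M\<^esub> x) ` carrier M"
  by (auto simp: quot_mod_def A_RCOSETS_def' a_r_coset_def)

lemma mod_hom_coset:
  assumes "module R M" "submodule N R M"
  shows "mod_hom R M (quot_mod M N) (\<lambda>x. N +>\<^bsub>M\<^esub> x)"
proof -
  interpret M: module R M by fact
  have "mod_hom R M M ((\<odot>\<^bsub>M\<^esub>) a)" if "a \<in> carrier R" for a
    using that by (intro mod_homI) (auto simp: M.smult_r_distr M.smult_assoc1[symmetric] M.R.m_comm)
  then show ?thesis
    using assms submodule_smult[OF assms(2)]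
    by (intro mod_homI)
       (auto simp: quot_mod_carrier quot_mod_simps coset_add coset_map_coset[where R = R] image_subset_iff)
qed

lemma module_quot_mod:
  assumes "module R M" "submodule N R M"
  shows "module R (quot_mod M N)"
proof (rule module_image[OF assms(1)])
  show "(\<lambda>x. N +>\<^bsub>M\<^esub> x) ` carrier M = carrier (quot_mod M N)" by (simp add: quot_mod_carrier)
  show "N +>\<^bsub>M\<^esub> \<zero>\<^bsub>M\<^esub> = \<zero>\<^bsub>quot_mod M N\<^esub>" using coset_zero[OF assms] by (simp add: quot_mod_simps)
qed (fact mod_hom_add[OF mod_hom_coset[OF assms]] mod_hom_smult[OF mod_hom_coset[OF assms]])+

section \<open>Persistence modules\<close>

text \<open>Both sides sum \<open>h i l\<close> over the triangle i + l \<le> n, by antidiagonals on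
  the left and by rows on the right. The reordering is behind the action of a product of polynomials
  and behind the vanishing of the square of the alternating differential.\<close>

lemma (in abelian_monoid) finsum_triangle_swap:
  fixes h :: "nat \<Rightarrow> nat \<Rightarrow> 'a"
  assumes h: "\<And>i j. h i j \<in> carrier G"
  shows "(\<Oplus>k\<in>{..n}. \<Oplus>i\<in>{..k}. h i (k - i)) = (\<Oplus>k\<in>{..n}. \<Oplus>i\<in>{..n - k}. h k i)"
proof (induction n)
  case 0
  show ?case by (simp add: h)
next
  case (Suc n)
  have "(\<Oplus>k\<in>{..Suc n}. \<Oplus>i\<in>{..Suc n - k}. h k i) =
      h (Suc n) 0 \<oplus> (\<Oplus>k\<in>{..n}. \<Oplus>i\<in>{..Suc n - k}. h k i)"
    by (subst finsum_Suc) (simp_all add: h)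
  also have "(\<Oplus>k\<in>{..n}. \<Oplus>i\<in>{..Suc n - k}. h k i) =
      (\<Oplus>k\<in>{..n}. h k (Suc n - k) \<oplus> (\<Oplus>i\<in>{..n - k}. h k i))"
    by (rule finsum_cong) (auto simp: h Suc_diff_le simp_implies_def)
  also have "\<dots> = (\<Oplus>k\<in>{..n}. h k (Suc n - k)) \<oplus> (\<Oplus>k\<in>{..n}. \<Oplus>i\<in>{..k}. h i (k - i))"
    unfolding Suc by (rule finsum_addf) (auto simp: h)
  also have "h (Suc n) 0 \<oplus> ((\<Oplus>k\<in>{..n}. h k (Suc n - k)) \<oplus> (\<Oplus>k\<in>{..n}. \<Oplus>i\<in>{..k}. h i (k - i))) =
      (\<Oplus>k\<in>{..Suc n}. h k (Suc n - k)) \<oplus> (\<Oplus>k\<in>{..n}. \<Oplus>i\<in>{..k}. h i (k - i))"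
    by (subst finsum_Suc) (simp_all add: h a_assoc)
  also have "\<dots> = (\<Oplus>k\<in>{..Suc n}. \<Oplus>i\<in>{..k}. h i (k - i))"
    by (rule finsum_Suc[of "\<lambda>k. \<Oplus>i\<in>{..k}. h i (k - i)", symmetric]) (auto simp: h)
  finally show ?case by simp
qed

lemma (in module) finsum_smult_rdistr:
  assumes "finite A" "f \<in> A \<rightarrow> carrier R" "x \<in> carrier M"
  shows "(\<Oplus>a\<in>A. f a) \<odot>\<^bsub>M\<^esub> x = (\<Oplus>\<^bsub>M\<^esub>a\<in>A. f a \<odot>\<^bsub>M\<^esub> x)"
  using assms by (induction A) (auto simp: Pi_iff smult_l_distr)

locale persistence =
  fixes R :: "('r, 'z) ring_scheme" and M :: "int \<Rightarrow> ('r, 'm) module" and \<phi> :: "int \<Rightarrow> 'm \<Rightarrow> 'm"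
  assumes ring: "cring R"
    and module_at: "\<And>i. module R (M i)"
    and hom_at: "\<And>i. mod_hom R (M i) (M (i + 1)) (\<phi> i)"
begin

sublocale UP_cring R "UP R"
  using ring by (simp add: UP_cring_def)

lemma at: "abelian_group (M i)"
  using module_at module.axioms(2) by blast

lemma mod_hom_iter: "mod_hom R (M i) (M (i + int k)) (iter_map \<phi> i k)"
proof (induction k)
  case 0
  show ?case by (simp add: mod_hom_def)
next
  case (Suc k)
  have "mod_hom R (M (i + int k)) (M (i + int (Suc k))) (\<phi> (i + int k))"
    using hom_at[of "i + int k"] by (simp add: ac_simps)
  from mod_hom_comp[OF Suc this] show ?case by simp
qed

lemma iter_map_add: "iter_map \<phi> i (k + l) m = iter_map \<phi> (i + int k) l (iter_map \<phi> i k m)"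
  by (induction l) (auto simp: add.assoc)

text \<open>The target degree is a variable with an equation, because the action of t^k on component
  \<open>j\<close> starts in degree \<open>j - int k\<close>, where the target reads
  \<open>j - int k + int k\<close>.\<close>

lemma mod_hom_iter': "j = i + int k \<Longrightarrow> mod_hom R (M i) (M j) (iter_map \<phi> i k)"
  using mod_hom_iter by simp

lemma iter_closed: "x \<in> carrier (M (j - int k)) \<Longrightarrow> iter_map \<phi> (j - int k) k x \<in> carrier (M j)"
  using mod_hom_closed[OF mod_hom_iter'[of j "j - int k" k]] by simp

lemma pers_carrierD: "m \<in> carrier (pers_gmodule R M \<phi>) \<Longrightarrow> m i \<in> carrier (M i)"
  by (simp add: pers_gmodule_def)

text \<open>Coefficients above the degree vanish, so every bound \<open>n\<close> gives the same
  sum. The freedom in \<open>n\<close> lets polynomials of different degrees be summed over one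
  range.\<close>

lemma smult_pers_eq:
  assumes p: "p \<in> carrier (UP R)" and m: "\<And>i. m i \<in> carrier (M i)" and n: "deg R p \<le> n"
  shows "(p \<odot>\<^bsub>pers_gmodule R M \<phi>\<^esub> m) j =
    (\<Oplus>\<^bsub>M j\<^esub>k\<in>{..n}. coeff (UP R) p k \<odot>\<^bsub>M j\<^esub> iter_map \<phi> (j - int k) k (m (j - int k)))"
proof -
  interpret Mj: module R "M j" by (rule module_at)
  have zero: "coeff (UP R) p k = \<zero>\<^bsub>R\<^esub>" if "k \<in> {..n} - {..deg R p}" for k
    using p that by (simp add: deg_aboveD)
  show ?thesis
    using p m n
    by (simp add: pers_gmodule_def, intro Mj.add.finprod_mono_neutral_cong_left) (auto simp: zero iter_closed)
qed

lemma smult_monom: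
  assumes a: "a \<in> carrier R" and m: "\<And>i. m i \<in> carrier (M i)"
  shows "(monom (UP R) a k \<odot>\<^bsub>pers_gmodule R M \<phi>\<^esub> m) j = a \<odot>\<^bsub>M j\<^esub> iter_map \<phi> (j - int k) k (m (j - int k))"
proof -
  interpret Mj: module R "M j" by (rule module_at)
  have "(monom (UP R) a k \<odot>\<^bsub>pers_gmodule R M \<phi>\<^esub> m) j =
     (\<Oplus>\<^bsub>M j\<^esub>l\<in>{..k}. coeff (UP R) (monom (UP R) a k) l \<odot>\<^bsub>M j\<^esub> iter_map \<phi> (j - int l) l (m (j - int l)))"
    using a m by (intro smult_pers_eq) (auto simp: deg_monom_le)
  also have "\<dots> = (\<Oplus>\<^bsub>M j\<^esub>l\<in>{k}. a \<odot>\<^bsub>M j\<^esub> iter_map \<phi> (j - int l) l (m (j - int l)))"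
    using a m by (intro Mj.add.finprod_mono_neutral_cong_right) (auto simp: iter_closed)
  also have "\<dots> = a \<odot>\<^bsub>M j\<^esub> iter_map \<phi> (j - int k) k (m (j - int k))"
    using a m by (simp add: iter_closed)
  finally show ?thesis .
qed

text \<open>The support of the product lies in the translates of the support of \<open>m\<close> by
  0, ..., deg p, hence is finite.\<close>

lemma smult_pers_closed:
  assumes p: "p \<in> carrier (UP R)" and m: "m \<in> carrier (pers_gmodule R M \<phi>)"
  shows "p \<odot>\<^bsub>pers_gmodule R M \<phi>\<^esub> m \<in> carrier (pers_gmodule R M \<phi>)"
proof -
  let ?s = "p \<odot>\<^bsub>pers_gmodule R M \<phi>\<^esub> m"
  note mc = pers_carrierD[OF m]
  have "?s j \<in> carrier (M j)" for j
  proof -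
    interpret Mj: module R "M j" by (rule module_at)
    show ?thesis using p mc by (auto simp: smult_pers_eq[OF p mc order_refl] iter_closed intro!: Mj.finsum_closed)
  qed
  moreover have "{j. ?s j \<noteq> \<zero>\<^bsub>M j\<^esub>} \<subseteq> (\<Union>k\<in>{..deg R p}. (\<lambda>i. i + int k) ` {i. m i \<noteq> \<zero>\<^bsub>M i\<^esub>})"
  proof
    fix j assume j: "j \<in> {j. ?s j \<noteq> \<zero>\<^bsub>M j\<^esub>}"
    interpret Mj: module R "M j" by (rule module_at)
    have "\<exists>k\<le>deg R p. m (j - int k) \<noteq> \<zero>\<^bsub>M (j - int k)\<^esub>"
    proof (rule ccontr)
      assume "\<not> ?thesis"
      then have "iter_map \<phi> (j - int k) k (m (j - int k)) = \<zero>\<^bsub>M j\<^esub>" if "k \<le> deg R p" for k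
        using that mod_hom_zero[OF module_at module_at mod_hom_iter'[of j "j - int k" k]] by simp
      then have "?s j = (\<Oplus>\<^bsub>M j\<^esub>k\<in>{..deg R p}. \<zero>\<^bsub>M j\<^esub>)"
        unfolding smult_pers_eq[OF p mc order_refl] using p by (intro Mj.finsum_cong') auto
      with j show False by simp
    qed
    then obtain k where "k \<le> deg R p" "m (j - int k) \<noteq> \<zero>\<^bsub>M (j - int k)\<^esub>" by auto
    then show "j \<in> (\<Union>k\<in>{..deg R p}. (\<lambda>i. i + int k) ` {i. m i \<noteq> \<zero>\<^bsub>M i\<^esub>})"
      by (auto intro!: bexI[of _ k] image_eqI[of _ _ "j - int k"])
  qed
  moreover have "finite (\<Union>k\<in>{..deg R p}. (\<lambda>i. i + int k) ` {i. m i \<noteq> \<zero>\<^bsub>M i\<^esub>})"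
    using m by (auto simp: pers_gmodule_def)
  ultimately show ?thesis by (auto simp: pers_gmodule_def intro: finite_subset)
qed

text \<open>In degree \<open>j\<close> both sides are the sum of p_k q_l t^(k+l) m over k + l \<le>
  deg p + deg q: on the left grouped by k + l, as in the product of polynomials, on the right by
  k.\<close>

lemma smult_pers_mult:
  assumes p: "p \<in> carrier (UP R)" and q: "q \<in> carrier (UP R)" and m: "m \<in> carrier (pers_gmodule R M \<phi>)"
  shows "(p \<otimes>\<^bsub>UP R\<^esub> q) \<odot>\<^bsub>pers_gmodule R M \<phi>\<^esub> m =
    p \<odot>\<^bsub>pers_gmodule R M \<phi>\<^esub> (q \<odot>\<^bsub>pers_gmodule R M \<phi>\<^esub> m)"
proof
  fix j
  interpret Mj: module R "M j" by (rule module_at)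
  define n where "n = deg R p + deg R q"
  define f where "f k = iter_map \<phi> (j - int k) k (m (j - int k))" for k
  let ?c = "coeff (UP R)"
  note mc = pers_carrierD[OF m]
  have fc: "f k \<in> carrier (M j)" for k unfolding f_def by (simp add: iter_closed mc)
  have pc: "?c p k \<in> carrier R" "?c q k \<in> carrier R" for k using p q by auto
  have qm: "q \<odot>\<^bsub>pers_gmodule R M \<phi>\<^esub> m \<in> carrier (pers_gmodule R M \<phi>)"
    using q m by (rule smult_pers_closed)
  have "((p \<otimes>\<^bsub>UP R\<^esub> q) \<odot>\<^bsub>pers_gmodule R M \<phi>\<^esub> m) j = (\<Oplus>\<^bsub>M j\<^esub>k\<in>{..n}. ?c (p \<otimes>\<^bsub>UP R\<^esub> q) k \<odot>\<^bsub>M j\<^esub> f k)"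
    unfolding f_def n_def using p q mc by (intro smult_pers_eq) (auto intro: deg_mult_ring)
  \<comment> \<open>Writing k as i + (k - i) exposes the shape that
    \<open>finsum_triangle_swap\<close> expects.\<close>
  also have "\<dots> = (\<Oplus>\<^bsub>M j\<^esub>k\<in>{..n}. \<Oplus>\<^bsub>M j\<^esub>i\<in>{..k}. (?c p i \<otimes>\<^bsub>R\<^esub> ?c q (k - i)) \<odot>\<^bsub>M j\<^esub> f (i + (k - i)))"
  proof (intro Mj.finsum_cong' refl)
    fix k
    have "?c (p \<otimes>\<^bsub>UP R\<^esub> q) k \<odot>\<^bsub>M j\<^esub> f k =
        (\<Oplus>\<^bsub>M j\<^esub>i\<in>{..k}. (?c p i \<otimes>\<^bsub>R\<^esub> ?c q (k - i)) \<odot>\<^bsub>M j\<^esub> f k)"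
      using p q fc pc by (simp add: Mj.finsum_smult_rdistr Pi_iff)
    also have "\<dots> = (\<Oplus>\<^bsub>M j\<^esub>i\<in>{..k}. (?c p i \<otimes>\<^bsub>R\<^esub> ?c q (k - i)) \<odot>\<^bsub>M j\<^esub> f (i + (k - i)))"
      using pc fc by (intro Mj.finsum_cong') auto
    finally show "?c (p \<otimes>\<^bsub>UP R\<^esub> q) k \<odot>\<^bsub>M j\<^esub> f k =
      (\<Oplus>\<^bsub>M j\<^esub>i\<in>{..k}. (?c p i \<otimes>\<^bsub>R\<^esub> ?c q (k - i)) \<odot>\<^bsub>M j\<^esub> f (i + (k - i)))" .
  qed (use pc fc in \<open>auto intro!: Mj.finsum_closed\<close>)
  also have "\<dots> = (\<Oplus>\<^bsub>M j\<^esub>k\<in>{..n}. \<Oplus>\<^bsub>M j\<^esub>i\<in>{..n - k}. (?c p k \<otimes>\<^bsub>R\<^esub> ?c q i) \<odot>\<^bsub>M j\<^esub> f (k + i))"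
    using pc fc
    by (intro Mj.finsum_triangle_swap[of "\<lambda>i l. (?c p i \<otimes>\<^bsub>R\<^esub> ?c q l) \<odot>\<^bsub>M j\<^esub> f (i + l)"]) auto
  also have "\<dots> = (\<Oplus>\<^bsub>M j\<^esub>k\<in>{..n}. ?c p k \<odot>\<^bsub>M j\<^esub>
      iter_map \<phi> (j - int k) k ((q \<odot>\<^bsub>pers_gmodule R M \<phi>\<^esub> m) (j - int k)))"
  proof (intro Mj.finsum_cong' refl)
    fix k
    let ?it = "iter_map \<phi> (j - int k) k"
    show "(\<Oplus>\<^bsub>M j\<^esub>i\<in>{..n - k}. (?c p k \<otimes>\<^bsub>R\<^esub> ?c q i) \<odot>\<^bsub>M j\<^esub> f (k + i)) =
      ?c p k \<odot>\<^bsub>M j\<^esub> ?it ((q \<odot>\<^bsub>pers_gmodule R M \<phi>\<^esub> m) (j - int k))"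
    \<comment> \<open>For k \<le> deg p the number n - k still bounds deg q, so the inner action may
      be summed up to n - k. For larger k the coefficient of \<open>p\<close> vanishes and the inner
      sum does not matter.\<close>
    proof (cases "k \<le> deg R p")
      case True
      interpret Mk: module R "M (j - int k)" by (rule module_at)
      have it: "mod_hom R (M (j - int k)) (M j) ?it" by (rule mod_hom_iter') simp
      define g where "g i = iter_map \<phi> (j - int k - int i) i (m (j - int k - int i))" for i
      have gc: "g i \<in> carrier (M (j - int k))" for i unfolding g_def by (simp add: iter_closed mc)
      have itg: "?it (g i) = f (k + i)" for i
      proof -
        have "j - int (k + i) = j - int k - int i" "j - int k - int i + int i = j - int k" by auto
        then show ?thesis
          using iter_map_add[of "j - int k - int i" i k "m (j - int k - int i)"]
          by (simp only: f_def g_def add.commute[of k i])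
      qed
      have "(q \<odot>\<^bsub>pers_gmodule R M \<phi>\<^esub> m) (j - int k) =
          (\<Oplus>\<^bsub>M (j - int k)\<^esub>i\<in>{..n - k}. ?c q i \<odot>\<^bsub>M (j - int k)\<^esub> g i)"
        unfolding g_def using True q mc by (intro smult_pers_eq) (auto simp: n_def)
      then have "?it ((q \<odot>\<^bsub>pers_gmodule R M \<phi>\<^esub> m) (j - int k)) =
          (\<Oplus>\<^bsub>M j\<^esub>i\<in>{..n - k}. ?it (?c q i \<odot>\<^bsub>M (j - int k)\<^esub> g i))"
        using gc pc by (simp add: mod_hom_finsum[OF module_at module_at it] Pi_iff)
      also have "\<dots> = (\<Oplus>\<^bsub>M j\<^esub>i\<in>{..n - k}. ?c q i \<odot>\<^bsub>M j\<^esub> f (k + i))"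
        using gc pc fc by (intro Mj.finsum_cong') (auto simp: mod_hom_smult[OF it] itg)
      finally show ?thesis
        using pc fc by (simp add: Mj.finsum_smult_ldistr Pi_iff Mj.smult_assoc1)
    next
      case False
      then have "?c p k = \<zero>\<^bsub>R\<^esub>" using p by (simp add: deg_aboveD)
      then show ?thesis using pc fc pers_carrierD[OF qm] by (simp add: iter_closed)
    qed
  qed (use pc pers_carrierD[OF qm] in \<open>auto simp: iter_closed\<close>)
  also have "\<dots> = (p \<odot>\<^bsub>pers_gmodule R M \<phi>\<^esub> (q \<odot>\<^bsub>pers_gmodule R M \<phi>\<^esub> m)) j"
    using p pers_carrierD[OF qm] by (intro smult_pers_eq[symmetric]) (auto simp: n_def)
  finally show "((p \<otimes>\<^bsub>UP R\<^esub> q) \<odot>\<^bsub>pers_gmodule R M \<phi>\<^esub> m) j =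
    (p \<odot>\<^bsub>pers_gmodule R M \<phi>\<^esub> (q \<odot>\<^bsub>pers_gmodule R M \<phi>\<^esub> m)) j" .
qed

lemma pers_add: "(m \<oplus>\<^bsub>pers_gmodule R M \<phi>\<^esub> n) i = m i \<oplus>\<^bsub>M i\<^esub> n i"
  and pers_zero: "\<zero>\<^bsub>pers_gmodule R M \<phi>\<^esub> i = \<zero>\<^bsub>M i\<^esub>"
  by (simp_all add: pers_gmodule_def)

lemma pers_add_closed:
  assumes "m \<in> carrier (pers_gmodule R M \<phi>)" "n \<in> carrier (pers_gmodule R M \<phi>)"
  shows "m \<oplus>\<^bsub>pers_gmodule R M \<phi>\<^esub> n \<in> carrier (pers_gmodule R M \<phi>)"
proof -
  have "{i. m i \<oplus>\<^bsub>M i\<^esub> n i \<noteq> \<zero>\<^bsub>M i\<^esub>} \<subseteq> {i. m i \<noteq> \<zero>\<^bsub>M i\<^esub>} \<union> {i. n i \<noteq> \<zero>\<^bsub>M i\<^esub>}"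
    using abelian_groupE(2)[OF at] abelian_group.axioms(1)[OF at] by (auto simp: abelian_monoid.l_zero)
  then show ?thesis
    using assms abelian_groupE(1)[OF at]
    by (auto simp: pers_gmodule_def elim: finite_subset)
qed

lemma module_pers: "module (UP R) (pers_gmodule R M \<phi>)"
proof (intro moduleI abelian_groupI; (intro ext)?)
  let ?P = "pers_gmodule R M \<phi>"
  show "cring (UP R)" by (rule UP_cring)
  show "\<zero>\<^bsub>?P\<^esub> \<in> carrier ?P"
    using abelian_groupE(2)[OF at] by (simp add: pers_gmodule_def)
  fix x assume x: "x \<in> carrier ?P"
  note xc = pers_carrierD[OF x]
  show "(\<zero>\<^bsub>?P\<^esub> \<oplus>\<^bsub>?P\<^esub> x) i = x i" for i
    using xc abelian_groupE(5)[OF at] by (simp add: pers_add pers_zero)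
  show "\<exists>y\<in>carrier ?P. y \<oplus>\<^bsub>?P\<^esub> x = \<zero>\<^bsub>?P\<^esub>"
  proof (intro bexI ext)
    show "((\<lambda>i. \<ominus>\<^bsub>M i\<^esub> x i) \<oplus>\<^bsub>?P\<^esub> x) i = \<zero>\<^bsub>?P\<^esub> i" for i
      using xc[of i] abelian_group.l_neg[OF at] by (simp add: pers_add pers_zero)
    have "{i. \<ominus>\<^bsub>M i\<^esub> x i \<noteq> \<zero>\<^bsub>M i\<^esub>} \<subseteq> {i. x i \<noteq> \<zero>\<^bsub>M i\<^esub>}"
      using abelian_group.a_inv_zero[OF at] by auto
    then show "(\<lambda>i. \<ominus>\<^bsub>M i\<^esub> x i) \<in> carrier ?P"
      using x abelian_group.a_inv_closed[OF at] by (auto simp: pers_gmodule_def elim: finite_subset)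
  qed
  show "(\<one>\<^bsub>UP R\<^esub> \<odot>\<^bsub>?P\<^esub> x) i = x i" for i
  proof -
    interpret Mi: module R "M i" by (rule module_at)
    show ?thesis using smult_pers_eq[of "\<one>\<^bsub>UP R\<^esub>" x 0 i] xc by simp
  qed
  fix p assume p: "p \<in> carrier (UP R)"
  show "p \<odot>\<^bsub>?P\<^esub> x \<in> carrier ?P" using p x by (rule smult_pers_closed)
  show "((p \<oplus>\<^bsub>UP R\<^esub> q) \<odot>\<^bsub>?P\<^esub> x) i = (p \<odot>\<^bsub>?P\<^esub> x \<oplus>\<^bsub>?P\<^esub> q \<odot>\<^bsub>?P\<^esub> x) i" if q: "q \<in> carrier (UP R)" for q i
  proof -
    interpret Mi: module R "M i" by (rule module_at)
    let ?n = "max (deg R p) (deg R q)"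
    let ?f = "\<lambda>k. iter_map \<phi> (i - int k) k (x (i - int k))"
    have "((p \<oplus>\<^bsub>UP R\<^esub> q) \<odot>\<^bsub>?P\<^esub> x) i = (\<Oplus>\<^bsub>M i\<^esub>k\<in>{..?n}. coeff (UP R) (p \<oplus>\<^bsub>UP R\<^esub> q) k \<odot>\<^bsub>M i\<^esub> ?f k)"
      using p q xc by (intro smult_pers_eq) auto
    also have "\<dots> = (\<Oplus>\<^bsub>M i\<^esub>k\<in>{..?n}. coeff (UP R) p k \<odot>\<^bsub>M i\<^esub> ?f k \<oplus>\<^bsub>M i\<^esub> coeff (UP R) q k \<odot>\<^bsub>M i\<^esub> ?f k)"
      using p q xc by (intro Mi.finsum_cong') (auto simp: Mi.smult_l_distr iter_closed)
    also have "\<dots> = (p \<odot>\<^bsub>?P\<^esub> x \<oplus>\<^bsub>?P\<^esub> q \<odot>\<^bsub>?P\<^esub> x) i"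
      unfolding pers_add smult_pers_eq[OF p xc, of ?n, simplified] smult_pers_eq[OF q xc, of ?n, simplified]
      using p q xc by (intro Mi.finsum_addf) (auto simp: iter_closed)
    finally show ?thesis .
  qed
  show "(p \<odot>\<^bsub>?P\<^esub> (x \<oplus>\<^bsub>?P\<^esub> y)) i = (p \<odot>\<^bsub>?P\<^esub> x \<oplus>\<^bsub>?P\<^esub> p \<odot>\<^bsub>?P\<^esub> y) i" if y: "y \<in> carrier ?P" for y i
  proof -
    interpret Mi: module R "M i" by (rule module_at)
    note yc = pers_carrierD[OF y] and xyc = pers_carrierD[OF pers_add_closed[OF x y]]
    let ?f = "\<lambda>x k. iter_map \<phi> (i - int k) k (x (i - int k))"
    have "(p \<odot>\<^bsub>?P\<^esub> (x \<oplus>\<^bsub>?P\<^esub> y)) i = (\<Oplus>\<^bsub>M i\<^esub>k\<in>{..deg R p}. coeff (UP R) p k \<odot>\<^bsub>M i\<^esub> ?f (x \<oplus>\<^bsub>?P\<^esub> y) k)"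
      by (rule smult_pers_eq[OF p xyc order_refl])
    also have "\<dots> = (\<Oplus>\<^bsub>M i\<^esub>k\<in>{..deg R p}. coeff (UP R) p k \<odot>\<^bsub>M i\<^esub> ?f x k \<oplus>\<^bsub>M i\<^esub> coeff (UP R) p k \<odot>\<^bsub>M i\<^esub> ?f y k)"
    proof (intro Mi.finsum_cong' refl)
      fix k
      show "coeff (UP R) p k \<odot>\<^bsub>M i\<^esub> ?f (x \<oplus>\<^bsub>?P\<^esub> y) k =
          coeff (UP R) p k \<odot>\<^bsub>M i\<^esub> ?f x k \<oplus>\<^bsub>M i\<^esub> coeff (UP R) p k \<odot>\<^bsub>M i\<^esub> ?f y k"
        using p xc yc mod_hom_add[OF mod_hom_iter'[of i "i - int k" k]]
        by (simp add: pers_add Mi.smult_r_distr iter_closed)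
    qed (use p xc yc in \<open>auto simp: iter_closed\<close>)
    also have "\<dots> = (p \<odot>\<^bsub>?P\<^esub> x \<oplus>\<^bsub>?P\<^esub> p \<odot>\<^bsub>?P\<^esub> y) i"
      unfolding pers_add smult_pers_eq[OF p xc order_refl] smult_pers_eq[OF p yc order_refl]
      using p xc yc by (intro Mi.finsum_addf) (auto simp: iter_closed)
    finally show ?thesis .
  qed
  show "((p \<otimes>\<^bsub>UP R\<^esub> q) \<odot>\<^bsub>?P\<^esub> x) i = (p \<odot>\<^bsub>?P\<^esub> (q \<odot>\<^bsub>?P\<^esub> x)) i" if q: "q \<in> carrier (UP R)" for q i
    by (simp add: smult_pers_mult[OF p q x])
next
  fix x y assume x: "x \<in> carrier (pers_gmodule R M \<phi>)" and y: "y \<in> carrier (pers_gmodule R M \<phi>)"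
  show "x \<oplus>\<^bsub>pers_gmodule R M \<phi>\<^esub> y \<in> carrier (pers_gmodule R M \<phi>)" using x y by (rule pers_add_closed)
  show "(x \<oplus>\<^bsub>pers_gmodule R M \<phi>\<^esub> y) i = (y \<oplus>\<^bsub>pers_gmodule R M \<phi>\<^esub> x) i" for i
    using pers_carrierD[OF x] pers_carrierD[OF y] abelian_groupE(4)[OF at] by (simp add: pers_add)
  fix z assume z: "z \<in> carrier (pers_gmodule R M \<phi>)"
  show "(x \<oplus>\<^bsub>pers_gmodule R M \<phi>\<^esub> y \<oplus>\<^bsub>pers_gmodule R M \<phi>\<^esub> z) i =
      (x \<oplus>\<^bsub>pers_gmodule R M \<phi>\<^esub> (y \<oplus>\<^bsub>pers_gmodule R M \<phi>\<^esub> z)) i" for i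
    using pers_carrierD[OF x] pers_carrierD[OF y] pers_carrierD[OF z] abelian_groupE(3)[OF at]
    by (simp add: pers_add)
qed

end

section \<open>The grading of a persistence module\<close>

lemma (in module) finsum_extract:
  assumes "i \<in> A" "finite A" "x \<in> carrier M" "\<And>j. j \<in> A \<Longrightarrow> j \<noteq> i \<Longrightarrow> f j = \<zero>\<^bsub>M\<^esub>" "f i = x"
  shows "(\<Oplus>\<^bsub>M\<^esub>j\<in>A. f j) = x"
proof -
  have "(\<Oplus>\<^bsub>M\<^esub>j\<in>A. f j) = (\<Oplus>\<^bsub>M\<^esub>j\<in>{i}. f j)"
    using assms by (intro M.add.finprod_mono_neutral_cong_right) (auto simp: Pi_iff, metis M.zero_closed)
  with assms show ?thesis by simp
qed

context persistence
begin

interpretation P: module "UP R" "pers_gmodule R M \<phi>" by (rule module_pers)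

lemma pers_inv:
  assumes "m \<in> carrier (pers_gmodule R M \<phi>)"
  shows "(\<ominus>\<^bsub>pers_gmodule R M \<phi>\<^esub> m) i = \<ominus>\<^bsub>M i\<^esub> m i"
proof -
  have "(\<ominus>\<^bsub>pers_gmodule R M \<phi>\<^esub> m) i \<oplus>\<^bsub>M i\<^esub> m i = \<zero>\<^bsub>M i\<^esub>"
    using P.l_neg[OF assms] by (metis pers_add pers_zero)
  then show ?thesis
    using abelian_group.minus_equality[OF at] pers_carrierD assms P.a_inv_closed by metis
qed

lemma pers_minus:
  assumes "m \<in> carrier (pers_gmodule R M \<phi>)" "n \<in> carrier (pers_gmodule R M \<phi>)"
  shows "(m \<ominus>\<^bsub>pers_gmodule R M \<phi>\<^esub> n) i = m i \<ominus>\<^bsub>M i\<^esub> n i"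
  using assms by (simp add: a_minus_def pers_add pers_inv)

lemma pers_finsum:
  assumes "h \<in> A \<rightarrow> carrier (pers_gmodule R M \<phi>)"
  shows "(\<Oplus>\<^bsub>pers_gmodule R M \<phi>\<^esub>a\<in>A. h a) i = (\<Oplus>\<^bsub>M i\<^esub>a\<in>A. h a i)"
proof (cases "finite A")
  case True
  interpret Mi: module R "M i" by (rule module_at)
  from True assms show ?thesis
  proof (induction A)
    case empty
    show ?case by (simp add: pers_zero)
  next
    case (insert a A)
    then have "(\<lambda>a. h a i) \<in> A \<rightarrow> carrier (M i)" "h a i \<in> carrier (M i)" by (auto intro!: pers_carrierD)
    with insert show ?case by (simp add: pers_add Pi_iff)
  qed
next
  case False
  then show ?thesis by (simp add: finsum_def finprod_def pers_zero)
qed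

lemma gr_pers: "m \<in> gr (pers_gmodule R M \<phi>) i \<longleftrightarrow>
    m i \<in> carrier (M i) \<and> (\<forall>j. j \<noteq> i \<longrightarrow> m j = \<zero>\<^bsub>M j\<^esub>)"
  by (simp add: pers_gmodule_def)

lemma gr_pers_subset: "gr (pers_gmodule R M \<phi>) i \<subseteq> carrier (pers_gmodule R M \<phi>)"
proof
  fix m assume m: "m \<in> gr (pers_gmodule R M \<phi>) i"
  then have "m j \<in> carrier (M j)" for j
    using abelian_groupE(2)[OF at] by (cases "j = i") (auto simp: gr_pers)
  moreover have "{j. m j \<noteq> \<zero>\<^bsub>M j\<^esub>} \<subseteq> {i}" using m by (auto simp: gr_pers)
  ultimately show "m \<in> carrier (pers_gmodule R M \<phi>)" by (auto simp: pers_gmodule_def intro: finite_subset)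
qed

text \<open>Evaluating a sum of homogeneous families at \<open>j\<close> leaves only the summand of
  degree \<open>j\<close>. This yields the decomposition and its uniqueness at once.\<close>

lemma pers_decomposition:
  assumes m: "m \<in> carrier (pers_gmodule R M \<phi>)"
  shows "\<exists>!h. (\<forall>i. h i \<in> gr (pers_gmodule R M \<phi>) i) \<and> finite {i. h i \<noteq> \<zero>\<^bsub>pers_gmodule R M \<phi>\<^esub>} \<and>
    m = (\<Oplus>\<^bsub>pers_gmodule R M \<phi>\<^esub>i\<in>{i. h i \<noteq> \<zero>\<^bsub>pers_gmodule R M \<phi>\<^esub>}. h i)"
proof -
  let ?P = "pers_gmodule R M \<phi>"
  have component: "(\<Oplus>\<^bsub>?P\<^esub>i\<in>{i. h i \<noteq> \<zero>\<^bsub>?P\<^esub>}. h i) j = h j j"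
    if h: "\<forall>i. h i \<in> gr ?P i" "finite {i. h i \<noteq> \<zero>\<^bsub>?P\<^esub>}" for h j
  proof -
    interpret Mj: module R "M j" by (rule module_at)
    let ?A = "{i. h i \<noteq> \<zero>\<^bsub>?P\<^esub>}"
    have off: "h i j = \<zero>\<^bsub>M j\<^esub>" if "i \<noteq> j" for i using that h(1) by (auto simp: gr_pers)
    have "(\<Oplus>\<^bsub>?P\<^esub>i\<in>?A. h i) j = (\<Oplus>\<^bsub>M j\<^esub>i\<in>?A. h i j)"
      using h(1) gr_pers_subset by (intro pers_finsum) blast
    also have "\<dots> = h j j"
    proof (cases "j \<in> ?A")
      case True
      with h off show ?thesis by (intro Mj.finsum_extract[of j]) (auto simp: gr_pers)
    next
      case False
      then have "h j j = \<zero>\<^bsub>M j\<^esub>" by (simp add: pers_zero)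
      moreover have "(\<Oplus>\<^bsub>M j\<^esub>i\<in>?A. h i j) = (\<Oplus>\<^bsub>M j\<^esub>i\<in>?A. \<zero>\<^bsub>M j\<^esub>)"
        using False off by (intro Mj.finsum_cong') (auto, metis)
      ultimately show ?thesis by simp
    qed
    finally show ?thesis .
  qed
  define h where "h i j = (if j = i then m j else \<zero>\<^bsub>M j\<^esub>)" for i j
  have h_gr: "h i \<in> gr ?P i" for i using pers_carrierD[OF m] by (simp add: gr_pers h_def)
  have "{i. h i \<noteq> \<zero>\<^bsub>?P\<^esub>} \<subseteq> {i. m i \<noteq> \<zero>\<^bsub>M i\<^esub>}"
    by (auto simp: h_def fun_eq_iff pers_zero split: if_splits)
  then have h_fin: "finite {i. h i \<noteq> \<zero>\<^bsub>?P\<^esub>}" using m by (auto simp: pers_gmodule_def intro: finite_subset)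
  show ?thesis
  proof (rule ex1I[of _ h])
    show "(\<forall>i. h i \<in> gr ?P i) \<and> finite {i. h i \<noteq> \<zero>\<^bsub>?P\<^esub>} \<and> m = (\<Oplus>\<^bsub>?P\<^esub>i\<in>{i. h i \<noteq> \<zero>\<^bsub>?P\<^esub>}. h i)"
      using h_gr h_fin by (auto intro!: ext simp: component) (simp add: h_def)
  next
    fix k assume k: "(\<forall>i. k i \<in> gr ?P i) \<and> finite {i. k i \<noteq> \<zero>\<^bsub>?P\<^esub>} \<and>
      m = (\<Oplus>\<^bsub>?P\<^esub>i\<in>{i. k i \<noteq> \<zero>\<^bsub>?P\<^esub>}. k i)"
    then have "m j = k j j" for j using component[of k j] by auto
    then have "k i j = h i j" for i j using k by (cases "j = i") (auto simp: gr_pers h_def)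
    then show "k = h" by (simp add: fun_eq_iff)
  qed
qed

theorem graded_pers: "graded_module R (pers_gmodule R M \<phi>)"
  unfolding graded_module_def
proof (intro conjI allI ballI)
  let ?P = "pers_gmodule R M \<phi>"
  show "module (UP R) ?P" by (rule module_pers)
  show "subgroup (gr ?P i) (add_monoid ?P)" for i
  proof (rule P.add.subgroupI)
    show "gr ?P i \<subseteq> carrier ?P" by (rule gr_pers_subset)
    have "(\<lambda>i. \<zero>\<^bsub>M i\<^esub>) \<in> gr ?P i" using abelian_groupE(2)[OF at] by (simp add: gr_pers)
    then show "gr ?P i \<noteq> {}" by blast
  next
    fix a assume a: "a \<in> gr ?P i"
    then have "a \<in> carrier ?P" using gr_pers_subset by blast
    with a show "\<ominus>\<^bsub>?P\<^esub> a \<in> gr ?P i"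
      using abelian_group.a_inv_zero[OF at] abelian_group.a_inv_closed[OF at]
      by (simp add: gr_pers pers_inv)
  next
    fix a b assume "a \<in> gr ?P i" "b \<in> gr ?P i"
    then show "a \<oplus>\<^bsub>?P\<^esub> b \<in> gr ?P i"
      using abelian_groupE(1,2,5)[OF at] by (simp add: gr_pers pers_add)
  qed
  show "monom (UP R) a k \<odot>\<^bsub>?P\<^esub> m \<in> gr ?P (i + int k)"
    if a: "a \<in> carrier R" and m: "m \<in> gr ?P i" for i k a m
  proof -
    have mc: "m j \<in> carrier (M j)" for j using m gr_pers_subset pers_carrierD by blast
    have "(monom (UP R) a k \<odot>\<^bsub>?P\<^esub> m) j = \<zero>\<^bsub>M j\<^esub>" if "j \<noteq> i + int k" for j
    proof -
      have "m (j - int k) = \<zero>\<^bsub>M (j - int k)\<^esub>" using m that by (auto simp: gr_pers)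
      then have "iter_map \<phi> (j - int k) k (m (j - int k)) = \<zero>\<^bsub>M j\<^esub>"
        using mod_hom_zero[OF module_at module_at mod_hom_iter'[of j "j - int k" k]] by simp
      then show ?thesis using a mc module.smult_r_null[OF module_at] by (simp add: smult_monom)
    qed
    moreover have "(monom (UP R) a k \<odot>\<^bsub>?P\<^esub> m) (i + int k) \<in> carrier (M (i + int k))"
      using a mc iter_closed[of "m (i + int k - int k)" "i + int k" k] module.smult_closed[OF module_at]
      by (simp add: smult_monom iter_closed)
    ultimately show ?thesis by (simp add: gr_pers)
  qed
  show "\<exists>!h. (\<forall>i. h i \<in> gr ?P i) \<and> finite {i. h i \<noteq> \<zero>\<^bsub>?P\<^esub>} \<and>
    m = (\<Oplus>\<^bsub>?P\<^esub>i\<in>{i. h i \<noteq> \<zero>\<^bsub>?P\<^esub>}. h i)" if "m \<in> carrier ?P" for m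
    using that by (rule pers_decomposition)
qed

end

section \<open>Morphisms of persistence modules and isomorphisms of graded subquotients\<close>

lemma gmod_hom_iff:
  "h \<in> gmod_hom R M N \<longleftrightarrow> mod_hom (UP R) M N h \<and> (\<forall>i. h ` gr M i \<subseteq> gr N i)"
  by (auto simp: gmod_hom_def mod_hom_def hom_def)

lemma (in persistence) iter_map_natural:
  assumes "persistence R M' \<phi>'" and h: "\<And>i. mod_hom R (M i) (M' i) (h i)"
    and nat: "\<And>i m. m \<in> carrier (M i) \<Longrightarrow> h (i + 1) (\<phi> i m) = \<phi>' i (h i m)"
    and m: "m \<in> carrier (M i)"
  shows "h (i + int k) (iter_map \<phi> i k m) = iter_map \<phi>' i k (h i m)"
proof (induction k)
  case (Suc k)
  have "h (i + int k + 1) (\<phi> (i + int k) (iter_map \<phi> i k m)) = \<phi>' (i + int k) (h (i + int k) (iter_map \<phi> i k m))"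
    using mod_hom_closed[OF mod_hom_iter m] by (intro nat)
  then show ?case by (simp add: Suc ac_simps)
qed simp

text \<open>The source of the graded R[t]-linear maps below: a family of R-linear maps commuting
  with the structure maps commutes with each power of t, hence with every polynomial.\<close>

lemma gmod_hom_pers:
  assumes "persistence R M \<phi>" "persistence R M' \<phi>'"
    and h: "\<And>i. mod_hom R (M i) (M' i) (h i)"
    and nat: "\<And>i m. m \<in> carrier (M i) \<Longrightarrow> h (i + 1) (\<phi> i m) = \<phi>' i (h i m)"
  shows "(\<lambda>m i. h i (m i)) \<in> gmod_hom R (pers_gmodule R M \<phi>) (pers_gmodule R M' \<phi>')"
proof -
  interpret M: persistence R M \<phi> by fact
  interpret M': persistence R M' \<phi>' by fact
  have zero: "h i \<zero>\<^bsub>M i\<^esub> = \<zero>\<^bsub>M' i\<^esub>" for i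
    by (rule mod_hom_zero[OF M.module_at M'.module_at h])
  have closed: "(\<lambda>i. h i (m i)) \<in> carrier (pers_gmodule R M' \<phi>')" if "m \<in> carrier (pers_gmodule R M \<phi>)" for m
  proof -
    have "{i. h i (m i) \<noteq> \<zero>\<^bsub>M' i\<^esub>} \<subseteq> {i. m i \<noteq> \<zero>\<^bsub>M i\<^esub>}" using zero by auto
    with that show ?thesis by (auto simp: pers_gmodule_def mod_hom_closed[OF h] elim: finite_subset)
  qed
  show ?thesis unfolding gmod_hom_iff
  proof (intro conjI mod_homI allI)
    fix p m assume p: "p \<in> carrier (UP R)" and m: "m \<in> carrier (pers_gmodule R M \<phi>)"
    note mc = M.pers_carrierD[OF m] and mc' = M'.pers_carrierD[OF closed[OF m]]
    show "(\<lambda>i. h i ((p \<odot>\<^bsub>pers_gmodule R M \<phi>\<^esub> m) i)) = p \<odot>\<^bsub>pers_gmodule R M' \<phi>'\<^esub> (\<lambda>i. h i (m i))"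
    proof
      fix j
      interpret M'j: module R "M' j" by (rule M'.module_at)
      have it: "h j (iter_map \<phi> (j - int k) k (m (j - int k))) = iter_map \<phi>' (j - int k) k (h (j - int k) (m (j - int k)))"
        for k using M.iter_map_natural[where h = h, OF assms(2) h nat mc, of "j - int k" k] by simp
      have pc: "coeff (UP R) p k \<in> carrier R" for k using p by simp
      interpret Mj: module R "M j" by (rule M.module_at)
      have "h j ((p \<odot>\<^bsub>pers_gmodule R M \<phi>\<^esub> m) j) =
          (\<Oplus>\<^bsub>M' j\<^esub>k\<in>{..deg R p}. h j (coeff (UP R) p k \<odot>\<^bsub>M j\<^esub> iter_map \<phi> (j - int k) k (m (j - int k))))"
        using pc mc unfolding M.smult_pers_eq[OF p mc order_refl]
        by (intro mod_hom_finsum[OF M.module_at M'.module_at h]) (auto simp: M.iter_closed)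
      also have "\<dots> = (\<Oplus>\<^bsub>M' j\<^esub>k\<in>{..deg R p}. coeff (UP R) p k \<odot>\<^bsub>M' j\<^esub> iter_map \<phi>' (j - int k) k (h (j - int k) (m (j - int k))))"
        using pc mc mc' by (intro M'j.finsum_cong') (auto simp: mod_hom_smult[OF h] M.iter_closed it M'.iter_closed)
      also have "\<dots> = (p \<odot>\<^bsub>pers_gmodule R M' \<phi>'\<^esub> (\<lambda>i. h i (m i))) j"
        by (rule M'.smult_pers_eq[OF p mc' order_refl, symmetric])
      finally show "h j ((p \<odot>\<^bsub>pers_gmodule R M \<phi>\<^esub> m) j) = (p \<odot>\<^bsub>pers_gmodule R M' \<phi>'\<^esub> (\<lambda>i. h i (m i))) j" .
    qed
  next
    fix i show "(\<lambda>m i. h i (m i)) ` gr (pers_gmodule R M \<phi>) i \<subseteq> gr (pers_gmodule R M' \<phi>') i"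
      by (auto simp: M.gr_pers M'.gr_pers mod_hom_closed[OF h] zero)
  qed (auto simp: closed M.pers_add M'.pers_add mod_hom_add[OF h] M.pers_carrierD intro!: ext)
qed

text \<open>A preimage is chosen in each degree, and zero is chosen over zero, so the chosen family
  has finite support again. Images of graded maps can thus be computed degree by degree.\<close>

lemma pers_map_image:
  assumes "persistence R M \<phi>" "persistence R M' \<phi>'"
    and h: "\<And>i. mod_hom R (M i) (M' i) (h i)"
  shows "(\<lambda>m i. h i (m i)) ` carrier (pers_gmodule R M \<phi>) =
      {m \<in> carrier (pers_gmodule R M' \<phi>'). \<forall>i. m i \<in> h i ` carrier (M i)}" (is "?A = ?B")
    and "(\<lambda>m i. h i (m i)) ` gr (pers_gmodule R M \<phi>) j =
      {m \<in> gr (pers_gmodule R M' \<phi>') j. \<forall>i. m i \<in> h i ` carrier (M i)}" (is "?C = ?D")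
proof -
  interpret M: persistence R M \<phi> by fact
  interpret M': persistence R M' \<phi>' by fact
  have zero: "h i \<zero>\<^bsub>M i\<^esub> = \<zero>\<^bsub>M' i\<^esub>" for i
    by (rule mod_hom_zero[OF M.module_at M'.module_at h])
  have zc: "\<zero>\<^bsub>M i\<^esub> \<in> carrier (M i)" for i using abelian_groupE(2)[OF M.at] .
  define s where "s m i = (if m i = \<zero>\<^bsub>M' i\<^esub> then \<zero>\<^bsub>M i\<^esub> else SOME x. x \<in> carrier (M i) \<and> h i x = m i)" for m i
  have s: "s m i \<in> carrier (M i) \<and> h i (s m i) = m i" if "\<forall>i. m i \<in> h i ` carrier (M i)" for m i
  proof (cases "m i = \<zero>\<^bsub>M' i\<^esub>")
    case False
    from that obtain x where "x \<in> carrier (M i) \<and> h i x = m i" by force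
    from someI[of "\<lambda>x. x \<in> carrier (M i) \<and> h i x = m i", OF this] False show ?thesis by (simp add: s_def)
  qed (simp add: s_def zero zc)
  have s0: "m i = \<zero>\<^bsub>M' i\<^esub> \<Longrightarrow> s m i = \<zero>\<^bsub>M i\<^esub>" for m i by (simp add: s_def)
  show "?A = ?B"
  proof (intro equalityI subsetI)
    fix m assume "m \<in> ?A"
    then obtain n where n: "n \<in> carrier (pers_gmodule R M \<phi>)" "m = (\<lambda>i. h i (n i))" by auto
    have "{i. h i (n i) \<noteq> \<zero>\<^bsub>M' i\<^esub>} \<subseteq> {i. n i \<noteq> \<zero>\<^bsub>M i\<^esub>}" using zero by auto
    with n show "m \<in> ?B" by (auto simp: pers_gmodule_def mod_hom_closed[OF h] elim: finite_subset)
  next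
    fix m assume m: "m \<in> ?B"
    have "{i. s m i \<noteq> \<zero>\<^bsub>M i\<^esub>} \<subseteq> {i. m i \<noteq> \<zero>\<^bsub>M' i\<^esub>}" using s0 by auto
    then have "s m \<in> carrier (pers_gmodule R M \<phi>)"
      using m s[of m] by (auto simp: pers_gmodule_def elim: finite_subset)
    moreover have "m = (\<lambda>i. h i (s m i))" using m s[of m] by auto
    ultimately show "m \<in> ?A" by blast
  qed
  show "?C = ?D"
  proof (intro equalityI subsetI)
    fix m assume "m \<in> ?C"
    then show "m \<in> ?D" by (auto simp: M.gr_pers M'.gr_pers mod_hom_closed[OF h] zero) (metis imageI zc zero)
  next
    fix m assume m: "m \<in> ?D"
    then have "s m \<in> gr (pers_gmodule R M \<phi>) j" using s[of m] s0 by (auto simp: M.gr_pers M'.gr_pers)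
    moreover have "m = (\<lambda>i. h i (s m i))" using m s[of m] by auto
    ultimately show "m \<in> ?C" by blast
  qed
qed

text \<open>\<open>M\<close> and \<open>N\<close> enter only as images of \<open>P\<close>, so a
  quotient can be compared without first being shown to be graded. For this reason surjectivity in
  every degree is listed next to surjectivity.\<close>

lemma gmod_iso_of_surjections:
  assumes P: "module (UP R) P" "\<And>i. gr P i \<subseteq> carrier P"
    and g: "g \<in> gmod_hom R P M" "g ` carrier P = carrier M" "\<And>i. g ` gr P i = gr M i"
    and h: "h \<in> gmod_hom R P N" "h ` carrier P = carrier N" "\<And>i. h ` gr P i = gr N i"
    and eq: "\<And>x y. x \<in> carrier P \<Longrightarrow> y \<in> carrier P \<Longrightarrow> g x = g y \<longleftrightarrow> h x = h y"
  shows "gmod_iso R M N"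
proof -
  interpret P: module "UP R" P by fact
  \<comment> \<open>Any preimage under \<open>g\<close> would do: by \<open>eq\<close> the value of
    \<open>h\<close> does not depend on it.\<close>
  define k where "k u = h (SOME x. x \<in> carrier P \<and> g x = u)" for u
  have k: "k (g x) = h x" if "x \<in> carrier P" for x
  proof -
    let ?y = "SOME y. y \<in> carrier P \<and> g y = g x"
    have "?y \<in> carrier P \<and> g ?y = g x" by (rule someI[of _ x]) (simp add: that)
    then have "h ?y = h x" using eq[of ?y x] that by blast
    then show ?thesis by (simp only: k_def)
  qed
  have gM: "mod_hom (UP R) P M g" and hN: "mod_hom (UP R) P N h" using g h by (auto simp: gmod_hom_iff)
  have k_gr: "k ` gr M i = gr N i" for i
  proof -
    have "k ` g ` gr P i = h ` gr P i"
      unfolding image_image by (rule image_cong[OF refl k[OF subsetD[OF P(2)]]])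
    then show ?thesis using g(3) h(3) by simp
  qed
  have "k \<in> gmod_hom R M N"
    unfolding gmod_hom_iff
  proof (intro conjI mod_homI allI)
    fix x assume "x \<in> carrier M"
    then obtain x' where x: "x' \<in> carrier P" "x = g x'" unfolding g(2)[symmetric] by blast
    then show "k x \<in> carrier N" using k mod_hom_closed[OF hN] by simp
    { fix y assume "y \<in> carrier M"
      then obtain y' where y: "y' \<in> carrier P" "y = g y'" unfolding g(2)[symmetric] by blast
      have "k (g (x' \<oplus>\<^bsub>P\<^esub> y')) = k x \<oplus>\<^bsub>N\<^esub> k y" using x y k mod_hom_add[OF hN] by simp
      then show "k (x \<oplus>\<^bsub>M\<^esub> y) = k x \<oplus>\<^bsub>N\<^esub> k y" using x y mod_hom_add[OF gM] by simp }
    fix a assume a: "a \<in> carrier (UP R)"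
    have "k (g (a \<odot>\<^bsub>P\<^esub> x')) = a \<odot>\<^bsub>N\<^esub> k x" using x a k mod_hom_smult[OF hN] by simp
    then show "k (a \<odot>\<^bsub>M\<^esub> x) = a \<odot>\<^bsub>N\<^esub> k x" using x a mod_hom_smult[OF gM] by simp
  qed (simp add: k_gr)
  moreover have "bij_betw k (carrier M) (carrier N)"
    unfolding bij_betw_def
  proof
    have "k ` g ` carrier P = h ` carrier P" unfolding image_image by (rule image_cong[OF refl k])
    then show "k ` carrier M = carrier N" using g(2) h(2) by simp
    show "inj_on k (carrier M)"
    proof (rule inj_onI)
      fix u v assume "u \<in> carrier M" "v \<in> carrier M" and uv: "k u = k v"
      then obtain x y where "x \<in> carrier P" "u = g x" "y \<in> carrier P" "v = g y"
        unfolding g(2)[symmetric] by blast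
      with uv k eq[of x y] show "u = v" by simp
    qed
  qed
  ultimately show ?thesis unfolding gmod_iso_def using k_gr by blast
qed

lemma gsub_simps [simp]:
  "carrier (gsub M Z) = Z" "add (gsub M Z) = add M" "zero (gsub M Z) = zero M"
  "smult (gsub M Z) = smult M" "gr (gsub M Z) i = gr M i \<inter> Z"
  by (simp_all add: gsub_def)

lemma gquot_simps:
  "carrier (gquot M N) = (\<lambda>m. N +>\<^bsub>M\<^esub> m) ` carrier M" "add (gquot M N) = add (quot_mod M N)"
  "zero (gquot M N) = N" "smult (gquot M N) = smult (quot_mod M N)"
  "gr (gquot M N) i = (\<lambda>m. N +>\<^bsub>M\<^esub> m) ` gr M i"
  by (simp_all add: gquot_def module.extend_def gmodule.fields_def quot_mod_carrier[symmetric] quot_mod_simps)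

lemma module_gsub:
  assumes "module R M" "submodule Z R M"
  shows "module R (gsub M Z)"
  by (rule module_image[OF module_restrict[OF assms(2,1)], where h = "\<lambda>x. x"]) simp_all

lemma submodule_gsub:
  assumes "module R M" "submodule Z R M" "submodule B R M" "B \<subseteq> Z"
  shows "submodule B R (gsub M Z)"
proof -
  have "mod_hom R (M\<lparr>carrier := Z\<rparr>) (gsub M Z) (\<lambda>x. x)" by (rule mod_homI) simp_all
  from submodule_image[OF module_restrict[OF assms(2,1)] module_gsub[OF assms(1,2)] this submodule_restrict[OF assms]]
  show ?thesis by simp
qed

lemma gmod_hom_gquot:
  assumes M: "module (UP R) M" "submodule Z (UP R) M" "submodule B (UP R) M" "B \<subseteq> Z"
  shows "(\<lambda>m. B +>\<^bsub>M\<^esub> m) \<in> gmod_hom R (gsub M Z) (gquot (gsub M Z) B)"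
proof -
  have "mod_hom (UP R) (gsub M Z) (quot_mod (gsub M Z) B) (\<lambda>m. B +>\<^bsub>gsub M Z\<^esub> m)"
    using M by (intro mod_hom_coset module_gsub submodule_gsub)
  moreover have "B +>\<^bsub>gsub M Z\<^esub> m = B +>\<^bsub>M\<^esub> m" for m by (rule a_r_coset_cong) simp
  ultimately show ?thesis
    unfolding gmod_hom_iff by (auto simp: mod_hom_def gquot_simps quot_mod_carrier)
qed

text \<open>Tailored to quotients that the definitions spell out with \<open>gquot\<close> and
  \<open>gsub\<close>, such as the homology of a page or Cech cohomology. \<open>gmod_iso\<close> is
  directed, and the comparison of pages needs one direction while the filtration quotients need the
  other, so both are given.\<close>

lemma gmod_iso_gquot:
  assumes P: "module (UP R) P" "\<And>i. gr P i \<subseteq> carrier P"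
    and M: "module (UP R) M" "submodule B (UP R) M" "B \<subseteq> Z"
    and g: "mod_hom (UP R) P M g" "g ` carrier P = Z" "\<And>i. g ` gr P i = gr M i \<inter> Z"
    and h: "h \<in> gmod_hom R P N" "h ` carrier P = carrier N" "\<And>i. h ` gr P i = gr N i"
    and eq: "\<And>x y. x \<in> carrier P \<Longrightarrow> y \<in> carrier P \<Longrightarrow> h x = h y \<longleftrightarrow> g x \<ominus>\<^bsub>M\<^esub> g y \<in> B"
  shows "gmod_iso R (gquot (gsub M Z) B) N" and "gmod_iso R N (gquot (gsub M Z) B)"
proof -
  have Z: "submodule Z (UP R) M"
    using submodule_image[OF P(1) M(1) g(1) module.carrier_is_submodule[OF P(1)]] g(2) by simp
  let ?k = "\<lambda>x. B +>\<^bsub>M\<^esub> g x"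
  have "g \<in> gmod_hom R P (gsub M Z)" using g by (auto simp: gmod_hom_iff mod_hom_def)
  then have k: "?k \<in> gmod_hom R P (gquot (gsub M Z) B)"
    using gmod_hom_gquot[OF M(1) Z M(2,3)]
    unfolding gmod_hom_iff by (auto intro: mod_hom_comp simp: image_subset_iff)
  have B: "B +>\<^bsub>gsub M Z\<^esub> m = B +>\<^bsub>M\<^esub> m" for m by (rule a_r_coset_cong) simp
  have "(\<lambda>m. B +>\<^bsub>M\<^esub> m) ` g ` carrier P = carrier (gquot (gsub M Z) B)"
    "(\<lambda>m. B +>\<^bsub>M\<^esub> m) ` g ` gr P i = gr (gquot (gsub M Z) B) i" for i
    unfolding g(2,3) by (simp_all add: gquot_simps B)
  then have k_surj: "?k ` carrier P = carrier (gquot (gsub M Z) B)"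
    "?k ` gr P i = gr (gquot (gsub M Z) B) i" for i
    by (simp_all only: image_image)
  have k_eq: "h x = h y \<longleftrightarrow> ?k x = ?k y" if "x \<in> carrier P" "y \<in> carrier P" for x y
    using that eq mod_hom_closed[OF g(1)] by (simp add: coset_eq_iff[OF M(1,2)])
  show "gmod_iso R (gquot (gsub M Z) B) N"
    using k_eq by (intro gmod_iso_of_surjections[OF P k k_surj h]) auto
  show "gmod_iso R N (gquot (gsub M Z) B)"
    using k_eq by (intro gmod_iso_of_surjections[OF P h k k_surj]) auto
qed

text \<open>Linearity descends along the surjection \<open>p\<close>. It serves for maps given by
  unions of cosets or by sums in quotients, whose values are known on representatives only.\<close>

lemma mod_hom_factor:
  assumes p: "mod_hom R P M p" "p ` carrier P = carrier M" and k: "mod_hom R P N k"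
    and P: "module R P" and f: "\<And>x. x \<in> carrier P \<Longrightarrow> f (p x) = k x"
  shows "mod_hom R M N f"
proof -
  interpret P: module R P by fact
  have M: "\<exists>x\<in>carrier P. u = p x" if "u \<in> carrier M" for u using that p(2) by blast
  show ?thesis
  proof (rule mod_homI)
    fix u assume "u \<in> carrier M"
    then obtain x where x: "x \<in> carrier P" "u = p x" using M by blast
    then show "f u \<in> carrier N" using f mod_hom_closed[OF k] by simp
    { fix v assume "v \<in> carrier M"
      then obtain y where y: "y \<in> carrier P" "v = p y" using M by blast
      have "f (p (x \<oplus>\<^bsub>P\<^esub> y)) = f u \<oplus>\<^bsub>N\<^esub> f v" using x y f mod_hom_add[OF k] by simp
      then show "f (u \<oplus>\<^bsub>M\<^esub> v) = f u \<oplus>\<^bsub>N\<^esub> f v" using x y mod_hom_add[OF p(1)] by simp }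
    fix a assume a: "a \<in> carrier R"
    have "f (p (a \<odot>\<^bsub>P\<^esub> x)) = a \<odot>\<^bsub>N\<^esub> f u" using x a f mod_hom_smult[OF k] by simp
    then show "f (a \<odot>\<^bsub>M\<^esub> u) = a \<odot>\<^bsub>N\<^esub> f u" using x a mod_hom_smult[OF p(1)] by simp
  qed
qed

lemma coset_map_restrict [simp]: "coset_map (M\<lparr>carrier := Z\<rparr>) B = coset_map M B"
  by (intro ext) (simp add: coset_map_def)

lemma coset_map_coset_restrict:
  assumes M: "module R M" "submodule Z R M" "submodule B R M" "B \<subseteq> Z"
    and M': "module R M'" "submodule Z' R M'" "submodule B' R M'" "B' \<subseteq> Z'"
    and h: "mod_hom R M M' h" "h ` Z \<subseteq> Z'" "h ` B \<subseteq> B'" and x: "x \<in> Z"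
  shows "coset_map M' B' h (B +>\<^bsub>M\<^esub> x) = B' +>\<^bsub>M'\<^esub> h x"
  using coset_map_coset[OF module_restrict[OF M(2,1)] submodule_restrict[OF M]
      module_restrict[OF M'(2,1)] submodule_restrict[OF M']
      mod_hom_restrict[OF h(1) submodule_subset[OF M(2)] h(2)] h(3)] x by simp

lemma quot_mod_restrict_carrier:
  "carrier (quot_mod (M\<lparr>carrier := Z\<rparr>) B) = (\<lambda>x. B +>\<^bsub>M\<^esub> x) ` Z"
  by (simp add: quot_mod_carrier)

lemma mod_hom_coset_restrict:
  assumes "module R M" "submodule Z R M" "submodule B R M" "B \<subseteq> Z"
  shows "mod_hom R (M\<lparr>carrier := Z\<rparr>) (quot_mod (M\<lparr>carrier := Z\<rparr>) B) (\<lambda>x. B +>\<^bsub>M\<^esub> x)"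
  using mod_hom_coset[OF module_restrict[OF assms(2,1)] submodule_restrict[OF assms]] by simp

lemma mod_hom_coset_map:
  assumes M: "module R M" "submodule Z R M" "submodule B R M" "B \<subseteq> Z"
    and M': "module R M'" "submodule Z' R M'" "submodule B' R M'" "B' \<subseteq> Z'"
    and h: "mod_hom R M M' h" "h ` Z \<subseteq> Z'" "h ` B \<subseteq> B'"
  shows "mod_hom R (quot_mod (M\<lparr>carrier := Z\<rparr>) B) (quot_mod (M'\<lparr>carrier := Z'\<rparr>) B') (coset_map M' B' h)"
proof (rule mod_hom_factor[OF mod_hom_coset_restrict[OF M]])
  show "mod_hom R (M\<lparr>carrier := Z\<rparr>) (quot_mod (M'\<lparr>carrier := Z'\<rparr>) B') (\<lambda>x. B' +>\<^bsub>M'\<^esub> h x)"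
    by (rule mod_hom_comp[OF mod_hom_restrict[OF h(1) submodule_subset[OF M(2)] h(2)] mod_hom_coset_restrict[OF M']])
  show "module R (M\<lparr>carrier := Z\<rparr>)" by (rule module_restrict[OF M(2,1)])
  show "coset_map M' B' h (B +>\<^bsub>M\<^esub> x) = B' +>\<^bsub>M'\<^esub> h x" if "x \<in> carrier (M\<lparr>carrier := Z\<rparr>)" for x
    using that by (intro coset_map_coset_restrict[OF M M' h]) simp
qed (simp add: quot_mod_restrict_carrier)

section \<open>Degreewise submodules and subquotients of persistence modules\<close>

definition sub_pers ::
    "('r, 'z) ring_scheme \<Rightarrow> (int \<Rightarrow> ('r, 'm) module) \<Rightarrow> (int \<Rightarrow> 'm \<Rightarrow> 'm) \<Rightarrow> (int \<Rightarrow> 'm set) \<Rightarrow>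
     (nat \<Rightarrow> 'r, int \<Rightarrow> 'm) gmodule" where
  "sub_pers R T \<phi> Z = pers_gmodule R (\<lambda>i. (T i)\<lparr>carrier := Z i\<rparr>) \<phi>"

text \<open>The subquotients Z i / B i with the induced maps. Persistent cohomology unfolds to
  exactly this shape, as do the pages, so one theory covers both.\<close>

definition quot_pers ::
    "('r, 'z) ring_scheme \<Rightarrow> (int \<Rightarrow> ('r, 'm) module) \<Rightarrow> (int \<Rightarrow> 'm \<Rightarrow> 'm) \<Rightarrow> (int \<Rightarrow> 'm set) \<Rightarrow>
     (int \<Rightarrow> 'm set) \<Rightarrow> (nat \<Rightarrow> 'r, int \<Rightarrow> 'm set) gmodule" where
  "quot_pers R T \<phi> Z B =
    pers_gmodule R (\<lambda>i. quot_mod ((T i)\<lparr>carrier := Z i\<rparr>) (B i)) (\<lambda>i. coset_map (T (i + 1)) (B (i + 1)) (\<phi> i))"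

locale subpersistence = persistence R T \<phi>
  for R :: "('r, 'z) ring_scheme" and T :: "int \<Rightarrow> ('r, 'm) module" and \<phi> +
  fixes Z :: "int \<Rightarrow> 'm set"
  assumes sub_Z: "\<And>i. submodule (Z i) R (T i)"
    and hom_Z: "\<And>i. \<phi> i ` Z i \<subseteq> Z (i + 1)"
begin

lemma persistence_sub: "persistence R (\<lambda>i. (T i)\<lparr>carrier := Z i\<rparr>) \<phi>"
  by (intro persistence.intro ring module_restrict sub_Z module_at mod_hom_restrict hom_at hom_Z
      submodule_subset[OF sub_Z])

lemma sub_pers_carrierD: "x \<in> carrier (sub_pers R T \<phi> Z) \<Longrightarrow> x i \<in> Z i"
  by (simp add: sub_pers_def pers_gmodule_def)

lemma module_sub_pers: "module (UP R) (sub_pers R T \<phi> Z)"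
  unfolding sub_pers_def by (rule persistence.module_pers[OF persistence_sub])

lemma gr_sub_pers_subset: "gr (sub_pers R T \<phi> Z) i \<subseteq> carrier (sub_pers R T \<phi> Z)"
  unfolding sub_pers_def by (rule persistence.gr_pers_subset[OF persistence_sub])

lemma sub_pers_minus:
  assumes "x \<in> carrier (sub_pers R T \<phi> Z)" "y \<in> carrier (sub_pers R T \<phi> Z)"
  shows "(x \<ominus>\<^bsub>sub_pers R T \<phi> Z\<^esub> y) i = x i \<ominus>\<^bsub>T i\<^esub> y i"
  using persistence.pers_minus[OF persistence_sub] assms sub_pers_carrierD
    a_minus_restrict[OF module_at sub_Z]
  unfolding sub_pers_def by simp

lemma gmod_hom_sub_pers:
  "(\<lambda>x i. x i) \<in> gmod_hom R (sub_pers R T \<phi> Z) (pers_gmodule R T \<phi>)"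
  unfolding sub_pers_def
proof (rule gmod_hom_pers[OF persistence_sub persistence_axioms])
  show "mod_hom R ((T i)\<lparr>carrier := Z i\<rparr>) (T i) (\<lambda>x. x)" for i
    using submodule_subset[OF sub_Z] by (intro mod_homI) auto
qed simp

lemma carrier_sub_pers: "carrier (sub_pers R T \<phi> Z) = {m \<in> carrier (pers_gmodule R T \<phi>). \<forall>i. m i \<in> Z i}"
  using submodule_subset[OF sub_Z] by (auto simp: sub_pers_def pers_gmodule_def)

lemma gr_sub_pers: "gr (sub_pers R T \<phi> Z) i = gr (pers_gmodule R T \<phi>) i \<inter> carrier (sub_pers R T \<phi> Z)"
proof -
  have "m \<in> gr (sub_pers R T \<phi> Z) i \<longleftrightarrow> m \<in> gr (pers_gmodule R T \<phi>) i \<and> (\<forall>i. m i \<in> Z i)" for m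
  proof -
    have "m j \<in> Z j" if "m i \<in> Z i" "\<forall>j. j \<noteq> i \<longrightarrow> m j = \<zero>\<^bsub>T j\<^esub>" for j
      using that submodule_zero[OF sub_Z, of j] by (cases "j = i") auto
    then show ?thesis using submodule_subset[OF sub_Z, of i] by (auto simp: sub_pers_def pers_gmodule_def)
  qed
  then show ?thesis using gr_pers_subset by (auto simp: carrier_sub_pers)
qed

lemma submodule_sub_pers:
  "submodule {m \<in> carrier (pers_gmodule R T \<phi>). \<forall>i. m i \<in> Z i} (UP R) (pers_gmodule R T \<phi>)"
  using submodule_image[OF module_sub_pers module_pers _ module.carrier_is_submodule[OF module_sub_pers], of "\<lambda>x i. x i"]
    gmod_hom_sub_pers carrier_sub_pers by (simp add: gmod_hom_iff)

text \<open>\<open>gsub\<close> of the ambient module and \<open>sub_pers\<close> share carrier,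
  addition and grading, but their scalar multiplications are sums in different records, known to
  agree on the carrier only. Gradedness is therefore transferred axiom by axiom.\<close>

lemma graded_submodule_sub_pers:
  "graded_submodule R {m \<in> carrier (pers_gmodule R T \<phi>). \<forall>i. m i \<in> Z i} (pers_gmodule R T \<phi>)"
proof -
  let ?P = "pers_gmodule R T \<phi>" and ?S = "sub_pers R T \<phi> Z"
  let ?G = "gsub ?P {m \<in> carrier ?P. \<forall>i. m i \<in> Z i}"
  have add: "add_monoid ?G = add_monoid ?S"
    by (simp add: carrier_sub_pers) (simp add: sub_pers_def pers_gmodule_def)
  have eqs: "carrier ?G = carrier ?S" "zero ?G = zero ?S" "gr ?G = gr ?S"
    by (simp_all add: carrier_sub_pers gr_sub_pers fun_eq_iff) (simp add: sub_pers_def pers_gmodule_def)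
  have smult: "p \<odot>\<^bsub>?G\<^esub> m = p \<odot>\<^bsub>?S\<^esub> m" if "p \<in> carrier (UP R)" "m \<in> carrier ?S" for p m
    using that gmod_hom_sub_pers by (simp add: gmod_hom_iff mod_hom_def)
  have fin: "finsum ?G = finsum ?S" by (intro ext) (simp only: finsum_def add)
  have S: "graded_module R ?S" unfolding sub_pers_def by (rule persistence.graded_pers[OF persistence_sub])
  have monom: "monom (UP R) a k \<odot>\<^bsub>?G\<^esub> m \<in> gr ?G (i + int k)" if "a \<in> carrier R" "m \<in> gr ?G i" for a k m i
  proof -
    have m: "m \<in> gr ?S i" "m \<in> carrier ?S" using that gr_sub_pers_subset by (auto simp: eqs)
    with that S have "monom (UP R) a k \<odot>\<^bsub>?S\<^esub> m \<in> gr ?S (i + int k)" by (simp add: graded_module_def)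
    with m that show ?thesis by (simp only: smult eqs monom_closed)
  qed
  have "graded_module R ?G"
    unfolding graded_module_def
  proof (intro conjI allI ballI)
    show "module (UP R) ?G" by (rule module_gsub[OF module_pers submodule_sub_pers])
    show "subgroup (gr ?G i) (add_monoid ?G)" for i
      unfolding add eqs(3) using S by (simp only: graded_module_def)
    show "monom (UP R) a k \<odot>\<^bsub>?G\<^esub> m \<in> gr ?G (i + int k)" if "a \<in> carrier R" "m \<in> gr ?G i" for a k m i
      by (rule monom[OF that])
    show "\<exists>!h. (\<forall>i. h i \<in> gr ?G i) \<and> finite {i. h i \<noteq> \<zero>\<^bsub>?G\<^esub>} \<and>
        m = (\<Oplus>\<^bsub>?G\<^esub>i\<in>{i. h i \<noteq> \<zero>\<^bsub>?G\<^esub>}. h i)" if "m \<in> carrier ?G" for m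
      using that S unfolding eqs fin graded_module_def by simp
  qed
  then show ?thesis using submodule_sub_pers by (simp add: graded_submodule_def)
qed

end

locale subquotient = subpersistence R T \<phi> Z
  for R :: "('r, 'z) ring_scheme" and T :: "int \<Rightarrow> ('r, 'm) module" and \<phi> Z +
  fixes B :: "int \<Rightarrow> 'm set"
  assumes sub_B: "\<And>i. submodule (B i) R (T i)"
    and hom_B: "\<And>i. \<phi> i ` B i \<subseteq> B (i + 1)"
    and B_le_Z: "\<And>i. B i \<subseteq> Z i"
begin

lemma persistence_quot:
  "persistence R (\<lambda>i. quot_mod ((T i)\<lparr>carrier := Z i\<rparr>) (B i)) (\<lambda>i. coset_map (T (i + 1)) (B (i + 1)) (\<phi> i))"
  by (intro persistence.intro ring module_quot_mod module_restrict submodule_restrict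
      sub_Z sub_B module_at B_le_Z hom_at hom_Z hom_B mod_hom_coset_map)

lemma graded_quot_pers: "graded_module R (quot_pers R T \<phi> Z B)"
  unfolding quot_pers_def by (rule persistence.graded_pers[OF persistence_quot])

lemma module_quot_pers: "module (UP R) (quot_pers R T \<phi> Z B)"
  unfolding quot_pers_def by (rule persistence.module_pers[OF persistence_quot])

text \<open>Together these facts make passing to cosets an admissible surjection out of
  \<open>sub_pers\<close> for \<open>gmod_iso_gquot\<close>.\<close>

lemma coset_hom:
  shows "(\<lambda>x i. B i +>\<^bsub>T i\<^esub> x i) \<in> gmod_hom R (sub_pers R T \<phi> Z) (quot_pers R T \<phi> Z B)"
    and "(\<lambda>x i. B i +>\<^bsub>T i\<^esub> x i) ` carrier (sub_pers R T \<phi> Z) = carrier (quot_pers R T \<phi> Z B)"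
    and "(\<lambda>x i. B i +>\<^bsub>T i\<^esub> x i) ` gr (sub_pers R T \<phi> Z) j = gr (quot_pers R T \<phi> Z B) j"
proof -
  have h: "mod_hom R ((T i)\<lparr>carrier := Z i\<rparr>) (quot_mod ((T i)\<lparr>carrier := Z i\<rparr>) (B i)) (\<lambda>x. B i +>\<^bsub>T i\<^esub> x)" for i
    by (intro mod_hom_coset_restrict module_at sub_Z sub_B B_le_Z)
  show "(\<lambda>x i. B i +>\<^bsub>T i\<^esub> x i) \<in> gmod_hom R (sub_pers R T \<phi> Z) (quot_pers R T \<phi> Z B)"
    unfolding sub_pers_def quot_pers_def
  proof (rule gmod_hom_pers[OF persistence_sub persistence_quot h])
    fix i m assume "m \<in> carrier ((T i)\<lparr>carrier := Z i\<rparr>)"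
    then show "B (i + 1) +>\<^bsub>T (i + 1)\<^esub> \<phi> i m = coset_map (T (i + 1)) (B (i + 1)) (\<phi> i) (B i +>\<^bsub>T i\<^esub> m)"
      by (intro coset_map_coset_restrict[OF module_at sub_Z sub_B B_le_Z module_at sub_Z sub_B B_le_Z
            hom_at hom_Z hom_B, symmetric]) simp
  qed
  note im = pers_map_image[OF persistence_sub persistence_quot h]
  show "(\<lambda>x i. B i +>\<^bsub>T i\<^esub> x i) ` carrier (sub_pers R T \<phi> Z) = carrier (quot_pers R T \<phi> Z B)"
    using persistence.pers_carrierD[OF persistence_quot]
    unfolding sub_pers_def quot_pers_def im by (auto simp: quot_mod_restrict_carrier)
  show "(\<lambda>x i. B i +>\<^bsub>T i\<^esub> x i) ` gr (sub_pers R T \<phi> Z) j = gr (quot_pers R T \<phi> Z B) j"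
    using persistence.pers_carrierD[OF persistence_quot] persistence.gr_pers_subset[OF persistence_quot]
    unfolding sub_pers_def quot_pers_def im
    by (auto simp: quot_mod_restrict_carrier subset_iff)
qed

lemma coset_hom_eq_iff:
  assumes "x \<in> carrier (sub_pers R T \<phi> Z)" "y \<in> carrier (sub_pers R T \<phi> Z)"
  shows "(\<lambda>i. B i +>\<^bsub>T i\<^esub> x i) = (\<lambda>i. B i +>\<^bsub>T i\<^esub> y i) \<longleftrightarrow> (\<forall>i. x i \<ominus>\<^bsub>T i\<^esub> y i \<in> B i)"
proof -
  have "x i \<in> carrier (T i)" "y i \<in> carrier (T i)" for i
    using assms sub_pers_carrierD submodule_subset[OF sub_Z] by blast+
  then show ?thesis by (simp add: fun_eq_iff coset_eq_iff[OF module_at sub_B])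
qed

text \<open>The comparison is reduced to one linear map \<open>g\<close> on families of
  representatives: it has to hit exactly \<open>Z'\<close> and pull \<open>B'\<close> back to the
  families in \<open>B\<close>. It is applied to the next page, to the limit page and to the second
  page.\<close>

lemma gmod_iso_gquot_quot_pers:
  assumes M: "module (UP R) M" "submodule B' (UP R) M" "B' \<subseteq> Z'"
    and g: "mod_hom (UP R) (sub_pers R T \<phi> Z) M g" "g ` carrier (sub_pers R T \<phi> Z) = Z'"
      "\<And>i. g ` gr (sub_pers R T \<phi> Z) i = gr M i \<inter> Z'"
    and ker: "\<And>x. x \<in> carrier (sub_pers R T \<phi> Z) \<Longrightarrow> g x \<in> B' \<longleftrightarrow> (\<forall>i. x i \<in> B i)"
  shows "gmod_iso R (gquot (gsub M Z') B') (quot_pers R T \<phi> Z B)"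
    and "gmod_iso R (quot_pers R T \<phi> Z B) (gquot (gsub M Z') B')"
proof -
  let ?P = "sub_pers R T \<phi> Z"
  interpret P: module "UP R" ?P by (rule module_sub_pers)
  have eq: "(\<lambda>i. B i +>\<^bsub>T i\<^esub> x i) = (\<lambda>i. B i +>\<^bsub>T i\<^esub> y i) \<longleftrightarrow> g x \<ominus>\<^bsub>M\<^esub> g y \<in> B'"
    if "x \<in> carrier ?P" "y \<in> carrier ?P" for x y
  proof -
    have d: "x \<ominus>\<^bsub>?P\<^esub> y \<in> carrier ?P" using that by simp
    show ?thesis
      using ker[OF d] that
      by (simp add: coset_hom_eq_iff sub_pers_minus mod_hom_diff[OF module_sub_pers M(1) g(1)])
  qed
  show "gmod_iso R (gquot (gsub M Z') B') (quot_pers R T \<phi> Z B)"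
    and "gmod_iso R (quot_pers R T \<phi> Z B) (gquot (gsub M Z') B')"
    by (rule gmod_iso_gquot[OF module_sub_pers gr_sub_pers_subset M g coset_hom eq]; assumption)+
qed

end

lemma gmod_hom_quot_pers:
  assumes "subquotient R T \<phi> Z B" "subquotient R T' \<phi>' Z' B'"
    and h: "\<And>i. mod_hom R (T i) (T' i) (h i)" "\<And>i. h i ` Z i \<subseteq> Z' i" "\<And>i. h i ` B i \<subseteq> B' i"
    and nat: "\<And>i m. m \<in> Z i \<Longrightarrow> h (i + 1) (\<phi> i m) = \<phi>' i (h i m)"
  shows "(\<lambda>e i. coset_map (T' i) (B' i) (h i) (e i)) \<in>
    gmod_hom R (quot_pers R T \<phi> Z B) (quot_pers R T' \<phi>' Z' B')"
proof -
  interpret A: subquotient R T \<phi> Z B by fact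
  interpret B: subquotient R T' \<phi>' Z' B' by fact
  note [simp] =
    coset_map_coset_restrict[OF A.module_at A.sub_Z A.sub_B A.B_le_Z B.module_at B.sub_Z B.sub_B B.B_le_Z h]
    coset_map_coset_restrict[OF A.module_at A.sub_Z A.sub_B A.B_le_Z A.module_at A.sub_Z A.sub_B A.B_le_Z
      A.hom_at A.hom_Z A.hom_B]
    coset_map_coset_restrict[OF B.module_at B.sub_Z B.sub_B B.B_le_Z B.module_at B.sub_Z B.sub_B B.B_le_Z
      B.hom_at B.hom_Z B.hom_B]
  show ?thesis
    unfolding quot_pers_def
  proof (rule gmod_hom_pers[OF A.persistence_quot B.persistence_quot])
    show "mod_hom R (quot_mod ((T i)\<lparr>carrier := Z i\<rparr>) (B i)) (quot_mod ((T' i)\<lparr>carrier := Z' i\<rparr>) (B' i))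
        (coset_map (T' i) (B' i) (h i))" for i
      by (intro mod_hom_coset_map A.module_at A.sub_Z A.sub_B A.B_le_Z B.module_at B.sub_Z B.sub_B B.B_le_Z h)
    fix i C assume "C \<in> carrier (quot_mod ((T i)\<lparr>carrier := Z i\<rparr>) (B i))"
    then obtain m where m: "m \<in> Z i" "C = B i +>\<^bsub>T i\<^esub> m" by (auto simp: quot_mod_restrict_carrier)
    moreover have "\<phi> i m \<in> Z (i + 1)" "h i m \<in> Z' i" using A.hom_Z h(2) m(1) by blast+
    ultimately show "coset_map (T' (i + 1)) (B' (i + 1)) (h (i + 1))
          (coset_map (T (i + 1)) (B (i + 1)) (\<phi> i) C) =
        coset_map (T' (i + 1)) (B' (i + 1)) (\<phi>' i) (coset_map (T' i) (B' i) (h i) C)"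
      by (simp add: nat)
  qed
qed

section \<open>The spectral sequence of a filtered complex\<close>

text \<open>The approximate cycles Z_r^p in total degree \<open>n\<close>: the boundary jumps
  \<open>r\<close> filtration steps. Indices are integers so that p - r and n - 1 always make
  sense.\<close>

definition fc_Z :: "(int \<Rightarrow> 'm \<Rightarrow> 'm) \<Rightarrow> (int \<Rightarrow> int \<Rightarrow> 'm set) \<Rightarrow> int \<Rightarrow> int \<Rightarrow> int \<Rightarrow> 'm set" where
  "fc_Z D F r n p = {x \<in> F n p. D n x \<in> F (n + 1) (p + r)}"

text \<open>The classical denominator Z_(r-1)^(p+1) + D Z_(r-1)^(p-r+1), for which E_r^p is Z_r^p
  modulo it. The first summand makes elements deeper in the filtration negligible, the second holds
  the boundaries that earlier differentials account for.\<close>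

definition fc_B ::
    "(int \<Rightarrow> ('r, 'm) module) \<Rightarrow> (int \<Rightarrow> 'm \<Rightarrow> 'm) \<Rightarrow> (int \<Rightarrow> int \<Rightarrow> 'm set) \<Rightarrow> int \<Rightarrow> int \<Rightarrow> int \<Rightarrow> 'm set" where
  "fc_B T D F r n p = {a \<oplus>\<^bsub>T n\<^esub> b | a b. a \<in> fc_Z D F (r - 1) n (p + 1) \<and>
    b \<in> D (n - 1) ` fc_Z D F (r - 1) (n - 1) (p - r + 1)}"

text \<open>By \<open>F_top\<close> and \<open>F_bot\<close> the filtration in total degree
  \<open>n\<close> changes only between steps 0 and n + 1. This makes the pages first-quadrant and
  stationary.\<close>

locale filtered_complex =
  fixes R :: "('r, 'z) ring_scheme" and T :: "int \<Rightarrow> ('r, 'm) module"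
    and D :: "int \<Rightarrow> 'm \<Rightarrow> 'm" and F :: "int \<Rightarrow> int \<Rightarrow> 'm set"
  assumes module_T: "\<And>n. module R (T n)"
    and hom_D: "\<And>n. mod_hom R (T n) (T (n + 1)) (D n)"
    and D_D: "\<And>n x. x \<in> carrier (T n) \<Longrightarrow> D (n + 1) (D n x) = \<zero>\<^bsub>T (n + 2)\<^esub>"
    and sub_F: "\<And>n p. submodule (F n p) R (T n)"
    and F_decr: "\<And>n p. F n (p + 1) \<subseteq> F n p"
    and D_F: "\<And>n p x. x \<in> F n p \<Longrightarrow> D n x \<in> F (n + 1) p"
    and F_top: "\<And>n p. p \<le> 0 \<Longrightarrow> F n p = carrier (T n)"
    and F_bot: "\<And>n p. n < p \<Longrightarrow> F n p = {\<zero>\<^bsub>T n\<^esub>}"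
begin

abbreviation "Z \<equiv> fc_Z D F"
abbreviation "B \<equiv> fc_B T D F"

lemma F_closed: "x \<in> F n p \<Longrightarrow> x \<in> carrier (T n)"
  using submodule_subset[OF sub_F] by blast

lemma zero_F: "\<zero>\<^bsub>T n\<^esub> \<in> F n p"
  by (rule submodule_zero[OF sub_F])

lemma F_mono: "p \<le> q \<Longrightarrow> F n q \<subseteq> F n p"
proof (induction q rule: int_ge_induct)
  case (step i)
  then show ?case using F_decr by blast
qed simp

lemma hom_D': "m = n + 1 \<Longrightarrow> mod_hom R (T n) (T m) (D n)"
  using hom_D by simp

lemma D_D': "m = n + 1 \<Longrightarrow> k = n + 2 \<Longrightarrow> x \<in> carrier (T n) \<Longrightarrow> D m (D n x) = \<zero>\<^bsub>T k\<^esub>"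
  using D_D by simp

lemma sub_Z: "submodule (Z r n p) R (T n)"
  unfolding fc_Z_def by (rule submodule_vimage[OF module_T module_T hom_D sub_F sub_F])

lemma sub_B: "submodule (B r n p) R (T n)"
  unfolding fc_B_def
  by (rule submodule_sum[OF module_T sub_Z submodule_image[OF module_T module_T hom_D' sub_Z]]) simp

lemma Z_closed: "x \<in> Z r n p \<Longrightarrow> x \<in> carrier (T n)"
  using submodule_subset[OF sub_Z] by blast

lemma Z_B: "a \<in> Z (r - 1) n (p + 1) \<Longrightarrow> a \<in> B r n p"
  and D_B: "y \<in> Z (r - 1) (n - 1) (p - r + 1) \<Longrightarrow> D (n - 1) y \<in> B r n p"
proof -
  interpret T: module R "T n" by (rule module_T)
  have hom: "mod_hom R (T (n - 1)) (T n) (D (n - 1))" by (rule hom_D') simp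
  have zero: "D (n - 1) \<zero>\<^bsub>T (n - 1)\<^esub> = \<zero>\<^bsub>T n\<^esub>" by (rule mod_hom_zero[OF module_T module_T hom])
  show "a \<in> B r n p" if "a \<in> Z (r - 1) n (p + 1)"
  proof -
    have "a = a \<oplus>\<^bsub>T n\<^esub> \<zero>\<^bsub>T n\<^esub>" using Z_closed[OF that] by simp
    moreover have "\<zero>\<^bsub>T n\<^esub> \<in> D (n - 1) ` Z (r - 1) (n - 1) (p - r + 1)"
      using zero submodule_zero[OF sub_Z] by (metis image_eqI)
    ultimately show ?thesis using that unfolding fc_B_def by blast
  qed
  show "D (n - 1) y \<in> B r n p" if "y \<in> Z (r - 1) (n - 1) (p - r + 1)"
  proof -
    have "D (n - 1) y = \<zero>\<^bsub>T n\<^esub> \<oplus>\<^bsub>T n\<^esub> D (n - 1) y" using mod_hom_closed[OF hom Z_closed[OF that]] by simp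
    then show ?thesis using that submodule_zero[OF sub_Z] unfolding fc_B_def by blast
  qed
qed

lemma B_cases:
  assumes "x \<in> B r n p"
  obtains a y where "a \<in> Z (r - 1) n (p + 1)" "y \<in> Z (r - 1) (n - 1) (p - r + 1)"
    "x = a \<oplus>\<^bsub>T n\<^esub> D (n - 1) y"
  using assms unfolding fc_B_def by auto

text \<open>The boundary of an element of Z_(r-1)^(p+1) lies in filtration (p + 1) + (r - 1) = p +
  r, and an element of the second summand is itself a cycle, in filtration (p - r + 1) + (r - 1) =
  p.\<close>

lemma B_le_Z: "1 \<le> r \<Longrightarrow> B r n p \<subseteq> Z r n p"
proof
  fix x assume r: "1 \<le> r" and x: "x \<in> B r n p"
  from x obtain a y where a: "a \<in> Z (r - 1) n (p + 1)" and y: "y \<in> Z (r - 1) (n - 1) (p - r + 1)"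
    and xay: "x = a \<oplus>\<^bsub>T n\<^esub> D (n - 1) y" by (rule B_cases)
  have "a \<in> Z r n p" using a F_decr[of n p] by (auto simp: fc_Z_def add.assoc)
  moreover have "D (n - 1) y \<in> Z r n p"
    using y Z_closed[OF y] zero_F[of "n + 1"]
    by (auto simp: fc_Z_def D_D'[of n "n - 1" "n + 1"])
  ultimately show "x \<in> Z r n p" unfolding xay by (rule submodule_add[OF sub_Z])
qed

lemma D_Z: "D n ` Z r n p \<subseteq> Z r (n + 1) (p + r)"
  using zero_F F_closed by (auto simp: fc_Z_def D_D'[of "n + 1" n "n + 1 + 1"])

text \<open>\<open>D\<close> kills the second summand and turns the first into the second summand of
  the target, where sources start in filtration (p + r) - r + 1 = p + 1.\<close>

lemma D_image_B: "D n ` B r n p \<subseteq> B r (n + 1) (p + r)"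
proof
  fix u assume "u \<in> D n ` B r n p"
  then obtain x where x: "x \<in> B r n p" "u = D n x" by auto
  from x(1) obtain a y where a: "a \<in> Z (r - 1) n (p + 1)" and y: "y \<in> Z (r - 1) (n - 1) (p - r + 1)"
    and xay: "x = a \<oplus>\<^bsub>T n\<^esub> D (n - 1) y" by (rule B_cases)
  interpret T: module R "T (n + 1)" by (rule module_T)
  have "D (n - 1) y \<in> carrier (T n)" using mod_hom_closed[OF hom_D' Z_closed[OF y], of n] by simp
  then have "D n x = D n a \<oplus>\<^bsub>T (n + 1)\<^esub> D n (D (n - 1) y)"
    unfolding xay using Z_closed[OF a] by (intro mod_hom_add[OF hom_D])
  also have "\<dots> = D n a"
    using mod_hom_closed[OF hom_D Z_closed[OF a]] Z_closed[OF y] by (simp add: D_D'[of n "n - 1" "n + 1"])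
  finally show "u \<in> B r (n + 1) (p + r)" using D_B[of a r "n + 1" "p + r"] a x(2) by simp
qed

text \<open>The cycles of d_r are the classes of Z_(r+1). If D x = a + D z with \<open>a\<close> one
  step deeper than required, then x - z lies in Z_(r+1), and \<open>z\<close> is in the denominator.
  Conversely, the boundary of an element of Z_(r+1) is negligible in the target.\<close>

lemma kernel_iff:
  assumes "1 \<le> r" and x: "x \<in> Z r n p"
  shows "D n x \<in> B r (n + 1) (p + r) \<longleftrightarrow> (\<exists>z\<in>Z (r + 1) n p. x \<ominus>\<^bsub>T n\<^esub> z \<in> B r n p)"
proof
  interpret T: module R "T n" by (rule module_T)
  interpret T1: module R "T (n + 1)" by (rule module_T)
  note xc = Z_closed[OF x]
  {
    assume "D n x \<in> B r (n + 1) (p + r)"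
    \<comment> \<open>The sources for the denominator at (n + 1, p + r) lie in filtration p + 1, so
      \<open>z\<close> is one step deeper than \<open>x\<close>.\<close>
    then obtain a z where a: "a \<in> Z (r - 1) (n + 1) (p + r + 1)" and z: "z \<in> Z (r - 1) n (p + 1)"
      and Dx: "D n x = a \<oplus>\<^bsub>T (n + 1)\<^esub> D n z" by (auto elim: B_cases)
    note zc = Z_closed[OF z] and ac = Z_closed[OF a]
    have "D n (x \<ominus>\<^bsub>T n\<^esub> z) = a"
      using mod_hom_diff[OF module_T module_T hom_D xc zc] ac mod_hom_closed[OF hom_D zc]
      by (simp add: Dx a_minus_def T1.a_assoc T1.r_neg)
    moreover have "z \<in> F n p" using z F_decr by (auto simp: fc_Z_def)
    ultimately have "x \<ominus>\<^bsub>T n\<^esub> z \<in> Z (r + 1) n p"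
      using x a submodule_diff[OF sub_F] by (auto simp: fc_Z_def add.assoc)
    moreover have "x \<ominus>\<^bsub>T n\<^esub> (x \<ominus>\<^bsub>T n\<^esub> z) = z"
      using xc zc by (simp add: a_minus_def T.minus_add T.a_assoc[symmetric] T.r_neg)
    ultimately show "\<exists>z\<in>Z (r + 1) n p. x \<ominus>\<^bsub>T n\<^esub> z \<in> B r n p"
      using Z_B[OF z] by (intro bexI[of _ "x \<ominus>\<^bsub>T n\<^esub> z"]) simp_all
  }
  {
    assume "\<exists>z\<in>Z (r + 1) n p. x \<ominus>\<^bsub>T n\<^esub> z \<in> B r n p"
    then obtain z where z: "z \<in> Z (r + 1) n p" "x \<ominus>\<^bsub>T n\<^esub> z \<in> B r n p" by auto
    note zc = Z_closed[OF z(1)]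
    have "D n z \<in> Z (r - 1) (n + 1) (p + r + 1)"
      using z zero_F zc by (auto simp: fc_Z_def add.assoc[of p] D_D'[of "n + 1" n "n + 1 + 1"])
    from Z_B[OF this] have "D n z \<in> B r (n + 1) (p + r)" .
    moreover have "D n (x \<ominus>\<^bsub>T n\<^esub> z) \<in> B r (n + 1) (p + r)" using z(2) D_image_B by blast
    ultimately have "D n (x \<ominus>\<^bsub>T n\<^esub> z) \<oplus>\<^bsub>T (n + 1)\<^esub> D n z \<in> B r (n + 1) (p + r)"
      by (intro submodule_add[OF sub_B])
    moreover have "D n (x \<ominus>\<^bsub>T n\<^esub> z) \<oplus>\<^bsub>T (n + 1)\<^esub> D n z = D n x"
      using mod_hom_diff[OF module_T module_T hom_D xc zc] mod_hom_closed[OF hom_D xc] mod_hom_closed[OF hom_D zc]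
      by (simp add: a_minus_def T1.a_assoc T1.l_neg)
    ultimately show "D n x \<in> B r (n + 1) (p + r)" by simp
  }
qed

text \<open>Modulo the denominator of page \<open>r\<close>, the denominator of page
  \<open>r + 1\<close> is the image of d_r from filtration p - r. Passing back and forth changes the
  remainder \<open>a\<close> between Z_r^(p+1) and the larger Z_(r-1)^(p+1).\<close>

lemma boundary_iff:
  assumes "1 \<le> r" and x: "x \<in> Z (r + 1) n p"
  shows "x \<in> B (r + 1) n p \<longleftrightarrow> (\<exists>y\<in>Z r (n - 1) (p - r). x \<ominus>\<^bsub>T n\<^esub> D (n - 1) y \<in> B r n p)"
proof
  interpret T: module R "T n" by (rule module_T)
  interpret T0: module R "T (n - 1)" by (rule module_T)
  have hom: "mod_hom R (T (n - 1)) (T n) (D (n - 1))" by (rule hom_D') simp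
  note xc = Z_closed[OF x]
  {
    assume "x \<in> B (r + 1) n p"
    then obtain a y where a: "a \<in> Z r n (p + 1)" and y: "y \<in> Z r (n - 1) (p - r)"
      and xay: "x = a \<oplus>\<^bsub>T n\<^esub> D (n - 1) y" by (rule B_cases) auto
    have "p + r \<le> p + 1 + r" by simp
    then have "a \<in> Z (r - 1) n (p + 1)" using a F_mono[of "p + r" "p + 1 + r" "n + 1"] by (auto simp: fc_Z_def)
    moreover have "x \<ominus>\<^bsub>T n\<^esub> D (n - 1) y = a"
      using Z_closed[OF a] mod_hom_closed[OF hom Z_closed[OF y]]
      by (simp add: xay a_minus_def T.a_assoc T.r_neg)
    ultimately show "\<exists>y\<in>Z r (n - 1) (p - r). x \<ominus>\<^bsub>T n\<^esub> D (n - 1) y \<in> B r n p"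
      using y Z_B[of a] by (intro bexI[of _ y]) simp_all
  }
  {
    assume "\<exists>y\<in>Z r (n - 1) (p - r). x \<ominus>\<^bsub>T n\<^esub> D (n - 1) y \<in> B r n p"
    then obtain y where y: "y \<in> Z r (n - 1) (p - r)" "x \<ominus>\<^bsub>T n\<^esub> D (n - 1) y \<in> B r n p" by auto
    from y(2) obtain a z where a: "a \<in> Z (r - 1) n (p + 1)" and z: "z \<in> Z (r - 1) (n - 1) (p - r + 1)"
      and xaz: "x \<ominus>\<^bsub>T n\<^esub> D (n - 1) y = a \<oplus>\<^bsub>T n\<^esub> D (n - 1) z" by (rule B_cases)
    note yc = Z_closed[OF y(1)] and zc = Z_closed[OF z] and ac = Z_closed[OF a]
    note Dyc = mod_hom_closed[OF hom yc] and Dzc = mod_hom_closed[OF hom zc]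
    have z': "z \<in> Z r (n - 1) (p - r)" using z F_decr[of "n - 1" "p - r"] by (auto simp: fc_Z_def)
    have "x = (x \<ominus>\<^bsub>T n\<^esub> D (n - 1) y) \<oplus>\<^bsub>T n\<^esub> D (n - 1) y"
      using xc Dyc by (simp add: a_minus_def T.a_assoc T.l_neg)
    also have "\<dots> = a \<oplus>\<^bsub>T n\<^esub> D (n - 1) (z \<oplus>\<^bsub>T (n - 1)\<^esub> y)"
      unfolding xaz using ac Dyc Dzc by (simp add: mod_hom_add[OF hom zc yc] T.a_assoc)
    finally have x_eq: "x = a \<oplus>\<^bsub>T n\<^esub> D (n - 1) (z \<oplus>\<^bsub>T (n - 1)\<^esub> y)" .
    have zy: "z \<oplus>\<^bsub>T (n - 1)\<^esub> y \<in> Z r (n - 1) (p - r)" using z' y(1) by (rule submodule_add[OF sub_Z])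
    interpret T1: module R "T (n + 1)" by (rule module_T)
    have "D n x = D n a"
      using mod_hom_add[OF hom_D ac mod_hom_closed[OF hom Z_closed[OF zy]]] mod_hom_closed[OF hom_D ac]
        Z_closed[OF zy] unfolding x_eq by (simp add: D_D'[of n "n - 1" "n + 1"])
    \<comment> \<open>Here D a = D x, and \<open>x\<close> is in Z_(r+1)^p, so the boundary of
      \<open>a\<close> lies one step deeper than is known from \<open>a\<close> alone.\<close>
    then have "a \<in> Z r n (p + 1)" using a x by (auto simp: fc_Z_def algebra_simps)
    then show "x \<in> B (r + 1) n p"
      using zy x_eq unfolding fc_B_def by auto
  }
qed

text \<open>For negative \<open>p\<close> the steps p and p + 1 of the filtration are both
  everything, so Z_r^p is already the first summand Z_(r-1)^(p+1).\<close>

lemma Z_negative: "p < 0 \<Longrightarrow> Z r n p \<subseteq> B r n p"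
proof
  fix x assume "p < 0" "x \<in> Z r n p"
  then have "x \<in> Z (r - 1) n (p + 1)" using F_top[of p n] F_top[of "p + 1" n] by (auto simp: fc_Z_def)
  then show "x \<in> B r n p" by (rule Z_B)
qed

lemma Z_above: "n < p \<Longrightarrow> Z r n p \<subseteq> B r n p"
  using F_bot[of n p] submodule_zero[OF sub_B] by (auto simp: fc_Z_def)

end

section \<open>The pages of a persistence module of filtered complexes\<close>

locale filtered_persistence =
  fixes R :: "('r, 'z) ring_scheme" and T :: "int \<Rightarrow> int \<Rightarrow> ('r, 'm) module"
    and D :: "int \<Rightarrow> int \<Rightarrow> 'm \<Rightarrow> 'm" and F :: "int \<Rightarrow> int \<Rightarrow> int \<Rightarrow> 'm set"
    and \<phi> :: "int \<Rightarrow> int \<Rightarrow> 'm \<Rightarrow> 'm"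
  assumes ring: "cring R"
    and fc: "\<And>i. filtered_complex R (T i) (D i) (F i)"
    and hom_\<phi>: "\<And>i n. mod_hom R (T i n) (T (i + 1) n) (\<phi> i n)"
    and \<phi>_F: "\<And>i n p x. x \<in> F i n p \<Longrightarrow> \<phi> i n x \<in> F (i + 1) n p"
    and \<phi>_D: "\<And>i n x. x \<in> carrier (T i n) \<Longrightarrow> \<phi> i (n + 1) (D i n x) = D (i + 1) n (\<phi> i n x)"
begin

sublocale fc: filtered_complex R "T i" "D i" "F i" for i
  by (rule fc)

abbreviation "Z i \<equiv> fc_Z (D i) (F i)"
abbreviation "B i \<equiv> fc_B (T i) (D i) (F i)"

lemma \<phi>_Z: "\<phi> i n ` Z i r n p \<subseteq> Z (i + 1) r n p"
proof
  fix u assume "u \<in> \<phi> i n ` Z i r n p"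
  then obtain x where x: "x \<in> Z i r n p" "u = \<phi> i n x" by auto
  then have "D (i + 1) n u = \<phi> i (n + 1) (D i n x)" using \<phi>_D fc.Z_closed by simp
  with x show "u \<in> Z (i + 1) r n p" by (simp add: fc_Z_def \<phi>_F)
qed

lemma \<phi>_B: "\<phi> i n ` B i r n p \<subseteq> B (i + 1) r n p"
proof
  fix u assume "u \<in> \<phi> i n ` B i r n p"
  then obtain x where x: "x \<in> B i r n p" "u = \<phi> i n x" by auto
  from x(1) obtain a y where a: "a \<in> Z i (r - 1) n (p + 1)" and y: "y \<in> Z i (r - 1) (n - 1) (p - r + 1)"
    and xay: "x = a \<oplus>\<^bsub>T i n\<^esub> D i (n - 1) y" by (rule fc.B_cases)
  have "D i (n - 1) y \<in> carrier (T i n)" using mod_hom_closed[OF fc.hom_D' fc.Z_closed[OF y], of n] by simp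
  then have "u = \<phi> i n a \<oplus>\<^bsub>T (i + 1) n\<^esub> \<phi> i n (D i (n - 1) y)"
    unfolding x(2) xay using fc.Z_closed[OF a] by (intro mod_hom_add[OF hom_\<phi>])
  also have "\<phi> i n (D i (n - 1) y) = D (i + 1) (n - 1) (\<phi> i (n - 1) y)"
    using \<phi>_D[OF fc.Z_closed[OF y]] by simp
  finally show "u \<in> B (i + 1) r n p"
    using subsetD[OF \<phi>_Z imageI[OF a]] subsetD[OF \<phi>_Z imageI[OF y]] unfolding fc_B_def by blast
qed

lemma subquotient_ZB: "1 \<le> r \<Longrightarrow> subquotient R (\<lambda>i. T i n) (\<lambda>i. \<phi> i n) (\<lambda>i. Z i r n p) (\<lambda>i. B i r n p)"
  by (intro subquotient.intro subpersistence.intro persistence.intro subpersistence_axioms.intro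
      subquotient_axioms.intro ring fc.module_T hom_\<phi> fc.sub_Z fc.sub_B \<phi>_Z \<phi>_B fc.B_le_Z)

text \<open>Indexed by total degree and filtration: position (p, q) is
  \<open>page r (p + q) p\<close>, and the differential d_r goes from (n, p) to (n + 1, p +
  r).\<close>

definition page :: "int \<Rightarrow> int \<Rightarrow> int \<Rightarrow> (nat \<Rightarrow> 'r, int \<Rightarrow> 'm set) gmodule" where
  "page r n p = quot_pers R (\<lambda>i. T i n) (\<lambda>i. \<phi> i n) (\<lambda>i. Z i r n p) (\<lambda>i. B i r n p)"

definition page_diff :: "int \<Rightarrow> int \<Rightarrow> int \<Rightarrow> (int \<Rightarrow> 'm set) \<Rightarrow> int \<Rightarrow> 'm set" where
  "page_diff r n p e = (\<lambda>i. coset_map (T i (n + 1)) (B i r (n + 1) (p + r)) (D i n) (e i))"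

lemma page_zero: "\<zero>\<^bsub>page r n p\<^esub> = (\<lambda>i. B i r n p)"
  by (simp add: page_def quot_pers_def pers_gmodule_def quot_mod_simps)

lemma page_carrierE:
  assumes "e \<in> carrier (page r n p)"
  obtains x where "x \<in> Z i r n p" "e i = B i r n p +>\<^bsub>T i n\<^esub> x"
  using assms by (auto simp: page_def quot_pers_def pers_gmodule_def quot_mod_restrict_carrier)

lemma coset_map_D:
  assumes "1 \<le> r" "x \<in> Z i r n p"
  shows "coset_map (T i (n + 1)) (B i r (n + 1) (p + r)) (D i n) (B i r n p +>\<^bsub>T i n\<^esub> x) =
    B i r (n + 1) (p + r) +>\<^bsub>T i (n + 1)\<^esub> D i n x"
  by (intro coset_map_coset_restrict[where R = R and Z = "Z i r n p" and Z' = "Z i r (n + 1) (p + r)"]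
      fc.module_T fc.sub_Z fc.sub_B fc.B_le_Z fc.hom_D fc.D_Z fc.D_image_B assms)

lemma gmod_hom_page_diff:
  assumes "1 \<le> r"
  shows "page_diff r n p \<in> gmod_hom R (page r n p) (page r (n + 1) (p + r))"
proof -
  have "(\<lambda>e i. coset_map (T i (n + 1)) (B i r (n + 1) (p + r)) (D i n) (e i)) \<in>
      gmod_hom R (page r n p) (page r (n + 1) (p + r))"
    unfolding page_def
  proof (rule gmod_hom_quot_pers[where h = "\<lambda>i. D i n" and T' = "\<lambda>i. T i (n + 1)"
        and Z' = "\<lambda>i. Z i r (n + 1) (p + r)" and B' = "\<lambda>i. B i r (n + 1) (p + r)"
        and \<phi>' = "\<lambda>i. \<phi> i (n + 1)", OF subquotient_ZB[OF assms] subquotient_ZB[OF assms]])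
    show "D (i + 1) n (\<phi> i n m) = \<phi> i (n + 1) (D i n m)" if "m \<in> Z i r n p" for i m
      using that by (rule \<phi>_D[OF fc.Z_closed, symmetric])
  qed (fact fc.hom_D fc.D_Z fc.D_image_B)+
  then show ?thesis unfolding page_diff_def[abs_def] .
qed

lemma graded_page: "1 \<le> r \<Longrightarrow> graded_module R (page r n p)"
  unfolding page_def by (rule subquotient.graded_quot_pers[OF subquotient_ZB])

lemma module_page: "1 \<le> r \<Longrightarrow> module (UP R) (page r n p)"
  unfolding page_def by (rule subquotient.module_quot_pers, rule subquotient_ZB)

lemma page_trivial:
  assumes "1 \<le> r" "p < 0 \<or> n < p"
  shows "carrier (page r n p) = {\<zero>\<^bsub>page r n p\<^esub>}"
proof -
  have "e = \<zero>\<^bsub>page r n p\<^esub>" if e: "e \<in> carrier (page r n p)" for e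
  proof
    fix i
    obtain x where x: "x \<in> Z i r n p" "e i = B i r n p +>\<^bsub>T i n\<^esub> x" using e by (rule page_carrierE)
    from assms(2) have "x \<in> B i r n p"
      using subsetD[OF fc.Z_negative x(1)] subsetD[OF fc.Z_above x(1)] by (elim disjE)
    with x show "e i = \<zero>\<^bsub>page r n p\<^esub> i"
      using coset_eq_zero_iff[OF fc.module_T fc.sub_B fc.Z_closed[OF x(1)]] by (simp add: page_zero)
  qed
  moreover have "\<zero>\<^bsub>page r n p\<^esub> \<in> carrier (page r n p)"
    using abelian_groupE(2)[OF module.axioms(2)[OF module_page[OF assms(1)]]] .
  ultimately show ?thesis by blast
qed

lemma page_diff_diff:
  assumes "1 \<le> r" "e \<in> carrier (page r n p)"
  shows "page_diff r (n + 1) (p + r) (page_diff r n p e) = \<zero>\<^bsub>page r (n + 2) (p + 2 * r)\<^esub>"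
proof
  fix i
  obtain x where x: "x \<in> Z i r n p" "e i = B i r n p +>\<^bsub>T i n\<^esub> x" using assms(2) by (rule page_carrierE)
  have Dx: "D i n x \<in> Z i r (n + 1) (p + r)" using fc.D_Z x(1) by blast
  have "page_diff r (n + 1) (p + r) (page_diff r n p e) i =
      B i r (n + 1 + 1) (p + r + r) +>\<^bsub>T i (n + 1 + 1)\<^esub> D i (n + 1) (D i n x)"
    unfolding page_diff_def x(2) coset_map_D[OF assms(1) x(1)] by (rule coset_map_D[OF assms(1) Dx])
  also have "\<dots> = B i r (n + 2) (p + 2 * r)"
  proof -
    have n: "n + 1 + 1 = n + 2" "p + r + r = p + 2 * r" by simp_all
    show ?thesis unfolding n fc.D_D[OF fc.Z_closed[OF x(1)]] by (rule coset_zero[OF fc.module_T fc.sub_B])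
  qed
  finally show "page_diff r (n + 1) (p + r) (page_diff r n p e) i = \<zero>\<^bsub>page r (n + 2) (p + 2 * r)\<^esub> i"
    by (simp add: page_zero)
qed

text \<open>A representative in Z_(r+1) is sent to its class on page \<open>r\<close>. By
  \<open>kernel_iff\<close> these classes are all the cycles of d_r, and by
  \<open>boundary_iff\<close> precisely B_(r+1) goes to the image of d_r.\<close>

lemma gmod_iso_next_page:
  assumes r: "1 \<le> r"
  shows "gmod_iso R (page (r + 1) n p)
    (gquot (gsub (page r n p) (gker (page r n p) (page r (n + 1) (p + r)) (page_diff r n p)))
      (page_diff r (n - 1) (p - r) ` carrier (page r (n - 1) (p - r))))"
proof -
  interpret A: subquotient R "\<lambda>i. T i n" "\<lambda>i. \<phi> i n" "\<lambda>i. Z i (r + 1) n p" "\<lambda>i. B i (r + 1) n p"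
    using r by (intro subquotient_ZB) simp
  interpret C: subquotient R "\<lambda>i. T i n" "\<lambda>i. \<phi> i n" "\<lambda>i. Z i r n p" "\<lambda>i. B i r n p"
    using r by (rule subquotient_ZB)
  interpret E: subquotient R "\<lambda>i. T i (n - 1)" "\<lambda>i. \<phi> i (n - 1)" "\<lambda>i. Z i r (n - 1) (p - r)" "\<lambda>i. B i r (n - 1) (p - r)"
    using r by (rule subquotient_ZB)
  let ?P = "sub_pers R (\<lambda>i. T i n) (\<lambda>i. \<phi> i n) (\<lambda>i. Z i (r + 1) n p)"
  let ?K = "gker (page r n p) (page r (n + 1) (p + r)) (page_diff r n p)"
  let ?I = "page_diff r (n - 1) (p - r) ` carrier (page r (n - 1) (p - r))"
  let ?g = "\<lambda>x i. B i r n p +>\<^bsub>T i n\<^esub> x i"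
  have Z_le: "Z i (r + 1) n p \<subseteq> Z i r n p" for i
    using fc.F_mono[of "p + r" "p + (r + 1)" i "n + 1"] by (auto simp: fc_Z_def)
  have hom: "mod_hom R ((T i n)\<lparr>carrier := Z i (r + 1) n p\<rparr>) (quot_mod ((T i n)\<lparr>carrier := Z i r n p\<rparr>) (B i r n p))
      (\<lambda>x. B i r n p +>\<^bsub>T i n\<^esub> x)" for i
    using mod_hom_restrict_dom[OF mod_hom_coset_restrict[OF A.module_at C.sub_Z C.sub_B C.B_le_Z], of "Z i (r + 1) n p" i]
      Z_le by simp
  have g: "?g \<in> gmod_hom R ?P (page r n p)"
    unfolding sub_pers_def page_def quot_pers_def
  proof (rule gmod_hom_pers[OF A.persistence_sub C.persistence_quot hom])
    fix i m assume "m \<in> carrier ((T i n)\<lparr>carrier := Z i (r + 1) n p\<rparr>)"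
    then have "m \<in> Z i r n p" using Z_le by auto
    then show "B (i + 1) r n p +>\<^bsub>T (i + 1) n\<^esub> \<phi> i n m =
        coset_map (T (i + 1) n) (B (i + 1) r n p) (\<phi> i n) (B i r n p +>\<^bsub>T i n\<^esub> m)"
      by (intro coset_map_coset_restrict[OF A.module_at C.sub_Z C.sub_B C.B_le_Z A.module_at C.sub_Z C.sub_B C.B_le_Z
            A.hom_at C.hom_Z C.hom_B, symmetric])
  qed
  have im: "?g ` carrier ?P = {e \<in> carrier (page r n p). \<forall>i. e i \<in> (\<lambda>x. B i r n p +>\<^bsub>T i n\<^esub> x) ` Z i (r + 1) n p}"
    "?g ` gr ?P j = {e \<in> gr (page r n p) j. \<forall>i. e i \<in> (\<lambda>x. B i r n p +>\<^bsub>T i n\<^esub> x) ` Z i (r + 1) n p}" for j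
    using pers_map_image[OF A.persistence_sub C.persistence_quot hom]
    by (simp_all add: sub_pers_def page_def quot_pers_def)
  have in_kernel: "e \<in> ?K \<longleftrightarrow> (\<forall>i. e i \<in> (\<lambda>x. B i r n p +>\<^bsub>T i n\<^esub> x) ` Z i (r + 1) n p)"
    if e: "e \<in> carrier (page r n p)" for e
  proof -
    have "page_diff r n p e i = \<zero>\<^bsub>page r (n + 1) (p + r)\<^esub> i \<longleftrightarrow>
        e i \<in> (\<lambda>x. B i r n p +>\<^bsub>T i n\<^esub> x) ` Z i (r + 1) n p" for i
    proof -
      obtain x where x: "x \<in> Z i r n p" "e i = B i r n p +>\<^bsub>T i n\<^esub> x" using e by (rule page_carrierE)
      have "page_diff r n p e i = \<zero>\<^bsub>page r (n + 1) (p + r)\<^esub> i \<longleftrightarrow> D i n x \<in> B i r (n + 1) (p + r)"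
        unfolding page_diff_def page_zero x(2) coset_map_D[OF r x(1)]
        by (rule coset_eq_zero_iff[OF fc.module_T fc.sub_B mod_hom_closed[OF fc.hom_D fc.Z_closed[OF x(1)]]])
      also have "\<dots> \<longleftrightarrow> (\<exists>z\<in>Z i (r + 1) n p. x \<ominus>\<^bsub>T i n\<^esub> z \<in> B i r n p)"
        by (rule fc.kernel_iff[OF r x(1)])
      also have "\<dots> \<longleftrightarrow> e i \<in> (\<lambda>x. B i r n p +>\<^bsub>T i n\<^esub> x) ` Z i (r + 1) n p"
        unfolding x(2) image_iff
        by (intro bex_cong refl coset_eq_iff[OF fc.module_T fc.sub_B fc.Z_closed[OF x(1)] fc.Z_closed, symmetric])
      finally show ?thesis .
    qed
    with e show ?thesis by (auto simp: gker_def fun_eq_iff)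
  qed
  have diff: "page_diff r (n - 1) (p - r) \<in> gmod_hom R (page r (n - 1) (p - r)) (page r n p)"
    using gmod_hom_page_diff[OF r, of "n - 1" "p - r"] by simp
  have D_coset: "coset_map (T i n) (B i r n p) (D i (n - 1)) (B i r (n - 1) (p - r) +>\<^bsub>T i (n - 1)\<^esub> y) =
      B i r n p +>\<^bsub>T i n\<^esub> D i (n - 1) y" if "y \<in> Z i r (n - 1) (p - r)" for i y
    using coset_map_D[OF r that] by simp
  have hom_D: "mod_hom R (quot_mod ((T i (n - 1))\<lparr>carrier := Z i r (n - 1) (p - r)\<rparr>) (B i r (n - 1) (p - r)))
      (quot_mod ((T i n)\<lparr>carrier := Z i r n p\<rparr>) (B i r n p)) (coset_map (T i n) (B i r n p) (D i (n - 1)))" for i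
  proof (rule mod_hom_coset_map[OF E.module_at E.sub_Z E.sub_B E.B_le_Z A.module_at C.sub_Z C.sub_B C.B_le_Z])
    show "mod_hom R (T i (n - 1)) (T i n) (D i (n - 1))" by (rule fc.hom_D') simp
    show "D i (n - 1) ` Z i r (n - 1) (p - r) \<subseteq> Z i r n p" using fc.D_Z[of i "n - 1" r "p - r"] by simp
    show "D i (n - 1) ` B i r (n - 1) (p - r) \<subseteq> B i r n p" using fc.D_image_B[of i "n - 1" r "p - r"] by simp
  qed
  \<comment> \<open>The image of the differential is tested degree by degree;
    \<open>pers_map_image\<close> turns the separate preimages into one of finite support.\<close>
  have in_image: "e \<in> ?I \<longleftrightarrow> (\<forall>i. \<exists>y\<in>Z i r (n - 1) (p - r). e i = B i r n p +>\<^bsub>T i n\<^esub> D i (n - 1) y)"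
    if e: "e \<in> carrier (page r n p)" for e
  proof -
    have "page_diff r (n - 1) (p - r) = (\<lambda>e i. coset_map (T i n) (B i r n p) (D i (n - 1)) (e i))"
      by (simp add: page_diff_def[abs_def])
    then have "e \<in> ?I \<longleftrightarrow> (\<forall>i. e i \<in> coset_map (T i n) (B i r n p) (D i (n - 1)) `
        carrier (quot_mod ((T i (n - 1))\<lparr>carrier := Z i r (n - 1) (p - r)\<rparr>) (B i r (n - 1) (p - r))))"
      using e pers_map_image(1)[OF E.persistence_quot C.persistence_quot hom_D]
      by (simp add: page_def quot_pers_def)
    also have "\<dots> \<longleftrightarrow> (\<forall>i. \<exists>y\<in>Z i r (n - 1) (p - r). e i = B i r n p +>\<^bsub>T i n\<^esub> D i (n - 1) y)"
      by (simp add: quot_mod_restrict_carrier image_iff D_coset)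
    finally show ?thesis .
  qed
  show ?thesis
    unfolding page_def[of "r + 1"]
  proof (rule A.gmod_iso_gquot_quot_pers(2))
    show "module (UP R) (page r n p)" by (rule module_page[OF r])
    show "submodule ?I (UP R) (page r n p)"
      by (rule submodule_image[OF module_page[OF r] module_page[OF r]
            conjunct1[OF diff[unfolded gmod_hom_iff]] module.carrier_is_submodule[OF module_page[OF r]]])
    show "mod_hom (UP R) ?P (page r n p) ?g" using g by (simp add: gmod_hom_iff)
    have K: "?K = {e \<in> carrier (page r n p). \<forall>i. e i \<in> (\<lambda>x. B i r n p +>\<^bsub>T i n\<^esub> x) ` Z i (r + 1) n p}"
      using in_kernel by (auto simp: gker_def)
    then show "?g ` carrier ?P = ?K" unfolding im(1) by simp
    have "gr (page r n p) j \<subseteq> carrier (page r n p)" for j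
      unfolding page_def quot_pers_def by (rule persistence.gr_pers_subset[OF C.persistence_quot])
    then show "?g ` gr ?P j = gr (page r n p) j \<inter> ?K" for j unfolding im(2) K by blast
    show "?I \<subseteq> ?K"
    proof
      fix e assume e: "e \<in> ?I"
      then have ec: "e \<in> carrier (page r n p)" using diff by (auto simp: gmod_hom_iff mod_hom_def)
      \<comment> \<open>The boundary of \<open>y\<close> is a genuine cycle in filtration
        \<open>p\<close>, so it lies in the numerator of every page.\<close>
      have "D i (n - 1) y \<in> Z i (r + 1) n p" if "y \<in> Z i r (n - 1) (p - r)" for i y
        using that fc.Z_closed[OF that] fc.zero_F[of i "n + 1"]
        by (auto simp: fc_Z_def fc.D_D'[of n "n - 1" "n + 1"])
      then show "e \<in> ?K" using e unfolding in_kernel[OF ec] in_image[OF ec] by blast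
    qed
    show "?g x \<in> ?I \<longleftrightarrow> (\<forall>i. x i \<in> B i (r + 1) n p)" if x: "x \<in> carrier ?P" for x
    proof -
      have xZ: "x i \<in> Z i (r + 1) n p" for i using x by (rule A.sub_pers_carrierD)
      have "?g x \<in> carrier (page r n p)" using g x by (auto simp: gmod_hom_iff mod_hom_def)
      moreover have "(\<exists>y\<in>Z i r (n - 1) (p - r). B i r n p +>\<^bsub>T i n\<^esub> x i = B i r n p +>\<^bsub>T i n\<^esub> D i (n - 1) y) \<longleftrightarrow>
          x i \<in> B i (r + 1) n p" for i
        unfolding fc.boundary_iff[OF r xZ]
        by (intro bex_cong refl coset_eq_iff[OF fc.module_T fc.sub_B fc.Z_closed[OF xZ]
            mod_hom_closed[OF fc.hom_D' fc.Z_closed]]) simp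
      ultimately show ?thesis by (simp add: in_image)
    qed
  qed
qed

theorem spectral_sequence_pages:
  "spectral_sequence R (\<lambda>r p q. page (int r) (p + q) p) (\<lambda>r p q. page_diff (int r) (p + q) p)"
  unfolding spectral_sequence_def
proof (intro allI impI)
  fix r :: nat and p q :: int assume "2 \<le> r"
  then have r: "1 \<le> int r" by simp
  have n: "p + int r + (q - int r + 1) = p + q + 1"
    "p + 2 * int r + (q - 2 * int r + 2) = p + q + 2"
    "p - int r + (q + int r - 1) = p + q - 1" "int (Suc r) = int r + 1" by simp_all
  show "graded_module R (page (int r) (p + q) p) \<and>
    (p < 0 \<or> q < 0 \<longrightarrow> carrier (page (int r) (p + q) p) = {\<zero>\<^bsub>page (int r) (p + q) p\<^esub>}) \<and>
    page_diff (int r) (p + q) p \<in> gmod_hom R (page (int r) (p + q) p)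
      (page (int r) (p + int r + (q - int r + 1)) (p + int r)) \<and>
    (\<forall>x\<in>carrier (page (int r) (p + q) p).
      page_diff (int r) (p + int r + (q - int r + 1)) (p + int r) (page_diff (int r) (p + q) p x) =
      \<zero>\<^bsub>page (int r) (p + 2 * int r + (q - 2 * int r + 2)) (p + 2 * int r)\<^esub>) \<and>
    gmod_iso R (page (int (Suc r)) (p + q) p)
      (gquot (gsub (page (int r) (p + q) p)
          (gker (page (int r) (p + q) p) (page (int r) (p + int r + (q - int r + 1)) (p + int r))
            (page_diff (int r) (p + q) p)))
        (page_diff (int r) (p - int r + (q + int r - 1)) (p - int r) `
          carrier (page (int r) (p - int r + (q + int r - 1)) (p - int r))))"
    unfolding n
    by (intro conjI impI ballI graded_page[OF r] page_trivial[OF r] gmod_hom_page_diff[OF r]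
        page_diff_diff[OF r] gmod_iso_next_page[OF r]) auto
qed

end

section \<open>Stabilisation of the pages and convergence\<close>

lemma (in abelian_group) minus_eq_zero_iff:
  assumes "x \<in> carrier G" "y \<in> carrier G"
  shows "x \<ominus> y = \<zero> \<longleftrightarrow> x = y"
proof
  assume "x \<ominus> y = \<zero>"
  then have "(x \<ominus> y) \<oplus> y = y" using assms by simp
  then show "x = y" using assms by (simp add: a_minus_def a_assoc l_neg)
qed (use assms in \<open>simp add: a_minus_def r_neg\<close>)

context filtered_complex
begin

text \<open>Boundaries have degree n + 1 < p + r, where the filtration is zero.\<close>

lemma Z_stable:
  assumes "n + 2 \<le> p + r"
  shows "Z r n p = {x \<in> F n p. D n x = \<zero>\<^bsub>T (n + 1)\<^esub>}"
  using F_bot[of "n + 1" "p + r"] assms by (simp add: fc_Z_def)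

text \<open>As p - r + 1 \<le> 0, every element of degree n - 1 is available as a source in the
  second summand, and by \<open>Z_stable\<close> the first summand consists of the cycles in
  filtration p + 1. The denominator becomes cycles one step deeper plus boundaries lying in
  F^p.\<close>

lemma B_stable_iff:
  assumes "n + 2 \<le> p + r" "p + 1 \<le> r" and x: "x \<in> F n p"
  shows "x \<in> B r n p \<longleftrightarrow> (\<exists>a\<in>F n (p + 1). D n a = \<zero>\<^bsub>T (n + 1)\<^esub> \<and>
    x \<ominus>\<^bsub>T n\<^esub> a \<in> D (n - 1) ` carrier (T (n - 1)))"
proof
  interpret T: module R "T n" by (rule module_T)
  have hom: "mod_hom R (T (n - 1)) (T n) (D (n - 1))" by (rule hom_D') simp
  {
    assume "x \<in> B r n p"
    then obtain a y where a: "a \<in> Z (r - 1) n (p + 1)" and y: "y \<in> Z (r - 1) (n - 1) (p - r + 1)"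
      and xay: "x = a \<oplus>\<^bsub>T n\<^esub> D (n - 1) y" by (rule B_cases)
    have a': "a \<in> F n (p + 1)" "D n a = \<zero>\<^bsub>T (n + 1)\<^esub>"
      using a Z_stable[of n "p + 1" "r - 1"] assms by auto
    note ac = Z_closed[OF a] and yc = mod_hom_closed[OF hom Z_closed[OF y]]
    have "x \<ominus>\<^bsub>T n\<^esub> a = D (n - 1) y"
      using ac yc by (simp add: xay T.a_comm[of a] a_minus_def T.a_assoc T.r_neg)
    then show "\<exists>a\<in>F n (p + 1). D n a = \<zero>\<^bsub>T (n + 1)\<^esub> \<and>
        x \<ominus>\<^bsub>T n\<^esub> a \<in> D (n - 1) ` carrier (T (n - 1))"
      using a' Z_closed[OF y] by blast
  }
  {
    assume "\<exists>a\<in>F n (p + 1). D n a = \<zero>\<^bsub>T (n + 1)\<^esub> \<and>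
        x \<ominus>\<^bsub>T n\<^esub> a \<in> D (n - 1) ` carrier (T (n - 1))"
    then obtain a y where a: "a \<in> F n (p + 1)" "D n a = \<zero>\<^bsub>T (n + 1)\<^esub>"
      and y: "y \<in> carrier (T (n - 1))" "x \<ominus>\<^bsub>T n\<^esub> a = D (n - 1) y" by blast
    \<comment> \<open>The source \<open>y\<close> is arbitrary; that its boundary lies in F^p is
      forced by x and a.\<close>
    have "D (n - 1) y \<in> F n p"
      unfolding y(2)[symmetric] using x a(1) F_decr by (intro submodule_diff[OF sub_F]) auto
    then have "y \<in> Z (r - 1) (n - 1) (p - r + 1)"
      using y(1) F_top[of "p - r + 1" "n - 1"] assms by (simp add: fc_Z_def)
    moreover have "a \<in> Z (r - 1) n (p + 1)" using a zero_F by (simp add: fc_Z_def)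
    moreover have "x = a \<oplus>\<^bsub>T n\<^esub> D (n - 1) y"
      using F_closed[OF x] F_closed[OF a(1)] mod_hom_closed[OF hom y(1)]
      by (simp add: y(2)[symmetric] a_minus_def T.a_comm[of x] T.a_assoc[symmetric] T.r_neg)
    ultimately show "x \<in> B r n p" unfolding fc_B_def by blast
  }
qed

end

context filtered_persistence
begin

text \<open>The zero condition is written as membership in a singleton so that
  \<open>submodule_vimage\<close> applies to it directly.\<close>

definition cyc :: "int \<Rightarrow> int \<Rightarrow> int \<Rightarrow> 'm set" where
  "cyc i n p = {x \<in> F i n p. D i n x \<in> {\<zero>\<^bsub>T i (n + 1)\<^esub>}}"

lemma sub_zero: "submodule {\<zero>\<^bsub>T i n\<^esub>} R (T i n)"
  using fc.sub_F[of i n "n + 1"] fc.F_bot[of n "n + 1" i] by simp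

lemma sub_cyc: "submodule (cyc i n p) R (T i n)"
  unfolding cyc_def by (rule submodule_vimage[OF fc.module_T fc.module_T fc.hom_D fc.sub_F sub_zero])

lemma cyc_mono: "p \<le> q \<Longrightarrow> cyc i n q \<subseteq> cyc i n p"
  using fc.F_mono[of p q i n] by (auto simp: cyc_def)

lemma \<phi>_cyc: "\<phi> i n ` cyc i n p \<subseteq> cyc (i + 1) n p"
  using mod_hom_zero[OF fc.module_T fc.module_T hom_\<phi>] \<phi>_F \<phi>_D[OF fc.F_closed, symmetric]
  by (auto simp: cyc_def)

text \<open>\<open>\<kappa>\<close> identifies the cohomology of the complexes with an abstract
  persistence module \<open>H\<close>. The filtration of \<open>H\<close> consists of the images of
  the cycles in F^p; the kernel of passing to a filtration quotient is described by cycles one step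
  deeper and boundaries, which is the stable denominator.\<close>

theorem converges_pages:
  fixes H :: "nat \<Rightarrow> int \<Rightarrow> ('r, 'h) module" and \<psi> :: "nat \<Rightarrow> int \<Rightarrow> 'h \<Rightarrow> 'h"
    and \<kappa> :: "int \<Rightarrow> nat \<Rightarrow> 'm \<Rightarrow> 'h"
  assumes H: "\<And>n. persistence R (H n) (\<psi> n)"
    and hom: "\<And>i n. mod_hom R ((T i (int n))\<lparr>carrier := cyc i (int n) 0\<rparr>) (H n i) (\<kappa> i n)"
    and surj: "\<And>i n. \<kappa> i n ` cyc i (int n) 0 = carrier (H n i)"
    and ker: "\<And>i n x. x \<in> cyc i (int n) 0 \<Longrightarrow>
      \<kappa> i n x = \<zero>\<^bsub>H n i\<^esub> \<longleftrightarrow> x \<in> D i (int n - 1) ` carrier (T i (int n - 1))"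
    and nat: "\<And>i n x. x \<in> cyc i (int n) 0 \<Longrightarrow> \<kappa> (i + 1) n (\<phi> i (int n) x) = \<psi> n i (\<kappa> i n x)"
  shows "converges_to R (\<lambda>r p q. page (int r) (p + q) p) (\<lambda>n. pers_gmodule R (H n) (\<psi> n))"
  unfolding converges_to_def
proof
  fix n :: nat
  interpret H: persistence R "H n" "\<psi> n" by (rule H)
  let ?P = "pers_gmodule R (H n) (\<psi> n)"
  define G where "G p i = \<kappa> i n ` cyc i (int n) (int p)" for p i
  define Fil where "Fil p = {e \<in> carrier ?P. \<forall>i. e i \<in> G p i}" for p
  have cyc_le: "cyc i (int n) (int p) \<subseteq> cyc i (int n) 0" for i p by (rule cyc_mono) simp
  have mod_K: "module R ((T i (int n))\<lparr>carrier := cyc i (int n) 0\<rparr>)" for i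
    by (rule module_restrict[OF sub_cyc fc.module_T])
  have G_sub: "submodule (G p i) R (H n i)" for p i
    unfolding G_def
    by (rule submodule_image[OF mod_K H.module_at hom submodule_restrict[OF fc.module_T sub_cyc sub_cyc cyc_le]])
  have sub: "subpersistence R (H n) (\<psi> n) (G p)" for p
  proof (intro subpersistence.intro H subpersistence_axioms.intro G_sub)
    show "\<psi> n i ` G p i \<subseteq> G p (i + 1)" for i
    proof
      fix u assume "u \<in> \<psi> n i ` G p i"
      then obtain x where x: "x \<in> cyc i (int n) (int p)" "u = \<psi> n i (\<kappa> i n x)" by (auto simp: G_def)
      then have "u = \<kappa> (i + 1) n (\<phi> i (int n) x)" using nat[OF subsetD[OF cyc_le x(1)]] by simp
      moreover have "\<phi> i (int n) x \<in> cyc (i + 1) (int n) (int p)" using x(1) \<phi>_cyc by blast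
      ultimately show "u \<in> G p (i + 1)" by (simp add: G_def)
    qed
  qed
  have \<kappa>_zero: "\<kappa> i n \<zero>\<^bsub>T i (int n)\<^esub> = \<zero>\<^bsub>H n i\<^esub>" for i
    using mod_hom_zero[OF mod_K H.module_at hom] by simp
  show "\<exists>F. F 0 = carrier ?P \<and> F (Suc n) = {\<zero>\<^bsub>?P\<^esub>} \<and>
      (\<forall>p\<le>Suc n. graded_submodule R (F p) ?P) \<and>
      (\<forall>p\<le>n. F (Suc p) \<subseteq> F p \<and>
        gmod_iso R (gquot (gsub ?P (F p)) (F (Suc p))) (E_infinity (\<lambda>r p q. page (int r) (p + q) p) p (n - p)))"
  proof (intro exI[of _ Fil] conjI allI impI)
    show "Fil 0 = carrier ?P"
      using H.pers_carrierD by (auto simp: Fil_def G_def surj)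
    have "cyc i (int n) (int (Suc n)) = {\<zero>\<^bsub>T i (int n)\<^esub>}" for i
      using fc.F_bot[of "int n" "int (Suc n)" i] submodule_zero[OF sub_cyc, of i "int n" "int (Suc n)"]
      by (auto simp: cyc_def)
    then have "G (Suc n) i = {\<zero>\<^bsub>H n i\<^esub>}" for i by (simp add: G_def \<kappa>_zero)
    moreover have "\<zero>\<^bsub>?P\<^esub> \<in> carrier ?P"
      using abelian_groupE(2)[OF module.axioms(2)[OF H.module_pers]] .
    ultimately show "Fil (Suc n) = {\<zero>\<^bsub>?P\<^esub>}"
      by (auto simp: Fil_def H.pers_zero fun_eq_iff)
    show "graded_submodule R (Fil p) ?P" for p
      unfolding Fil_def by (rule subpersistence.graded_submodule_sub_pers[OF sub])
    fix p assume p: "p \<le> n"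
    have "G (Suc p) i \<subseteq> G p i" for i
      unfolding G_def using cyc_mono[of "int p" "int (Suc p)" i "int n"] by (intro image_mono) simp
    then show Fil_le: "Fil (Suc p) \<subseteq> Fil p" by (auto simp: Fil_def)
    \<comment> \<open>The page that \<open>E_infinity\<close> names at (p, n - p). It satisfies p +
      1 \<le> r and n + 2 \<le> p + r, the two conditions for stability.\<close>
    define r where "r = int (max (p + 1) (n - p + 2))"
    have r: "1 \<le> r" "int n + 2 \<le> int p + r" "int p + 1 \<le> r"
      using p by (auto simp: r_def max_def)
    have E: "E_infinity (\<lambda>r p q. page (int r) (p + q) p) p (n - p) = page r (int n) (int p)"
      using p by (simp add: E_infinity_def r_def)
    have Z_cyc: "Z i r (int n) (int p) = cyc i (int n) (int p)" for i
      using fc.Z_stable[OF r(2), of i] by (simp add: cyc_def)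
    interpret A: subquotient R "\<lambda>i. T i (int n)" "\<lambda>i. \<phi> i (int n)" "\<lambda>i. cyc i (int n) (int p)" "\<lambda>i. B i r (int n) (int p)"
      using subquotient_ZB[OF r(1), of "int n" "int p"] by (simp only: Z_cyc)
    let ?S = "sub_pers R (\<lambda>i. T i (int n)) (\<lambda>i. \<phi> i (int n)) (\<lambda>i. cyc i (int n) (int p))"
    let ?g = "\<lambda>x i. \<kappa> i n (x i)"
    have hom_p: "mod_hom R ((T i (int n))\<lparr>carrier := cyc i (int n) (int p)\<rparr>) (H n i) (\<kappa> i n)" for i
      using mod_hom_restrict_dom[OF hom[of i n], of "cyc i (int n) (int p)"] cyc_le by simp
    have g: "?g \<in> gmod_hom R ?S ?P"
      unfolding sub_pers_def
    proof (rule gmod_hom_pers[OF A.persistence_sub H hom_p])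
      fix i m assume "m \<in> carrier ((T i (int n))\<lparr>carrier := cyc i (int n) (int p)\<rparr>)"
      then show "\<kappa> (i + 1) n (\<phi> i (int n) m) = \<psi> n i (\<kappa> i n m)" using cyc_le by (intro nat) auto
    qed
    have im: "?g ` carrier ?S = Fil p" "?g ` gr ?S j = gr ?P j \<inter> Fil p" for j
    proof -
      note pim = pers_map_image[OF A.persistence_sub H hom_p]
      show "?g ` carrier ?S = Fil p" using pim(1) by (simp add: sub_pers_def Fil_def G_def)
      show "?g ` gr ?S j = gr ?P j \<inter> Fil p"
        using pim(2)[of j] H.gr_pers_subset[of j] unfolding sub_pers_def Fil_def G_def by auto
    qed
    have "gmod_iso R (gquot (gsub ?P (Fil p)) (Fil (Suc p)))
        (quot_pers R (\<lambda>i. T i (int n)) (\<lambda>i. \<phi> i (int n)) (\<lambda>i. cyc i (int n) (int p)) (\<lambda>i. B i r (int n) (int p)))"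
    proof (rule A.gmod_iso_gquot_quot_pers(1)[OF H.module_pers _ Fil_le _ im])
      show "submodule (Fil (Suc p)) (UP R) ?P"
        unfolding Fil_def by (rule subpersistence.submodule_sub_pers[OF sub])
      show "mod_hom (UP R) ?S ?P ?g" using g by (simp add: gmod_hom_iff)
      fix x assume x: "x \<in> carrier ?S"
      have xc: "x i \<in> cyc i (int n) (int p)" for i using x by (rule A.sub_pers_carrierD)
      have "\<kappa> i n (x i) \<in> G (Suc p) i \<longleftrightarrow> x i \<in> B i r (int n) (int p)" for i
      proof -
        interpret Hi: module R "H n i" by (rule H.module_at)
        have "\<kappa> i n (x i) = \<kappa> i n a \<longleftrightarrow> x i \<ominus>\<^bsub>T i (int n)\<^esub> a \<in> D i (int n - 1) ` carrier (T i (int n - 1))"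
          if a: "a \<in> cyc i (int n) (int (Suc p))" for a
        proof -
          have a0: "a \<in> cyc i (int n) 0" and x0: "x i \<in> cyc i (int n) 0" using a xc cyc_le by blast+
          have "\<kappa> i n (x i \<ominus>\<^bsub>T i (int n)\<^esub> a) = \<kappa> i n (x i) \<ominus>\<^bsub>H n i\<^esub> \<kappa> i n a"
            using mod_hom_diff[OF mod_K H.module_at hom, of "x i" i a] a0 x0
            by (simp add: a_minus_restrict[OF fc.module_T sub_cyc])
          then show ?thesis
            using ker[OF submodule_diff[OF sub_cyc x0 a0]]
              mod_hom_closed[OF hom, of "x i" i n] mod_hom_closed[OF hom, of a i n] a0 x0
            by (simp add: Hi.minus_eq_zero_iff)
        qed
        then have "\<kappa> i n (x i) \<in> G (Suc p) i \<longleftrightarrow> (\<exists>a\<in>cyc i (int n) (int (Suc p)).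
            x i \<ominus>\<^bsub>T i (int n)\<^esub> a \<in> D i (int n - 1) ` carrier (T i (int n - 1)))"
          unfolding G_def image_iff by (rule bex_cong[OF refl])
        also have "\<dots> \<longleftrightarrow> x i \<in> B i r (int n) (int p)"
          using xc[of i] by (subst fc.B_stable_iff[OF r(2,3)]) (auto simp: cyc_def add.commute)
        finally show ?thesis .
      qed
      moreover have "?g x \<in> carrier ?P" using g x by (auto simp: gmod_hom_iff mod_hom_def)
      ultimately show "?g x \<in> Fil (Suc p) \<longleftrightarrow> (\<forall>i. x i \<in> B i r (int n) (int p))"
        by (simp add: Fil_def)
    qed
    then show "gmod_iso R (gquot (gsub ?P (Fil p)) (Fil (Suc p)))
        (E_infinity (\<lambda>r p q. page (int r) (p + q) p) p (n - p))"
      unfolding E unfolding page_def by (simp only: Z_cyc)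
  qed
qed

end

section \<open>The total complex of a double complex\<close>

text \<open>The full product of plain modules, in three roles: over the columns of a total complex,
  over the index tuples of a Cech cochain, and over all singular chains, where cochains are its
  additive members.\<close>

definition prod_mod :: "'i set \<Rightarrow> ('i \<Rightarrow> ('r, 'm) module) \<Rightarrow> ('r, 'i \<Rightarrow> 'm) module" where
  "prod_mod I M =
    \<lparr>carrier = (\<Pi>\<^sub>E i\<in>I. carrier (M i)), mult = undefined, one = undefined,
     zero = (\<lambda>i\<in>I. \<zero>\<^bsub>M i\<^esub>), add = (\<lambda>v w. \<lambda>i\<in>I. v i \<oplus>\<^bsub>M i\<^esub> w i),
     smult = (\<lambda>a w. \<lambda>i\<in>I. a \<odot>\<^bsub>M i\<^esub> w i)\<rparr>"

lemma prod_mod_simps: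
  "carrier (prod_mod I M) = (\<Pi>\<^sub>E i\<in>I. carrier (M i))"
  "i \<in> I \<Longrightarrow> \<zero>\<^bsub>prod_mod I M\<^esub> i = \<zero>\<^bsub>M i\<^esub>"
  "i \<in> I \<Longrightarrow> (v \<oplus>\<^bsub>prod_mod I M\<^esub> w) i = v i \<oplus>\<^bsub>M i\<^esub> w i"
  "i \<in> I \<Longrightarrow> (a \<odot>\<^bsub>prod_mod I M\<^esub> w) i = a \<odot>\<^bsub>M i\<^esub> w i"
  by (simp_all add: prod_mod_def)

lemma prod_mod_ext: "v \<oplus>\<^bsub>prod_mod I M\<^esub> w \<in> extensional I" "a \<odot>\<^bsub>prod_mod I M\<^esub> w \<in> extensional I"
  "\<zero>\<^bsub>prod_mod I M\<^esub> \<in> extensional I"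
  by (simp_all add: prod_mod_def)

lemma module_prod_mod:
  assumes "cring R" "\<And>i. i \<in> I \<Longrightarrow> module R (M i)"
  shows "module R (prod_mod I M)"
proof -
  let ?P = "prod_mod I M"
  have ag: "abelian_group (M i)" if "i \<in> I" for i using assms(2)[OF that] module.axioms(2) by blast
  have c: "x i \<in> carrier (M i)" if "x \<in> carrier ?P" "i \<in> I" for x i
    using that by (auto simp: prod_mod_simps)
  have e: "x \<in> extensional I" if "x \<in> carrier ?P" for x
    using that by (auto simp: prod_mod_simps PiE_def)
  note [simp] = prod_mod_simps(2-4)
  show ?thesis
  proof (intro moduleI abelian_groupI assms(1))
    fix x y assume x: "x \<in> carrier ?P" and y: "y \<in> carrier ?P"
    show "x \<oplus>\<^bsub>?P\<^esub> y \<in> carrier ?P"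
      using abelian_groupE(1)[OF ag] c[OF x] c[OF y] by (simp add: prod_mod_def)
    show "x \<oplus>\<^bsub>?P\<^esub> y = y \<oplus>\<^bsub>?P\<^esub> x"
      using abelian_groupE(4)[OF ag] x y by (intro extensionalityI[of _ I] prod_mod_ext) (simp add: c)
    show "x \<oplus>\<^bsub>?P\<^esub> y \<oplus>\<^bsub>?P\<^esub> z = x \<oplus>\<^bsub>?P\<^esub> (y \<oplus>\<^bsub>?P\<^esub> z)" if "z \<in> carrier ?P" for z
      using abelian_groupE(3)[OF ag] x y that by (intro extensionalityI[of _ I] prod_mod_ext) (simp add: c)
    show "a \<odot>\<^bsub>?P\<^esub> (x \<oplus>\<^bsub>?P\<^esub> y) = a \<odot>\<^bsub>?P\<^esub> x \<oplus>\<^bsub>?P\<^esub> a \<odot>\<^bsub>?P\<^esub> y" if "a \<in> carrier R" for a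
      using module.smult_r_distr[OF assms(2)] that x y
      by (intro extensionalityI[of _ I] prod_mod_ext) (simp add: c)
  next
    show "\<zero>\<^bsub>?P\<^esub> \<in> carrier ?P" using abelian_groupE(2)[OF ag] by (auto simp: prod_mod_def)
  next
    fix x assume x: "x \<in> carrier ?P"
    show "\<zero>\<^bsub>?P\<^esub> \<oplus>\<^bsub>?P\<^esub> x = x"
      using abelian_groupE(5)[OF ag] x e by (intro extensionalityI[of _ I] prod_mod_ext) (simp_all add: c)
    show "\<exists>y\<in>carrier ?P. y \<oplus>\<^bsub>?P\<^esub> x = \<zero>\<^bsub>?P\<^esub>"
    proof
      show "(\<lambda>i\<in>I. \<ominus>\<^bsub>M i\<^esub> x i) \<in> carrier ?P"
        using abelian_group.a_inv_closed[OF ag] c[OF x] by (simp add: prod_mod_def)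
      show "(\<lambda>i\<in>I. \<ominus>\<^bsub>M i\<^esub> x i) \<oplus>\<^bsub>?P\<^esub> x = \<zero>\<^bsub>?P\<^esub>"
        using abelian_group.l_neg[OF ag] x by (intro extensionalityI[of _ I] prod_mod_ext) (simp add: c)
    qed
    show "\<one>\<^bsub>R\<^esub> \<odot>\<^bsub>?P\<^esub> x = x"
      using module.smult_one[OF assms(2)] x e by (intro extensionalityI[of _ I] prod_mod_ext) (simp_all add: c)
    fix a assume a: "a \<in> carrier R"
    show "a \<odot>\<^bsub>?P\<^esub> x \<in> carrier ?P"
      using module.smult_closed[OF assms(2)] c[OF x] a by (simp add: prod_mod_def)
    fix b assume b: "b \<in> carrier R"
    show "(a \<oplus>\<^bsub>R\<^esub> b) \<odot>\<^bsub>?P\<^esub> x = a \<odot>\<^bsub>?P\<^esub> x \<oplus>\<^bsub>?P\<^esub> b \<odot>\<^bsub>?P\<^esub> x"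
      using module.smult_l_distr[OF assms(2)] x a b
      by (intro extensionalityI[of _ I] prod_mod_ext) (simp add: c)
    show "a \<otimes>\<^bsub>R\<^esub> b \<odot>\<^bsub>?P\<^esub> x = a \<odot>\<^bsub>?P\<^esub> (b \<odot>\<^bsub>?P\<^esub> x)"
      using module.smult_assoc1[OF assms(2)] x a b
      by (intro extensionalityI[of _ I] prod_mod_ext) (simp add: c)
  qed
qed

lemma mod_hom_prodI:
  assumes "\<And>i. i \<in> I \<Longrightarrow> mod_hom R M (N i) (h i)"
  shows "mod_hom R M (prod_mod I N) (\<lambda>x. \<lambda>i\<in>I. h i x)"
proof (rule mod_homI)
  show "(\<lambda>i\<in>I. h i x) \<in> carrier (prod_mod I N)" if "x \<in> carrier M" for x
    using that mod_hom_closed[OF assms] by (auto simp: prod_mod_simps)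
qed (auto simp: prod_mod_simps mod_hom_add[OF assms] mod_hom_smult[OF assms] intro!: extensionalityI[of _ I] prod_mod_ext)

lemma mod_hom_proj: "i \<in> I \<Longrightarrow> mod_hom R (prod_mod I N) (N i) (\<lambda>x. x i)"
  by (rule mod_homI) (auto simp: prod_mod_simps)

text \<open>The sign (-1)^p, by parity rather than as a scalar, so that it makes sense in every
  abelian group and commutes with every homomorphism.\<close>

definition sg :: "('m, 'u) ring_scheme \<Rightarrow> nat \<Rightarrow> 'm \<Rightarrow> 'm" where
  "sg M p x = (if even p then x else \<ominus>\<^bsub>M\<^esub> x)"

lemma (in abelian_group) sg_closed [simp]: "x \<in> carrier G \<Longrightarrow> sg G p x \<in> carrier G"
  and sg_Suc: "x \<in> carrier G \<Longrightarrow> sg G (Suc p) x = \<ominus> sg G p x"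
  and sg_zero [simp]: "sg G p \<zero> = \<zero>"
  and sg_sg [simp]: "x \<in> carrier G \<Longrightarrow> sg G p (sg G p x) = x"
  and sg_add_neg: "x \<in> carrier G \<Longrightarrow> sg G p x \<oplus> sg G (Suc p) x = \<zero>"
  by (auto simp: sg_def r_neg l_neg)

lemma mod_hom_sg:
  assumes "module R M" "module R N" "mod_hom R M N h"
  shows "mod_hom R M N (\<lambda>x. sg N p (h x))"
  using assms mod_hom_uminus[OF assms] by (cases "even p") (simp_all add: sg_def)

lemma sg_hom:
  assumes "module R M" "module R N" "mod_hom R M N h" "x \<in> carrier M"
  shows "h (sg M p x) = sg N p (h x)"
  using assms by (simp add: sg_def mod_hom_neg)

text \<open>A product over all columns is harmless: the double complexes below vanish in negative
  vertical degree, so only columns 0 to n contribute.\<close>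

definition tot_mod :: "(nat \<Rightarrow> int \<Rightarrow> ('r, 'm) module) \<Rightarrow> int \<Rightarrow> ('r, nat \<Rightarrow> 'm) module" where
  "tot_mod C n = prod_mod UNIV (\<lambda>p. C p (n - int p))"

text \<open>Horizontal plus (-1)^p times vertical. The two differentials of the double complex
  commute, so a sign is needed on one of them; no horizontal term enters column 0.\<close>

definition tot_D ::
    "(nat \<Rightarrow> int \<Rightarrow> ('r, 'm) module) \<Rightarrow> (nat \<Rightarrow> int \<Rightarrow> 'm \<Rightarrow> 'm) \<Rightarrow> (nat \<Rightarrow> int \<Rightarrow> 'm \<Rightarrow> 'm) \<Rightarrow> int \<Rightarrow>
     (nat \<Rightarrow> 'm) \<Rightarrow> nat \<Rightarrow> 'm" where
  "tot_D C \<delta> d n w p =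
    (case p of 0 \<Rightarrow> \<zero>\<^bsub>C p (n + 1 - int p)\<^esub> | Suc k \<Rightarrow> \<delta> k (n - int k) (w k)) \<oplus>\<^bsub>C p (n + 1 - int p)\<^esub>
    sg (C p (n + 1 - int p)) p (d p (n - int p) (w p))"

definition tot_F :: "(nat \<Rightarrow> int \<Rightarrow> ('r, 'm) module) \<Rightarrow> int \<Rightarrow> int \<Rightarrow> (nat \<Rightarrow> 'm) set" where
  "tot_F C n p = {w \<in> carrier (tot_mod C n). \<forall>k. int k < p \<longrightarrow> w k = \<zero>\<^bsub>C k (n - int k)\<^esub>}"

locale double_complex =
  fixes R :: "('r, 'z) ring_scheme" and C :: "nat \<Rightarrow> int \<Rightarrow> ('r, 'm) module"
    and \<delta> :: "nat \<Rightarrow> int \<Rightarrow> 'm \<Rightarrow> 'm" and d :: "nat \<Rightarrow> int \<Rightarrow> 'm \<Rightarrow> 'm"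
  assumes ring: "cring R"
    and module_C: "\<And>p q. module R (C p q)"
    and hom_\<delta>: "\<And>p q. mod_hom R (C p q) (C (Suc p) q) (\<delta> p q)"
    and hom_d: "\<And>p q. mod_hom R (C p q) (C p (q + 1)) (d p q)"
    and \<delta>_\<delta>: "\<And>p q x. x \<in> carrier (C p q) \<Longrightarrow> \<delta> (Suc p) q (\<delta> p q x) = \<zero>\<^bsub>C (Suc (Suc p)) q\<^esub>"
    and d_d: "\<And>p q x. x \<in> carrier (C p q) \<Longrightarrow> d p (q + 1) (d p q x) = \<zero>\<^bsub>C p (q + 2)\<^esub>"
    and \<delta>_d: "\<And>p q x. x \<in> carrier (C p q) \<Longrightarrow> \<delta> p (q + 1) (d p q x) = d (Suc p) q (\<delta> p q x)"
    and C_neg: "\<And>p q. q < 0 \<Longrightarrow> carrier (C p q) = {\<zero>\<^bsub>C p q\<^esub>}"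
begin

abbreviation "Tot \<equiv> tot_mod C"
abbreviation "TD \<equiv> tot_D C \<delta> d"
abbreviation "TF \<equiv> tot_F C"

lemma ab_C: "abelian_group (C p q)"
  using module_C module.axioms(2) by blast

lemma zero_C: "\<zero>\<^bsub>C p q\<^esub> \<in> carrier (C p q)"
  using abelian_groupE(2)[OF ab_C] .

lemma hom_d': "q' = q + 1 \<Longrightarrow> mod_hom R (C p q) (C p q') (d p q)"
  using hom_d by simp

lemma \<delta>_zero: "\<delta> p q \<zero>\<^bsub>C p q\<^esub> = \<zero>\<^bsub>C (Suc p) q\<^esub>"
  by (rule mod_hom_zero[OF module_C module_C hom_\<delta>])

lemma d_zero: "q' = q + 1 \<Longrightarrow> d p q \<zero>\<^bsub>C p q\<^esub> = \<zero>\<^bsub>C p q'\<^esub>"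
  by (rule mod_hom_zero[OF module_C module_C hom_d'])

lemma module_Tot: "module R (Tot n)"
  unfolding tot_mod_def by (intro module_prod_mod ring module_C)

lemma Tot_carrier: "w \<in> carrier (Tot n) \<longleftrightarrow> (\<forall>p. w p \<in> carrier (C p (n - int p)))"
  by (simp add: tot_mod_def prod_mod_simps PiE_def Pi_iff)

lemma Tot_simps:
  "\<zero>\<^bsub>Tot n\<^esub> p = \<zero>\<^bsub>C p (n - int p)\<^esub>"
  "(v \<oplus>\<^bsub>Tot n\<^esub> w) p = v p \<oplus>\<^bsub>C p (n - int p)\<^esub> w p"
  "(a \<odot>\<^bsub>Tot n\<^esub> w) p = a \<odot>\<^bsub>C p (n - int p)\<^esub> w p"
  by (simp_all add: tot_mod_def prod_mod_simps)

lemma hom_proj: "mod_hom R (Tot n) (C p (n - int p)) (\<lambda>w. w p)"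
  unfolding tot_mod_def by (rule mod_hom_proj) simp

lemma Tot_minus:
  "v \<in> carrier (Tot n) \<Longrightarrow> w \<in> carrier (Tot n) \<Longrightarrow> (v \<ominus>\<^bsub>Tot n\<^esub> w) p = v p \<ominus>\<^bsub>C p (n - int p)\<^esub> w p"
  by (rule mod_hom_diff[OF module_Tot module_C hom_proj])

lemma TD_0: "w \<in> carrier (Tot n) \<Longrightarrow> TD n w 0 = d 0 n (w 0)"
proof -
  assume w: "w \<in> carrier (Tot n)"
  interpret C: module R "C 0 (n + 1)" by (rule module_C)
  have "d 0 n (w 0) \<in> carrier (C 0 (n + 1))"
    using w[unfolded Tot_carrier, rule_format, of 0] by (intro mod_hom_closed[OF hom_d]) simp
  then show ?thesis by (simp add: tot_D_def sg_def)
qed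

lemma TD_Suc: "TD n w (Suc k) = \<delta> k (n - int k) (w k) \<oplus>\<^bsub>C (Suc k) (n - int k)\<^esub>
    sg (C (Suc k) (n - int k)) (Suc k) (d (Suc k) (n - int k - 1) (w (Suc k)))"
proof -
  have "n + 1 - int (Suc k) = n - int k" "n - int (Suc k) = n - int k - 1" by simp_all
  then show ?thesis by (simp only: tot_D_def nat.case)
qed

lemma \<delta>_closed: "w \<in> carrier (Tot n) \<Longrightarrow> \<delta> k (n - int k) (w k) \<in> carrier (C (Suc k) (n - int k))"
  by (rule mod_hom_closed[OF hom_\<delta>]) (simp add: Tot_carrier)

lemma Tot_Suc_closed: "w \<in> carrier (Tot n) \<Longrightarrow> w (Suc k) \<in> carrier (C (Suc k) (n - int k - 1))"
  unfolding Tot_carrier by (drule spec[of _ "Suc k"]) (simp add: algebra_simps)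

lemma d_Suc_closed:
  "w \<in> carrier (Tot n) \<Longrightarrow> d (Suc k) (n - int k - 1) (w (Suc k)) \<in> carrier (C (Suc k) (n - int k))"
  using mod_hom_closed[OF hom_d'[of "n - int k" "n - int k - 1" "Suc k"] Tot_Suc_closed[of w n k]] by simp

lemma hom_TD: "mod_hom R (Tot n) (Tot (n + 1)) (TD n)"
proof -
  have "mod_hom R (Tot n) (Tot (n + 1)) (\<lambda>w. \<lambda>p\<in>UNIV. TD n w p)"
    unfolding tot_mod_def[of C "n + 1"]
  proof (rule mod_hom_prodI)
    fix p
    show "mod_hom R (Tot n) (C p (n + 1 - int p)) (\<lambda>w. TD n w p)"
    proof (cases p)
      case 0
      have "mod_hom R (Tot n) (C 0 (n + 1)) (\<lambda>w. d 0 n (w 0))"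
        using mod_hom_comp[OF hom_proj[of n 0]] hom_d[of 0 n] by simp
      then have "mod_hom R (Tot n) (C 0 (n + 1)) (\<lambda>w. TD n w 0)"
        using TD_0 module.smult_closed[OF module_Tot] abelian_groupE(1)[OF module.axioms(2)[OF module_Tot]]
        by (auto simp: mod_hom_def Pi_iff)
      with 0 show ?thesis by simp
    next
      case (Suc k)
      have "mod_hom R (Tot n) (C (Suc k) (n - int k)) (\<lambda>w. \<delta> k (n - int k) (w k))"
        by (rule mod_hom_comp[OF hom_proj hom_\<delta>])
      moreover have "mod_hom R (Tot n) (C (Suc k) (n - int k))
          (\<lambda>w. sg (C (Suc k) (n - int k)) (Suc k) (d (Suc k) (n - int k - 1) (w (Suc k))))"
        using mod_hom_comp[OF hom_proj[of n "Suc k"], of "C (Suc k) (n - int k)"]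
          mod_hom_sg[OF module_C module_C hom_d'[of "n - int k" "n - int k - 1" "Suc k"], of "Suc k"]
        by (simp add: algebra_simps)
      ultimately have "mod_hom R (Tot n) (C (Suc k) (n - int k)) (\<lambda>w. TD n w (Suc k))"
        unfolding TD_Suc by (rule mod_hom_plus[OF module_Tot module_C])
      with Suc show ?thesis by simp
    qed
  qed
  moreover have "(\<lambda>w. \<lambda>p\<in>UNIV. TD n w p) = TD n" by (simp add: fun_eq_iff)
  ultimately show ?thesis by (simp only:)
qed

text \<open>In column k + 1 the squares of the two differentials vanish, and the mixed terms occur
  once with sign (-1)^k, from the vertical part in column k, and once with (-1)^(k+1).\<close>

lemma TD_TD:
  assumes w: "w \<in> carrier (Tot n)"
  shows "TD (n + 1) (TD n w) = \<zero>\<^bsub>Tot (n + 2)\<^esub>"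
proof
  fix p
  have Dw: "TD n w \<in> carrier (Tot (n + 1))" using w by (rule mod_hom_closed[OF hom_TD])
  have w0: "w 0 \<in> carrier (C 0 n)" using w[unfolded Tot_carrier, rule_format, of 0] by simp
  show "TD (n + 1) (TD n w) p = \<zero>\<^bsub>Tot (n + 2)\<^esub> p"
  proof (cases p)
    case 0
    show ?thesis unfolding 0 using d_d[OF w0] by (simp add: TD_0[OF Dw] TD_0[OF w] Tot_simps)
  next
    case (Suc k)
    let ?q = "n - int k"
    let ?M = "C (Suc k) (?q + 1)"
    interpret M: module R ?M by (rule module_C)
    have wk: "w k \<in> carrier (C k ?q)" using w by (simp add: Tot_carrier)
    note wS = Tot_Suc_closed[OF w, of k] and dwk = mod_hom_closed[OF hom_d wk]
    have hd: "mod_hom R (C (Suc k) ?q) ?M (d (Suc k) ?q)" by (rule hom_d)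
    have q: "n + 1 - int k = ?q + 1" "n + 1 - int k - 1 = ?q" by simp_all
    have a: "\<delta> k (?q + 1) (TD n w k) = sg ?M k (\<delta> k (?q + 1) (d k ?q (w k)))"
    proof (cases k)
      case 0
      then show ?thesis using TD_0[OF w] by (simp add: sg_def)
    next
      case (Suc j)
      interpret L: module R "C k (?q + 1)" by (rule module_C)
      have qj: "n - int j = ?q + 1" "n - int j - 1 = ?q" using Suc by simp_all
      have wj: "w j \<in> carrier (C j (?q + 1))" using w[unfolded Tot_carrier, rule_format, of j] by (simp only: qj(1))
      have "TD n w k = \<delta> j (?q + 1) (w j) \<oplus>\<^bsub>C k (?q + 1)\<^esub> sg (C k (?q + 1)) k (d k ?q (w k))"
        using TD_Suc[of n w j] by (simp only: qj(1) add_diff_cancel_right' Suc[symmetric])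
      then have "\<delta> k (?q + 1) (TD n w k) = \<delta> k (?q + 1) (\<delta> j (?q + 1) (w j) \<oplus>\<^bsub>C k (?q + 1)\<^esub>
          sg (C k (?q + 1)) k (d k ?q (w k)))" by (rule arg_cong)
      also have "\<dots> = \<delta> k (?q + 1) (\<delta> j (?q + 1) (w j)) \<oplus>\<^bsub>?M\<^esub>
          \<delta> k (?q + 1) (sg (C k (?q + 1)) k (d k ?q (w k)))"
        using mod_hom_closed[OF hom_\<delta> wj, folded Suc]
        by (rule mod_hom_add[OF hom_\<delta> _ L.sg_closed[OF dwk]])
      also have "\<dots> = sg ?M k (\<delta> k (?q + 1) (d k ?q (w k)))"
        using \<delta>_\<delta>[OF wj, folded Suc] mod_hom_closed[OF hom_\<delta> dwk]
        by (simp only: sg_hom[OF module_C module_C hom_\<delta> dwk] M.l_zero M.sg_closed)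
      finally show ?thesis .
    qed
    have dd0: "d (Suc k) ?q (sg (C (Suc k) ?q) (Suc k) (d (Suc k) (?q - 1) (w (Suc k)))) = \<zero>\<^bsub>?M\<^esub>"
    proof -
      have "?q - 1 + 1 = ?q" "?q - 1 + 2 = ?q + 1" by simp_all
      then have "d (Suc k) ?q (d (Suc k) (?q - 1) (w (Suc k))) = \<zero>\<^bsub>?M\<^esub>"
        using d_d[OF wS] by (simp only:)
      then show ?thesis
        by (simp only: sg_hom[OF module_C module_C hd d_Suc_closed[OF w]] M.sg_zero)
    qed
    have b: "d (Suc k) ?q (TD n w (Suc k)) = d (Suc k) ?q (\<delta> k ?q (w k))"
    proof -
      interpret L: module R "C (Suc k) ?q" by (rule module_C)
      show ?thesis
        unfolding TD_Suc using \<delta>_closed[OF w, of k] d_Suc_closed[OF w, of k] dd0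
          mod_hom_closed[OF hd \<delta>_closed[OF w]]
        by (simp add: mod_hom_add[OF hd])
    qed
    have "TD (n + 1) (TD n w) (Suc k) =
        sg ?M k (\<delta> k (?q + 1) (d k ?q (w k))) \<oplus>\<^bsub>?M\<^esub> sg ?M (Suc k) (\<delta> k (?q + 1) (d k ?q (w k)))"
      unfolding TD_Suc[of "n + 1"] q(1) add_diff_cancel_right' a b \<delta>_d[OF wk] ..
    also have "\<dots> = \<zero>\<^bsub>?M\<^esub>" using mod_hom_closed[OF hom_\<delta> dwk] by (rule M.sg_add_neg)
    also have "?q + 1 = n + 2 - int (Suc k)" by simp
    finally show ?thesis unfolding Suc Tot_simps .
  qed
qed

lemma TF_closed: "w \<in> TF n p \<Longrightarrow> w \<in> carrier (Tot n)"
  by (simp add: tot_F_def)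

sublocale tot: filtered_complex R Tot TD TF
proof (rule filtered_complex.intro)
  fix n p
  show "module R (Tot n)" by (rule module_Tot)
  show "mod_hom R (Tot n) (Tot (n + 1)) (TD n)" by (rule hom_TD)
  show "TD (n + 1) (TD n x) = \<zero>\<^bsub>Tot (n + 2)\<^esub>" if "x \<in> carrier (Tot n)" for x
    using that by (rule TD_TD)
  interpret T: module R "Tot n" by (rule module_Tot)
  show "submodule (TF n p) R (Tot n)"
  proof (rule T.submoduleI)
    show "\<ominus>\<^bsub>Tot n\<^esub> a \<in> TF n p" if "a \<in> TF n p" for a
      using that abelian_group.a_inv_zero[OF ab_C]
      by (auto simp: tot_F_def mod_hom_neg[OF module_Tot module_C hom_proj])
  qed (use zero_C abelian_groupE(5)[OF ab_C] module.smult_r_null[OF module_C] in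
      \<open>auto simp: tot_F_def Tot_simps\<close>)
  show "TF n (p + 1) \<subseteq> TF n p" by (auto simp: tot_F_def)
  show "TF n p = carrier (Tot n)" if "p \<le> 0" using that by (auto simp: tot_F_def)
  \<comment> \<open>Columns below \<open>p\<close> vanish by definition of the filtration; the
    others have negative vertical degree.\<close>
  show "TF n p = {\<zero>\<^bsub>Tot n\<^esub>}" if "n < p"
  proof -
    have "w = \<zero>\<^bsub>Tot n\<^esub>" if w: "w \<in> TF n p" for w
    proof
      fix k show "w k = \<zero>\<^bsub>Tot n\<^esub> k"
      proof (cases "int k < p")
        case False
        with \<open>n < p\<close> C_neg[of "n - int k" k] w show ?thesis by (auto simp: tot_F_def Tot_carrier Tot_simps)
      qed (use w in \<open>simp add: tot_F_def Tot_simps\<close>)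
    qed
    moreover have "\<zero>\<^bsub>Tot n\<^esub> \<in> TF n p" by (simp add: tot_F_def Tot_simps)
    ultimately show ?thesis by blast
  qed
  show "TD n w \<in> TF (n + 1) p" if w: "w \<in> TF n p" for w
  proof -
    have wc: "w \<in> carrier (Tot n)" and wz: "\<And>k. int k < p \<Longrightarrow> w k = \<zero>\<^bsub>C k (n - int k)\<^esub>"
      using w by (auto simp: tot_F_def)
    have "TD n w k = \<zero>\<^bsub>C k (n + 1 - int k)\<^esub>" if k: "int k < p" for k
    proof (cases k)
      case 0
      then show ?thesis using wz[of 0] k d_zero[of "n + 1" n 0] by (simp add: TD_0[OF wc])
    next
      case (Suc j)
      have q: "n - int (Suc j) = n - int j - 1" "n + 1 - int (Suc j) = n - int j" by simp_all
      interpret L: module R "C (Suc j) (n - int j)" by (rule module_C)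
      have "w j = \<zero>\<^bsub>C j (n - int j)\<^esub>" "w (Suc j) = \<zero>\<^bsub>C (Suc j) (n - int j - 1)\<^esub>"
        using wz[of j] wz[of "Suc j", unfolded q] k Suc by auto
      then have "TD n w (Suc j) = \<zero>\<^bsub>C (Suc j) (n - int j)\<^esub>"
        unfolding TD_Suc by (simp add: \<delta>_zero d_zero[of "n - int j" "n - int j - 1"])
      with Suc q show ?thesis by simp
    qed
    with mod_hom_closed[OF hom_TD wc] show ?thesis by (simp add: tot_F_def)
  qed
qed

end

lemma (in abelian_group) add_eq_zero_imp:
  assumes "x \<oplus> y = \<zero>" "x \<in> carrier G" "y \<in> carrier G"
  shows "x = \<ominus> y"
  using minus_equality[OF assms(1) assms(3,2)] by simp

lemma (in abelian_group) minus_minus_cancel: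
  "x \<in> carrier G \<Longrightarrow> y \<in> carrier G \<Longrightarrow> x \<ominus> (x \<ominus> y) = y"
  "x \<in> carrier G \<Longrightarrow> y \<in> carrier G \<Longrightarrow> x \<ominus> y \<oplus> y = x"
  "x \<in> carrier G \<Longrightarrow> y \<in> carrier G \<Longrightarrow> y \<oplus> (x \<ominus> y) = x"
  "x \<in> carrier G \<Longrightarrow> y \<in> carrier G \<Longrightarrow> x \<oplus> y \<ominus> y = x"
  "x \<in> carrier G \<Longrightarrow> x \<ominus> \<zero> = x"
  by (simp_all add: a_minus_def minus_add a_assoc[symmetric] r_neg l_neg)
     (simp_all add: a_assoc l_neg r_neg a_comm[of y] )

section \<open>Reduction of total cochains along exact rows, and the second page\<close>

context double_complex
begin

definition inj_C :: "int \<Rightarrow> nat \<Rightarrow> 'm \<Rightarrow> nat \<Rightarrow> 'm" where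
  "inj_C n k c p = (if p = k then c else \<zero>\<^bsub>C p (n - int p)\<^esub>)"

lemma inj_C_closed: "c \<in> carrier (C k (n - int k)) \<Longrightarrow> inj_C n k c \<in> carrier (Tot n)"
  by (simp add: Tot_carrier inj_C_def zero_C)

lemma TD_inj_C:
  assumes c: "c \<in> carrier (C k (n - int k))"
  shows "TD n (inj_C n k c) p =
    (if p = k then sg (C k (n + 1 - int k)) k (d k (n - int k) c)
     else if p = Suc k then \<delta> k (n - int k) c else \<zero>\<^bsub>C p (n + 1 - int p)\<^esub>)"
proof (cases p)
  case 0
  interpret L: module R "C 0 (n + 1)" by (rule module_C)
  show ?thesis
    unfolding 0 using TD_0[OF inj_C_closed[OF c]] d_zero[of "n + 1" n 0]
    by (auto simp: inj_C_def sg_def)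
next
  case (Suc j)
  interpret L: module R "C (Suc j) (n - int j)" by (rule module_C)
  have q: "n + 1 - int (Suc j) = n - int j" "n - int (Suc j) = n - int j - 1" by simp_all
  have dz: "d (Suc j) (n - int j - 1) \<zero>\<^bsub>C (Suc j) (n - int j - 1)\<^esub> = \<zero>\<^bsub>C (Suc j) (n - int j)\<^esub>"
    by (rule d_zero) simp
  consider "k = Suc j" | "k = j" | "k \<noteq> j" "k \<noteq> Suc j" by blast
  then show ?thesis
  proof cases
    case 1
    have c': "c \<in> carrier (C (Suc j) (n - int j - 1))" using c unfolding 1 q .
    have "d (Suc j) (n - int j - 1) c \<in> carrier (C (Suc j) (n - int j))"
      by (rule mod_hom_closed[OF hom_d' c']) simp
    then show ?thesis unfolding Suc TD_Suc 1 q by (simp add: inj_C_def \<delta>_zero)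
  next
    case 2
    have i: "inj_C n k c (Suc j) = \<zero>\<^bsub>C (Suc j) (n - int j - 1)\<^esub>"
      unfolding inj_C_def q using 2 by simp
    have "\<delta> j (n - int j) c \<in> carrier (C (Suc j) (n - int j))"
      using mod_hom_closed[OF hom_\<delta> c] unfolding 2 .
    then have "TD n (inj_C n k c) (Suc j) = \<delta> j (n - int j) c"
      unfolding TD_Suc i dz L.sg_zero using 2 by (simp add: inj_C_def)
    then show ?thesis unfolding Suc using 2 by simp
  next
    case 3
    have i: "inj_C n k c (Suc j) = \<zero>\<^bsub>C (Suc j) (n - int j - 1)\<^esub>"
      unfolding inj_C_def q using 3 by simp
    have "TD n (inj_C n k c) (Suc j) = \<zero>\<^bsub>C (Suc j) (n - int j)\<^esub>"
      unfolding TD_Suc i dz L.sg_zero using 3 by (simp add: inj_C_def \<delta>_zero)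
    then show ?thesis unfolding Suc q using 3 by simp
  qed
qed

lemma inj_C_eqI:
  assumes "\<And>k. w (Suc k) = \<zero>\<^bsub>C (Suc k) (n - int (Suc k))\<^esub>"
  shows "w = inj_C n 0 (w 0)"
proof
  fix p show "w p = inj_C n 0 (w 0) p" using assms[of "p - 1"] by (cases p) (auto simp: inj_C_def)
qed

text \<open>Descending induction over the columns. The last nonzero component is a horizontal
  cocycle, hence by exactness the horizontal coboundary of some \<open>b\<close> one column to the
  left; subtracting the total coboundary of \<open>b\<close> removes it without touching later
  columns. Column 0 of the coboundary of \<open>x\<close> is left free, because later
  \<open>x\<close> may have the image of the augmentation as its coboundary.\<close>

lemma row_reduction:
  assumes exact: "\<And>k q c. c \<in> carrier (C (Suc k) q) \<Longrightarrow> \<delta> (Suc k) q c = \<zero>\<^bsub>C (Suc (Suc k)) q\<^esub> \<Longrightarrow>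
      \<exists>b\<in>carrier (C k q). c = \<delta> k q b"
    and x: "x \<in> carrier (Tot n)"
    and Dx: "\<And>k. TD n x (Suc k) = \<zero>\<^bsub>C (Suc k) (n - int k)\<^esub>"
  shows "\<exists>z\<in>carrier (Tot (n - 1)). \<forall>k. (x \<ominus>\<^bsub>Tot n\<^esub> TD (n - 1) z) (Suc k) = \<zero>\<^bsub>C (Suc k) (n - int (Suc k))\<^esub>"
proof -
  interpret T: module R "Tot n" by (rule module_Tot)
  have hom: "mod_hom R (Tot (n - 1)) (Tot n) (TD (n - 1))" by (rule tot.hom_D') simp
  have "\<exists>z\<in>carrier (Tot (n - 1)). \<forall>k\<ge>m. (x \<ominus>\<^bsub>Tot n\<^esub> TD (n - 1) z) (Suc k) = \<zero>\<^bsub>C (Suc k) (n - int (Suc k))\<^esub>"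
    if "m \<le> nat n" for m
    using that
  proof (induction m rule: inc_induct)
    \<comment> \<open>Columns beyond \<open>nat n\<close> have negative vertical degree, so nothing
      has to be removed.\<close>
    case base
    have "x (Suc k) = \<zero>\<^bsub>C (Suc k) (n - int (Suc k))\<^esub>" if "nat n \<le> k" for k
      using x[unfolded Tot_carrier, rule_format, of "Suc k"] C_neg[of "n - int (Suc k)" "Suc k"] that by auto
    moreover have "TD (n - 1) \<zero>\<^bsub>Tot (n - 1)\<^esub> = \<zero>\<^bsub>Tot n\<^esub>" by (rule mod_hom_zero[OF module_Tot module_Tot hom])
    ultimately show ?case
      using submodule_zero[OF tot.sub_F, of "n - 1" 0] x
      by (intro bexI[of _ "\<zero>\<^bsub>Tot (n - 1)\<^esub>"]) (simp_all add: T.minus_minus_cancel tot.F_top)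
  next
    case (step m)
    then obtain z where z: "z \<in> carrier (Tot (n - 1))"
      and xz: "\<And>k. Suc m \<le> k \<Longrightarrow> (x \<ominus>\<^bsub>Tot n\<^esub> TD (n - 1) z) (Suc k) = \<zero>\<^bsub>C (Suc k) (n - int (Suc k))\<^esub>" by blast
    let ?y = "x \<ominus>\<^bsub>Tot n\<^esub> TD (n - 1) z" and ?q = "n - int (Suc m)"
    note Dz = mod_hom_closed[OF hom z]
    have y: "?y \<in> carrier (Tot n)" using x Dz by (simp add: a_minus_def)
    have ym: "?y (Suc m) \<in> carrier (C (Suc m) ?q)" using y unfolding Tot_carrier by blast
    interpret L: module R "C (Suc (Suc m)) ?q" by (rule module_C)
    have "TD n ?y = TD n x"
    proof -
      interpret T1: module R "Tot (n + 1)" by (rule module_Tot)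
      have "TD n (TD (n - 1) z) = \<zero>\<^bsub>Tot (n + 1)\<^esub>" using z by (intro tot.D_D') simp_all
      then show ?thesis
        using mod_hom_diff[OF module_Tot module_Tot hom_TD x Dz] mod_hom_closed[OF hom_TD x]
        by (simp add: T1.minus_minus_cancel)
    qed
    then have "TD n ?y (Suc (Suc m)) = \<zero>\<^bsub>C (Suc (Suc m)) ?q\<^esub>" using Dx[of "Suc m"] by simp
    \<comment> \<open>The next column is already zero, so only the horizontal term
      contributes.\<close>
    moreover have "TD n ?y (Suc (Suc m)) = \<delta> (Suc m) ?q (?y (Suc m))"
    proof -
      have q: "n - int (Suc (Suc m)) = ?q - 1" by simp
      have "d (Suc (Suc m)) (?q - 1) (?y (Suc (Suc m))) = \<zero>\<^bsub>C (Suc (Suc m)) ?q\<^esub>"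
        unfolding xz[of "Suc m", OF order_refl] q by (rule d_zero) simp
      then show ?thesis
        unfolding TD_Suc[of n _ "Suc m"] using mod_hom_closed[OF hom_\<delta> ym] by (simp only: L.sg_zero L.r_zero)
    qed
    ultimately have "\<delta> (Suc m) ?q (?y (Suc m)) = \<zero>\<^bsub>C (Suc (Suc m)) ?q\<^esub>" by simp
    from exact[OF ym this] obtain b where b: "b \<in> carrier (C m ?q)" "?y (Suc m) = \<delta> m ?q b" by blast
    have q': "n - 1 - int m = ?q" "n - 1 + 1 = n" by simp_all
    have b': "b \<in> carrier (C m (n - 1 - int m))" using b(1) unfolding q' .
    let ?i = "inj_C (n - 1) m b"
    have i: "?i \<in> carrier (Tot (n - 1))" by (rule inj_C_closed[OF b'])
    interpret T0: module R "Tot (n - 1)" by (rule module_Tot)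
    note Di = mod_hom_closed[OF hom i]
    have zi: "z \<oplus>\<^bsub>Tot (n - 1)\<^esub> ?i \<in> carrier (Tot (n - 1))" using z i by simp
    have split: "x \<ominus>\<^bsub>Tot n\<^esub> TD (n - 1) (z \<oplus>\<^bsub>Tot (n - 1)\<^esub> ?i) = ?y \<ominus>\<^bsub>Tot n\<^esub> TD (n - 1) ?i"
      using x Dz Di by (simp add: mod_hom_add[OF hom z i] a_minus_def T.minus_add T.a_assoc)
    have "(?y \<ominus>\<^bsub>Tot n\<^esub> TD (n - 1) ?i) (Suc k) = \<zero>\<^bsub>C (Suc k) (n - int (Suc k))\<^esub>" if "m \<le> k" for k
    proof -
      interpret K: module R "C (Suc k) (n - int (Suc k))" by (rule module_C)
      show ?thesis
      proof (cases "k = m")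
        case True
        then have "TD (n - 1) ?i (Suc k) = ?y (Suc k)"
          unfolding TD_inj_C[OF b'] unfolding q' using b(2) by simp
        then show ?thesis
          using Tot_minus[OF y Di] y unfolding Tot_carrier by (simp only: K.minus_eq_zero_iff)
      next
        case False
        then have "TD (n - 1) ?i (Suc k) = \<zero>\<^bsub>C (Suc k) (n - int (Suc k))\<^esub>"
          unfolding TD_inj_C[OF b'] using that q' by simp
        moreover have "?y (Suc k) = \<zero>\<^bsub>C (Suc k) (n - int (Suc k))\<^esub>" using xz[of k] False that by simp
        ultimately show ?thesis
          unfolding Tot_minus[OF y Di] by (simp only: K.minus_eq_zero_iff K.zero_closed)
      qed
    qed
    then show ?case using zi split by (intro bexI[of _ "z \<oplus>\<^bsub>Tot (n - 1)\<^esub> ?i"]) simp_all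
  qed
  from this[of 0] show ?thesis by simp
qed

text \<open>An element of \<open>Z\<^sub>2\<close> in filtration \<open>p\<close> is determined modulo \<open>B\<^sub>2\<close> by its component in column \<open>p\<close>,
  which is a vertical cocycle whose horizontal coboundary is a vertical coboundary.\<close>

lemma second_page_component:
  assumes x: "x \<in> tot.Z 2 n (int p)"
  shows "x p \<in> carrier (C p (n - int p))"
    and "d p (n - int p) (x p) = \<zero>\<^bsub>C p (n - int p + 1)\<^esub>"
    and "\<delta> p (n - int p) (x p) \<in> d (Suc p) (n - int p - 1) ` carrier (C (Suc p) (n - int p - 1))"
proof -
  note xc = tot.Z_closed[OF x]
  show xp: "x p \<in> carrier (C p (n - int p))" using xc unfolding Tot_carrier by blast
  have zero: "x k = \<zero>\<^bsub>C k (n - int k)\<^esub>" if "k < p" for k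
    using x that by (auto simp: fc_Z_def tot_F_def)
  have Dzero: "TD n x k = \<zero>\<^bsub>C k (n + 1 - int k)\<^esub>" if "k < p + 2" for k
    using x that by (auto simp: fc_Z_def tot_F_def)
  have q: "n + 1 - int p = n - int p + 1" by simp
  interpret L: module R "C p (n - int p + 1)" by (rule module_C)
  note dxp = mod_hom_closed[OF hom_d xp]
  have "sg (C p (n - int p + 1)) p (d p (n - int p) (x p)) = \<zero>\<^bsub>C p (n - int p + 1)\<^esub>"
  proof (cases p)
    case 0
    with Dzero[of 0] TD_0[OF xc] show ?thesis by (simp add: sg_def)
  next
    case (Suc j)
    have qj: "n - int j = n - int p + 1" "n - int j - 1 = n - int p" using Suc by simp_all
    have "\<delta> j (n - int j) (x j) = \<zero>\<^bsub>C p (n - int p + 1)\<^esub>"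
      unfolding zero[of j, unfolded Suc, OF lessI] \<delta>_zero unfolding Suc[symmetric] qj(1) ..
    moreover have "TD n x p = \<delta> j (n - int j) (x j) \<oplus>\<^bsub>C p (n - int p + 1)\<^esub>
        sg (C p (n - int p + 1)) p (d p (n - int p) (x p))"
      using TD_Suc[of n x j] unfolding Suc[symmetric] qj(2) unfolding qj(1) .
    ultimately show ?thesis using Dzero[of p] dxp unfolding q by simp
  qed
  then have "sg (C p (n - int p + 1)) p (sg (C p (n - int p + 1)) p (d p (n - int p) (x p))) = \<zero>\<^bsub>C p (n - int p + 1)\<^esub>"
    by simp
  then show "d p (n - int p) (x p) = \<zero>\<^bsub>C p (n - int p + 1)\<^esub>" using dxp by simp
  interpret M: module R "C (Suc p) (n - int p)" by (rule module_C)
  let ?y = "x (Suc p)" and ?M = "C (Suc p) (n - int p)" and ?N = "C (Suc p) (n - int p - 1)"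
  interpret N: module R ?N by (rule module_C)
  have q': "n + 1 - int (Suc p) = n - int p" by simp
  have hom: "mod_hom R ?N ?M (d (Suc p) (n - int p - 1))" by (rule hom_d') simp
  note y = Tot_Suc_closed[OF xc, of p] and dy = d_Suc_closed[OF xc, of p]
  \<comment> \<open>D x lies in filtration p + 2, so its component in column p + 1 vanishes; this
    equation makes the horizontal coboundary of x p a vertical one.\<close>
  have "\<delta> p (n - int p) (x p) \<oplus>\<^bsub>?M\<^esub> sg ?M (Suc p) (d (Suc p) (n - int p - 1) ?y) = \<zero>\<^bsub>?M\<^esub>"
    using Dzero[of "Suc p"] TD_Suc[of n x p] unfolding q' by simp
  then have "\<delta> p (n - int p) (x p) = \<ominus>\<^bsub>?M\<^esub> sg ?M (Suc p) (d (Suc p) (n - int p - 1) ?y)"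
    using \<delta>_closed[OF xc, of p] dy by (intro M.add_eq_zero_imp) simp_all
  also have "\<dots> = d (Suc p) (n - int p - 1) (\<ominus>\<^bsub>?N\<^esub> sg ?N (Suc p) ?y)"
    using sg_hom[OF module_C module_C hom y] mod_hom_neg[OF module_C module_C hom N.sg_closed[OF y]] by simp
  finally show "\<delta> p (n - int p) (x p) \<in> d (Suc p) (n - int p - 1) ` carrier ?N"
    using y by simp
qed

text \<open>The lift is \<open>c\<close> in column p together with (-1)^p y in column p + 1. The
  vertical differential carries (-1)^(p+1) there, so its contribution cancels the horizontal
  coboundary of \<open>c\<close>.\<close>

lemma second_page_lift:
  assumes c: "c \<in> carrier (C p (n - int p))" "d p (n - int p) c = \<zero>\<^bsub>C p (n - int p + 1)\<^esub>"
    and y: "y \<in> carrier (C (Suc p) (n - int p - 1))" "\<delta> p (n - int p) c = d (Suc p) (n - int p - 1) y"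
  shows "\<exists>x\<in>tot.Z 2 n (int p). x p = c"
proof -
  let ?M = "C (Suc p) (n - int p)" and ?N = "C (Suc p) (n - int p - 1)"
  interpret T: module R "Tot n" by (rule module_Tot)
  interpret N: module R ?N by (rule module_C)
  interpret M: module R ?M by (rule module_C)
  have hom: "mod_hom R ?N ?M (d (Suc p) (n - int p - 1))" by (rule hom_d') simp
  have q: "n - int (Suc p) = n - int p - 1" "n + 1 - int (Suc p) = n - int p" "n + 1 - int p = n - int p + 1" by simp_all
  let ?y = "sg ?N p y"
  have y': "?y \<in> carrier (C (Suc p) (n - int (Suc p)))" unfolding q using y(1) by simp
  define x where "x = inj_C n p c \<oplus>\<^bsub>Tot n\<^esub> inj_C n (Suc p) ?y"
  note ic = inj_C_closed[OF c(1)] and iy = inj_C_closed[OF y']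
  have xc: "x \<in> carrier (Tot n)" unfolding x_def using ic iy by simp
  have xk: "x k = (if k = p then c else if k = Suc p then ?y else \<zero>\<^bsub>C k (n - int k)\<^esub>)" for k
  proof -
    interpret K: module R "C k (n - int k)" by (rule module_C)
    have ck: "inj_C n p c k \<in> carrier (C k (n - int k))" "inj_C n (Suc p) ?y k \<in> carrier (C k (n - int k))"
      using ic iy unfolding Tot_carrier by blast+
    show ?thesis
    proof (cases "k = p")
      case True
      have z: "inj_C n (Suc p) ?y k = \<zero>\<^bsub>C k (n - int k)\<^esub>" using True by (simp add: inj_C_def)
      have "x k = inj_C n p c k" unfolding x_def Tot_simps z using ck(1) by (rule K.r_zero)
      with True show ?thesis by (simp add: inj_C_def)
    next
      case False
      have z: "inj_C n p c k = \<zero>\<^bsub>C k (n - int k)\<^esub>" using False by (simp add: inj_C_def)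
      have "x k = inj_C n (Suc p) ?y k" unfolding x_def Tot_simps z using ck(2) by (rule K.l_zero)
      with False show ?thesis by (simp add: inj_C_def)
    qed
  qed
  have "TD n x = TD n (inj_C n p c) \<oplus>\<^bsub>Tot (n + 1)\<^esub> TD n (inj_C n (Suc p) ?y)"
    unfolding x_def by (rule mod_hom_add[OF hom_TD ic iy])
  then have TDk: "TD n x k = TD n (inj_C n p c) k \<oplus>\<^bsub>C k (n + 1 - int k)\<^esub> TD n (inj_C n (Suc p) ?y) k" for k
    by (simp add: Tot_simps)
  have "TD n x k = \<zero>\<^bsub>C k (n + 1 - int k)\<^esub>" if k: "int k < int p + 2" for k
  proof -
    interpret K: module R "C k (n + 1 - int k)" by (rule module_C)
    consider "k = p" | "k = Suc p" | "k < p" using k by linarith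
    then show ?thesis
    proof cases
      case 1
      interpret P: module R "C p (n - int p + 1)" by (rule module_C)
      show ?thesis unfolding TDk TD_inj_C[OF c(1)] TD_inj_C[OF y'] 1 unfolding q(3) c(2) by simp
    next
      case 2
      have "sg ?M (Suc p) (d (Suc p) (n - int p - 1) ?y) = \<ominus>\<^bsub>?M\<^esub> d (Suc p) (n - int p - 1) y"
        using sg_hom[OF module_C module_C hom y(1), of p] mod_hom_closed[OF hom y(1)] by (simp add: M.sg_Suc)
      then show ?thesis unfolding TDk TD_inj_C[OF c(1)] TD_inj_C[OF y'] 2 q
        using y(2) mod_hom_closed[OF hom y(1)] by (simp add: M.r_neg)
    next
      case 3
      then show ?thesis unfolding TDk TD_inj_C[OF c(1)] TD_inj_C[OF y'] by simp
    qed
  qed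
  then have "TD n x \<in> TF (n + 1) (int p + 2)"
    using mod_hom_closed[OF hom_TD xc] by (simp add: tot_F_def)
  then have "x \<in> tot.Z 2 n (int p)" using xc xk by (simp add: fc_Z_def tot_F_def)
  with xk[of p] show ?thesis by auto
qed

text \<open>Horizontal coboundaries of vertical cocycles, not of all cochains: modulo vertical
  coboundaries they are the coboundaries in the row of vertical cohomology.\<close>

definition hor_bd :: "nat \<Rightarrow> int \<Rightarrow> 'm set" where
  "hor_bd p q = (case p of 0 \<Rightarrow> {\<zero>\<^bsub>C p q\<^esub>}
    | Suc k \<Rightarrow> \<delta> k q ` {v \<in> carrier (C k q). d k q v = \<zero>\<^bsub>C k (q + 1)\<^esub>})"

text \<open>If x = a + D w with \<open>a\<close> zero in column p and \<open>w\<close> starting in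
  column p - 1, then x p is the column-p part of D w, and the vanishing of D w in column p - 1 makes
  the component of \<open>w\<close> there a vertical cocycle. Conversely, \<open>w\<close> is
  assembled from a preimage of \<open>v\<close> in column p - 1 and a signed \<open>y\<close> in
  column p, and x - D w starts one column later.\<close>

lemma second_page_boundary_iff:
  assumes x: "x \<in> tot.Z 2 n (int p)"
  shows "x \<in> tot.B 2 n (int p) \<longleftrightarrow>
    (\<exists>v\<in>hor_bd p (n - int p). \<exists>y\<in>carrier (C p (n - int p - 1)). x p = v \<oplus>\<^bsub>C p (n - int p)\<^esub> d p (n - int p - 1) y)"
proof
  interpret T: module R "Tot n" by (rule module_Tot)
  let ?q = "n - int p"
  let ?L = "C p ?q" and ?N = "C p (?q - 1)"
  interpret L: module R ?L by (rule module_C)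
  interpret N: module R ?N by (rule module_C)
  have hom: "mod_hom R ?N ?L (d p (?q - 1))" by (rule hom_d') simp
  have Thom: "mod_hom R (Tot (n - 1)) (Tot n) (TD (n - 1))" by (rule tot.hom_D') simp
  have q: "n - 1 - int p = ?q - 1" "n - 1 + 1 - int p = ?q" by simp_all
  {
    assume "x \<in> tot.B 2 n (int p)"
    then obtain a w where a: "a \<in> tot.Z (2 - 1) n (int p + 1)" and w: "w \<in> tot.Z (2 - 1) (n - 1) (int p - 2 + 1)"
      and xaw: "x = a \<oplus>\<^bsub>Tot n\<^esub> TD (n - 1) w" by (rule tot.B_cases)
    note wc = tot.Z_closed[OF w]
    have ap: "a p = \<zero>\<^bsub>?L\<^esub>" using a by (simp add: fc_Z_def tot_F_def)
    have wz: "w k = \<zero>\<^bsub>C k (n - 1 - int k)\<^esub>" if "int k < int p - 1" for k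
      using w that by (simp add: fc_Z_def tot_F_def)
    have Dw: "TD (n - 1) w k = \<zero>\<^bsub>C k (n - int k)\<^esub>" if "k < p" for k
      using w that by (simp add: fc_Z_def tot_F_def)
    have wp: "w p \<in> carrier ?N" using wc unfolding Tot_carrier q(1)[symmetric] by blast
    have Dwp: "TD (n - 1) w p \<in> carrier ?L" using mod_hom_closed[OF Thom wc] unfolding Tot_carrier by blast
    have xp: "x p = TD (n - 1) w p" unfolding xaw Tot_simps ap using Dwp by simp
    have dwp: "sg ?L p (d p (?q - 1) (w p)) = d p (?q - 1) (sg ?N p (w p))"
      using sg_hom[OF module_C module_C hom wp] by simp
    have "\<exists>v\<in>hor_bd p ?q. TD (n - 1) w p = v \<oplus>\<^bsub>?L\<^esub> sg ?L p (d p (?q - 1) (w p))"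
    proof (cases p)
      case 0
      then have "TD (n - 1) w p = sg ?L p (d p (?q - 1) (w p))" using TD_0[OF wc] by (simp add: sg_def)
      moreover have "\<zero>\<^bsub>?L\<^esub> \<in> hor_bd p ?q" using 0 by (simp add: hor_bd_def)
      ultimately show ?thesis
        using L.l_zero[OF L.sg_closed[OF mod_hom_closed[OF hom wp]], of p]
        by (intro bexI[of _ "\<zero>\<^bsub>?L\<^esub>"]) simp_all
    next
      case (Suc k)
      have qk: "n - 1 - int k = ?q" "n - 1 - int k - 1 = ?q - 1" using Suc by simp_all
      have wk: "w k \<in> carrier (C k ?q)" using wc unfolding Tot_carrier qk(1)[symmetric] by blast
      interpret K: module R "C k (?q + 1)" by (rule module_C)
      note dwk = mod_hom_closed[OF hom_d wk]
      have "sg (C k (?q + 1)) k (d k ?q (w k)) = \<zero>\<^bsub>C k (?q + 1)\<^esub>"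
      proof -
        have "TD (n - 1) w k = sg (C k (?q + 1)) k (d k ?q (w k))"
        proof (cases k)
          case 0
          then show ?thesis using TD_0[OF wc] Suc by (simp add: sg_def)
        next
          case (Suc j)
          have qj: "n - 1 - int j = ?q + 1" "n - 1 - int j - 1 = ?q" using Suc qk by simp_all
          \<comment> \<open>\<open>w\<close> starts in column p - 1, which is \<open>k\<close>, so
            nothing enters from column \<open>j\<close>.\<close>
          have "w j = \<zero>\<^bsub>C j (n - 1 - int j)\<^esub>" using wz[of j] Suc \<open>p = Suc k\<close> by simp
          then have "TD (n - 1) w k = \<delta> j (?q + 1) \<zero>\<^bsub>C j (?q + 1)\<^esub> \<oplus>\<^bsub>C k (?q + 1)\<^esub>
              sg (C k (?q + 1)) k (d k ?q (w k))"
            using TD_Suc[of "n - 1" w j] unfolding Suc[symmetric] qj(2) unfolding qj(1) by (simp only:)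
          then show ?thesis using \<delta>_zero[of j "?q + 1"] dwk unfolding Suc[symmetric] by simp
        qed
        moreover have "TD (n - 1) w k = \<zero>\<^bsub>C k (?q + 1)\<^esub>" using Dw[of k] Suc by simp
        ultimately show ?thesis by simp
      qed
      then have "sg (C k (?q + 1)) k (sg (C k (?q + 1)) k (d k ?q (w k))) = \<zero>\<^bsub>C k (?q + 1)\<^esub>" by simp
      then have "d k ?q (w k) = \<zero>\<^bsub>C k (?q + 1)\<^esub>" using dwk by simp
      then have "\<delta> k ?q (w k) \<in> hor_bd p ?q"
        using wk unfolding hor_bd_def Suc nat.case by blast
      moreover have "TD (n - 1) w p = \<delta> k ?q (w k) \<oplus>\<^bsub>?L\<^esub> sg ?L p (d p (?q - 1) (w p))"
        using TD_Suc[of "n - 1" w k] unfolding Suc[symmetric] qk(2) unfolding qk(1) .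
      ultimately show ?thesis by blast
    qed
    then show "\<exists>v\<in>hor_bd p ?q. \<exists>y\<in>carrier ?N. x p = v \<oplus>\<^bsub>?L\<^esub> d p (?q - 1) y"
      unfolding xp dwp using N.sg_closed[OF wp] by blast
  }
  {
    assume "\<exists>v\<in>hor_bd p ?q. \<exists>y\<in>carrier ?N. x p = v \<oplus>\<^bsub>?L\<^esub> d p (?q - 1) y"
    then obtain v y where v: "v \<in> hor_bd p ?q" and y: "y \<in> carrier ?N" and xp: "x p = v \<oplus>\<^bsub>?L\<^esub> d p (?q - 1) y"
      by blast
    interpret T0: module R "Tot (n - 1)" by (rule module_Tot)
    have y': "sg ?N p y \<in> carrier (C p (n - 1 - int p))" unfolding q using y by simp
    have dy: "sg ?L p (d p (?q - 1) (sg ?N p y)) = d p (?q - 1) y"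
      using sg_hom[OF module_C module_C hom N.sg_closed[OF y], of p p] y by simp
    note dyc = mod_hom_closed[OF hom y]
    note iy = inj_C_closed[OF y']
    have "\<exists>u\<in>carrier (Tot (n - 1)). u \<in> TF (n - 1) (int p - 1) \<and>
      (\<forall>k\<le>p. TD (n - 1) u k = (if k = p then v else \<zero>\<^bsub>C k (n - int k)\<^esub>))"
    proof (cases p)
      case 0
      then have "v = \<zero>\<^bsub>?L\<^esub>" using v by (simp add: hor_bd_def)
      then show ?thesis using 0 mod_hom_zero[OF module_Tot module_Tot Thom]
        by (intro bexI[of _ "\<zero>\<^bsub>Tot (n - 1)\<^esub>"]) (simp_all add: tot.zero_F Tot_simps)
    next
      case (Suc k)
      then obtain u where u: "u \<in> carrier (C k ?q)" "d k ?q u = \<zero>\<^bsub>C k (?q + 1)\<^esub>" "v = \<delta> k ?q u"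
        using v unfolding hor_bd_def Suc nat.case by blast
      have qk: "n - 1 - int k = ?q" "n - 1 + 1 - int k = ?q + 1" using Suc by simp_all
      have u': "u \<in> carrier (C k (n - 1 - int k))" unfolding qk by (rule u(1))
      interpret K: module R "C k (?q + 1)" by (rule module_C)
      have "TD (n - 1) (inj_C (n - 1) k u) j = (if j = p then v else \<zero>\<^bsub>C j (n - int j)\<^esub>)" if "j \<le> p" for j
        unfolding TD_inj_C[OF u'] unfolding qk u(2,3) using Suc by (auto simp: abelian_group.sg_zero[OF ab_C])
      moreover have "inj_C (n - 1) k u \<in> TF (n - 1) (int p - 1)"
        using inj_C_closed[OF u'] Suc by (auto simp: tot_F_def inj_C_def)
      ultimately show ?thesis using inj_C_closed[OF u'] by blast
    qed
    then obtain u where u: "u \<in> carrier (Tot (n - 1))" "u \<in> TF (n - 1) (int p - 1)"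
      and Du: "\<And>k. k \<le> p \<Longrightarrow> TD (n - 1) u k = (if k = p then v else \<zero>\<^bsub>C k (n - int k)\<^esub>)" by blast
    define w where "w = u \<oplus>\<^bsub>Tot (n - 1)\<^esub> inj_C (n - 1) p (sg ?N p y)"
    have iyF: "inj_C (n - 1) p (sg ?N p y) \<in> TF (n - 1) (int p - 1)"
      using iy by (auto simp: tot_F_def inj_C_def)
    have wF: "w \<in> TF (n - 1) (int p - 1)" unfolding w_def by (rule submodule_add[OF tot.sub_F u(2) iyF])
    note wc = TF_closed[OF wF]
    have Dw: "TD (n - 1) w k = (if k = p then x p else \<zero>\<^bsub>C k (n - int k)\<^esub>)" if "k \<le> p" for k
    proof -
      interpret K: module R "C k (n - int k)" by (rule module_C)
      have "TD (n - 1) w k = TD (n - 1) u k \<oplus>\<^bsub>C k (n - int k)\<^esub> TD (n - 1) (inj_C (n - 1) p (sg ?N p y)) k"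
        unfolding w_def mod_hom_add[OF Thom u(1) iy] by (rule Tot_simps)
      then show ?thesis
        using that unfolding Du[OF that] TD_inj_C[OF y'] q by (auto simp: dy xp)
    qed
    note Dwc = mod_hom_closed[OF Thom wc]
    have "TD (n - 1) w \<in> TF n (int p)" using Dwc Dw by (simp add: tot_F_def)
    then have wZ: "w \<in> tot.Z (2 - 1) (n - 1) (int p - 2 + 1)" using wF by (simp add: fc_Z_def)
    note xc = tot.Z_closed[OF x]
    define a where "a = x \<ominus>\<^bsub>Tot n\<^esub> TD (n - 1) w"
    have ac: "a \<in> carrier (Tot n)" unfolding a_def using xc Dwc by (simp add: a_minus_def)
    have "a k = \<zero>\<^bsub>C k (n - int k)\<^esub>" if "int k < int p + 1" for k
    proof -
      interpret K: module R "C k (n - int k)" by (rule module_C)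
      have "TD (n - 1) w k = x k" using Dw[of k] that x by (auto simp: fc_Z_def tot_F_def)
      then show ?thesis unfolding a_def Tot_minus[OF xc Dwc]
        using xc unfolding Tot_carrier by (simp add: K.minus_eq_zero_iff)
    qed
    then have aF: "a \<in> TF n (int p + 1)" using ac by (simp add: tot_F_def)
    have "TD n a = TD n x"
    proof -
      interpret T1: module R "Tot (n + 1)" by (rule module_Tot)
      have "TD n (TD (n - 1) w) = \<zero>\<^bsub>Tot (n + 1)\<^esub>" using wc by (intro tot.D_D') simp_all
      then show ?thesis unfolding a_def
        using mod_hom_diff[OF module_Tot module_Tot hom_TD xc Dwc] mod_hom_closed[OF hom_TD xc]
        by (simp add: T1.minus_minus_cancel)
    qed
    then have "a \<in> tot.Z (2 - 1) n (int p + 1)" using aF x by (simp add: fc_Z_def add.commute)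
    moreover have "x = a \<oplus>\<^bsub>Tot n\<^esub> TD (n - 1) w"
      unfolding a_def using xc Dwc by (simp add: T.minus_minus_cancel)
    ultimately show "x \<in> tot.B 2 n (int p)" using wZ unfolding fc_B_def by blast
  }
qed

end

section \<open>Augmented double complexes with exact rows\<close>

definition cocyc_of :: "(nat \<Rightarrow> ('r, 'm) module) \<Rightarrow> (nat \<Rightarrow> 'm \<Rightarrow> 'm) \<Rightarrow> nat \<Rightarrow> 'm set" where
  "cocyc_of A dA n = {u \<in> carrier (A n). dA n u = \<zero>\<^bsub>A (Suc n)\<^esub>}"

definition bd_of :: "(nat \<Rightarrow> ('r, 'm) module) \<Rightarrow> (nat \<Rightarrow> 'm \<Rightarrow> 'm) \<Rightarrow> nat \<Rightarrow> 'm set" where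
  "bd_of A dA n = (case n of 0 \<Rightarrow> {\<zero>\<^bsub>A 0\<^esub>} | Suc k \<Rightarrow> dA k ` carrier (A k))"

text \<open>In place of injectivity of \<open>\<epsilon>\<close>, \<open>kernel_0\<close> and
  \<open>kernel_Suc\<close> ask that a cocycle killed by \<open>\<epsilon>\<close> is the coboundary
  of an element killed by \<open>\<epsilon>\<close>. Together with the exact rows this suffices to
  compute the cohomology of \<open>A\<close>.\<close>

locale augmented_double_complex = double_complex R C \<delta> d
  for R :: "('r, 'z) ring_scheme" and C :: "nat \<Rightarrow> int \<Rightarrow> ('r, 'm) module" and \<delta> d +
  fixes A :: "nat \<Rightarrow> ('r, 'a) module" and dA :: "nat \<Rightarrow> 'a \<Rightarrow> 'a" and \<epsilon> :: "nat \<Rightarrow> 'a \<Rightarrow> 'm"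
  assumes module_A: "\<And>n. module R (A n)"
    and hom_dA: "\<And>n. mod_hom R (A n) (A (Suc n)) (dA n)"
    and dA_dA: "\<And>n u. u \<in> carrier (A n) \<Longrightarrow> dA (Suc n) (dA n u) = \<zero>\<^bsub>A (Suc (Suc n))\<^esub>"
    and hom_\<epsilon>: "\<And>n. mod_hom R (A n) (C 0 (int n)) (\<epsilon> n)"
    and \<epsilon>_d: "\<And>n u. u \<in> carrier (A n) \<Longrightarrow> \<epsilon> (Suc n) (dA n u) = d 0 (int n) (\<epsilon> n u)"
    and \<delta>_\<epsilon>: "\<And>n u. u \<in> carrier (A n) \<Longrightarrow> \<delta> 0 (int n) (\<epsilon> n u) = \<zero>\<^bsub>C (Suc 0) (int n)\<^esub>"
    and exact_row: "\<And>k q c. c \<in> carrier (C (Suc k) q) \<Longrightarrow> \<delta> (Suc k) q c = \<zero>\<^bsub>C (Suc (Suc k)) q\<^esub> \<Longrightarrow>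
      \<exists>b\<in>carrier (C k q). c = \<delta> k q b"
    and exact_0: "\<And>n c. c \<in> carrier (C 0 (int n)) \<Longrightarrow> \<delta> 0 (int n) c = \<zero>\<^bsub>C (Suc 0) (int n)\<^esub> \<Longrightarrow>
      \<exists>u\<in>carrier (A n). \<epsilon> n u = c"
    and kernel_0: "\<And>v. v \<in> carrier (A 0) \<Longrightarrow> dA 0 v = \<zero>\<^bsub>A (Suc 0)\<^esub> \<Longrightarrow> \<epsilon> 0 v = \<zero>\<^bsub>C 0 0\<^esub> \<Longrightarrow> v = \<zero>\<^bsub>A 0\<^esub>"
    and kernel_Suc: "\<And>n v. v \<in> carrier (A (Suc n)) \<Longrightarrow> dA (Suc n) v = \<zero>\<^bsub>A (Suc (Suc n))\<^esub> \<Longrightarrow>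
      \<epsilon> (Suc n) v = \<zero>\<^bsub>C 0 (int (Suc n))\<^esub> \<Longrightarrow>
      \<exists>y\<in>carrier (A n). \<epsilon> n y = \<zero>\<^bsub>C 0 (int n)\<^esub> \<and> v = dA n y"
begin

abbreviation "cocyc \<equiv> cocyc_of A dA"
abbreviation "bd \<equiv> bd_of A dA"

definition \<iota> :: "nat \<Rightarrow> 'a \<Rightarrow> nat \<Rightarrow> 'm" where
  "\<iota> n u = inj_C (int n) 0 (\<epsilon> n u)"

lemma sub_cocyc: "submodule (cocyc n) R (A n)"
proof -
  interpret A1: module R "A (Suc n)" by (rule module_A)
  have zero: "submodule {\<zero>\<^bsub>A (Suc n)\<^esub>} R (A (Suc n))" by (intro A1.submoduleI) auto
  have "cocyc n = {u \<in> carrier (A n). dA n u \<in> {\<zero>\<^bsub>A (Suc n)\<^esub>}}" by (simp add: cocyc_of_def)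
  then show ?thesis
    using submodule_vimage[OF module_A module_A hom_dA module.carrier_is_submodule[OF module_A] zero] by simp
qed

lemma cocyc_closed: "u \<in> cocyc n \<Longrightarrow> u \<in> carrier (A n)"
  by (simp add: cocyc_of_def)

lemma sub_bd: "submodule (bd n) R (A n)"
proof (cases n)
  case 0
  interpret A0: module R "A 0" by (rule module_A)
  have "submodule {\<zero>\<^bsub>A 0\<^esub>} R (A 0)" by (intro A0.submoduleI) auto
  with 0 show ?thesis by (simp add: bd_of_def)
next
  case (Suc k)
  then show ?thesis
    using submodule_image[OF module_A module_A hom_dA module.carrier_is_submodule[OF module_A], of k]
    by (simp add: bd_of_def)
qed

lemma bd_cocyc: "bd n \<subseteq> cocyc n"
proof (cases n)
  case 0
  then show ?thesis using submodule_zero[OF sub_cocyc, of 0] by (simp add: bd_of_def)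
next
  case (Suc k)
  then show ?thesis using mod_hom_closed[OF hom_dA] dA_dA by (auto simp: bd_of_def cocyc_of_def)
qed

lemma \<epsilon>_closed: "u \<in> carrier (A n) \<Longrightarrow> \<epsilon> n u \<in> carrier (C 0 (int n - int 0))"
  using mod_hom_closed[OF hom_\<epsilon>] by simp

lemma \<iota>_closed: "u \<in> carrier (A n) \<Longrightarrow> \<iota> n u \<in> carrier (Tot (int n))"
  unfolding \<iota>_def by (intro inj_C_closed \<epsilon>_closed)

lemma hom_\<iota>: "mod_hom R (A n) (Tot (int n)) (\<iota> n)"
proof (rule mod_homI)
  interpret A: module R "A n" by (rule module_A)
  show "\<iota> n (x \<oplus>\<^bsub>A n\<^esub> y) = \<iota> n x \<oplus>\<^bsub>Tot (int n)\<^esub> \<iota> n y" if "x \<in> carrier (A n)" "y \<in> carrier (A n)" for x y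
    using that mod_hom_add[OF hom_\<epsilon>] abelian_groupE(5)[OF ab_C zero_C]
    by (intro ext) (simp add: \<iota>_def inj_C_def Tot_simps)
  show "\<iota> n (a \<odot>\<^bsub>A n\<^esub> x) = a \<odot>\<^bsub>Tot (int n)\<^esub> \<iota> n x" if "a \<in> carrier R" "x \<in> carrier (A n)" for a x
    using that mod_hom_smult[OF hom_\<epsilon>] module.smult_r_null[OF module_C]
    by (intro ext) (simp add: \<iota>_def inj_C_def Tot_simps)
qed (rule \<iota>_closed)

lemma TD_\<iota>:
  assumes u: "u \<in> carrier (A n)"
  shows "TD (int n) (\<iota> n u) = \<iota> (Suc n) (dA n u)"
proof
  fix p
  show "TD (int n) (\<iota> n u) p = \<iota> (Suc n) (dA n u) p"
    unfolding \<iota>_def TD_inj_C[OF \<epsilon>_closed[OF u]]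
    using \<epsilon>_d[OF u] \<delta>_\<epsilon>[OF u] by (auto simp: inj_C_def sg_def add.commute)
qed

section \<open>Comparison of the total cohomology with that of the augmenting complex\<close>

lemma hom_TD_pred: "mod_hom R (Tot (n - 1)) (Tot n) (TD (n - 1))"
  by (rule tot.hom_D') simp

text \<open>After \<open>row_reduction\<close> a single element \<open>c\<close> of column 0 is
  left. That the total coboundary vanishes in column 1 says that \<open>c\<close> is a horizontal
  cocycle, so the augmentation will hit it.\<close>

lemma column_form:
  assumes x: "x \<in> carrier (Tot n)" and Dx: "\<And>k. TD n x (Suc k) = \<zero>\<^bsub>C (Suc k) (n - int k)\<^esub>"
  obtains z c where "z \<in> carrier (Tot (n - 1))" "c \<in> carrier (C 0 n)" "\<delta> 0 n c = \<zero>\<^bsub>C (Suc 0) n\<^esub>"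
    "x = inj_C n 0 c \<oplus>\<^bsub>Tot n\<^esub> TD (n - 1) z" "d 0 n c = TD n x 0"
proof -
  interpret T: module R "Tot n" by (rule module_Tot)
  from row_reduction[OF exact_row x Dx] obtain z where z: "z \<in> carrier (Tot (n - 1))"
    and xz: "\<And>k. (x \<ominus>\<^bsub>Tot n\<^esub> TD (n - 1) z) (Suc k) = \<zero>\<^bsub>C (Suc k) (n - int (Suc k))\<^esub>" by blast
  let ?y = "x \<ominus>\<^bsub>Tot n\<^esub> TD (n - 1) z"
  note Dz = mod_hom_closed[OF hom_TD_pred z]
  have y: "?y \<in> carrier (Tot n)" using x Dz by (simp add: a_minus_def)
  have c: "?y 0 \<in> carrier (C 0 (n - int 0))" using y unfolding Tot_carrier by blast
  have yc: "?y = inj_C n 0 (?y 0)" by (rule inj_C_eqI) (rule xz)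
  have Dy: "TD n ?y = TD n x"
  proof -
    interpret T1: module R "Tot (n + 1)" by (rule module_Tot)
    have "TD n (TD (n - 1) z) = \<zero>\<^bsub>Tot (n + 1)\<^esub>" using z by (intro tot.D_D') simp_all
    then show ?thesis
      using mod_hom_diff[OF module_Tot module_Tot hom_TD x Dz] mod_hom_closed[OF hom_TD x]
      by (simp add: T1.minus_minus_cancel)
  qed
  have "\<delta> 0 n (?y 0) = TD n (inj_C n 0 (?y 0)) (Suc 0)" by (simp add: TD_inj_C[OF c])
  also have "\<dots> = \<zero>\<^bsub>C (Suc 0) n\<^esub>" using Dx[of 0] unfolding yc[symmetric] Dy by simp
  finally have \<delta>: "\<delta> 0 n (?y 0) = \<zero>\<^bsub>C (Suc 0) n\<^esub>" .
  have "d 0 n (?y 0) = TD n x 0" using TD_0[OF y] Dy by simp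
  moreover have "x = inj_C n 0 (?y 0) \<oplus>\<^bsub>Tot n\<^esub> TD (n - 1) z"
    unfolding yc[symmetric] using x Dz by (simp add: T.minus_minus_cancel)
  ultimately show thesis using c by (intro that[OF z _ \<delta>]) simp_all
qed

text \<open>Some \<open>u\<close> is sent to the element of \<open>column_form\<close>, but
  \<open>u\<close> need not be a cocycle. Its coboundary lies in the kernel of
  \<open>\<epsilon>\<close>, so it equals the coboundary of an element \<open>y\<close> of this
  kernel, and u - y is a cocycle with the same image.\<close>

lemma augmentation_surj:
  assumes x: "x \<in> carrier (Tot (int n))" and Dx: "TD (int n) x = \<zero>\<^bsub>Tot (int n + 1)\<^esub>"
  shows "\<exists>u\<in>cocyc n. \<exists>y\<in>carrier (Tot (int n - 1)). x = \<iota> n u \<oplus>\<^bsub>Tot (int n)\<^esub> TD (int n - 1) y"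
proof -
  have "TD (int n) x (Suc k) = \<zero>\<^bsub>C (Suc k) (int n - int k)\<^esub>" for k
    unfolding Dx Tot_simps by simp
  from column_form[OF x this] obtain z c where z: "z \<in> carrier (Tot (int n - 1))"
    and c: "c \<in> carrier (C 0 (int n))" "\<delta> 0 (int n) c = \<zero>\<^bsub>C (Suc 0) (int n)\<^esub>"
    and xc: "x = inj_C (int n) 0 c \<oplus>\<^bsub>Tot (int n)\<^esub> TD (int n - 1) z" and dc: "d 0 (int n) c = TD (int n) x 0"
    by blast
  from exact_0[OF c] obtain u where u: "u \<in> carrier (A n)" "\<epsilon> n u = c" by blast
  interpret A: module R "A n" by (rule module_A)
  interpret A1: module R "A (Suc n)" by (rule module_A)
  interpret C0: module R "C 0 (int n)" by (rule module_C)
  note du = mod_hom_closed[OF hom_dA u(1)]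
  have "\<epsilon> (Suc n) (dA n u) = \<zero>\<^bsub>C 0 (int (Suc n))\<^esub>"
    unfolding \<epsilon>_d[OF u(1)] u(2) dc Dx by (simp add: Tot_simps add.commute)
  from kernel_Suc[OF du dA_dA[OF u(1)] this] obtain y where
    y: "y \<in> carrier (A n)" "\<epsilon> n y = \<zero>\<^bsub>C 0 (int n)\<^esub>" "dA n u = dA n y" by blast
  have "dA n (u \<ominus>\<^bsub>A n\<^esub> y) = \<zero>\<^bsub>A (Suc n)\<^esub>"
    using mod_hom_diff[OF module_A module_A hom_dA u(1) y(1)] du y(3) by (simp add: A1.minus_eq_zero_iff)
  then have "u \<ominus>\<^bsub>A n\<^esub> y \<in> cocyc n" using u y by (simp add: cocyc_of_def a_minus_def)
  moreover have "\<epsilon> n (u \<ominus>\<^bsub>A n\<^esub> y) = c"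
    using mod_hom_diff[OF module_A module_C hom_\<epsilon> u(1) y(1)] u y(2) c(1) by (simp add: C0.minus_minus_cancel)
  ultimately show ?thesis using xc z by (auto simp: \<iota>_def)
qed

text \<open>The coboundary of \<open>y\<close> is concentrated in column 0, so
  \<open>column_form\<close> replaces \<open>y\<close> by an element of column 0 that is the image
  of some \<open>v\<close>. Then u - dA v is a cocycle in the kernel of the augmentation, hence a
  coboundary.\<close>

lemma augmentation_inj:
  assumes u: "u \<in> cocyc n" and y: "y \<in> carrier (Tot (int n - 1))" and eq: "\<iota> n u = TD (int n - 1) y"
  shows "u \<in> bd n"
proof -
  note uc = cocyc_closed[OF u]
  have "TD (int n - 1) y (Suc k) = \<zero>\<^bsub>C (Suc k) (int n - 1 - int k)\<^esub>" for k
    unfolding eq[symmetric] \<iota>_def inj_C_def by (simp add: algebra_simps)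
  from column_form[OF y this] obtain c where
    c: "c \<in> carrier (C 0 (int n - 1))" "\<delta> 0 (int n - 1) c = \<zero>\<^bsub>C (Suc 0) (int n - 1)\<^esub>"
    and dc: "d 0 (int n - 1) c = TD (int n - 1) y 0"
    by blast
  have \<epsilon>u: "\<epsilon> n u = d 0 (int n - 1) c"
    unfolding dc eq[symmetric] by (simp add: \<iota>_def inj_C_def)
  show ?thesis
  proof (cases n)
    \<comment> \<open>Column 0 is zero in vertical degree -1, so \<open>c\<close> is zero and
      \<open>u\<close> lies in the kernel of the augmentation.\<close>
    case 0
    then have "c = \<zero>\<^bsub>C 0 (- 1)\<^esub>" using c(1) C_neg[of "- 1" 0] by simp
    then have "\<epsilon> 0 u = \<zero>\<^bsub>C 0 0\<^esub>" using \<epsilon>u 0 d_zero[of 0 "- 1" 0] by simp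
    then have "u = \<zero>\<^bsub>A 0\<^esub>" using u 0 by (intro kernel_0) (simp_all add: cocyc_of_def)
    with 0 show ?thesis by (simp add: bd_of_def)
  next
    case (Suc m)
    then have c': "c \<in> carrier (C 0 (int m))" "\<delta> 0 (int m) c = \<zero>\<^bsub>C (Suc 0) (int m)\<^esub>" using c by simp_all
    from exact_0[OF this] obtain v where v: "v \<in> carrier (A m)" "\<epsilon> m v = c" by blast
    interpret A: module R "A (Suc m)" by (rule module_A)
    interpret Am: module R "A m" by (rule module_A)
    interpret A1: module R "A (Suc (Suc m))" by (rule module_A)
    interpret C0: module R "C 0 (int (Suc m))" by (rule module_C)
    have uc': "u \<in> carrier (A (Suc m))" "dA (Suc m) u = \<zero>\<^bsub>A (Suc (Suc m))\<^esub>"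
      using u Suc by (simp_all add: cocyc_of_def)
    note dv = mod_hom_closed[OF hom_dA v(1)]
    let ?w = "u \<ominus>\<^bsub>A (Suc m)\<^esub> dA m v"
    have w: "?w \<in> carrier (A (Suc m))" using uc' dv by (simp add: a_minus_def)
    have dw: "dA (Suc m) ?w = \<zero>\<^bsub>A (Suc (Suc m))\<^esub>"
      using mod_hom_diff[OF module_A module_A hom_dA uc'(1) dv] uc'(2) dA_dA[OF v(1)]
      by (simp add: A1.minus_eq_zero_iff)
    have "\<epsilon> (Suc m) (dA m v) = \<epsilon> (Suc m) u" using \<epsilon>_d[OF v(1)] v(2) \<epsilon>u Suc by simp
    then have "\<epsilon> (Suc m) ?w = \<zero>\<^bsub>C 0 (int (Suc m))\<^esub>"
      using mod_hom_diff[OF module_A module_C hom_\<epsilon> uc'(1) dv] mod_hom_closed[OF hom_\<epsilon> uc'(1)]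
      by (simp only: C0.minus_eq_zero_iff)
    from kernel_Suc[OF w dw this] obtain y' where y': "y' \<in> carrier (A m)" "?w = dA m y'" by blast
    have "u = ?w \<oplus>\<^bsub>A (Suc m)\<^esub> dA m v" using uc' dv by (simp add: A.minus_minus_cancel)
    also have "\<dots> = dA m (y' \<oplus>\<^bsub>A m\<^esub> v)" unfolding y'(2) by (rule mod_hom_add[OF hom_dA y'(1) v(1), symmetric])
    finally show ?thesis using y'(1) v(1) unfolding bd_of_def Suc nat.case by (intro image_eqI[of u _ "y' \<oplus>\<^bsub>A m\<^esub> v"]) simp_all
  qed
qed

text \<open>The inverse of the map that \<open>\<iota>\<close> induces on cohomology, taken on total
  cocycles because \<open>converges_pages\<close> asks for a surjection in this direction. By
  \<open>augmentation_inj\<close> the chosen \<open>u\<close> is unique modulo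
  \<open>bd n\<close>.\<close>

definition kappa :: "nat \<Rightarrow> (nat \<Rightarrow> 'm) \<Rightarrow> 'a set" where
  "kappa n x = bd n +>\<^bsub>A n\<^esub> (SOME u. u \<in> cocyc n \<and>
    (\<exists>y\<in>carrier (Tot (int n - 1)). x = \<iota> n u \<oplus>\<^bsub>Tot (int n)\<^esub> TD (int n - 1) y))"

lemma kappa_eq:
  assumes u: "u \<in> cocyc n" and y: "y \<in> carrier (Tot (int n - 1))"
    and x: "x = \<iota> n u \<oplus>\<^bsub>Tot (int n)\<^esub> TD (int n - 1) y"
  shows "kappa n x = bd n +>\<^bsub>A n\<^esub> u"
proof -
  let ?Q = "\<lambda>u. u \<in> cocyc n \<and> (\<exists>y\<in>carrier (Tot (int n - 1)). x = \<iota> n u \<oplus>\<^bsub>Tot (int n)\<^esub> TD (int n - 1) y)"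
  define v where "v = (SOME u. ?Q u)"
  have "?Q v" unfolding v_def by (rule someI[of ?Q u]) (use assms in blast)
  then obtain z where v: "v \<in> cocyc n" and z: "z \<in> carrier (Tot (int n - 1))"
    and xv: "x = \<iota> n v \<oplus>\<^bsub>Tot (int n)\<^esub> TD (int n - 1) z" by blast
  interpret T: module R "Tot (int n)" by (rule module_Tot)
  interpret T0: module R "Tot (int n - 1)" by (rule module_Tot)
  note uc = cocyc_closed[OF u] and vc = cocyc_closed[OF v]
  note Du = mod_hom_closed[OF hom_TD_pred y] and Dv = mod_hom_closed[OF hom_TD_pred z]
  note iu = \<iota>_closed[OF uc] and iv = \<iota>_closed[OF vc]
  have "\<iota> n (v \<ominus>\<^bsub>A n\<^esub> u) = \<iota> n v \<ominus>\<^bsub>Tot (int n)\<^esub> \<iota> n u"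
    by (rule mod_hom_diff[OF module_A module_Tot hom_\<iota> vc uc])
  also have "\<dots> = TD (int n - 1) y \<ominus>\<^bsub>Tot (int n)\<^esub> TD (int n - 1) z"
  proof -
    have "\<iota> n v = \<iota> n u \<oplus>\<^bsub>Tot (int n)\<^esub> TD (int n - 1) y \<ominus>\<^bsub>Tot (int n)\<^esub> TD (int n - 1) z"
      using xv x iv Dv by (simp add: T.minus_minus_cancel)
    also have "\<dots> = \<iota> n u \<oplus>\<^bsub>Tot (int n)\<^esub> (TD (int n - 1) y \<ominus>\<^bsub>Tot (int n)\<^esub> TD (int n - 1) z)"
      using iu Du Dv by (simp add: a_minus_def T.a_assoc)
    finally show ?thesis
      using iu Du Dv by (simp add: T.a_comm[of "\<iota> n u"] T.minus_minus_cancel)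
  qed
  also have "\<dots> = TD (int n - 1) (y \<ominus>\<^bsub>Tot (int n - 1)\<^esub> z)"
    by (rule mod_hom_diff[OF module_Tot module_Tot hom_TD_pred y z, symmetric])
  finally have "v \<ominus>\<^bsub>A n\<^esub> u \<in> bd n"
    using submodule_diff[OF sub_cocyc v u] y z by (intro augmentation_inj) (simp_all add: a_minus_def)
  then show ?thesis
    unfolding kappa_def v_def[symmetric] using coset_eq_iff[OF module_A sub_bd vc uc] by simp
qed

abbreviation "Cyc n \<equiv> {x \<in> TF (int n) 0. TD (int n) x \<in> {\<zero>\<^bsub>Tot (int n + 1)\<^esub>}}"

lemma CycE:
  assumes "x \<in> Cyc n"
  obtains u y where "u \<in> cocyc n" "y \<in> carrier (Tot (int n - 1))" "x = \<iota> n u \<oplus>\<^bsub>Tot (int n)\<^esub> TD (int n - 1) y"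
  using augmentation_surj[of x n] assms TF_closed by blast

lemma CycI:
  assumes u: "u \<in> cocyc n" and y: "y \<in> carrier (Tot (int n - 1))"
  shows "\<iota> n u \<oplus>\<^bsub>Tot (int n)\<^esub> TD (int n - 1) y \<in> Cyc n"
proof -
  interpret T: module R "Tot (int n)" by (rule module_Tot)
  interpret T1: module R "Tot (int n + 1)" by (rule module_Tot)
  note iu = \<iota>_closed[OF cocyc_closed[OF u]] and Dy = mod_hom_closed[OF hom_TD_pred y]
  have "TD (int n) (\<iota> n u) = \<iota> (Suc n) \<zero>\<^bsub>A (Suc n)\<^esub>"
    using TD_\<iota>[OF cocyc_closed[OF u]] u by (simp add: cocyc_of_def)
  also have "\<dots> = \<zero>\<^bsub>Tot (int n + 1)\<^esub>"
    using mod_hom_zero[OF module_A module_Tot hom_\<iota>, of "Suc n"] by (simp add: add.commute)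
  finally have "TD (int n) (\<iota> n u \<oplus>\<^bsub>Tot (int n)\<^esub> TD (int n - 1) y) = \<zero>\<^bsub>Tot (int n + 1)\<^esub>"
    unfolding mod_hom_add[OF hom_TD iu Dy] using tot.D_D'[of "int n" "int n - 1" "int n + 1" y] y by simp
  with iu Dy show ?thesis by (simp add: tot.F_top)
qed

lemma mod_hom_restrictI:
  assumes "\<And>x. x \<in> Z \<Longrightarrow> h x \<in> carrier N"
    and "\<And>x y. x \<in> Z \<Longrightarrow> y \<in> Z \<Longrightarrow> h (x \<oplus>\<^bsub>M\<^esub> y) = h x \<oplus>\<^bsub>N\<^esub> h y"
    and "\<And>a x. a \<in> carrier R \<Longrightarrow> x \<in> Z \<Longrightarrow> h (a \<odot>\<^bsub>M\<^esub> x) = a \<odot>\<^bsub>N\<^esub> h x"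
  shows "mod_hom R (M\<lparr>carrier := Z\<rparr>) N h"
  using assms by (intro mod_homI) simp_all

lemma hom_kappa:
  "mod_hom R ((Tot (int n))\<lparr>carrier := Cyc n\<rparr>) (quot_mod ((A n)\<lparr>carrier := cocyc n\<rparr>) (bd n)) (kappa n)"
proof -
  interpret T: module R "Tot (int n)" by (rule module_Tot)
  interpret T0: module R "Tot (int n - 1)" by (rule module_Tot)
  note q = mod_hom_coset_restrict[OF module_A sub_cocyc sub_bd bd_cocyc, of n]
  show ?thesis
  proof (rule mod_hom_restrictI)
    fix x assume "x \<in> Cyc n"
    then obtain u y where u: "u \<in> cocyc n" and y: "y \<in> carrier (Tot (int n - 1))"
      and x: "x = \<iota> n u \<oplus>\<^bsub>Tot (int n)\<^esub> TD (int n - 1) y" by (rule CycE)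
    note k = kappa_eq[OF u y x]
    note iu = \<iota>_closed[OF cocyc_closed[OF u]] and Dy = mod_hom_closed[OF hom_TD_pred y]
    show "kappa n x \<in> carrier (quot_mod ((A n)\<lparr>carrier := cocyc n\<rparr>) (bd n))"
      unfolding k quot_mod_restrict_carrier using u by blast
    {
      fix x' assume "x' \<in> Cyc n"
      then obtain u' y' where u': "u' \<in> cocyc n" and y': "y' \<in> carrier (Tot (int n - 1))"
        and x': "x' = \<iota> n u' \<oplus>\<^bsub>Tot (int n)\<^esub> TD (int n - 1) y'" by (rule CycE)
      note iu' = \<iota>_closed[OF cocyc_closed[OF u']] and Dy' = mod_hom_closed[OF hom_TD_pred y']
      have "x \<oplus>\<^bsub>Tot (int n)\<^esub> x' = \<iota> n (u \<oplus>\<^bsub>A n\<^esub> u') \<oplus>\<^bsub>Tot (int n)\<^esub> TD (int n - 1) (y \<oplus>\<^bsub>Tot (int n - 1)\<^esub> y')"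
        unfolding x x' mod_hom_add[OF hom_TD_pred y y'] mod_hom_add[OF hom_\<iota> cocyc_closed[OF u] cocyc_closed[OF u']]
        using iu iu' Dy Dy' by (simp add: T.a_ac)
      from kappa_eq[OF submodule_add[OF sub_cocyc u u'] _ this] y y'
      have "kappa n (x \<oplus>\<^bsub>Tot (int n)\<^esub> x') = bd n +>\<^bsub>A n\<^esub> (u \<oplus>\<^bsub>A n\<^esub> u')" by simp
      also have "\<dots> = (bd n +>\<^bsub>A n\<^esub> u) \<oplus>\<^bsub>quot_mod ((A n)\<lparr>carrier := cocyc n\<rparr>) (bd n)\<^esub> (bd n +>\<^bsub>A n\<^esub> u')"
        using mod_hom_add[OF q, of u u'] u u' by simp
      finally show "kappa n (x \<oplus>\<^bsub>Tot (int n)\<^esub> x') =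
          kappa n x \<oplus>\<^bsub>quot_mod ((A n)\<lparr>carrier := cocyc n\<rparr>) (bd n)\<^esub> kappa n x'"
        unfolding k kappa_eq[OF u' y' x'] .
    }
    fix a assume a: "a \<in> carrier R"
    have "a \<odot>\<^bsub>Tot (int n)\<^esub> x = \<iota> n (a \<odot>\<^bsub>A n\<^esub> u) \<oplus>\<^bsub>Tot (int n)\<^esub> TD (int n - 1) (a \<odot>\<^bsub>Tot (int n - 1)\<^esub> y)"
      unfolding x mod_hom_smult[OF hom_TD_pred a y] mod_hom_smult[OF hom_\<iota> a cocyc_closed[OF u]]
      using iu Dy a by (simp add: T.smult_r_distr)
    from kappa_eq[OF submodule_smult[OF sub_cocyc a u] _ this] y a
    have "kappa n (a \<odot>\<^bsub>Tot (int n)\<^esub> x) = bd n +>\<^bsub>A n\<^esub> (a \<odot>\<^bsub>A n\<^esub> u)" by simp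
    also have "\<dots> = a \<odot>\<^bsub>quot_mod ((A n)\<lparr>carrier := cocyc n\<rparr>) (bd n)\<^esub> (bd n +>\<^bsub>A n\<^esub> u)"
      using mod_hom_smult[OF q a, of u] u by simp
    finally show "kappa n (a \<odot>\<^bsub>Tot (int n)\<^esub> x) =
        a \<odot>\<^bsub>quot_mod ((A n)\<lparr>carrier := cocyc n\<rparr>) (bd n)\<^esub> kappa n x"
      unfolding k .
  qed
qed

lemma kappa_surj: "kappa n ` Cyc n = carrier (quot_mod ((A n)\<lparr>carrier := cocyc n\<rparr>) (bd n))"
proof
  show "kappa n ` Cyc n \<subseteq> carrier (quot_mod ((A n)\<lparr>carrier := cocyc n\<rparr>) (bd n))"
    using mod_hom_closed[OF hom_kappa] by auto
  interpret T0: module R "Tot (int n - 1)" by (rule module_Tot)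
  show "carrier (quot_mod ((A n)\<lparr>carrier := cocyc n\<rparr>) (bd n)) \<subseteq> kappa n ` Cyc n"
  proof
    fix e assume "e \<in> carrier (quot_mod ((A n)\<lparr>carrier := cocyc n\<rparr>) (bd n))"
    then obtain u where u: "u \<in> cocyc n" "e = bd n +>\<^bsub>A n\<^esub> u" by (auto simp: quot_mod_restrict_carrier)
    with kappa_eq[OF u(1) T0.zero_closed refl] CycI[OF u(1) T0.zero_closed] show "e \<in> kappa n ` Cyc n"
      by (intro image_eqI) simp_all
  qed
qed

text \<open>The coboundary part of \<open>x\<close> has no influence, and \<open>\<iota> n u\<close>
  is a total coboundary exactly if \<open>u\<close> is a coboundary: one direction is
  \<open>TD_\<iota>\<close>, the other \<open>augmentation_inj\<close>.\<close>

lemma kappa_zero_iff: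
  assumes "x \<in> Cyc n"
  shows "kappa n x = \<zero>\<^bsub>quot_mod ((A n)\<lparr>carrier := cocyc n\<rparr>) (bd n)\<^esub> \<longleftrightarrow>
    x \<in> TD (int n - 1) ` carrier (Tot (int n - 1))"
proof -
  interpret T: module R "Tot (int n)" by (rule module_Tot)
  interpret T0: module R "Tot (int n - 1)" by (rule module_Tot)
  from assms obtain u y where u: "u \<in> cocyc n" and y: "y \<in> carrier (Tot (int n - 1))"
    and x: "x = \<iota> n u \<oplus>\<^bsub>Tot (int n)\<^esub> TD (int n - 1) y" by (rule CycE)
  note uc = cocyc_closed[OF u] and Dy = mod_hom_closed[OF hom_TD_pred y]
  have "kappa n x = \<zero>\<^bsub>quot_mod ((A n)\<lparr>carrier := cocyc n\<rparr>) (bd n)\<^esub> \<longleftrightarrow> u \<in> bd n"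
    unfolding kappa_eq[OF u y x] quot_mod_simps by (rule coset_eq_zero_iff[OF module_A sub_bd uc])
  also have "\<dots> \<longleftrightarrow> x \<in> TD (int n - 1) ` carrier (Tot (int n - 1))"
  proof
    assume "u \<in> bd n"
    have "\<exists>z\<in>carrier (Tot (int n - 1)). \<iota> n u = TD (int n - 1) z"
    proof (cases n)
      case 0
      then have "u = \<zero>\<^bsub>A n\<^esub>" using \<open>u \<in> bd n\<close> by (simp add: bd_of_def)
      then have "\<iota> n u = TD (int n - 1) \<zero>\<^bsub>Tot (int n - 1)\<^esub>"
        using mod_hom_zero[OF module_A module_Tot hom_\<iota>] mod_hom_zero[OF module_Tot module_Tot hom_TD_pred] by simp
      then show ?thesis by blast
    next
      case (Suc m)
      then obtain v where v: "v \<in> carrier (A m)" "u = dA m v" using \<open>u \<in> bd n\<close> by (auto simp: bd_of_def)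
      have "int n - 1 = int m" using Suc by simp
      then have "\<iota> n u = TD (int n - 1) (\<iota> m v)" "\<iota> m v \<in> carrier (Tot (int n - 1))"
        using TD_\<iota>[OF v(1)] \<iota>_closed[OF v(1)] unfolding v(2) Suc by simp_all
      then show ?thesis by blast
    qed
    then obtain z where z: "z \<in> carrier (Tot (int n - 1))" "\<iota> n u = TD (int n - 1) z" by blast
    then have "x = TD (int n - 1) (z \<oplus>\<^bsub>Tot (int n - 1)\<^esub> y)" unfolding x using y by (simp add: mod_hom_add[OF hom_TD_pred])
    with z(1) y show "x \<in> TD (int n - 1) ` carrier (Tot (int n - 1))" by simp
  next
    assume "x \<in> TD (int n - 1) ` carrier (Tot (int n - 1))"
    then obtain z where z: "z \<in> carrier (Tot (int n - 1))" "x = TD (int n - 1) z" by blast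
    have "\<iota> n u = x \<ominus>\<^bsub>Tot (int n)\<^esub> TD (int n - 1) y"
      unfolding x using \<iota>_closed[OF uc] Dy by (simp add: T.minus_minus_cancel)
    also have "\<dots> = TD (int n - 1) (z \<ominus>\<^bsub>Tot (int n - 1)\<^esub> y)"
      unfolding z(2) by (rule mod_hom_diff[OF module_Tot module_Tot hom_TD_pred z(1) y, symmetric])
    finally show "u \<in> bd n" using u y z(1) by (intro augmentation_inj) (simp_all add: a_minus_def)
  qed
  finally show ?thesis .
qed

end

section \<open>Augmented double complexes varying with the filtration degree\<close>

locale persistent_double_complex =
  fixes R :: "('r, 'z) ring_scheme" and C :: "int \<Rightarrow> nat \<Rightarrow> int \<Rightarrow> ('r, 'm) module"
    and \<delta> :: "int \<Rightarrow> nat \<Rightarrow> int \<Rightarrow> 'm \<Rightarrow> 'm" and d :: "int \<Rightarrow> nat \<Rightarrow> int \<Rightarrow> 'm \<Rightarrow> 'm"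
    and A :: "int \<Rightarrow> nat \<Rightarrow> ('r, 'a) module" and dA :: "int \<Rightarrow> nat \<Rightarrow> 'a \<Rightarrow> 'a"
    and \<epsilon> :: "int \<Rightarrow> nat \<Rightarrow> 'a \<Rightarrow> 'm"
    and \<phi> :: "int \<Rightarrow> nat \<Rightarrow> int \<Rightarrow> 'm \<Rightarrow> 'm" and \<psi> :: "int \<Rightarrow> nat \<Rightarrow> 'a \<Rightarrow> 'a"
  assumes adc: "\<And>i. augmented_double_complex R (C i) (\<delta> i) (d i) (A i) (dA i) (\<epsilon> i)"
    and hom_\<phi>: "\<And>i p q. mod_hom R (C i p q) (C (i + 1) p q) (\<phi> i p q)"
    and hom_\<psi>: "\<And>i n. mod_hom R (A i n) (A (i + 1) n) (\<psi> i n)"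
    and \<phi>_\<delta>: "\<And>i p q x. x \<in> carrier (C i p q) \<Longrightarrow> \<phi> i (Suc p) q (\<delta> i p q x) = \<delta> (i + 1) p q (\<phi> i p q x)"
    and \<phi>_d: "\<And>i p q x. x \<in> carrier (C i p q) \<Longrightarrow> \<phi> i p (q + 1) (d i p q x) = d (i + 1) p q (\<phi> i p q x)"
    and \<psi>_dA: "\<And>i n u. u \<in> carrier (A i n) \<Longrightarrow> \<psi> i (Suc n) (dA i n u) = dA (i + 1) n (\<psi> i n u)"
    and \<phi>_\<epsilon>: "\<And>i n u. u \<in> carrier (A i n) \<Longrightarrow> \<phi> i 0 (int n) (\<epsilon> i n u) = \<epsilon> (i + 1) n (\<psi> i n u)"
begin

sublocale adc: augmented_double_complex R "C i" "\<delta> i" "d i" "A i" "dA i" "\<epsilon> i" for i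
  by (rule adc)

definition tot_\<phi> :: "int \<Rightarrow> int \<Rightarrow> (nat \<Rightarrow> 'm) \<Rightarrow> nat \<Rightarrow> 'm" where
  "tot_\<phi> i n w p = \<phi> i p (n - int p) (w p)"

lemma \<phi>_zero: "\<phi> i p q \<zero>\<^bsub>C i p q\<^esub> = \<zero>\<^bsub>C (i + 1) p q\<^esub>"
  by (rule mod_hom_zero[OF adc.module_C adc.module_C hom_\<phi>])

lemma hom_tot_\<phi>: "mod_hom R (tot_mod (C i) n) (tot_mod (C (i + 1)) n) (tot_\<phi> i n)"
proof (rule mod_homI)
  show "tot_\<phi> i n w \<in> carrier (tot_mod (C (i + 1)) n)" if "w \<in> carrier (tot_mod (C i) n)" for w
    using that mod_hom_closed[OF hom_\<phi>] by (simp add: adc.Tot_carrier tot_\<phi>_def)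
  show "tot_\<phi> i n (v \<oplus>\<^bsub>tot_mod (C i) n\<^esub> w) = tot_\<phi> i n v \<oplus>\<^bsub>tot_mod (C (i + 1)) n\<^esub> tot_\<phi> i n w"
    if "v \<in> carrier (tot_mod (C i) n)" "w \<in> carrier (tot_mod (C i) n)" for v w
    using that mod_hom_add[OF hom_\<phi>] by (intro ext) (simp add: adc.Tot_carrier adc.Tot_simps tot_\<phi>_def)
  show "tot_\<phi> i n (a \<odot>\<^bsub>tot_mod (C i) n\<^esub> w) = a \<odot>\<^bsub>tot_mod (C (i + 1)) n\<^esub> tot_\<phi> i n w"
    if "a \<in> carrier R" "w \<in> carrier (tot_mod (C i) n)" for a w
    using that mod_hom_smult[OF hom_\<phi>] by (intro ext) (simp add: adc.Tot_carrier adc.Tot_simps tot_\<phi>_def)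
qed

lemma tot_\<phi>_TD:
  assumes w: "w \<in> carrier (tot_mod (C i) n)"
  shows "tot_\<phi> i (n + 1) (tot_D (C i) (\<delta> i) (d i) n w) = tot_D (C (i + 1)) (\<delta> (i + 1)) (d (i + 1)) n (tot_\<phi> i n w)"
proof
  fix p
  have \<phi>w: "tot_\<phi> i n w \<in> carrier (tot_mod (C (i + 1)) n)" using w by (rule mod_hom_closed[OF hom_tot_\<phi>])
  show "tot_\<phi> i (n + 1) (tot_D (C i) (\<delta> i) (d i) n w) p =
    tot_D (C (i + 1)) (\<delta> (i + 1)) (d (i + 1)) n (tot_\<phi> i n w) p"
  proof (cases p)
    case 0
    have w0: "w 0 \<in> carrier (C i 0 n)" using w[unfolded adc.Tot_carrier, rule_format, of 0] by simp
    show ?thesis unfolding 0 tot_\<phi>_def[of i "n + 1"]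
      using adc.TD_0[OF w] adc.TD_0[OF \<phi>w] \<phi>_d[OF w0] by (simp add: tot_\<phi>_def)
  next
    case (Suc k)
    let ?q = "n - int k"
    have q: "n + 1 - int (Suc k) = ?q" "n - int (Suc k) = ?q - 1" by simp_all
    have wk: "w k \<in> carrier (C i k ?q)" using w unfolding adc.Tot_carrier by blast
    note wS = adc.Tot_Suc_closed[OF w, of k]
    note dS = adc.d_Suc_closed[OF w, of k] and \<delta>k = adc.\<delta>_closed[OF w, of k]
    interpret L: module R "C i (Suc k) ?q" by (rule adc.module_C)
    let ?d = "d i (Suc k) (?q - 1) (w (Suc k))"
    have "\<phi> i (Suc k) ?q (tot_D (C i) (\<delta> i) (d i) n w (Suc k)) =
        \<phi> i (Suc k) ?q (\<delta> i k ?q (w k)) \<oplus>\<^bsub>C (i + 1) (Suc k) ?q\<^esub>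
        sg (C (i + 1) (Suc k) ?q) (Suc k) (\<phi> i (Suc k) ?q ?d)"
      unfolding adc.TD_Suc mod_hom_add[OF hom_\<phi> \<delta>k L.sg_closed[OF dS]]
        sg_hom[OF adc.module_C adc.module_C hom_\<phi> dS] ..
    also have "\<phi> i (Suc k) ?q ?d = d (i + 1) (Suc k) (?q - 1) (\<phi> i (Suc k) (?q - 1) (w (Suc k)))"
      using \<phi>_d[OF wS] by simp
    also have "\<phi> i (Suc k) ?q (\<delta> i k ?q (w k)) = \<delta> (i + 1) k ?q (\<phi> i k ?q (w k))" by (rule \<phi>_\<delta>[OF wk])
    finally show ?thesis
      unfolding Suc tot_\<phi>_def[of i "n + 1"] q adc.TD_Suc unfolding tot_\<phi>_def q .
  qed
qed

sublocale fp: filtered_persistence R "\<lambda>i. tot_mod (C i)" "\<lambda>i. tot_D (C i) (\<delta> i) (d i)" "\<lambda>i. tot_F (C i)" tot_\<phi>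
proof (rule filtered_persistence.intro)
  show "tot_\<phi> i n x \<in> tot_F (C (i + 1)) n p" if "x \<in> tot_F (C i) n p" for i n p x
    using that mod_hom_closed[OF hom_tot_\<phi>, of x i n] \<phi>_zero by (simp add: tot_F_def tot_\<phi>_def)
qed (fact adc.ring adc.tot.filtered_complex_axioms hom_tot_\<phi> tot_\<phi>_TD)+

lemma subquotient_A:
  "subquotient R (\<lambda>i. A i n) (\<lambda>i. \<psi> i n) (\<lambda>i. cocyc_of (A i) (dA i) n) (\<lambda>i. bd_of (A i) (dA i) n)"
proof (intro subquotient.intro subpersistence.intro persistence.intro subpersistence_axioms.intro
      subquotient_axioms.intro adc.ring adc.module_A hom_\<psi> adc.sub_cocyc adc.sub_bd adc.bd_cocyc)
  fix i
  show "\<psi> i n ` cocyc_of (A i) (dA i) n \<subseteq> cocyc_of (A (i + 1)) (dA (i + 1)) n"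
    using mod_hom_closed[OF hom_\<psi>] \<psi>_dA[symmetric] mod_hom_zero[OF adc.module_A adc.module_A hom_\<psi>]
    by (auto simp: cocyc_of_def)
  show "\<psi> i n ` bd_of (A i) (dA i) n \<subseteq> bd_of (A (i + 1)) (dA (i + 1)) n"
  proof (cases n)
    case 0
    then show ?thesis using mod_hom_zero[OF adc.module_A adc.module_A hom_\<psi>] by (simp add: bd_of_def)
  next
    case (Suc k)
    then show ?thesis using \<psi>_dA mod_hom_closed[OF hom_\<psi>] by (auto simp: bd_of_def)
  qed
qed

lemma tot_\<phi>_\<iota>:
  assumes "u \<in> carrier (A i n)"
  shows "tot_\<phi> i (int n) (adc.\<iota> i n u) = adc.\<iota> (i + 1) n (\<psi> i n u)"
  by (intro ext) (simp add: tot_\<phi>_def adc.\<iota>_def adc.inj_C_def \<phi>_zero \<phi>_\<epsilon>[OF assms])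

text \<open>A decomposition of \<open>x\<close> into an augmented cocycle and a coboundary is
  carried to such a decomposition in degree i + 1, and \<open>kappa\<close> may be computed from any
  decomposition.\<close>

lemma kappa_natural:
  assumes x: "x \<in> adc.Cyc i n"
  shows "adc.kappa (i + 1) n (tot_\<phi> i (int n) x) =
    coset_map (A (i + 1) n) (bd_of (A (i + 1)) (dA (i + 1)) n) (\<psi> i n) (adc.kappa i n x)"
proof -
  interpret S: subquotient R "\<lambda>i. A i n" "\<lambda>i. \<psi> i n" "\<lambda>i. cocyc_of (A i) (dA i) n" "\<lambda>i. bd_of (A i) (dA i) n"
    by (rule subquotient_A)
  from x obtain u y where u: "u \<in> cocyc_of (A i) (dA i) n" and y: "y \<in> carrier (tot_mod (C i) (int n - 1))"
    and xuy: "x = adc.\<iota> i n u \<oplus>\<^bsub>tot_mod (C i) (int n)\<^esub> tot_D (C i) (\<delta> i) (d i) (int n - 1) y"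
    by (rule adc.CycE)
  note uc = adc.cocyc_closed[OF u]
  have "tot_\<phi> i (int n) x = adc.\<iota> (i + 1) n (\<psi> i n u) \<oplus>\<^bsub>tot_mod (C (i + 1)) (int n)\<^esub>
      tot_D (C (i + 1)) (\<delta> (i + 1)) (d (i + 1)) (int n - 1) (tot_\<phi> i (int n - 1) y)"
    unfolding xuy mod_hom_add[OF hom_tot_\<phi> adc.\<iota>_closed[OF uc] mod_hom_closed[OF adc.hom_TD_pred y]] tot_\<phi>_\<iota>[OF uc]
    using tot_\<phi>_TD[OF y] by simp
  moreover have "\<psi> i n u \<in> cocyc_of (A (i + 1)) (dA (i + 1)) n" using u S.hom_Z by blast
  ultimately have "adc.kappa (i + 1) n (tot_\<phi> i (int n) x) = bd_of (A (i + 1)) (dA (i + 1)) n +>\<^bsub>A (i + 1) n\<^esub> \<psi> i n u"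
    using mod_hom_closed[OF hom_tot_\<phi> y] by (intro adc.kappa_eq)
  also have "\<dots> = coset_map (A (i + 1) n) (bd_of (A (i + 1)) (dA (i + 1)) n) (\<psi> i n) (bd_of (A i) (dA i) n +>\<^bsub>A i n\<^esub> u)"
    by (rule coset_map_coset_restrict[OF S.module_at S.sub_Z S.sub_B S.B_le_Z S.module_at S.sub_Z S.sub_B S.B_le_Z
          S.hom_at S.hom_Z S.hom_B u, symmetric])
  also have "bd_of (A i) (dA i) n +>\<^bsub>A i n\<^esub> u = adc.kappa i n x"
    by (rule adc.kappa_eq[OF u y xuy, symmetric])
  finally show ?thesis .
qed

theorem converges_total:
  "converges_to R (\<lambda>r p q. fp.page (int r) (p + q) p)
    (\<lambda>n. quot_pers R (\<lambda>i. A i n) (\<lambda>i. \<psi> i n) (\<lambda>i. cocyc_of (A i) (dA i) n) (\<lambda>i. bd_of (A i) (dA i) n))"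
  unfolding quot_pers_def
proof (rule fp.converges_pages[where \<kappa> = "\<lambda>i n. adc.kappa i n"])
  have cyc: "fp.cyc i (int n) 0 = adc.Cyc i n" for i n by (simp add: fp.cyc_def)
  fix n i
  show "persistence R (\<lambda>i. quot_mod (A i n\<lparr>carrier := cocyc_of (A i) (dA i) n\<rparr>) (bd_of (A i) (dA i) n))
      (\<lambda>i. coset_map (A (i + 1) n) (bd_of (A (i + 1)) (dA (i + 1)) n) (\<psi> i n))"
    by (rule subquotient.persistence_quot[OF subquotient_A])
  show "mod_hom R (tot_mod (C i) (int n)\<lparr>carrier := fp.cyc i (int n) 0\<rparr>)
      (quot_mod (A i n\<lparr>carrier := cocyc_of (A i) (dA i) n\<rparr>) (bd_of (A i) (dA i) n)) (adc.kappa i n)"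
    unfolding cyc by (rule adc.hom_kappa)
  show "adc.kappa i n ` fp.cyc i (int n) 0 =
      carrier (quot_mod (A i n\<lparr>carrier := cocyc_of (A i) (dA i) n\<rparr>) (bd_of (A i) (dA i) n))"
    unfolding cyc by (rule adc.kappa_surj)
  fix x assume x: "x \<in> fp.cyc i (int n) 0"
  show "adc.kappa i n x = \<zero>\<^bsub>quot_mod (A i n\<lparr>carrier := cocyc_of (A i) (dA i) n\<rparr>) (bd_of (A i) (dA i) n)\<^esub> \<longleftrightarrow>
      x \<in> tot_D (C i) (\<delta> i) (d i) (int n - 1) ` carrier (tot_mod (C i) (int n - 1))"
    using x unfolding cyc by (rule adc.kappa_zero_iff)
  show "adc.kappa (i + 1) n (tot_\<phi> i (int n) x) =
      coset_map (A (i + 1) n) (bd_of (A (i + 1)) (dA (i + 1)) n) (\<psi> i n) (adc.kappa i n x)"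
    using x unfolding cyc by (rule kappa_natural)
qed

end

section \<open>Singular cochains\<close>

text \<open>The ring as a module over itself, so that evaluating cochains at a chain is a module
  homomorphism.\<close>

definition self_mod :: "('r, 'z) ring_scheme \<Rightarrow> ('r, 'r) module" where
  "self_mod R = \<lparr>carrier = carrier R, mult = undefined, one = undefined, zero = \<zero>\<^bsub>R\<^esub>,
    add = (\<lambda>x y. x \<oplus>\<^bsub>R\<^esub> y), smult = (\<lambda>x y. x \<otimes>\<^bsub>R\<^esub> y)\<rparr>"

lemma self_mod_simps [simp]:
  "carrier (self_mod R) = carrier R" "\<zero>\<^bsub>self_mod R\<^esub> = \<zero>\<^bsub>R\<^esub>"
  "x \<oplus>\<^bsub>self_mod R\<^esub> y = x \<oplus>\<^bsub>R\<^esub> y" "x \<odot>\<^bsub>self_mod R\<^esub> y = x \<otimes>\<^bsub>R\<^esub> y"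
  by (simp_all add: self_mod_def)

lemma module_self_mod:
  assumes "cring R" shows "module R (self_mod R)"
proof -
  interpret cring R by fact
  show ?thesis
    by (intro moduleI abelian_groupI) (auto simp: a_ac l_distr r_distr m_assoc is_cring intro: add.l_inv_ex)
qed

lemma a_inv_self_mod: "cring R \<Longrightarrow> x \<in> carrier R \<Longrightarrow> \<ominus>\<^bsub>self_mod R\<^esub> x = \<ominus>\<^bsub>R\<^esub> x"
proof -
  assume R: "cring R" and x: "x \<in> carrier R"
  interpret cring R by fact
  interpret S: module R "self_mod R" using R by (rule module_self_mod)
  show ?thesis using x by (intro S.minus_equality) (simp_all add: l_neg)
qed

lemma carrier_cochain_mod:
  "u \<in> carrier (cochain_mod R q T) \<longleftrightarrow> u \<in> extensional (singular_chain_set q T) \<and>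
    (\<forall>c. singular_chain q T c \<longrightarrow> u c \<in> carrier R) \<and>
    (\<forall>c c'. singular_chain q T c \<longrightarrow> singular_chain q T c' \<longrightarrow> u (c + c') = u c \<oplus>\<^bsub>R\<^esub> u c')"
  by (auto simp: cochain_mod_def hom_def)

lemma cochain_closed: "u \<in> carrier (cochain_mod R q T) \<Longrightarrow> singular_chain q T c \<Longrightarrow> u c \<in> carrier R"
  and cochain_add: "u \<in> carrier (cochain_mod R q T) \<Longrightarrow> singular_chain q T c \<Longrightarrow> singular_chain q T c' \<Longrightarrow>
    u (c + c') = u c \<oplus>\<^bsub>R\<^esub> u c'"
  by (simp_all add: carrier_cochain_mod)

lemma cochain_mod_ops:
  "singular_chain q T c \<Longrightarrow> \<zero>\<^bsub>cochain_mod R q T\<^esub> c = \<zero>\<^bsub>R\<^esub>"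
  "singular_chain q T c \<Longrightarrow> (u \<oplus>\<^bsub>cochain_mod R q T\<^esub> v) c = u c \<oplus>\<^bsub>R\<^esub> v c"
  "singular_chain q T c \<Longrightarrow> (a \<odot>\<^bsub>cochain_mod R q T\<^esub> u) c = a \<otimes>\<^bsub>R\<^esub> u c"
  by (simp_all add: cochain_mod_def)

lemma cochain_mod_ext:
  "\<zero>\<^bsub>cochain_mod R q T\<^esub> \<in> extensional (singular_chain_set q T)"
  "u \<oplus>\<^bsub>cochain_mod R q T\<^esub> v \<in> extensional (singular_chain_set q T)"
  "a \<odot>\<^bsub>cochain_mod R q T\<^esub> u \<in> extensional (singular_chain_set q T)"
  by (simp_all add: cochain_mod_def)

context cring
begin

lemma cochain_zero: "u \<in> carrier (cochain_mod R q T) \<Longrightarrow> u 0 = \<zero>"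
  using cochain_add[of u R q T 0 0] cochain_closed[of u R q T 0] by simp

lemma cochain_uminus:
  assumes "u \<in> carrier (cochain_mod R q T)" "singular_chain q T c"
  shows "u (- c) = \<ominus> u c"
proof -
  have c: "singular_chain q T (- c)" using assms by (simp add: singular_chain_minus)
  have "u (- c) \<oplus> u c = \<zero>"
    using cochain_add[OF assms(1) c assms(2)] cochain_zero[OF assms(1)] by simp
  then show ?thesis
    using cochain_closed[OF assms(1) c] cochain_closed[OF assms] by (simp add: minus_equality)
qed

lemma cochain_diff:
  assumes "u \<in> carrier (cochain_mod R q T)" "singular_chain q T c" "singular_chain q T c'"
  shows "u (c - c') = u c \<ominus> u c'"
  using cochain_add[OF assms(1,2), of "- c'"] assms cochain_uminus[OF assms(1,3)]
  by (simp add: singular_chain_minus a_minus_def)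

text \<open>As a record this is the product of copies of \<open>R\<close> over the singular chains
  with a smaller carrier, so closure under the operations is all that has to be checked.\<close>

lemma module_cochain_mod: "module R (cochain_mod R q T)"
proof -
  interpret P: module R "prod_mod (singular_chain_set q T) (\<lambda>_. self_mod R)"
    by (intro module_prod_mod module_self_mod is_cring)
  let ?H = "carrier (cochain_mod R q T)"
  have eq: "cochain_mod R q T = (prod_mod (singular_chain_set q T) (\<lambda>_. self_mod R))\<lparr>carrier := ?H\<rparr>"
    by (simp add: cochain_mod_def prod_mod_def)
  have sub: "?H \<subseteq> carrier (prod_mod (singular_chain_set q T) (\<lambda>_. self_mod R))"
    by (auto simp: carrier_cochain_mod prod_mod_simps PiE_def)
  have "submodule ?H R (prod_mod (singular_chain_set q T) (\<lambda>_. self_mod R))"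
  proof (rule P.submoduleI[OF sub])
    show "\<zero>\<^bsub>prod_mod (singular_chain_set q T) (\<lambda>_. self_mod R)\<^esub> \<in> ?H"
      by (auto simp: carrier_cochain_mod prod_mod_def singular_chain_add)
    fix u assume u: "u \<in> ?H"
    have inv: "(\<ominus>\<^bsub>prod_mod (singular_chain_set q T) (\<lambda>_. self_mod R)\<^esub> u) c = \<ominus> u c" if c: "singular_chain q T c" for c
    proof -
      have "mod_hom R (prod_mod (singular_chain_set q T) (\<lambda>_. self_mod R)) (self_mod R) (\<lambda>u. u c)"
        using c by (intro mod_hom_proj) simp
      from mod_hom_neg[OF P.module_axioms module_self_mod[OF is_cring] this, of u] u sub
      show ?thesis using c cochain_closed[OF u] by (auto simp: a_inv_self_mod[OF is_cring])
    qed
    have ue: "\<ominus>\<^bsub>prod_mod (singular_chain_set q T) (\<lambda>_. self_mod R)\<^esub> u \<in> extensional (singular_chain_set q T)"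
      using P.a_inv_closed[of u] u sub by (auto simp: prod_mod_simps PiE_def)
    then show "\<ominus>\<^bsub>prod_mod (singular_chain_set q T) (\<lambda>_. self_mod R)\<^esub> u \<in> ?H"
      using cochain_closed[OF u] cochain_add[OF u]
      by (auto simp: carrier_cochain_mod inv singular_chain_add minus_add)
    fix v assume v: "v \<in> ?H"
    show "u \<oplus>\<^bsub>prod_mod (singular_chain_set q T) (\<lambda>_. self_mod R)\<^esub> v \<in> ?H"
      using cochain_closed[OF u] cochain_add[OF u] cochain_closed[OF v] cochain_add[OF v]
      by (auto simp: carrier_cochain_mod prod_mod_def singular_chain_add a_ac)
  next
    fix a u assume a: "a \<in> carrier R" and u: "u \<in> ?H"
    show "a \<odot>\<^bsub>prod_mod (singular_chain_set q T) (\<lambda>_. self_mod R)\<^esub> u \<in> ?H"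
      using a cochain_closed[OF u] cochain_add[OF u]
      by (auto simp: carrier_cochain_mod prod_mod_def singular_chain_add r_distr)
  qed
  from module_restrict[OF this P.module_axioms] show ?thesis unfolding eq[symmetric] .
qed

lemma mod_hom_eval: "singular_chain q T c \<Longrightarrow> mod_hom R (cochain_mod R q T) (self_mod R) (\<lambda>u. u c)"
  by (intro mod_homI) (simp_all add: cochain_closed cochain_mod_ops)

text \<open>Chains are generated by simplices under differences, which is the form of
  \<open>frag_induction\<close>. Identities of cochains are henceforth checked one simplex at a
  time.\<close>

lemma cochain_eqI:
  assumes u: "u \<in> carrier (cochain_mod R q T)" and v: "v \<in> carrier (cochain_mod R q T)"
    and eq: "\<And>s. singular_simplex q T s \<Longrightarrow> u (frag_of s) = v (frag_of s)"
  shows "u = v"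
proof (rule extensionalityI[of _ "singular_chain_set q T"])
  show "u \<in> extensional (singular_chain_set q T)" "v \<in> extensional (singular_chain_set q T)"
    using u v by (auto simp: carrier_cochain_mod)
  fix c assume "c \<in> singular_chain_set q T"
  then have "Poly_Mapping.keys c \<subseteq> singular_simplex_set q T" by (simp add: singular_chain_def)
  then have "singular_chain q T c \<and> u c = v c"
  proof (induction c rule: frag_induction)
    case zero
    then show ?case using cochain_zero[OF u] cochain_zero[OF v] by simp
  next
    case (one x)
    then show ?case using eq by (simp add: singular_chain_of)
  next
    case (diff a b)
    then show ?case using cochain_diff[OF u] cochain_diff[OF v] by (simp add: singular_chain_diff)
  qed
  then show "u c = v c" ..
qed

lemma cochain_vanishes:
  assumes u: "u \<in> carrier (cochain_mod R q T)" and keys: "Poly_Mapping.keys c \<subseteq> S"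
    and S: "\<And>s. s \<in> S \<Longrightarrow> singular_simplex q T s \<and> u (frag_of s) = \<zero>"
  shows "u c = \<zero>"
proof -
  from keys have "singular_chain q T c \<and> u c = \<zero>"
  proof (induction c rule: frag_induction)
    case zero
    then show ?case using cochain_zero[OF u] by simp
  next
    case (one x)
    then show ?case using S by (simp add: singular_chain_of)
  next
    case (diff a b)
    then show ?case using cochain_diff[OF u] by (simp add: singular_chain_diff a_minus_def)
  qed
  then show ?thesis ..
qed

text \<open>The universal property of the free abelian group on the simplices. It permits cochains
  to be built from choices made separately for every simplex.\<close>

lemma cochain_exists:
  assumes "\<And>s. singular_simplex q T s \<Longrightarrow> g s \<in> carrier R"
  shows "\<exists>u\<in>carrier (cochain_mod R q T). \<forall>s. singular_simplex q T s \<longrightarrow> u (frag_of s) = g s"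
proof -
  have "g ` singular_simplex_set q T \<subseteq> carrier (add_monoid R)" using assms by auto
  from comm_group.free_Abelian_group_universal[OF a_comm_group this] obtain h
    where h: "h \<in> hom (chain_group q T) (add_monoid R)" "\<And>x. x \<in> singular_simplex_set q T \<Longrightarrow> h (frag_of x) = g x"
    unfolding chain_group_def by blast
  then have "restrict h (singular_chain_set q T) \<in> carrier (cochain_mod R q T)"
    by (auto simp: carrier_cochain_mod hom_def singular_chain_add)
  moreover have "\<forall>s. singular_simplex q T s \<longrightarrow> restrict h (singular_chain_set q T) (frag_of s) = g s"
    using h(2) by (simp add: singular_chain_of)
  ultimately show ?thesis by blast
qed

lemma mod_hom_cochain_restrict:
  assumes "\<And>c. singular_chain q T' c \<Longrightarrow> singular_chain q T c"
  shows "mod_hom R (cochain_mod R q T) (cochain_mod R q T') (\<lambda>u. restrict u (singular_chain_set q T'))"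
proof (rule mod_homI)
  show "restrict u (singular_chain_set q T') \<in> carrier (cochain_mod R q T')" if "u \<in> carrier (cochain_mod R q T)" for u
    using that assms by (auto simp: carrier_cochain_mod singular_chain_add)
qed (auto simp: cochain_mod_ops assms intro!: extensionalityI[of _ "singular_chain_set q T'"] cochain_mod_ext)

lemma mod_hom_coboundary: "mod_hom R (cochain_mod R q T) (cochain_mod R (Suc q) T) (coboundary_map q T)"
proof (rule mod_homI)
  show "coboundary_map q T u \<in> carrier (cochain_mod R (Suc q) T)" if "u \<in> carrier (cochain_mod R q T)" for u
    using that
    by (auto simp: carrier_cochain_mod coboundary_map_def singular_chain_add chain_boundary_add singular_chain_boundary_alt)
qed (auto simp: coboundary_map_def cochain_mod_ops singular_chain_boundary_alt
    intro!: extensionalityI[of _ "singular_chain_set (Suc q) T"] cochain_mod_ext)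

lemma coboundary_coboundary:
  assumes "u \<in> carrier (cochain_mod R q T)"
  shows "coboundary_map (Suc q) T (coboundary_map q T u) = \<zero>\<^bsub>cochain_mod R (Suc (Suc q)) T\<^esub>"
proof (rule extensionalityI[of _ "singular_chain_set (Suc (Suc q)) T"])
  fix c assume "c \<in> singular_chain_set (Suc (Suc q)) T"
  then show "coboundary_map (Suc q) T (coboundary_map q T u) c = \<zero>\<^bsub>cochain_mod R (Suc (Suc q)) T\<^esub> c"
    using cochain_zero[OF assms]
    by (simp add: coboundary_map_def cochain_mod_ops singular_chain_boundary_alt chain_boundary_boundary_alt)
qed (auto simp: coboundary_map_def cochain_mod_ext)

end

lemma coboundary_restrict:
  assumes "\<And>q c. singular_chain q T' c \<Longrightarrow> singular_chain q T c"
  shows "coboundary_map q T' (restrict u (singular_chain_set q T')) =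
    restrict (coboundary_map q T u) (singular_chain_set (Suc q) T')"
  by (rule ext) (simp add: coboundary_map_def assms singular_chain_boundary_alt restrict_def)

section \<open>Cochains vanishing on small simplices\<close>

text \<open>Smallness is expressed by singular simplices of a subspace, so that operators natural in
  the space, such as subdivision, preserve it by being applied inside \<open>V\<close>.\<close>

definition small_simplex :: "'x topology \<Rightarrow> 'x set set \<Rightarrow> nat \<Rightarrow> ((nat \<Rightarrow> real) \<Rightarrow> 'x) \<Rightarrow> bool" where
  "small_simplex T \<U> p s \<longleftrightarrow> singular_simplex p T s \<and> (\<exists>V\<in>\<U>. singular_simplex p (subtopology T V) s)"

definition small_chain :: "'x topology \<Rightarrow> 'x set set \<Rightarrow> nat \<Rightarrow> 'x chain \<Rightarrow> bool" where
  "small_chain T \<U> p c \<longleftrightarrow> Poly_Mapping.keys c \<subseteq> {s. small_simplex T \<U> p s}"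

lemma small_chain_0 [simp]: "small_chain T \<U> p 0"
  by (simp add: small_chain_def)

lemma small_chain_of [simp]: "small_chain T \<U> p (frag_of s) \<longleftrightarrow> small_simplex T \<U> p s"
  by (simp add: small_chain_def)

lemma small_chain_diff: "small_chain T \<U> p a \<Longrightarrow> small_chain T \<U> p b \<Longrightarrow> small_chain T \<U> p (a - b)"
  unfolding small_chain_def using keys_diff[of a b] by auto

lemma small_chain_minus: "small_chain T \<U> p a \<Longrightarrow> small_chain T \<U> p (- a)"
  by (simp add: small_chain_def)

lemma small_chain_add: "small_chain T \<U> p a \<Longrightarrow> small_chain T \<U> p b \<Longrightarrow> small_chain T \<U> p (a + b)"
  using small_chain_diff[of T \<U> p a "- b"] small_chain_minus[of T \<U> p b] by simp

lemma small_chain_sum: "(\<And>i. i \<in> I \<Longrightarrow> small_chain T \<U> p (g i)) \<Longrightarrow> small_chain T \<U> p (sum g I)"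
  by (induction I rule: infinite_finite_induct) (auto intro: small_chain_add)

lemma small_chain_cmul: "small_chain T \<U> p a \<Longrightarrow> small_chain T \<U> p (frag_cmul k a)"
  unfolding small_chain_def using keys_cmul[of k a] by auto

lemma small_chain_subtopology:
  "V \<in> \<U> \<Longrightarrow> singular_chain p (subtopology T V) c \<Longrightarrow> small_chain T \<U> p c"
  unfolding small_chain_def small_simplex_def singular_chain_def
  using singular_simplex_subtopology by blast

text \<open>A single small simplex lives in one \<open>V\<close>, where \<open>g\<close> preserves
  chains; compatibility with differences does the rest.\<close>

lemma small_chain_map:
  assumes g0: "g 0 = 0" and gd: "\<And>a b. g (a - b) = g a - g b"
    and g: "\<And>V c. singular_chain p (subtopology T V) c \<Longrightarrow> singular_chain q (subtopology T V) (g c)"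
    and c: "small_chain T \<U> p c"
  shows "small_chain T \<U> q (g c)"
  using c[unfolded small_chain_def]
proof (induction c rule: frag_induction)
  case zero
  show ?case by (simp add: g0)
next
  case (one s)
  then obtain V where V: "V \<in> \<U>" "singular_simplex p (subtopology T V) s" by (auto simp: small_simplex_def)
  then show ?case using g[of V "frag_of s"] by (intro small_chain_subtopology[OF V(1)]) (simp add: singular_chain_of)
next
  case (diff a b)
  then show ?case by (simp add: gd small_chain_diff)
qed

lemma small_simplex_face:
  assumes "small_simplex T \<U> (Suc p) s" "k \<le> Suc p"
  shows "small_simplex T \<U> p (singular_face (Suc p) k s)"
  using assms singular_simplex_singular_face[of "Suc p" _ s k] by (fastforce simp: small_simplex_def)

lemma singular_subdivision_power_chain:
  "singular_chain p X c \<Longrightarrow> singular_chain p X ((singular_subdivision p ^^ n) c)"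
  by (induction n) (auto intro: singular_chain_singular_subdivision)

lemma chain_boundary_subdivision_power:
  assumes "singular_chain p X c"
  shows "chain_boundary p ((singular_subdivision p ^^ n) c) =
    (singular_subdivision (p - Suc 0) ^^ n) (chain_boundary p c)"
proof (induction n)
  case (Suc n)
  then show ?case
    using chain_boundary_singular_subdivision[OF singular_subdivision_power_chain[OF assms]] by simp
qed simp

text \<open>Taking the maximum with the depths of the faces makes the depth monotone under faces by
  definition. No comparison between the subdivisions of a simplex and those of its faces is
  needed.\<close>

primrec small_depth :: "'x topology \<Rightarrow> 'x set set \<Rightarrow> nat \<Rightarrow> ((nat \<Rightarrow> real) \<Rightarrow> 'x) \<Rightarrow> nat" where
  "small_depth T \<U> 0 = (\<lambda>s. LEAST n. small_chain T \<U> 0 ((singular_subdivision 0 ^^ n) (frag_of s)))"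
| "small_depth T \<U> (Suc p) = (\<lambda>s. Max (insert
    (LEAST n. small_chain T \<U> (Suc p) ((singular_subdivision (Suc p) ^^ n) (frag_of s)))
    ((\<lambda>k. small_depth T \<U> p (singular_face (Suc p) k s)) ` {..Suc p})))"

lemma small_depth_face: "k \<le> Suc p \<Longrightarrow> small_depth T \<U> p (singular_face (Suc p) k s) \<le> small_depth T \<U> (Suc p) s"
  unfolding small_depth.simps by (rule Max_ge) auto

lemma small_depth_ge_least:
  "(LEAST n. small_chain T \<U> p ((singular_subdivision p ^^ n) (frag_of s))) \<le> small_depth T \<U> p s"
  by (cases p) (simp_all del: atMost_Suc)

text \<open>Faces of small simplices are small, so every term of the maximum is zero. Depth 0 gives
  an empty sum in the operator \<open>D\<close> below, which therefore vanishes on small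
  chains.\<close>

lemma small_depth_small: "small_simplex T \<U> p s \<Longrightarrow> small_depth T \<U> p s = 0"
proof (induction p arbitrary: s)
  case 0
  then show ?case by (simp add: Least_eq_0)
next
  case (Suc p)
  have "(LEAST n. small_chain T \<U> (Suc p) ((singular_subdivision (Suc p) ^^ n) (frag_of s))) = 0"
    using Suc.prems by (simp add: Least_eq_0)
  moreover have "small_depth T \<U> p (singular_face (Suc p) k s) = 0" if "k \<le> Suc p" for k
    using Suc small_simplex_face that by blast
  ultimately show ?case by (simp del: atMost_Suc)
qed

section \<open>Contraction onto small chains by subdivision\<close>

locale open_cover =
  fixes T :: "'x topology" and \<U> :: "'x set set"
  assumes cover_open: "\<And>V. V \<in> \<U> \<Longrightarrow> openin T V" and cover: "topspace T \<subseteq> \<Union>\<U>"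
begin

lemma small_subdivision: "small_chain T \<U> p c \<Longrightarrow> small_chain T \<U> p (singular_subdivision p c)"
  by (rule small_chain_map[where g = "singular_subdivision p"])
     (auto simp: singular_subdivision_diff intro: singular_chain_singular_subdivision)

lemma small_subdivision_mono:
  assumes "small_chain T \<U> p ((singular_subdivision p ^^ n) c)" "n \<le> m"
  shows "small_chain T \<U> p ((singular_subdivision p ^^ m) c)"
  using assms(2) by (induction m rule: dec_induct) (auto simp: assms(1) small_subdivision)

lemma eventually_small:
  assumes "singular_chain p T c"
  shows "\<exists>n. small_chain T \<U> p ((singular_subdivision p ^^ n) c)"
proof -
  obtain n where n: "\<And>m f. n \<le> m \<Longrightarrow> f \<in> Poly_Mapping.keys ((singular_subdivision p ^^ m) c) \<Longrightarrow>
      \<exists>V\<in>\<U>. f \<in> standard_simplex p \<rightarrow> V"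
    using sufficient_iterated_singular_subdivision_exists[OF cover_open cover assms] by metis
  have "small_simplex T \<U> p f" if f: "f \<in> Poly_Mapping.keys ((singular_subdivision p ^^ n) c)" for f
  proof -
    have "singular_simplex p T f"
      using singular_subdivision_power_chain[OF assms, of n] f by (auto simp: singular_chain_def)
    then show ?thesis using n[OF order_refl f] by (auto simp: small_simplex_def singular_simplex_subtopology)
  qed
  then show ?thesis unfolding small_chain_def by blast
qed

lemma small_at_depth:
  assumes "singular_simplex p T s" "small_depth T \<U> p s \<le> n"
  shows "small_chain T \<U> p ((singular_subdivision p ^^ n) (frag_of s))"
proof -
  have "\<exists>n. small_chain T \<U> p ((singular_subdivision p ^^ n) (frag_of s))"
    using assms by (intro eventually_small) (simp add: singular_chain_of)
  from LeastI_ex[OF this] show ?thesis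
    by (rule small_subdivision_mono) (rule order_trans[OF small_depth_ge_least assms(2)])
qed

lemma zero_simplex_small: "singular_simplex 0 T s \<Longrightarrow> small_simplex T \<U> 0 s"
proof -
  assume s: "singular_simplex 0 T s"
  obtain x where x: "standard_simplex 0 = {x}" using standard_simplex_0 by blast
  have "s ` standard_simplex 0 \<subseteq> topspace T"
    using s by (auto simp: singular_simplex_def continuous_map_def topspace_standard_simplex Pi_iff)
  then obtain V where "V \<in> \<U>" "s x \<in> V" using cover x by auto
  then show ?thesis using s x by (auto simp: small_simplex_def singular_simplex_subtopology)
qed

text \<open>The operator \<open>D\<close> subdivides each simplex just often enough; \<open>1 + \<partial> D + D \<partial>\<close> has values in
  small chains. Taking the depth of a simplex to be at least that of its faces makes the
  correction terms on the boundary small.\<close>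

definition contracts_to_small :: "(nat \<Rightarrow> 'x chain \<Rightarrow> 'x chain) \<Rightarrow> bool" where
  "contracts_to_small D \<longleftrightarrow> (\<forall>p. D p 0 = 0) \<and> (\<forall>p a b. D p (a - b) = D p a - D p b) \<and>
    (\<forall>p c. singular_chain p T c \<longrightarrow> singular_chain (Suc p) T (D p c)) \<and>
    (\<forall>p c. small_chain T \<U> p c \<longrightarrow> D p c = 0) \<and>
    (\<forall>p s. singular_simplex (Suc p) T s \<longrightarrow> small_chain T \<U> (Suc p)
      (frag_of s + chain_boundary (Suc (Suc p)) (D (Suc p) (frag_of s)) + D p (chain_boundary (Suc p) (frag_of s))))"

text \<open>\<open>H p n\<close> adds up the subdivision homotopy over the first n iterates S^0,
  ..., S^(n-1), so that \<partial> H + H \<partial> = S^n - 1. \<open>D\<close> takes n to be the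
  depth of each simplex. With n the depth of \<open>s\<close>, the sum s + \<partial> D s + D
  \<partial> s equals S^n s minus the difference of H_n and D on \<partial> s; on a face this
  difference only involves iterates from the depth of the face on, which are small.\<close>

lemma small_homotopy: "\<exists>D. contracts_to_small D"
proof -
  obtain h :: "nat \<Rightarrow> 'x chain \<Rightarrow> 'x chain" where h0: "\<And>p. h p 0 = 0"
    and hd: "\<And>p a b. h p (a - b) = h p a - h p b"
    and hc: "\<And>p X c. singular_chain p X c \<Longrightarrow> singular_chain (Suc p) X (h p c)"
    and hb: "\<And>p X c. singular_chain p X c \<Longrightarrow>
      chain_boundary (Suc p) (h p c) + h (p - Suc 0) (chain_boundary p c) = singular_subdivision p c - c"
    using chain_homotopic_singular_subdivision by metis
  define H where "H p n c = (\<Sum>i<n. h p ((singular_subdivision p ^^ i) c))" for p n c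
  have H0: "H p n 0 = 0" for p n by (simp add: H_def h0)
  have Hd: "H p n (a - b) = H p n a - H p n b" for p n a b
    by (simp add: H_def hd singular_subdivision_power_diff sum_subtractf)
  have Hc: "singular_chain (Suc p) X (H p n c)" if "singular_chain p X c" for p n X c
    unfolding H_def using that by (intro singular_chain_sum hc singular_subdivision_power_chain)
  have Hb: "chain_boundary (Suc p) (H p n c) + H (p - Suc 0) n (chain_boundary p c) =
      (singular_subdivision p ^^ n) c - c" if c: "singular_chain p X c" for p n X c
  proof (induction n)
    case 0
    show ?case by (simp add: H_def)
  next
    case (Suc n)
    have step: "chain_boundary (Suc p) (h p ((singular_subdivision p ^^ n) c)) +
        h (p - Suc 0) ((singular_subdivision (p - Suc 0) ^^ n) (chain_boundary p c)) =
        (singular_subdivision p ^^ Suc n) c - (singular_subdivision p ^^ n) c"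
      using hb[OF singular_subdivision_power_chain[OF c, of n]] chain_boundary_subdivision_power[OF c, of n] by simp
    have HS: "H q (Suc n) b = H q n b + h q ((singular_subdivision q ^^ n) b)" for q b by (simp add: H_def)
    have "chain_boundary (Suc p) (H p (Suc n) c) + H (p - Suc 0) (Suc n) (chain_boundary p c) =
        (chain_boundary (Suc p) (H p n c) + H (p - Suc 0) n (chain_boundary p c)) +
        (chain_boundary (Suc p) (h p ((singular_subdivision p ^^ n) c)) +
        h (p - Suc 0) ((singular_subdivision (p - Suc 0) ^^ n) (chain_boundary p c)))"
      unfolding HS chain_boundary_add by (simp only: ac_simps)
    also have "\<dots> = (singular_subdivision p ^^ Suc n) c - c" unfolding Suc step by simp
    finally show ?case .
  qed
  define D where "D p = frag_extend (\<lambda>s. H p (small_depth T \<U> p s) (frag_of s))" for p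
  have Ds: "D p (frag_of s) = H p (small_depth T \<U> p s) (frag_of s)" for p s by (simp add: D_def)
  have D0: "D p 0 = 0" for p by (simp add: D_def)
  have Dd: "D p (a - b) = D p a - D p b" for p a b by (simp add: D_def frag_extend_diff)
  have Dc: "singular_chain (Suc p) T (D p c)" if "singular_chain p T c" for p c
    unfolding D_def using that
    by (intro singular_chain_extend Hc) (auto simp: singular_chain_of singular_chain_def)
  have Dsmall: "D p c = 0" if "small_chain T \<U> p c" for p c
    using that[unfolded small_chain_def]
  proof (induction c rule: frag_induction)
    case (one s)
    then have "small_depth T \<U> p s = 0" using small_depth_small by simp
    then show ?case unfolding Ds by (simp add: H_def)
  qed (simp_all add: D0 Dd)
  \<comment> \<open>The boundary is an alternating sum of faces; a map preserving zero and
    differences commutes with the signs.\<close>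
  have additive_sign_sum: "g (\<Sum>k\<le>n. frag_cmul ((-1) ^ k) (a k)) = (\<Sum>k\<le>n. frag_cmul ((-1) ^ k) (g (a k)))"
    if g: "g 0 = 0" "\<And>a b. g (a - b) = g a - g b" for g :: "'x chain \<Rightarrow> 'x chain" and a and n :: nat
  proof -
    have gm: "g (- x) = - g x" for x using g(2)[of 0 x] g(1) by simp
    have ga: "g (x + y) = g x + g y" for x y using g(2)[of x "- y"] gm by simp
    have gs: "g (frag_cmul ((-1) ^ k) x) = frag_cmul ((-1) ^ k) (g x)" for k x
      by (cases "even k") (simp_all add: gm)
    show ?thesis by (induction n) (simp_all add: ga gs del: power_Suc)
  qed
  show ?thesis
    unfolding contracts_to_small_def
  proof (intro exI[of _ D] conjI allI impI D0 Dd Dc Dsmall)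
    fix p s assume s: "singular_simplex (Suc p) T s"
    let ?n = "small_depth T \<U> (Suc p) s" and ?f = "\<lambda>k. singular_face (Suc p) k s"
    have sc: "singular_chain (Suc p) T (frag_of s)" using s by (simp add: singular_chain_of)
    have bd: "chain_boundary (Suc p) (frag_of s) = (\<Sum>k\<le>Suc p. frag_cmul ((-1) ^ k) (frag_of (?f k)))"
      by (simp only: chain_boundary_of) simp
    have face_diff: "small_chain T \<U> (Suc p) (H p ?n (frag_of (?f k)) - D p (frag_of (?f k)))" if k: "k \<le> Suc p" for k
    proof -
      have fk: "singular_simplex p T (?f k)" using singular_simplex_singular_face[OF s _ k] by simp
      let ?m = "small_depth T \<U> p (?f k)"
      have mn: "?m \<le> ?n" using k by (rule small_depth_face)
      have "H p ?n (frag_of (?f k)) = H p ?m (frag_of (?f k)) +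
          (\<Sum>i\<in>{?m..<?n}. h p ((singular_subdivision p ^^ i) (frag_of (?f k))))"
        using sum.atLeastLessThan_concat[of 0 ?m ?n "\<lambda>i. h p ((singular_subdivision p ^^ i) (frag_of (?f k)))"] mn
        unfolding H_def atLeast0LessThan by simp
      then have diff_eq: "H p ?n (frag_of (?f k)) - D p (frag_of (?f k)) =
          (\<Sum>i\<in>{?m..<?n}. h p ((singular_subdivision p ^^ i) (frag_of (?f k))))"
        unfolding Ds by simp
      have small_term: "small_chain T \<U> (Suc p) (h p ((singular_subdivision p ^^ i) (frag_of (?f k))))" if i: "i \<in> {?m..<?n}" for i
      proof -
        have "?m \<le> i" using i by simp
        from small_chain_map[where g = "h p", OF h0 hd hc small_at_depth[OF fk this]] show ?thesis .
      qed
      show ?thesis unfolding diff_eq by (rule small_chain_sum) (rule small_term)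
    qed
    have "small_chain T \<U> (Suc p) (H p ?n (chain_boundary (Suc p) (frag_of s)) - D p (chain_boundary (Suc p) (frag_of s)))"
    proof -
      define g where "g c = H p ?n c - D p c" for c
      have "g (chain_boundary (Suc p) (frag_of s)) = (\<Sum>k\<le>Suc p. frag_cmul ((-1) ^ k) (g (frag_of (?f k))))"
        unfolding bd by (rule additive_sign_sum) (simp_all add: g_def H0 D0 Hd Dd)
      moreover have "small_chain T \<U> (Suc p) (\<Sum>k\<le>Suc p. frag_cmul ((-1) ^ k) (g (frag_of (?f k))))"
        unfolding g_def using face_diff by (intro small_chain_sum small_chain_cmul) simp
      ultimately show ?thesis unfolding g_def by simp
    qed
    moreover have "small_chain T \<U> (Suc p) ((singular_subdivision (Suc p) ^^ ?n) (frag_of s))"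
      by (rule small_at_depth[OF s order_refl])
    ultimately have "small_chain T \<U> (Suc p) ((singular_subdivision (Suc p) ^^ ?n) (frag_of s) -
        (H p ?n (chain_boundary (Suc p) (frag_of s)) - D p (chain_boundary (Suc p) (frag_of s))))"
      by (rule small_chain_diff[rotated])
    moreover have "(singular_subdivision (Suc p) ^^ ?n) (frag_of s) =
        frag_of s + chain_boundary (Suc (Suc p)) (D (Suc p) (frag_of s)) + H p ?n (chain_boundary (Suc p) (frag_of s))"
      using Hb[OF sc, of ?n] unfolding Ds by (simp add: algebra_simps)
    ultimately show "small_chain T \<U> (Suc p) (frag_of s + chain_boundary (Suc (Suc p)) (D (Suc p) (frag_of s)) +
        D p (chain_boundary (Suc p) (frag_of s)))"
      by (simp add: algebra_simps)
  qed
qed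

text \<open>The primitive is y = - v D. On the small chain s + \<partial> D s + D \<partial> s the
  cochain \<open>v\<close> vanishes, and it vanishes on \<partial> D s as a cocycle, whence v s = -
  v (D \<partial> s). Since \<open>D\<close> kills small chains, \<open>y\<close> vanishes on them
  too.\<close>

lemma small_cocycle_is_coboundary:
  assumes R: "cring R" and v: "v \<in> carrier (cochain_mod R (Suc m) T)"
    and dv: "coboundary_map (Suc m) T v = \<zero>\<^bsub>cochain_mod R (Suc (Suc m)) T\<^esub>"
    and van: "\<And>V c. V \<in> \<U> \<Longrightarrow> singular_chain (Suc m) (subtopology T V) c \<Longrightarrow> v c = \<zero>\<^bsub>R\<^esub>"
  shows "\<exists>y\<in>carrier (cochain_mod R m T).
    (\<forall>V\<in>\<U>. \<forall>c. singular_chain m (subtopology T V) c \<longrightarrow> y c = \<zero>\<^bsub>R\<^esub>) \<and> v = coboundary_map m T y"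
proof -
  interpret R: cring R by fact
  from small_homotopy obtain D where D: "contracts_to_small D" ..
  note D = D[unfolded contracts_to_small_def]
  note D0 = D[THEN conjunct1, rule_format] and Dd = D[THEN conjunct2, THEN conjunct1, rule_format]
    and Dc = D[THEN conjunct2, THEN conjunct2, THEN conjunct1, rule_format]
    and Dsmall = D[THEN conjunct2, THEN conjunct2, THEN conjunct2, THEN conjunct1, rule_format]
    and e = D[THEN conjunct2, THEN conjunct2, THEN conjunct2, THEN conjunct2, rule_format]
  have Da: "D p (a + b) = D p a + D p b" for p a b
    using Dd[of p a "- b"] Dd[of p 0 b] D0 by simp
  define y where "y = (\<lambda>c\<in>singular_chain_set m T. \<ominus>\<^bsub>R\<^esub> v (D m c))"
  have y: "y \<in> carrier (cochain_mod R m T)"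
    using cochain_closed[OF v Dc] cochain_add[OF v Dc Dc]
    by (auto simp: y_def carrier_cochain_mod singular_chain_add Da R.minus_add)
  have "y c = \<zero>\<^bsub>R\<^esub>" if "V \<in> \<U>" "singular_chain m (subtopology T V) c" for V c
  proof -
    have "singular_chain m T c" using that by (simp add: singular_chain_subtopology)
    moreover have "D m c = 0" using that by (intro Dsmall small_chain_subtopology)
    ultimately show ?thesis using R.cochain_zero[OF v] by (simp add: y_def)
  qed
  moreover have "v = coboundary_map m T y"
  proof (rule R.cochain_eqI[OF v mod_hom_closed[OF R.mod_hom_coboundary y]])
    fix s assume s: "singular_simplex (Suc m) T s"
    let ?s = "frag_of s" and ?b = "chain_boundary (Suc m) (frag_of s)"
    have sc: "singular_chain (Suc m) T ?s" using s by (simp add: singular_chain_of)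
    have bc: "singular_chain m T ?b" using sc by (rule singular_chain_boundary_alt)
    have Db: "singular_chain (Suc m) T (D m ?b)" using bc by (rule Dc)
    have DDc: "singular_chain (Suc m) T (chain_boundary (Suc (Suc m)) (D (Suc m) ?s))"
      by (intro singular_chain_boundary_alt Dc sc)
    have "v (chain_boundary (Suc (Suc m)) (D (Suc m) ?s)) = \<zero>\<^bsub>R\<^esub>"
      using fun_cong[OF dv, of "D (Suc m) ?s"] Dc[OF sc] by (simp add: coboundary_map_def cochain_mod_ops)
    moreover have "v (?s + chain_boundary (Suc (Suc m)) (D (Suc m) ?s) + D m ?b) = \<zero>\<^bsub>R\<^esub>"
    proof (rule R.cochain_vanishes[OF v e[OF s, unfolded small_chain_def]])
      fix t assume "t \<in> {s. small_simplex T \<U> (Suc m) s}"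
      then show "singular_simplex (Suc m) T t \<and> v (frag_of t) = \<zero>\<^bsub>R\<^esub>"
        using van by (auto simp: small_simplex_def singular_chain_of)
    qed
    ultimately have "v ?s \<oplus>\<^bsub>R\<^esub> v (D m ?b) = \<zero>\<^bsub>R\<^esub>"
      using cochain_add[OF v sc DDc] cochain_add[OF v singular_chain_add[OF sc DDc] Db] cochain_closed[OF v sc] by simp
    then have "v ?s = \<ominus>\<^bsub>R\<^esub> v (D m ?b)"
      using cochain_closed[OF v sc] cochain_closed[OF v Db] by (rule R.add_eq_zero_imp)
    then show "v ?s = coboundary_map m T y ?s" using sc bc by (simp add: coboundary_map_def y_def)
  qed
  ultimately show ?thesis using y by blast
qed

text \<open>In degree 0 every simplex is small, its image being a point of some member of the
  cover.\<close>

lemma small_zero_cochain: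
  assumes R: "cring R" and v: "v \<in> carrier (cochain_mod R 0 T)"
    and van: "\<And>V c. V \<in> \<U> \<Longrightarrow> singular_chain 0 (subtopology T V) c \<Longrightarrow> v c = \<zero>\<^bsub>R\<^esub>"
  shows "v = \<zero>\<^bsub>cochain_mod R 0 T\<^esub>"
proof -
  interpret R: cring R by fact
  interpret M: module R "cochain_mod R 0 T" by (rule R.module_cochain_mod)
  show ?thesis
  proof (rule R.cochain_eqI[OF v M.zero_closed])
    fix s assume s: "singular_simplex 0 T s"
    from zero_simplex_small[OF s] obtain V where "V \<in> \<U>" "singular_simplex 0 (subtopology T V) s"
      by (auto simp: small_simplex_def)
    with van have "v (frag_of s) = \<zero>\<^bsub>R\<^esub>" by (simp add: singular_chain_of)
    with s show "v (frag_of s) = \<zero>\<^bsub>cochain_mod R 0 T\<^esub> (frag_of s)" by (simp add: cochain_mod_ops singular_chain_of)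
  qed
qed

end

section \<open>The Cech double complex of singular cochains\<close>

lemma (in abelian_group) sg_add: "x \<in> carrier G \<Longrightarrow> y \<in> carrier G \<Longrightarrow> sg G p (x \<oplus> y) = sg G p x \<oplus> sg G p y"
  by (simp add: sg_def minus_add)

lemma (in abelian_group) sg_commute: "x \<in> carrier G \<Longrightarrow> sg G p (sg G q x) = sg G q (sg G p x)"
  by (simp add: sg_def)

lemma (in abelian_group) sg_finsum:
  assumes "finite A" "g \<in> A \<rightarrow> carrier G"
  shows "sg G p (\<Oplus>a\<in>A. g a) = (\<Oplus>a\<in>A. sg G p (g a))"
  using assms by (induction A) (simp_all add: Pi_iff sg_add)

text \<open>For k \<le> j the terms at (j + 1, k) and at (k, j) have equal values and opposite
  signs, and these pairs exhaust the index rectangle.\<close>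

lemma (in abelian_group) alternating_double_sum:
  assumes a: "\<And>j k. j \<le> Suc n \<Longrightarrow> k \<le> n \<Longrightarrow> a j k \<in> carrier G"
    and sym: "\<And>j k. j \<le> k \<Longrightarrow> k \<le> n \<Longrightarrow> a j k = a (Suc k) j"
  shows "(\<Oplus>j\<in>{..Suc n}. sg G j (\<Oplus>k\<in>{..n}. sg G k (a j k))) = \<zero>"
proof -
  \<comment> \<open>Zero outside the rectangle, so that the reindexed sums below have all their
    terms in the group without range conditions.\<close>
  define b where "b j k = (if j \<le> Suc n \<and> k \<le> n then sg G j (sg G k (a j k)) else \<zero>)" for j k
  have bc: "b j k \<in> carrier G" for j k using a by (simp add: b_def)
  have cancel: "b (Suc j) k \<oplus> b k j = \<zero>" if "k \<le> j" "j \<le> n" for j k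
  proof -
    have ac: "a (Suc j) k \<in> carrier G" using a that by simp
    have "b k j = sg G j (sg G k (a (Suc j) k))"
      using that sym[of k j] sg_commute[OF ac] by (simp add: b_def)
    moreover have "b (Suc j) k = \<ominus> sg G j (sg G k (a (Suc j) k))"
      using that ac by (simp add: b_def sg_Suc)
    ultimately show ?thesis using ac by (simp add: l_neg)
  qed
  have split: "(\<Oplus>k\<in>{..n}. b j k) = (\<Oplus>k\<in>{..<j}. b j k) \<oplus> (\<Oplus>k\<in>{j..n}. b j k)" if "j \<le> Suc n" for j
  proof -
    have "{..n} = {..<j} \<union> {j..n}" using that by auto
    then show ?thesis using bc by (simp add: finsum_Un_disjoint ivl_disj_int)
  qed
  have "(\<Oplus>j\<in>{..Suc n}. sg G j (\<Oplus>k\<in>{..n}. sg G k (a j k))) = (\<Oplus>j\<in>{..Suc n}. \<Oplus>k\<in>{..n}. b j k)"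
  proof (rule finsum_cong')
    show "sg G j (\<Oplus>k\<in>{..n}. sg G k (a j k)) = (\<Oplus>k\<in>{..n}. b j k)" if j: "j \<in> {..Suc n}" for j
    proof -
      have "sg G j (\<Oplus>k\<in>{..n}. sg G k (a j k)) = (\<Oplus>k\<in>{..n}. sg G j (sg G k (a j k)))"
        using a j by (intro sg_finsum) auto
      also have "\<dots> = (\<Oplus>k\<in>{..n}. b j k)"
      proof (rule finsum_cong')
        show "sg G j (sg G k (a j k)) = b j k" if "k \<in> {..n}" for k using j that by (simp add: b_def)
      qed (simp_all add: bc)
      finally show ?thesis .
    qed
  qed (auto intro!: finsum_closed bc)
  also have "\<dots> = (\<Oplus>j\<in>{..Suc n}. (\<Oplus>k\<in>{..<j}. b j k) \<oplus> (\<Oplus>k\<in>{j..n}. b j k))"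
    using split bc by (intro finsum_cong') (auto intro!: finsum_closed)
  also have "\<dots> = (\<Oplus>j\<in>{..Suc n}. \<Oplus>k\<in>{..<j}. b j k) \<oplus> (\<Oplus>j\<in>{..Suc n}. \<Oplus>k\<in>{j..n}. b j k)"
    using bc by (intro finsum_addf) (auto intro!: finsum_closed)
  also have "(\<Oplus>j\<in>{..Suc n}. \<Oplus>k\<in>{..<j}. b j k) = (\<Oplus>j\<in>{..n}. \<Oplus>k\<in>{..j}. b (Suc j) k)"
    using bc by (subst finsum_Suc2) (simp_all add: lessThan_Suc_atMost finsum_closed Pi_iff)
  also have "(\<Oplus>j\<in>{..Suc n}. \<Oplus>k\<in>{j..n}. b j k) = (\<Oplus>j\<in>{..n}. \<Oplus>k\<in>{j..n}. b j k)"
    using bc by (subst finsum_Suc) (simp_all add: finsum_closed Pi_iff)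
  also have "\<dots> = (\<Oplus>j\<in>{..n}. \<Oplus>i\<in>{..n - j}. b j (j + i))"
  proof (rule finsum_cong')
    show "(\<Oplus>k\<in>{j..n}. b j k) = (\<Oplus>i\<in>{..n - j}. b j (j + i))" if "j \<in> {..n}" for j
    proof -
      have "{j..n} = (\<lambda>i. j + i) ` {..n - j}"
      proof (intro equalityI subsetI)
        fix k assume "k \<in> {j..n}"
        then show "k \<in> (\<lambda>i. j + i) ` {..n - j}" by (intro image_eqI[of _ _ "k - j"]) auto
      qed (use that in auto)
      then show ?thesis using bc by (simp add: finsum_reindex)
    qed
  qed (auto intro!: finsum_closed bc)
  also have "\<dots> = (\<Oplus>k\<in>{..n}. \<Oplus>i\<in>{..k}. b i (i + (k - i)))"
    using finsum_triangle_swap[of "\<lambda>j i. b j (j + i)" n] bc by simp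
  also have "\<dots> = (\<Oplus>k\<in>{..n}. \<Oplus>i\<in>{..k}. b i k)"
    using bc by (intro finsum_cong' refl) (auto intro!: finsum_closed finsum_cong')
  also have "(\<Oplus>j\<in>{..n}. \<Oplus>k\<in>{..j}. b (Suc j) k) \<oplus> (\<Oplus>k\<in>{..n}. \<Oplus>i\<in>{..k}. b i k) =
      (\<Oplus>j\<in>{..n}. (\<Oplus>k\<in>{..j}. b (Suc j) k) \<oplus> (\<Oplus>k\<in>{..j}. b k j))"
    using bc by (intro finsum_addf[symmetric]) (auto intro!: finsum_closed)
  also have "\<dots> = (\<Oplus>j\<in>{..n}. \<zero>)"
  proof (rule finsum_cong')
    show "(\<Oplus>k\<in>{..j}. b (Suc j) k) \<oplus> (\<Oplus>k\<in>{..j}. b k j) = \<zero>" if "j \<in> {..n}" for j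
    proof -
      have "(\<Oplus>k\<in>{..j}. b (Suc j) k) \<oplus> (\<Oplus>k\<in>{..j}. b k j) = (\<Oplus>k\<in>{..j}. b (Suc j) k \<oplus> b k j)"
        using bc by (intro finsum_addf[symmetric]) auto
      also have "\<dots> = (\<Oplus>k\<in>{..j}. \<zero>)" using cancel that bc by (intro finsum_cong') auto
      finally show ?thesis by simp
    qed
  qed auto
  finally show ?thesis by simp
qed

section \<open>Index tuples and complexes cut off in negative degrees\<close>

lemma omit_nth_simps [simp]: "omit_nth 0 (x # xs) = xs" "omit_nth (Suc j) (x # xs) = x # omit_nth j xs"
  by (simp_all add: omit_nth_def)

lemma omit_nth_append1: "j < length us \<Longrightarrow> omit_nth j (us @ vs) = omit_nth j us @ vs"
  by (simp add: omit_nth_def)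

lemma omit_nth_append2: "omit_nth (length us + j) (us @ vs) = us @ omit_nth j vs"
  by (simp add: omit_nth_def)

lemma omit_nth_middle [simp]: "omit_nth (length us) (us @ b # vs) = us @ vs"
  using omit_nth_append2[of us 0 "b # vs"] by simp

text \<open>The simplicial identity for omissions; it supplies the symmetry required by
  \<open>alternating_double_sum\<close>.\<close>

lemma omit_nth_omit_nth:
  "j \<le> k \<Longrightarrow> Suc k < length xs \<Longrightarrow> omit_nth k (omit_nth j xs) = omit_nth j (omit_nth (Suc k) xs)"
proof (induction j arbitrary: k xs)
  case 0
  then show ?case by (cases xs) auto
next
  case (Suc j)
  then obtain x ys k' where "xs = x # ys" "k = Suc k'" by (cases xs; cases k) auto
  with Suc show ?case by simp
qed

lemma set_omit_nth: "set (omit_nth j xs) \<subseteq> set xs"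
  unfolding omit_nth_def using set_take_subset set_drop_subset by fastforce

lemma incr_tuples_decomp:
  assumes "xs \<in> incr_tuples L A p" "j \<le> p"
  obtains us b vs where "xs = us @ b # vs" "length us = j" "omit_nth j xs = us @ vs"
proof -
  have "j < length xs" using assms by (simp add: incr_tuples_def)
  from id_take_nth_drop[OF this] \<open>j < length xs\<close> show thesis
    by (intro that[of "take j xs" "xs ! j" "drop (Suc j) xs"]) (simp_all add: omit_nth_def)
qed

lemma omit_nth_incr: "xs \<in> incr_tuples L A (Suc p) \<Longrightarrow> j \<le> Suc p \<Longrightarrow> omit_nth j xs \<in> incr_tuples L A p"
proof -
  assume xs: "xs \<in> incr_tuples L A (Suc p)" and j: "j \<le> Suc p"
  then obtain us b vs where "xs = us @ b # vs" "length us = j" "omit_nth j xs = us @ vs"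
    by (rule incr_tuples_decomp)
  with xs show ?thesis by (auto simp: incr_tuples_def sorted_wrt_append)
qed

lemma cover_int_mono: "set ys \<subseteq> set xs \<Longrightarrow> cover_int U xs \<subseteq> cover_int U ys"
  by (auto simp: cover_int_def)

text \<open>Extends a complex indexed by natural numbers to the integers: in negative degrees only
  the carrier is cut down to zero while the operations stay, so the horizontal maps need no case
  distinction.\<close>

definition trunc_mod :: "('r, 'm) module \<Rightarrow> bool \<Rightarrow> ('r, 'm) module" where
  "trunc_mod M b = M\<lparr>carrier := if b then carrier M else {\<zero>\<^bsub>M\<^esub>}\<rparr>"

lemma trunc_mod_simps [simp]:
  "zero (trunc_mod M b) = zero M" "add (trunc_mod M b) = add M" "smult (trunc_mod M b) = smult M"
  "carrier (trunc_mod M True) = carrier M" "carrier (trunc_mod M False) = {\<zero>\<^bsub>M\<^esub>}"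
  "trunc_mod M True = M"
  by (simp_all add: trunc_mod_def)

lemma submodule_zero_singleton: "module R M \<Longrightarrow> submodule {\<zero>\<^bsub>M\<^esub>} R M"
proof -
  assume "module R M"
  then interpret M: module R M .
  show ?thesis by (intro M.submoduleI) auto
qed

lemma module_trunc_mod: "module R M \<Longrightarrow> module R (trunc_mod M b)"
  using module_restrict[OF submodule_zero_singleton] by (cases b) (auto simp: trunc_mod_def)

lemma trunc_mod_carrier: "module R M \<Longrightarrow> x \<in> carrier (trunc_mod M b) \<Longrightarrow> x \<in> carrier M"
  using submodule_zero[OF module.carrier_is_submodule] by (cases b) auto

lemma mod_hom_trunc:
  assumes "module R M" "module R N" "mod_hom R M N h" "b \<Longrightarrow> b'"
  shows "mod_hom R (trunc_mod M b) (trunc_mod N b') h"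
proof -
  have z: "h \<zero>\<^bsub>M\<^esub> = \<zero>\<^bsub>N\<^esub>" by (rule mod_hom_zero[OF assms(1-3)])
  show ?thesis
  proof (rule mod_homI)
    show "h x \<in> carrier (trunc_mod N b')" if "x \<in> carrier (trunc_mod M b)" for x
      using that assms(4) mod_hom_closed[OF assms(3)] z submodule_zero[OF module.carrier_is_submodule[OF assms(2)]]
      by (cases b; cases b') auto
  qed (use trunc_mod_carrier[OF assms(1)] mod_hom_add[OF assms(3)] mod_hom_smult[OF assms(3)] in auto)
qed

section \<open>Rows and columns of the double complex in one filtration degree\<close>

locale cech_level =
  fixes R :: "('r, 'z) ring_scheme" and X :: "'x topology" and f :: "'x \<Rightarrow> 'y"
    and A :: "'a set" and L :: "('a \<times> 'a) set" and U :: "'a \<Rightarrow> 'y set" and K :: "'x set"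
  assumes ring: "cring R"
    and order: "linear_order_on A L"
    and preimage_open: "\<And>a. a \<in> A \<Longrightarrow> openin X {x \<in> topspace X. f x \<in> U a}"
    and preimage_cover: "\<And>x. x \<in> topspace X \<Longrightarrow> \<exists>a\<in>A. f x \<in> U a"
begin

sublocale R: cring R by (rule ring)

abbreviation "I \<equiv> incr_tuples L A"
abbreviation "TT xs \<equiv> subtopology X (K \<inter> f -` cover_int U xs)"
abbreviation "Ch q xs \<equiv> singular_chain_set q (TT xs)"
abbreviation "CC q xs \<equiv> cochain_mod R q (TT xs)"
abbreviation "S \<equiv> self_mod R"

sublocale S: module R S by (rule module_self_mod[OF ring])

lemma sg_S_closed [simp]: "x \<in> carrier R \<Longrightarrow> sg S p x \<in> carrier R"
  using S.sg_closed[of x p] by simp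

definition P :: "nat \<Rightarrow> nat \<Rightarrow> ('r, 'a list \<Rightarrow> 'x chain \<Rightarrow> 'r) module" where
  "P p q = prod_mod (I p) (CC q)"

definition dl :: "nat \<Rightarrow> nat \<Rightarrow> ('a list \<Rightarrow> 'x chain \<Rightarrow> 'r) \<Rightarrow> 'a list \<Rightarrow> 'x chain \<Rightarrow> 'r" where
  "dl p q w = (\<lambda>xs\<in>I (Suc p). \<Oplus>\<^bsub>CC q xs\<^esub>j\<in>{..Suc p}.
    sg (CC q xs) j (restrict (w (omit_nth j xs)) (Ch q xs)))"

definition dv :: "nat \<Rightarrow> nat \<Rightarrow> ('a list \<Rightarrow> 'x chain \<Rightarrow> 'r) \<Rightarrow> 'a list \<Rightarrow> 'x chain \<Rightarrow> 'r" where
  "dv p q w = (\<lambda>xs\<in>I p. coboundary_map q (TT xs) (w xs))"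

lemma module_CC: "module R (CC q xs)"
  by (rule R.module_cochain_mod)

lemma module_P: "module R (P p q)"
  unfolding P_def by (intro module_prod_mod ring module_CC)

lemma P_closed: "w \<in> carrier (P p q) \<Longrightarrow> xs \<in> I p \<Longrightarrow> w xs \<in> carrier (CC q xs)"
  by (auto simp: P_def prod_mod_simps)

lemma P_ext: "w \<in> carrier (P p q) \<Longrightarrow> w \<in> extensional (I p)"
  by (auto simp: P_def prod_mod_simps PiE_def)

lemma P_eqI: "v \<in> carrier (P p q) \<Longrightarrow> w \<in> carrier (P p q) \<Longrightarrow> (\<And>xs. xs \<in> I p \<Longrightarrow> v xs = w xs) \<Longrightarrow> v = w"
  by (rule extensionalityI[OF P_ext P_ext])

lemma P_zero: "xs \<in> I p \<Longrightarrow> \<zero>\<^bsub>P p q\<^esub> xs = \<zero>\<^bsub>CC q xs\<^esub>"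
  by (simp add: P_def prod_mod_simps)

lemma zero_P: "\<zero>\<^bsub>P p q\<^esub> \<in> carrier (P p q)"
  by (rule submodule_zero[OF module.carrier_is_submodule[OF module_P]])

lemma chain_mono: "set ys \<subseteq> set xs \<Longrightarrow> singular_chain q (TT xs) c \<Longrightarrow> singular_chain q (TT ys) c"
  by (erule singular_chain_mono) (use cover_int_mono[of ys xs U] in blast)

lemma chain_omit: "singular_chain q (TT xs) c \<Longrightarrow> singular_chain q (TT (omit_nth j xs)) c"
  by (rule chain_mono[OF set_omit_nth])

text \<open>The empty intersection is the whole type, so \<open>TT []\<close> stands for the
  subspace \<open>K\<close> itself.\<close>

lemma simplex_TT:
  "singular_simplex q (TT xs) s \<longleftrightarrow> singular_simplex q (TT []) s \<and> (\<forall>a\<in>set xs. f ` s ` standard_simplex q \<subseteq> U a)"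
  by (auto simp: singular_simplex_subtopology cover_int_def image_subset_iff)

lemma simplex_insert:
  "singular_simplex q (TT (us @ vs)) s \<Longrightarrow> f ` s ` standard_simplex q \<subseteq> U b \<Longrightarrow>
    singular_simplex q (TT (us @ b # vs)) s"
  unfolding simplex_TT[of q "us @ vs"] simplex_TT[of q "us @ b # vs"] by simp

lemma hom_omit: "xs \<in> I (Suc p) \<Longrightarrow> j \<le> Suc p \<Longrightarrow>
    mod_hom R (P p q) (CC q xs) (\<lambda>w. restrict (w (omit_nth j xs)) (Ch q xs))"
proof -
  assume "xs \<in> I (Suc p)" "j \<le> Suc p"
  then have "mod_hom R (P p q) (CC q (omit_nth j xs)) (\<lambda>w. w (omit_nth j xs))"
    unfolding P_def by (intro mod_hom_proj omit_nth_incr)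
  from mod_hom_comp[OF this R.mod_hom_cochain_restrict[OF chain_omit]] show ?thesis .
qed

lemma hom_dl: "mod_hom R (P p q) (P (Suc p) q) (dl p q)"
  unfolding P_def[of "Suc p"] dl_def
  by (intro mod_hom_prodI mod_hom_sum mod_hom_sg module_P module_CC hom_omit) auto

lemma hom_dv: "mod_hom R (P p q) (P p (Suc q)) (dv p q)"
proof -
  have "mod_hom R (P p q) (CC (Suc q) xs) (\<lambda>w. coboundary_map q (TT xs) (w xs))" if "xs \<in> I p" for xs
    unfolding P_def by (rule mod_hom_comp[OF mod_hom_proj[OF that] R.mod_hom_coboundary])
  then show ?thesis unfolding P_def[of p "Suc q"] dv_def[abs_def] by (rule mod_hom_prodI)
qed

text \<open>Evaluation at a chain is linear, so an identity of Cech cochains becomes an identity of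
  alternating sums in \<open>R\<close>.\<close>

lemma dl_eval:
  assumes w: "w \<in> carrier (P p q)" and xs: "xs \<in> I (Suc p)" and c: "singular_chain q (TT xs) c"
  shows "dl p q w xs c = (\<Oplus>\<^bsub>S\<^esub>j\<in>{..Suc p}. sg S j (w (omit_nth j xs) c))"
proof -
  have rc: "restrict (w (omit_nth j xs)) (Ch q xs) \<in> carrier (CC q xs)" if "j \<le> Suc p" for j
    by (rule mod_hom_closed[OF hom_omit[OF xs that] w])
  interpret C: module R "CC q xs" by (rule module_CC)
  have ev: "mod_hom R (CC q xs) S (\<lambda>u. u c)" by (rule R.mod_hom_eval[OF c])
  have "dl p q w xs c = (\<Oplus>\<^bsub>S\<^esub>j\<in>{..Suc p}. sg (CC q xs) j (restrict (w (omit_nth j xs)) (Ch q xs)) c)"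
    unfolding dl_def using xs rc by (simp only: restrict_apply' if_True) (rule mod_hom_finsum[OF module_CC S.module_axioms ev], auto)
  also have "\<dots> = (\<Oplus>\<^bsub>S\<^esub>j\<in>{..Suc p}. sg S j (w (omit_nth j xs) c))"
  proof (intro S.finsum_cong' refl)
    fix j assume j: "j \<in> {..Suc p}"
    then show "sg (CC q xs) j (restrict (w (omit_nth j xs)) (Ch q xs)) c = sg S j (w (omit_nth j xs) c)"
      using sg_hom[OF module_CC S.module_axioms ev rc, of j j] c by simp
  next
    show "(\<lambda>j. sg S j (w (omit_nth j xs) c)) \<in> {..Suc p} \<rightarrow> carrier S"
      using cochain_closed[OF P_closed[OF w omit_nth_incr[OF xs]] chain_omit[OF c]] by (intro Pi_I S.sg_closed) simp
  qed
  finally show ?thesis .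
qed

lemma dl_closed: "w \<in> carrier (P p q) \<Longrightarrow> dl p q w \<in> carrier (P (Suc p) q)"
  by (rule mod_hom_closed[OF hom_dl])

lemma dl_dl:
  assumes w: "w \<in> carrier (P p q)"
  shows "dl (Suc p) q (dl p q w) = \<zero>\<^bsub>P (Suc (Suc p)) q\<^esub>"
proof (rule P_eqI[OF dl_closed[OF dl_closed[OF w]] zero_P])
  fix xs assume xs: "xs \<in> I (Suc (Suc p))"
  interpret C: module R "CC q xs" by (rule module_CC)
  show "dl (Suc p) q (dl p q w) xs = \<zero>\<^bsub>P (Suc (Suc p)) q\<^esub> xs"
    unfolding P_zero[OF xs]
  proof (rule R.cochain_eqI[OF P_closed[OF dl_closed[OF dl_closed[OF w]] xs] C.zero_closed])
    fix s assume "singular_simplex q (TT xs) s"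
    then have c: "singular_chain q (TT xs) (frag_of s)" by (simp add: singular_chain_of)
    have len: "length xs = Suc (Suc (Suc p))" using xs by (simp add: incr_tuples_def)
    let ?a = "\<lambda>j k. w (omit_nth k (omit_nth j xs)) (frag_of s)"
    have "dl (Suc p) q (dl p q w) xs (frag_of s) =
        (\<Oplus>\<^bsub>S\<^esub>j\<in>{..Suc (Suc p)}. sg S j (\<Oplus>\<^bsub>S\<^esub>k\<in>{..Suc p}. sg S k (?a j k)))"
      unfolding dl_eval[OF dl_closed[OF w] xs c]
    proof (intro S.finsum_cong' refl)
      fix j assume j: "j \<in> {..Suc (Suc p)}"
      then show "sg S j (dl p q w (omit_nth j xs) (frag_of s)) = sg S j (\<Oplus>\<^bsub>S\<^esub>k\<in>{..Suc p}. sg S k (?a j k))"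
        using dl_eval[OF w omit_nth_incr[OF xs] chain_omit[OF c]] by simp
    next
      have ac: "?a j k \<in> carrier S" if "j \<le> Suc (Suc p)" "k \<le> Suc p" for j k
        using cochain_closed[OF P_closed[OF w omit_nth_incr[OF omit_nth_incr[OF xs that(1)] that(2)]] chain_omit[OF chain_omit[OF c]]]
        by simp
      show "(\<lambda>j. sg S j (\<Oplus>\<^bsub>S\<^esub>k\<in>{..Suc p}. sg S k (?a j k))) \<in> {..Suc (Suc p)} \<rightarrow> carrier S"
        using ac by (intro Pi_I S.sg_closed S.finsum_closed) auto
    qed
    also have "\<dots> = \<zero>\<^bsub>S\<^esub>"
    proof (rule S.alternating_double_sum)
      show "?a j k \<in> carrier S" if "j \<le> Suc (Suc p)" "k \<le> Suc p" for j k
        using cochain_closed[OF P_closed[OF w omit_nth_incr[OF omit_nth_incr[OF xs that(1)] that(2)]] chain_omit[OF chain_omit[OF c]]]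
        by simp
      show "?a j k = ?a (Suc k) j" if "j \<le> k" "k \<le> Suc p" for j k
        using omit_nth_omit_nth[OF that(1), of xs] that(2) len by simp
    qed
    also have "\<dots> = \<zero>\<^bsub>CC q xs\<^esub> (frag_of s)" using c by (simp add: cochain_mod_ops)
    finally show "dl (Suc p) q (dl p q w) xs (frag_of s) = \<zero>\<^bsub>CC q xs\<^esub> (frag_of s)" .
  qed
qed

lemma dv_dv: "w \<in> carrier (P p q) \<Longrightarrow> dv p (Suc q) (dv p q w) = \<zero>\<^bsub>P p (Suc (Suc q))\<^esub>"
  by (rule P_eqI[OF mod_hom_closed[OF hom_dv mod_hom_closed[OF hom_dv]] zero_P])
     (simp_all add: P_zero dv_def R.coboundary_coboundary[OF P_closed])

lemma dl_dv:
  assumes w: "w \<in> carrier (P p q)"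
  shows "dl p (Suc q) (dv p q w) = dv (Suc p) q (dl p q w)"
proof (rule P_eqI[OF dl_closed[OF mod_hom_closed[OF hom_dv w]] mod_hom_closed[OF hom_dv dl_closed[OF w]]])
  fix xs assume xs: "xs \<in> I (Suc p)"
  interpret C: module R "CC (Suc q) xs" by (rule module_CC)
  let ?r = "\<lambda>j. restrict (w (omit_nth j xs)) (Ch q xs)"
  have rc: "?r j \<in> carrier (CC q xs)" if "j \<le> Suc p" for j
    by (rule mod_hom_closed[OF hom_omit[OF xs that] w])
  interpret C0: module R "CC q xs" by (rule module_CC)
  have "dl p (Suc q) (dv p q w) xs = (\<Oplus>\<^bsub>CC (Suc q) xs\<^esub>j\<in>{..Suc p}. coboundary_map q (TT xs) (sg (CC q xs) j (?r j)))"
    unfolding dl_def using xs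
  proof (simp only: restrict_apply' if_True, intro C.finsum_cong' refl)
    fix j assume j: "j \<in> {..Suc p}"
    then have o: "omit_nth j xs \<in> I p" using omit_nth_incr[OF xs] by simp
    have "restrict (dv p q w (omit_nth j xs)) (Ch (Suc q) xs) = coboundary_map q (TT xs) (?r j)"
      unfolding dv_def using o coboundary_restrict[of "TT xs" "TT (omit_nth j xs)" q "w (omit_nth j xs)"] chain_omit
      by simp
    then show "sg (CC (Suc q) xs) j (restrict (dv p q w (omit_nth j xs)) (Ch (Suc q) xs)) =
        coboundary_map q (TT xs) (sg (CC q xs) j (?r j))"
      using sg_hom[OF module_CC module_CC R.mod_hom_coboundary rc, of j j] j by simp
  next
    show "(\<lambda>j. coboundary_map q (TT xs) (sg (CC q xs) j (?r j))) \<in> {..Suc p} \<rightarrow> carrier (CC (Suc q) xs)"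
      using rc by (intro Pi_I mod_hom_closed[OF R.mod_hom_coboundary] C0.sg_closed) simp
  qed
  also have "\<dots> = coboundary_map q (TT xs) (\<Oplus>\<^bsub>CC q xs\<^esub>j\<in>{..Suc p}. sg (CC q xs) j (?r j))"
    using rc by (intro mod_hom_finsum[OF module_CC module_CC R.mod_hom_coboundary, symmetric]) auto
  finally show "dl p (Suc q) (dv p q w) xs = dv (Suc p) q (dl p q w) xs"
    using xs by (simp add: dv_def dl_def)
qed

text \<open>Every simplex of an intersection lies in a chosen member \<open>U \<beta>\<close> of the cover; prefixing the
  index \<open>\<beta>\<close> to a tuple contracts the rows.\<close>

lemma insert_index:
  assumes "xs \<in> I p" "b \<in> A" "b \<notin> set xs"
  shows "\<exists>us vs. xs = us @ vs \<and> us @ b # vs \<in> I (Suc p)"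
proof -
  let ?lt = "\<lambda>a b. (a, b) \<in> L \<and> a \<noteq> b"
  have "\<exists>us vs. xs = us @ vs \<and> sorted_wrt ?lt (us @ b # vs)"
    if "sorted_wrt ?lt xs" "set xs \<subseteq> A" "b \<notin> set xs" for xs
    using that
  proof (induction xs)
    case Nil
    show ?case by simp
  next
    case (Cons x xs)
    show ?case
    proof (cases "(b, x) \<in> L")
      case True
      have tr: "trans L" using order by (simp add: order_on_defs)
      have "(b, y) \<in> L" if "y \<in> set (x # xs)" for y
        using that True Cons.prems(1) transD[OF tr, of b x y] by auto
      moreover have "b \<noteq> y" if "y \<in> set (x # xs)" for y using that Cons.prems(3) by blast
      ultimately have "sorted_wrt ?lt (b # x # xs)" using Cons.prems(1) by simp
      then show ?thesis by (intro exI[of _ "[]"] exI[of _ "x # xs"]) simp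
    next
      case False
      then have xb: "?lt x b" using Cons.prems assms(2) order by (auto simp: order_on_defs total_on_def)
      from Cons obtain us vs where uv: "xs = us @ vs" "sorted_wrt ?lt (us @ b # vs)" by auto
      have "sorted_wrt ?lt ((x # us) @ b # vs)" using uv xb Cons.prems by auto
      with uv show ?thesis by (intro exI[of _ "x # us"] exI[of _ vs]) simp
    qed
  qed
  from this[of xs] assms obtain us vs where "xs = us @ vs" "sorted_wrt ?lt (us @ b # vs)"
    by (auto simp: incr_tuples_def)
  then show ?thesis
    using assms by (intro exI[of _ us] exI[of _ vs]) (simp add: incr_tuples_def)
qed

text \<open>The entries before \<open>b\<close> in an increasing tuple are exactly those smaller
  than \<open>b\<close>, so the insertion point can be computed with
  \<open>takeWhile\<close>.\<close>

lemma insert_index_unique: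
  assumes "us @ b # vs \<in> I p"
  shows "takeWhile (\<lambda>a. (a, b) \<in> L \<and> a \<noteq> b) (us @ vs) = us" "dropWhile (\<lambda>a. (a, b) \<in> L \<and> a \<noteq> b) (us @ vs) = vs"
    "b \<notin> set (us @ vs)"
proof -
  have us: "\<forall>a\<in>set us. (a, b) \<in> L \<and> a \<noteq> b" and vs: "\<forall>a\<in>set vs. (b, a) \<in> L \<and> b \<noteq> a"
    using assms by (auto simp: incr_tuples_def sorted_wrt_append)
  have "antisym L" using order by (simp add: order_on_defs)
  then have vs': "\<forall>a\<in>set vs. \<not> ((a, b) \<in> L \<and> a \<noteq> b)" using vs by (auto dest: antisymD)
  show "b \<notin> set (us @ vs)" using us vs by auto
  have "takeWhile (\<lambda>a. (a, b) \<in> L \<and> a \<noteq> b) vs = []" "dropWhile (\<lambda>a. (a, b) \<in> L \<and> a \<noteq> b) vs = vs"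
    using vs' by (cases vs; simp)+
  with us show "takeWhile (\<lambda>a. (a, b) \<in> L \<and> a \<noteq> b) (us @ vs) = us"
    "dropWhile (\<lambda>a. (a, b) \<in> L \<and> a \<noteq> b) (us @ vs) = vs"
    by (simp_all add: takeWhile_append2 dropWhile_append2)
qed

text \<open>The index depends on the simplex alone and not on a tuple; this is what makes the
  contractions at different tuples fit together.\<close>

definition choice :: "nat \<Rightarrow> ((nat \<Rightarrow> real) \<Rightarrow> 'x) \<Rightarrow> 'a" where
  "choice q s = (SOME a. a \<in> A \<and> f ` s ` standard_simplex q \<subseteq> U a)"

lemma choice:
  assumes "a \<in> A" "f ` s ` standard_simplex q \<subseteq> U a"
  shows "choice q s \<in> A" "f ` s ` standard_simplex q \<subseteq> U (choice q s)"
  using someI[of "\<lambda>a. a \<in> A \<and> f ` s ` standard_simplex q \<subseteq> U a" a] assms by (auto simp: choice_def)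

text \<open>The value of \<open>w\<close> at the tuple with \<open>b\<close> in front, for
  \<open>w\<close> thought of as alternating: sorting \<open>b\<close> into place costs the sign of
  its position, and a repeated index gives zero.\<close>

definition contraction :: "nat \<Rightarrow> ('a list \<Rightarrow> 'x chain \<Rightarrow> 'r) \<Rightarrow> 'a list \<Rightarrow> ((nat \<Rightarrow> real) \<Rightarrow> 'x) \<Rightarrow> 'r" where
  "contraction q w xs s = (let b = choice q s; lt = (\<lambda>a. (a, b) \<in> L \<and> a \<noteq> b) in
    if b \<in> set xs then \<zero>\<^bsub>S\<^esub>
    else sg S (length (takeWhile lt xs)) (w (takeWhile lt xs @ b # dropWhile lt xs) (frag_of s)))"

lemma contraction_insert:
  assumes "us @ choice q s # vs \<in> I p"
  shows "contraction q w (us @ vs) s = sg S (length us) (w (us @ choice q s # vs) (frag_of s))"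
  using insert_index_unique[OF assms] by (simp add: contraction_def Let_def)

text \<open>On a simplex with chosen index b the values are compared at a tuple \<open>ys\<close>.
  If b occurs in \<open>ys\<close>, every omission other than that of b leaves b in the tuple and
  contributes zero, and the omission of b gives back \<open>w ys\<close>. If b does not occur, the
  cocycle condition at the tuple with b inserted expresses \<open>w ys\<close> by the remaining
  terms, which form the differential of the contraction.\<close>

lemma row_exact:
  assumes w: "w \<in> carrier (P (Suc p) q)" and dw: "dl (Suc p) q w = \<zero>\<^bsub>P (Suc (Suc p)) q\<^esub>"
  shows "\<exists>v\<in>carrier (P p q). w = dl p q v"
proof -
  have ch: "choice q s \<in> A" "f ` s ` standard_simplex q \<subseteq> U (choice q s)"
    if xs: "xs \<in> I n" and s: "singular_simplex q (TT xs) s" for xs s n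
  proof -
    \<comment> \<open>Tuples are nonempty, so a simplex of the intersection lies in some member of
      the cover and \<open>choice\<close> applies.\<close>
    have "xs \<noteq> []" using xs by (auto simp: incr_tuples_def)
    then obtain a where "a \<in> set xs" by (cases xs) auto
    then have "a \<in> A" "f ` s ` standard_simplex q \<subseteq> U a" using xs s simplex_TT[of q xs s] by (auto simp: incr_tuples_def)
    then show "choice q s \<in> A" "f ` s ` standard_simplex q \<subseteq> U (choice q s)" by (rule choice)+
  qed
  have contr_closed: "contraction q w xs s \<in> carrier R" if xs: "xs \<in> I p" and s: "singular_simplex q (TT xs) s" for xs s
  proof (cases "choice q s \<in> set xs")
    case True
    then show ?thesis by (simp add: contraction_def Let_def)
  next
    case False
    from insert_index[OF xs ch(1)[OF xs s] False] obtain us vs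
      where uv: "xs = us @ vs" "us @ choice q s # vs \<in> I (Suc p)" by blast
    have "singular_simplex q (TT (us @ choice q s # vs)) s"
      using s[unfolded uv(1)] ch(2)[OF xs s] by (rule simplex_insert)
    then have "w (us @ choice q s # vs) (frag_of s) \<in> carrier S"
      using cochain_closed[OF P_closed[OF w uv(2)]] by (simp add: singular_chain_of)
    then have "sg S (length us) (w (us @ choice q s # vs) (frag_of s)) \<in> carrier S" by (rule S.sg_closed)
    then show ?thesis unfolding uv(1) contraction_insert[OF uv(2)] by simp
  qed
  have "\<forall>xs\<in>I p. \<exists>u. u \<in> carrier (CC q xs) \<and> (\<forall>s. singular_simplex q (TT xs) s \<longrightarrow> u (frag_of s) = contraction q w xs s)"
    using R.cochain_exists[of q _ "contraction q w _"] contr_closed by blast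
  from bchoice[OF this] obtain v' where v': "\<And>xs. xs \<in> I p \<Longrightarrow> v' xs \<in> carrier (CC q xs)"
    "\<And>xs s. xs \<in> I p \<Longrightarrow> singular_simplex q (TT xs) s \<Longrightarrow> v' xs (frag_of s) = contraction q w xs s" by blast
  define v where "v = restrict v' (I p)"
  have v: "v \<in> carrier (P p q)" using v'(1) by (auto simp: v_def P_def prod_mod_simps)
  have veval: "v xs (frag_of s) = contraction q w xs s" if "xs \<in> I p" "singular_simplex q (TT xs) s" for xs s
    using v'(2)[OF that] that by (simp add: v_def)
  have "w = dl p q v"
  proof (rule P_eqI[OF w dl_closed[OF v]])
    fix ys assume ys: "ys \<in> I (Suc p)"
    show "w ys = dl p q v ys"
    proof (rule R.cochain_eqI[OF P_closed[OF w ys] P_closed[OF dl_closed[OF v] ys]])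
      fix s assume s: "singular_simplex q (TT ys) s"
      then have c: "singular_chain q (TT ys) (frag_of s)" by (simp add: singular_chain_of)
      let ?b = "choice q s" and ?c = "frag_of s"
      have wys: "w ys ?c \<in> carrier S" using cochain_closed[OF P_closed[OF w ys] c] by simp
      have so: "singular_simplex q (TT (omit_nth j ys)) s" for j
        using s set_omit_nth[of j ys] unfolding simplex_TT[of q ys s] simplex_TT[of q "omit_nth j ys" s] by blast
      have term_eq: "v (omit_nth j ys) ?c = contraction q w (omit_nth j ys) s" if "j \<le> Suc p" for j
        by (rule veval[OF omit_nth_incr[OF ys that] so])
      have dlv: "dl p q v ys ?c = (\<Oplus>\<^bsub>S\<^esub>j\<in>{..Suc p}. sg S j (contraction q w (omit_nth j ys) s))"
        unfolding dl_eval[OF v ys c]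
        using term_eq contr_closed[OF omit_nth_incr[OF ys] so]
        by (intro S.finsum_cong') (auto intro!: S.sg_closed)
      show "w ys ?c = dl p q v ys ?c"
      proof (cases "?b \<in> set ys")
        case True
        then obtain us vs where uv: "ys = us @ ?b # vs" by (meson split_list)
        have len: "length us \<le> Suc p" using ys uv by (auto simp: incr_tuples_def)
        have "sg S j (contraction q w (omit_nth j ys) s) = (if j = length us then w ys ?c else \<zero>\<^bsub>S\<^esub>)" if j: "j \<le> Suc p" for j
        proof (cases "j = length us")
          case True
          have "contraction q w (omit_nth j ys) s = sg S (length us) (w ys ?c)"
            using contraction_insert[OF ys[unfolded uv]] unfolding True uv by simp
          then show ?thesis using True wys by simp
        next
          case False
          have "?b \<in> set (omit_nth j ys)"
          proof (cases "j < length us")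
            case True
            then show ?thesis unfolding uv omit_nth_append1[OF True] by simp
          next
            case F2: False
            then obtain i where "j = length us + Suc i" using False by (metis add_Suc_right le_Suc_ex less_imp_Suc_add linorder_neqE_nat)
            then show ?thesis unfolding uv by (simp only: omit_nth_append2) simp
          qed
          then have "contraction q w (omit_nth j ys) s = \<zero>\<^bsub>S\<^esub>" by (simp add: contraction_def Let_def)
          then show ?thesis using False by (simp only: S.sg_zero if_False)
        qed
        then have "dl p q v ys ?c = (\<Oplus>\<^bsub>S\<^esub>j\<in>{..Suc p}. if j = length us then w ys ?c else \<zero>\<^bsub>S\<^esub>)"
          unfolding dlv using wys by (intro S.finsum_cong') auto
        also have "\<dots> = w ys ?c" using wys len by (intro S.finsum_extract[of "length us"]) auto
        finally show ?thesis ..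
      next
        case False
        from insert_index[OF ys ch(1)[OF ys s] False] obtain us vs
          where uv: "ys = us @ vs" and zs: "us @ ?b # vs \<in> I (Suc (Suc p))" by blast
        let ?zs = "us @ ?b # vs" and ?m = "length us"
        have sz: "singular_simplex q (TT ?zs) s"
          using s[unfolded uv] ch(2)[OF ys s] by (intro simplex_insert)
        then have cz: "singular_chain q (TT ?zs) ?c" by (simp add: singular_chain_of)
        have lenz: "length us + length vs = Suc (Suc p)" using ys uv by (simp add: incr_tuples_def)
        define t where "t j = sg S j (w (omit_nth j ?zs) ?c)" for j
        have wo: "w (omit_nth j ?zs) ?c \<in> carrier S" if "j \<le> Suc (Suc p)" for j
          using cochain_closed[OF P_closed[OF w omit_nth_incr[OF zs that]] chain_omit[OF cz]] by simp
        have tc: "t j \<in> carrier S" if "j \<le> Suc (Suc p)" for j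
          unfolding t_def using wo[OF that] by (rule S.sg_closed)
        have sum0: "(\<Oplus>\<^bsub>S\<^esub>j\<in>{..Suc (Suc p)}. t j) = \<zero>\<^bsub>S\<^esub>"
          using dl_eval[OF w zs cz] fun_cong[OF fun_cong[OF dw, of ?zs], of ?c] zs cz
          unfolding t_def by (simp add: P_zero cochain_mod_ops)
        \<comment> \<open>\<open>g\<close> enumerates the positions of the enlarged tuple other than
          that of the inserted index, in step with the positions of \<open>ys\<close>.\<close>
        define g where "g j = (if j < ?m then j else Suc j)" for j
        have m_le: "?m \<le> Suc (Suc p)" using lenz by simp
        have g_img: "{..Suc (Suc p)} = insert ?m (g ` {..Suc p})"
        proof (intro equalityI subsetI)
          fix j assume "j \<in> {..Suc (Suc p)}"
          then show "j \<in> insert ?m (g ` {..Suc p})"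
            using m_le by (cases "j < ?m"; cases "j = ?m")
              (auto simp: g_def intro!: image_eqI[of j _ "if j < ?m then j else j - 1"])
        qed (use m_le in \<open>auto simp: g_def\<close>)
        have g_notin: "?m \<notin> g ` {..Suc p}" by (auto simp: g_def)
        have g_inj: "inj_on g {..Suc p}" by (auto simp: inj_on_def g_def split: if_splits)
        have g_le: "g j \<le> Suc (Suc p)" if "j \<le> Suc p" for j using that by (simp add: g_def)
        have rest: "t ?m \<oplus>\<^bsub>S\<^esub> (\<Oplus>\<^bsub>S\<^esub>j\<in>{..Suc p}. t (g j)) = \<zero>\<^bsub>S\<^esub>"
        proof -
          have "(\<Oplus>\<^bsub>S\<^esub>j\<in>insert ?m (g ` {..Suc p}). t j) = t ?m \<oplus>\<^bsub>S\<^esub> (\<Oplus>\<^bsub>S\<^esub>j\<in>g ` {..Suc p}. t j)"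
            using tc m_le g_le g_notin by (intro S.finsum_insert) auto
          also have "(\<Oplus>\<^bsub>S\<^esub>j\<in>g ` {..Suc p}. t j) = (\<Oplus>\<^bsub>S\<^esub>j\<in>{..Suc p}. t (g j))"
            using tc g_le g_inj by (intro S.finsum_reindex) auto
          finally show ?thesis using sum0 unfolding g_img by simp
        qed
        \<comment> \<open>Omitting an entry before the inserted index moves that index to position
          \<open>?m - 1\<close>; omitting a later one shifts the omitted position by one instead.
          Either way the total sign changes by (-1)^(?m + 1).\<close>
        have term2: "sg S j (contraction q w (omit_nth j ys) s) = sg S (Suc ?m) (t (g j))" if j: "j \<le> Suc p" for j
        proof (cases "j < ?m")
          case True
          then have o: "omit_nth j ys = omit_nth j us @ vs" "omit_nth j ?zs = omit_nth j us @ ?b # vs"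
            unfolding uv by (simp_all add: omit_nth_append1)
          have l: "length (omit_nth j us) = ?m - 1" using True by (simp add: omit_nth_def)
          have "omit_nth j ?zs \<in> I (Suc p)" using omit_nth_incr[OF zs, of j] j by simp
          then have "contraction q w (omit_nth j ys) s = sg S (?m - 1) (w (omit_nth j ?zs) ?c)"
            using contraction_insert[of "omit_nth j us" q s vs "Suc p" w] unfolding o l by simp
          moreover have "sg S (?m - 1) x = sg S (Suc ?m) x" for x using True by (auto simp: sg_def)
          moreover have "g j = j" using True by (simp add: g_def)
          ultimately show ?thesis using S.sg_commute[OF wo[of j]] j by (simp add: t_def)
        next
          case False
          then obtain i where i: "j = ?m + i" using le_Suc_ex not_less by blast
          have o: "omit_nth j ys = us @ omit_nth i vs" "omit_nth (Suc j) ?zs = us @ ?b # omit_nth i vs"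
            unfolding uv i using omit_nth_append2[of us "Suc i" "?b # vs"] by (simp_all add: omit_nth_append2)
          have "omit_nth (Suc j) ?zs \<in> I (Suc p)" using omit_nth_incr[OF zs, of "Suc j"] j by simp
          then have "contraction q w (omit_nth j ys) s = sg S ?m (w (omit_nth (Suc j) ?zs) ?c)"
            using contraction_insert[of us q s "omit_nth i vs" "Suc p" w] unfolding o by simp
          moreover have "sg S j (sg S ?m x) = sg S (Suc ?m) (sg S (Suc j) x)" if "x \<in> carrier S" for x
            using that by (simp add: sg_def)
          moreover have "g j = Suc j" using False by (simp add: g_def)
          ultimately show ?thesis using wo[of "Suc j"] j by (simp add: t_def)
        qed
        have "dl p q v ys ?c = (\<Oplus>\<^bsub>S\<^esub>j\<in>{..Suc p}. sg S (Suc ?m) (t (g j)))"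
          unfolding dlv using term2 tc g_le by (intro S.finsum_cong') auto
        also have "\<dots> = sg S (Suc ?m) (\<Oplus>\<^bsub>S\<^esub>j\<in>{..Suc p}. t (g j))"
          using tc g_le by (intro S.sg_finsum[symmetric]) auto
        also have "(\<Oplus>\<^bsub>S\<^esub>j\<in>{..Suc p}. t (g j)) = \<ominus>\<^bsub>S\<^esub> t ?m"
        proof (rule S.add_eq_zero_imp)
          have sc: "(\<Oplus>\<^bsub>S\<^esub>j\<in>{..Suc p}. t (g j)) \<in> carrier S" using tc g_le by (intro S.finsum_closed) auto
          then show "(\<Oplus>\<^bsub>S\<^esub>j\<in>{..Suc p}. t (g j)) \<oplus>\<^bsub>S\<^esub> t ?m = \<zero>\<^bsub>S\<^esub>"
            using rest S.a_comm[OF sc tc[OF m_le]] by simp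
          show "(\<Oplus>\<^bsub>S\<^esub>j\<in>{..Suc p}. t (g j)) \<in> carrier S" by (rule sc)
        qed (rule tc[OF m_le])
        also have "sg S (Suc ?m) (\<ominus>\<^bsub>S\<^esub> t ?m) = sg S ?m (t ?m)"
          using tc[OF m_le] by (simp add: sg_def)
        also have "\<dots> = w ys ?c" unfolding t_def uv using wys uv by simp
        finally show ?thesis ..
      qed
    qed
  qed
  with v show ?thesis by blast
qed

end

section \<open>The augmented double complex of singular cochains\<close>

context cech_level
begin

definition C :: "nat \<Rightarrow> int \<Rightarrow> ('r, 'a list \<Rightarrow> 'x chain \<Rightarrow> 'r) module" where
  "C p q = trunc_mod (P p (nat q)) (0 \<le> q)"

definition del :: "nat \<Rightarrow> int \<Rightarrow> ('a list \<Rightarrow> 'x chain \<Rightarrow> 'r) \<Rightarrow> 'a list \<Rightarrow> 'x chain \<Rightarrow> 'r" where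
  "del p q = dl p (nat q)"

text \<open>In vertical degree -1 the formula \<open>dv p (nat q)\<close> would land in
  \<open>P p 1\<close>, since \<open>nat\<close> sends -1 to 0, whereas the target is
  \<open>P p 0\<close>. Negative degrees are therefore sent to zero explicitly.\<close>

definition ver :: "nat \<Rightarrow> int \<Rightarrow> ('a list \<Rightarrow> 'x chain \<Rightarrow> 'r) \<Rightarrow> 'a list \<Rightarrow> 'x chain \<Rightarrow> 'r" where
  "ver p q w = (if 0 \<le> q then dv p (nat q) w else \<zero>\<^bsub>P p (nat (q + 1))\<^esub>)"

abbreviation "base \<equiv> subtopology X K"

definition aug :: "nat \<Rightarrow> ('x chain \<Rightarrow> 'r) \<Rightarrow> 'a list \<Rightarrow> 'x chain \<Rightarrow> 'r" where
  "aug n u = (\<lambda>xs\<in>I 0. restrict u (Ch n xs))"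

lemma C_nonneg: "0 \<le> q \<Longrightarrow> C p q = P p (nat q)"
  by (simp add: C_def)

lemma C_int: "C p (int n) = P p n"
  by (simp add: C_def)

lemma C_zero: "\<zero>\<^bsub>C p q\<^esub> = \<zero>\<^bsub>P p (nat q)\<^esub>"
  by (simp add: C_def)

lemma module_C: "module R (C p q)"
  unfolding C_def by (intro module_trunc_mod module_P)

lemma C_closed: "x \<in> carrier (C p q) \<Longrightarrow> x \<in> carrier (P p (nat q))"
  unfolding C_def by (rule trunc_mod_carrier[OF module_P])

lemma dl_zero: "dl p q \<zero>\<^bsub>P p q\<^esub> = \<zero>\<^bsub>P (Suc p) q\<^esub>"
  by (rule mod_hom_zero[OF module_P module_P hom_dl])

lemma dv_zero: "dv p q \<zero>\<^bsub>P p q\<^esub> = \<zero>\<^bsub>P p (Suc q)\<^esub>"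
  by (rule mod_hom_zero[OF module_P module_P hom_dv])

lemma nat_plus: "0 \<le> q \<Longrightarrow> nat (q + 1) = Suc (nat q)" "0 \<le> q \<Longrightarrow> nat (q + 2) = Suc (Suc (nat q))"
  by simp_all

lemma double_complex_C: "double_complex R C del ver"
proof (rule double_complex.intro)
  show "mod_hom R (C p q) (C (Suc p) q) (del p q)" for p q
    unfolding C_def del_def by (intro mod_hom_trunc module_P hom_dl)
  show "mod_hom R (C p q) (C p (q + 1)) (ver p q)" for p q
  proof (cases "0 \<le> q")
    case True
    then have "ver p q = dv p (nat q)" by (simp add: ver_def fun_eq_iff)
    with True show ?thesis by (simp add: C_nonneg nat_plus hom_dv)
  next
    case False
    then have "ver p q = (\<lambda>_. \<zero>\<^bsub>C p (q + 1)\<^esub>)" by (simp add: ver_def fun_eq_iff C_zero)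
    then show ?thesis using mod_hom_const_zero[OF module_C module_C] by simp
  qed
  show "del (Suc p) q (del p q x) = \<zero>\<^bsub>C (Suc (Suc p)) q\<^esub>" if "x \<in> carrier (C p q)" for p q x
    unfolding del_def C_zero by (rule dl_dl[OF C_closed[OF that]])
  show "ver p (q + 1) (ver p q x) = \<zero>\<^bsub>C p (q + 2)\<^esub>" if x: "x \<in> carrier (C p q)" for p q x
  proof -
    consider "0 \<le> q" | "q = - 1" | "q < - 1" by linarith
    then show ?thesis
    proof cases
      case 1
      then show ?thesis using dv_dv[OF C_closed[OF x]] by (simp add: ver_def C_zero nat_plus)
    next
      case 2
      then show ?thesis using dv_zero[of p 0] by (simp add: ver_def C_zero)
    next
      case 3
      then show ?thesis by (simp add: ver_def C_zero)
    qed
  qed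
  show "del p (q + 1) (ver p q x) = ver (Suc p) q (del p q x)" if x: "x \<in> carrier (C p q)" for p q x
    using dl_dv[OF C_closed[OF x]] dl_zero by (auto simp: del_def ver_def nat_plus)
  show "carrier (C p q) = {\<zero>\<^bsub>C p q\<^esub>}" if "q < 0" for p q
    using that by (simp add: C_def)
qed (rule ring module_C)+

lemma chain_base: "singular_chain n (TT xs) c \<Longrightarrow> singular_chain n base c"
  by (erule singular_chain_mono) simp

lemma singleton_tuple: "xs \<in> I 0 \<longleftrightarrow> (\<exists>a\<in>A. xs = [a])"
  by (auto simp: incr_tuples_def length_Suc_conv)

lemma hom_aug: "mod_hom R (cochain_mod R n base) (P 0 n) (aug n)"
  unfolding P_def aug_def by (intro mod_hom_prodI R.mod_hom_cochain_restrict chain_base)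

lemma aug_dv: "aug (Suc n) (coboundary_map n base u) = dv 0 n (aug n u)"
proof
  fix xs
  show "aug (Suc n) (coboundary_map n base u) xs = dv 0 n (aug n u) xs"
    using coboundary_restrict[of "TT xs" base n u] chain_base by (simp add: aug_def dv_def restrict_def)
qed

text \<open>Both omissions from a pair restrict the same cochain \<open>u\<close> to the
  intersection, with opposite signs.\<close>

lemma dl_aug:
  assumes u: "u \<in> carrier (cochain_mod R n base)"
  shows "dl 0 n (aug n u) = \<zero>\<^bsub>P (Suc 0) n\<^esub>"
proof (rule P_eqI[OF dl_closed[OF mod_hom_closed[OF hom_aug u]] zero_P])
  fix xs assume xs: "xs \<in> I (Suc 0)"
  interpret C: module R "CC n xs" by (rule module_CC)
  have rc: "restrict u (Ch n xs) \<in> carrier (CC n xs)"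
    by (rule mod_hom_closed[OF R.mod_hom_cochain_restrict[OF chain_base] u])
  have "restrict (aug n u (omit_nth j xs)) (Ch n xs) = restrict u (Ch n xs)" if "j \<le> Suc 0" for j
    using omit_nth_incr[OF xs that] chain_omit[of n xs _ j] by (auto simp: aug_def fun_eq_iff restrict_def)
  then have "dl 0 n (aug n u) xs = (\<Oplus>\<^bsub>CC n xs\<^esub>j\<in>{..Suc 0}. sg (CC n xs) j (restrict u (Ch n xs)))"
    unfolding dl_def using xs rc by (simp only: restrict_apply' if_True) (intro C.finsum_cong', auto intro!: C.sg_closed)
  also have "\<dots> = sg (CC n xs) (Suc 0) (restrict u (Ch n xs)) \<oplus>\<^bsub>CC n xs\<^esub> sg (CC n xs) 0 (restrict u (Ch n xs))"
    using rc by (subst C.finsum_Suc) (simp_all add: C.sg_closed)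
  also have "\<dots> = \<zero>\<^bsub>CC n xs\<^esub>" using rc by (simp add: sg_def C.l_neg)
  finally show "dl 0 n (aug n u) xs = \<zero>\<^bsub>P (Suc 0) n\<^esub> xs" using P_zero[OF xs] by simp
qed

lemma pair_agree:
  assumes c: "c \<in> carrier (P 0 n)" and dc: "dl 0 n c = \<zero>\<^bsub>P (Suc 0) n\<^esub>"
    and xy: "[x, y] \<in> I (Suc 0)" and s: "singular_simplex n (TT [x, y]) s"
  shows "c [x] (frag_of s) = c [y] (frag_of s)"
proof -
  have ch: "singular_chain n (TT [x, y]) (frag_of s)" using s by (simp add: singular_chain_of)
  have xA: "[x] \<in> I 0" "[y] \<in> I 0" using xy by (auto simp: incr_tuples_def)
  have "singular_chain n (TT [x]) (frag_of s)" "singular_chain n (TT [y]) (frag_of s)"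
    using chain_mono[OF _ ch, of "[x]"] chain_mono[OF _ ch, of "[y]"] by simp_all
  then have cc: "c [x] (frag_of s) \<in> carrier S" "c [y] (frag_of s) \<in> carrier S"
    using cochain_closed[OF P_closed[OF c xA(1)]] cochain_closed[OF P_closed[OF c xA(2)]] by simp_all
  have "(\<Oplus>\<^bsub>S\<^esub>j\<in>{..Suc 0}. sg S j (c (omit_nth j [x, y]) (frag_of s))) = \<zero>\<^bsub>S\<^esub>"
    unfolding dl_eval[OF c xy ch, symmetric] dc P_zero[OF xy] using ch by (simp add: cochain_mod_ops)
  moreover have "(\<Oplus>\<^bsub>S\<^esub>j\<in>{..Suc 0}. sg S j (c (omit_nth j [x, y]) (frag_of s))) =
      sg S (Suc 0) (c [x] (frag_of s)) \<oplus>\<^bsub>S\<^esub> sg S 0 (c [y] (frag_of s))"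
  proof -
    have "(\<lambda>j. sg S j (c (omit_nth j [x, y]) (frag_of s))) \<in> {..Suc 0} \<rightarrow> carrier S"
    proof
      fix j assume "j \<in> {..Suc 0}"
      then consider "j = 0" | "j = Suc 0" by (cases j) auto
      then show "sg S j (c (omit_nth j [x, y]) (frag_of s)) \<in> carrier S" using cc by cases (simp_all only: omit_nth_simps S.sg_closed)
    qed
    moreover have "(\<Oplus>\<^bsub>S\<^esub>j\<in>{..0}. sg S j (c (omit_nth j [x, y]) (frag_of s))) =
        sg S 0 (c (omit_nth 0 [x, y]) (frag_of s))"
      using S.sg_closed[OF cc(2), of 0] by (intro S.finsum_0) simp
    ultimately show ?thesis by (simp only: S.finsum_Suc omit_nth_simps)
  qed
  ultimately have "sg S (Suc 0) (c [x] (frag_of s)) \<oplus>\<^bsub>S\<^esub> sg S 0 (c [y] (frag_of s)) = \<zero>\<^bsub>S\<^esub>" by simp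
  then have e: "\<ominus>\<^bsub>S\<^esub> c [x] (frag_of s) \<oplus>\<^bsub>S\<^esub> c [y] (frag_of s) = \<zero>\<^bsub>S\<^esub>" by (simp add: sg_def)
  have "c [y] (frag_of s) \<ominus>\<^bsub>S\<^esub> c [x] (frag_of s) = \<zero>\<^bsub>S\<^esub>"
    using e S.a_comm[OF S.a_inv_closed[OF cc(1)] cc(2)] by (simp add: a_minus_def)
  then show ?thesis using S.minus_eq_zero_iff[OF cc(2,1)] by simp
qed

text \<open>The cochain \<open>u\<close> is prescribed simplex by simplex: a simplex inside a member
  of the cover gets the value of \<open>c\<close> at the chosen index. By \<open>pair_agree\<close>
  any other member containing the simplex gives the same value, so \<open>u\<close> restricts to
  \<open>c\<close>.\<close>

lemma aug_exact:
  assumes c: "c \<in> carrier (P 0 n)" and dc: "dl 0 n c = \<zero>\<^bsub>P (Suc 0) n\<^esub>"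
  shows "\<exists>u\<in>carrier (cochain_mod R n base). aug n u = c"
proof -
  \<comment> \<open>The value zero on simplices that lie in no member of the cover is arbitrary; the
    augmentation does not see it.\<close>
  define g where "g s = (if choice n s \<in> A \<and> f ` s ` standard_simplex n \<subseteq> U (choice n s)
    then c [choice n s] (frag_of s) else \<zero>\<^bsub>R\<^esub>)" for s
  have base_TT: "singular_simplex n (TT [a]) s \<longleftrightarrow> singular_simplex n base s \<and> f ` s ` standard_simplex n \<subseteq> U a" for a s
    by (auto simp: singular_simplex_subtopology cover_int_def image_subset_iff)
  have "g s \<in> carrier R" if s: "singular_simplex n base s" for s
  proof (cases "choice n s \<in> A \<and> f ` s ` standard_simplex n \<subseteq> U (choice n s)")
    case True
    then have "[choice n s] \<in> I 0" "singular_chain n (TT [choice n s]) (frag_of s)"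
      using s base_TT[of "choice n s" s] by (auto simp: singleton_tuple singular_chain_of)
    then show ?thesis using True cochain_closed[OF P_closed[OF c]] by (simp add: g_def)
  next
    case False
    then have "g s = \<zero>\<^bsub>R\<^esub>" unfolding g_def by (rule if_not_P)
    then show ?thesis by simp
  qed
  from R.cochain_exists[of n base g, OF this] obtain u where u: "u \<in> carrier (cochain_mod R n base)"
    and ug: "\<And>s. singular_simplex n base s \<Longrightarrow> u (frag_of s) = g s" by blast
  have "aug n u = c"
  proof (rule P_eqI[OF mod_hom_closed[OF hom_aug u] c])
    fix xs assume xs: "xs \<in> I 0"
    then obtain a where a: "a \<in> A" "xs = [a]" by (auto simp: singleton_tuple)
    show "aug n u xs = c xs"
    proof (rule R.cochain_eqI[OF P_closed[OF mod_hom_closed[OF hom_aug u] xs] P_closed[OF c xs]])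
      fix s assume s: "singular_simplex n (TT xs) s"
      let ?b = "choice n s"
      have sa: "singular_simplex n base s" "f ` s ` standard_simplex n \<subseteq> U a"
        using s base_TT unfolding a(2) by blast+
      note b = choice[OF a(1) sa(2)]
      have "aug n u xs (frag_of s) = c [?b] (frag_of s)"
        using xs s b ug[OF sa(1)] by (simp add: aug_def g_def singular_chain_of)
      also have "\<dots> = c [a] (frag_of s)"
      proof (cases "?b = a")
        case False
        have sT: "singular_simplex n (TT [x, y]) s" if "{x, y} = {a, ?b}" for x y
        proof -
          have "x \<in> {a, ?b}" "y \<in> {a, ?b}" using that by blast+
          then show ?thesis
            using sa b(2) unfolding simplex_TT[of n "[x, y]"] by (auto simp: singular_simplex_subtopology cover_int_def)
        qed
        have "(a, ?b) \<in> L \<or> (?b, a) \<in> L"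
          using order a(1) b(1) False by (auto simp: order_on_defs total_on_def)
        then show ?thesis
        proof
          assume "(a, ?b) \<in> L"
          then have "[a, ?b] \<in> I (Suc 0)" using a(1) b(1) False by (auto simp: incr_tuples_def)
          from pair_agree[OF c dc this sT] show ?thesis by simp
        next
          assume "(?b, a) \<in> L"
          then have "[?b, a] \<in> I (Suc 0)" using a(1) b(1) False by (auto simp: incr_tuples_def)
          from pair_agree[OF c dc this sT] show ?thesis by auto
        qed
      qed simp
      finally show "aug n u xs (frag_of s) = c xs (frag_of s)" unfolding a(2) .
    qed
  qed
  with u show ?thesis by blast
qed

definition cov :: "'x set set" where
  "cov = (\<lambda>a. {x \<in> topspace X. f x \<in> U a} \<inter> K) ` A"

lemma open_cover_base: "open_cover base cov"
proof
  show "openin base V" if "V \<in> cov" for V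
    using that preimage_open by (auto simp: cov_def openin_subtopology)
  show "topspace base \<subseteq> \<Union>cov"
    using preimage_cover by (auto simp: cov_def)
qed

text \<open>Makes the members of \<open>cov\<close> and the one-element tuples name the same spaces,
  so that vanishing on small chains and vanishing of the augmentation can be compared.\<close>

lemma subtopology_cov: "subtopology base ({x \<in> topspace X. f x \<in> U a} \<inter> K) = TT [a]"
proof -
  have "K \<inter> ({x \<in> topspace X. f x \<in> U a} \<inter> K) = topspace X \<inter> (K \<inter> f -` cover_int U [a])"
    by (auto simp: cover_int_def)
  then show ?thesis by (simp only: subtopology_subtopology subtopology_restrict)
qed

lemma aug_zero_iff:
  "aug n u = \<zero>\<^bsub>P 0 n\<^esub> \<longleftrightarrow> (\<forall>V\<in>cov. \<forall>c. singular_chain n (subtopology base V) c \<longrightarrow> u c = \<zero>\<^bsub>R\<^esub>)"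
proof -
  have ext: "aug n u \<in> extensional (I 0)" by (simp add: aug_def)
  have "aug n u = \<zero>\<^bsub>P 0 n\<^esub> \<longleftrightarrow> (\<forall>xs\<in>I 0. aug n u xs = \<zero>\<^bsub>CC n xs\<^esub>)"
  proof
    show "\<forall>xs\<in>I 0. aug n u xs = \<zero>\<^bsub>CC n xs\<^esub>" if "aug n u = \<zero>\<^bsub>P 0 n\<^esub>"
      unfolding that by (simp add: P_zero)
    assume "\<forall>xs\<in>I 0. aug n u xs = \<zero>\<^bsub>CC n xs\<^esub>"
    then show "aug n u = \<zero>\<^bsub>P 0 n\<^esub>"
      by (intro extensionalityI[OF ext P_ext[OF zero_P]]) (simp add: P_zero)
  qed
  also have "\<dots> \<longleftrightarrow> (\<forall>xs\<in>I 0. \<forall>c. singular_chain n (TT xs) c \<longrightarrow> u c = \<zero>\<^bsub>R\<^esub>)"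
  proof (intro ball_cong refl)
    fix xs assume xs: "xs \<in> I 0"
    have "restrict u (Ch n xs) = \<zero>\<^bsub>CC n xs\<^esub> \<longleftrightarrow> (\<forall>c. singular_chain n (TT xs) c \<longrightarrow> u c = \<zero>\<^bsub>R\<^esub>)"
      by (auto simp: cochain_mod_def fun_eq_iff restrict_def split: if_splits)
    with xs show "aug n u xs = \<zero>\<^bsub>CC n xs\<^esub> \<longleftrightarrow> (\<forall>c. singular_chain n (TT xs) c \<longrightarrow> u c = \<zero>\<^bsub>R\<^esub>)"
      by (simp add: aug_def)
  qed
  also have "\<dots> \<longleftrightarrow> (\<forall>V\<in>cov. \<forall>c. singular_chain n (subtopology base V) c \<longrightarrow> u c = \<zero>\<^bsub>R\<^esub>)"
  proof -
    have "(\<forall>xs\<in>I 0. Q xs) \<longleftrightarrow> (\<forall>a\<in>A. Q [a])" for Q by (auto simp: singleton_tuple)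
    then show ?thesis unfolding cov_def ball_simps subtopology_cov .
  qed
  finally show ?thesis .
qed

theorem augmented_C:
  "augmented_double_complex R C del ver (\<lambda>n. cochain_mod R n base) (\<lambda>n. coboundary_map n base) aug"
proof (rule augmented_double_complex.intro[OF double_complex_C], rule augmented_double_complex_axioms.intro)
  interpret cov: open_cover base cov by (rule open_cover_base)
  show "mod_hom R (cochain_mod R n base) (C 0 (int n)) (aug n)" for n
    unfolding C_int by (rule hom_aug)
  show "aug (Suc n) (coboundary_map n base u) = ver 0 (int n) (aug n u)" for n u
    by (simp add: ver_def aug_dv)
  show "del 0 (int n) (aug n u) = \<zero>\<^bsub>C (Suc 0) (int n)\<^esub>" if "u \<in> carrier (cochain_mod R n base)" for n u
    using dl_aug[OF that] by (simp add: del_def C_int)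
  show "\<exists>b\<in>carrier (C k q). c = del k q b"
    if c: "c \<in> carrier (C (Suc k) q)" and dc: "del (Suc k) q c = \<zero>\<^bsub>C (Suc (Suc k)) q\<^esub>" for k q c
  proof (cases "0 \<le> q")
    case True
    then show ?thesis using row_exact[of c k "nat q"] c dc by (simp add: C_nonneg del_def)
  next
    case False
    then have "c = \<zero>\<^bsub>P (Suc k) (nat q)\<^esub>" using c by (simp add: C_def)
    then show ?thesis using False dl_zero[of k "nat q"] by (simp add: C_def del_def)
  qed
  show "\<exists>u\<in>carrier (cochain_mod R n base). aug n u = c"
    if "c \<in> carrier (C 0 (int n))" "del 0 (int n) c = \<zero>\<^bsub>C (Suc 0) (int n)\<^esub>" for n c
    using that aug_exact[of c n] by (simp add: C_int del_def)
  show "v = \<zero>\<^bsub>cochain_mod R 0 base\<^esub>" if v: "v \<in> carrier (cochain_mod R 0 base)" and z: "aug 0 v = \<zero>\<^bsub>C 0 0\<^esub>" for v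
    using z aug_zero_iff[of 0 v] by (intro cov.small_zero_cochain[OF ring v]) (simp add: C_def)
  show "\<exists>y\<in>carrier (cochain_mod R n base). aug n y = \<zero>\<^bsub>C 0 (int n)\<^esub> \<and> v = coboundary_map n base y"
    if v: "v \<in> carrier (cochain_mod R (Suc n) base)"
      and dv: "coboundary_map (Suc n) base v = \<zero>\<^bsub>cochain_mod R (Suc (Suc n)) base\<^esub>"
      and z: "aug (Suc n) v = \<zero>\<^bsub>C 0 (int (Suc n))\<^esub>" for n v
  proof -
    have "\<exists>y\<in>carrier (cochain_mod R n base). (\<forall>V\<in>cov. \<forall>c. singular_chain n (subtopology base V) c \<longrightarrow> y c = \<zero>\<^bsub>R\<^esub>) \<and>
        v = coboundary_map n base y"
    proof (rule cov.small_cocycle_is_coboundary[OF ring v dv])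
      fix V c assume "V \<in> cov" "singular_chain (Suc n) (subtopology base V) c"
      then show "v c = \<zero>\<^bsub>R\<^esub>" using z unfolding C_int aug_zero_iff by blast
    qed
    then obtain y where y: "y \<in> carrier (cochain_mod R n base)" "v = coboundary_map n base y"
        and van: "\<forall>V\<in>cov. \<forall>c. singular_chain n (subtopology base V) c \<longrightarrow> y c = \<zero>\<^bsub>R\<^esub>" by auto
    have "aug n y = \<zero>\<^bsub>C 0 (int n)\<^esub>" unfolding C_int aug_zero_iff by (rule van)
    with y show ?thesis by auto
  qed
qed (fact R.module_cochain_mod R.mod_hom_coboundary R.coboundary_coboundary)+

end

section \<open>Persistent cohomology of a filtered space\<close>

locale cech_persistence =
  fixes R :: "('r, 'z) ring_scheme" and X :: "'x topology" and f :: "'x \<Rightarrow> 'y"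
    and A :: "'a set" and L :: "('a \<times> 'a) set" and U :: "'a \<Rightarrow> 'y set" and K :: "int \<Rightarrow> 'x set"
  assumes level: "\<And>i. cech_level R X f A L U"
    and K_decr: "\<And>i. K (i + 1) \<subseteq> K i"
begin

sublocale lev: cech_level R X f A L U "K i" for i
  by (rule level)

abbreviation "I \<equiv> incr_tuples L A"
abbreviation "TT i xs \<equiv> subtopology X (K i \<inter> f -` cover_int U xs)"
abbreviation "Ch i q xs \<equiv> singular_chain_set q (TT i xs)"
abbreviation "CC i q xs \<equiv> cochain_mod R q (TT i xs)"

lemma chain_step: "singular_chain q (TT (i + 1) xs) c \<Longrightarrow> singular_chain q (TT i xs) c"
  by (erule singular_chain_mono) (use K_decr[of i] in blast)

lemma chain_step_base: "singular_chain q (subtopology X (K (i + 1))) c \<Longrightarrow> singular_chain q (subtopology X (K i)) c"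
  by (erule singular_chain_mono) (rule K_decr)

definition res_P :: "int \<Rightarrow> nat \<Rightarrow> nat \<Rightarrow> ('a list \<Rightarrow> 'x chain \<Rightarrow> 'r) \<Rightarrow> 'a list \<Rightarrow> 'x chain \<Rightarrow> 'r" where
  "res_P i p q w = (\<lambda>xs\<in>I p. restrict (w xs) (Ch (i + 1) q xs))"

lemma hom_res_CC: "mod_hom R (CC i q xs) (CC (i + 1) q xs) (\<lambda>u. restrict u (Ch (i + 1) q xs))"
  by (rule lev.R.mod_hom_cochain_restrict, rule chain_step)

lemma hom_res_P: "mod_hom R (lev.P i p q) (lev.P (i + 1) p q) (res_P i p q)"
proof -
  have "mod_hom R (lev.P i p q) (CC (i + 1) q xs) (\<lambda>w. restrict (w xs) (Ch (i + 1) q xs))" if "xs \<in> I p" for xs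
    unfolding lev.P_def by (rule mod_hom_comp[OF mod_hom_proj[OF that] hom_res_CC])
  then show ?thesis unfolding lev.P_def[of "i + 1"] res_P_def[abs_def] by (rule mod_hom_prodI)
qed

lemma res_P_dl:
  assumes w: "w \<in> carrier (lev.P i p q)"
  shows "res_P i (Suc p) q (lev.dl i p q w) = lev.dl (i + 1) p q (res_P i p q w)"
proof (rule lev.P_eqI[OF mod_hom_closed[OF hom_res_P lev.dl_closed[OF w]] lev.dl_closed[OF mod_hom_closed[OF hom_res_P w]]])
  fix xs assume xs: "xs \<in> I (Suc p)"
  let ?r = "\<lambda>j. restrict (w (omit_nth j xs)) (Ch i q xs)"
  have rc: "?r j \<in> carrier (CC i q xs)" if "j \<le> Suc p" for j
    by (rule mod_hom_closed[OF lev.hom_omit[OF xs that] w])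
  interpret C0: module R "CC i q xs" by (rule lev.module_CC)
  interpret C: module R "CC (i + 1) q xs" by (rule lev.module_CC)
  have "res_P i (Suc p) q (lev.dl i p q w) xs =
      restrict (\<Oplus>\<^bsub>CC i q xs\<^esub>j\<in>{..Suc p}. sg (CC i q xs) j (?r j)) (Ch (i + 1) q xs)"
    using xs by (simp add: res_P_def lev.dl_def)
  also have "\<dots> = (\<Oplus>\<^bsub>CC (i + 1) q xs\<^esub>j\<in>{..Suc p}. restrict (sg (CC i q xs) j (?r j)) (Ch (i + 1) q xs))"
    using rc by (intro mod_hom_finsum[OF lev.module_CC lev.module_CC hom_res_CC]) auto
  also have "\<dots> = (\<Oplus>\<^bsub>CC (i + 1) q xs\<^esub>j\<in>{..Suc p}. sg (CC (i + 1) q xs) j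
      (restrict (res_P i p q w (omit_nth j xs)) (Ch (i + 1) q xs)))"
  proof (intro C.finsum_cong' refl)
    fix j assume j: "j \<in> {..Suc p}"
    then have o: "omit_nth j xs \<in> I p" using omit_nth_incr[OF xs] by simp
    have "restrict (res_P i p q w (omit_nth j xs)) (Ch (i + 1) q xs) = restrict (?r j) (Ch (i + 1) q xs)"
      using o chain_step lev.chain_omit[of q "i + 1" xs _ j] by (auto simp: res_P_def restrict_def fun_eq_iff)
    then show "restrict (sg (CC i q xs) j (?r j)) (Ch (i + 1) q xs) =
        sg (CC (i + 1) q xs) j (restrict (res_P i p q w (omit_nth j xs)) (Ch (i + 1) q xs))"
      using sg_hom[OF lev.module_CC lev.module_CC hom_res_CC rc, of j j] j by simp
  next
    show "(\<lambda>j. sg (CC (i + 1) q xs) j (restrict (res_P i p q w (omit_nth j xs)) (Ch (i + 1) q xs)))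
        \<in> {..Suc p} \<rightarrow> carrier (CC (i + 1) q xs)"
      using mod_hom_closed[OF lev.hom_omit[OF xs] mod_hom_closed[OF hom_res_P w]] by (intro Pi_I C.sg_closed) simp
  qed
  also have "\<dots> = lev.dl (i + 1) p q (res_P i p q w) xs" using xs by (simp add: lev.dl_def)
  finally show "res_P i (Suc p) q (lev.dl i p q w) xs = lev.dl (i + 1) p q (res_P i p q w) xs" .
qed

lemma res_P_dv: "res_P i p (Suc q) (lev.dv i p q w) = lev.dv (i + 1) p q (res_P i p q w)"
proof
  fix xs
  show "res_P i p (Suc q) (lev.dv i p q w) xs = lev.dv (i + 1) p q (res_P i p q w) xs"
    using coboundary_restrict[of "TT (i + 1) xs" "TT i xs" q "w xs"] chain_step
    by (simp add: res_P_def lev.dv_def restrict_def)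
qed

definition res_A :: "int \<Rightarrow> nat \<Rightarrow> ('x chain \<Rightarrow> 'r) \<Rightarrow> 'x chain \<Rightarrow> 'r" where
  "res_A i n u = restrict u (singular_chain_set n (subtopology X (K (i + 1))))"

lemma res_P_zero: "res_P i p q \<zero>\<^bsub>lev.P i p q\<^esub> = \<zero>\<^bsub>lev.P (i + 1) p q\<^esub>"
  by (rule mod_hom_zero[OF lev.module_P lev.module_P hom_res_P])

sublocale pdc: persistent_double_complex R lev.C lev.del lev.ver
  "\<lambda>i n. cochain_mod R n (subtopology X (K i))" "\<lambda>i n. coboundary_map n (subtopology X (K i))" lev.aug
  "\<lambda>i p q. res_P i p (nat q)" res_A
proof (rule persistent_double_complex.intro)
  show "augmented_double_complex R (lev.C i) (lev.del i) (lev.ver i) (\<lambda>n. cochain_mod R n (subtopology X (K i)))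
      (\<lambda>n. coboundary_map n (subtopology X (K i))) (lev.aug i)" for i
    by (rule lev.augmented_C)
  show "mod_hom R (lev.C i p q) (lev.C (i + 1) p q) (res_P i p (nat q))" for i p q
    unfolding lev.C_def by (intro mod_hom_trunc lev.module_P hom_res_P)
  show "mod_hom R (cochain_mod R n (subtopology X (K i))) (cochain_mod R n (subtopology X (K (i + 1)))) (res_A i n)" for i n
    unfolding res_A_def by (rule lev.R.mod_hom_cochain_restrict, rule chain_step_base)
  show "res_P i (Suc p) (nat q) (lev.del i p q x) = lev.del (i + 1) p q (res_P i p (nat q) x)"
    if "x \<in> carrier (lev.C i p q)" for i p q x
    unfolding lev.del_def by (rule res_P_dl[OF lev.C_closed[OF that]])
  show "res_P i p (nat (q + 1)) (lev.ver i p q x) = lev.ver (i + 1) p q (res_P i p (nat q) x)" for i p q x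
    by (cases "0 \<le> q") (simp_all add: lev.ver_def lev.nat_plus res_P_dv res_P_zero)
  show "res_A i (Suc n) (coboundary_map n (subtopology X (K i)) u) =
      coboundary_map n (subtopology X (K (i + 1))) (res_A i n u)" for i n u
    unfolding res_A_def by (rule coboundary_restrict[OF chain_step_base, symmetric])
  show "res_P i 0 (nat (int n)) (lev.aug i n u) = lev.aug (i + 1) n (res_A i n u)" for i n u
  proof
    fix xs
    show "res_P i 0 (nat (int n)) (lev.aug i n u) xs = lev.aug (i + 1) n (res_A i n u) xs"
      using chain_step lev.chain_base[of n "i + 1" xs] by (auto simp: res_P_def lev.aug_def res_A_def restrict_def fun_eq_iff)
  qed
qed

lemma cocyc_of_cochain: "cocyc_of (\<lambda>n. cochain_mod R n T) (\<lambda>n. coboundary_map n T) q = cocycles R q T"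
  by (simp add: cocyc_of_def cocycles_def)

lemma bd_of_cochain: "bd_of (\<lambda>n. cochain_mod R n T) (\<lambda>n. coboundary_map n T) q = coboundaries R q T"
  by (simp add: bd_of_def coboundaries_def)

lemma cohom_restr_eq:
  "cohom_restr R q T = coset_map (cochain_mod R q T) (coboundaries R q T) (\<lambda>u. restrict u (singular_chain_set q T))"
  by (intro ext) (simp add: cohom_restr_def coset_map_def)

text \<open>Stated for an arbitrary family of subspaces, because it is applied both to the
  filtration of \<open>X\<close> and to its traces on the preimages of intersections of the
  cover.\<close>

lemma pers_cohom_eq:
  "pers_cohom R q X K' = quot_pers R (\<lambda>i. cochain_mod R q (subtopology X (K' i)))
    (\<lambda>i u. restrict u (singular_chain_set q (subtopology X (K' (i + 1)))))
    (\<lambda>i. cocycles R q (subtopology X (K' i))) (\<lambda>i. coboundaries R q (subtopology X (K' i)))"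
  by (simp add: pers_cohom_def quot_pers_def cohom_def cohom_restr_eq)

theorem converges_pers_cohom:
  "converges_to R (\<lambda>r p q. pdc.fp.page (int r) (p + q) p) (\<lambda>n. pers_cohom R n X K)"
  using pdc.converges_total unfolding pers_cohom_eq cocyc_of_cochain bd_of_cochain res_A_def[abs_def] .

end

section \<open>Graded products of subquotients\<close>

context persistence
begin

text \<open>Translates the membership condition of \<open>gprod\<close>: a sum of homogeneous
  elements with degrees in \<open>D\<close> is just a family supported in \<open>D\<close>.\<close>

lemma pers_supported_iff:
  assumes "finite D"
  shows "(\<exists>h. (\<forall>n\<in>D. h n \<in> gr (pers_gmodule R M \<phi>) n) \<and> m = (\<Oplus>\<^bsub>pers_gmodule R M \<phi>\<^esub>n\<in>D. h n)) \<longleftrightarrow>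
    (\<forall>i. m i \<in> carrier (M i)) \<and> (\<forall>i. i \<notin> D \<longrightarrow> m i = \<zero>\<^bsub>M i\<^esub>)"
    (is "?lhs \<longleftrightarrow> ?rhs")
proof
  let ?P = "pers_gmodule R M \<phi>"
  interpret P: module "UP R" ?P by (rule module_pers)
  show ?rhs if ?lhs
  proof -
    from that obtain h where h: "\<And>n. n \<in> D \<Longrightarrow> h n \<in> gr ?P n" and m: "m = (\<Oplus>\<^bsub>?P\<^esub>n\<in>D. h n)" by blast
    have hc: "h \<in> D \<rightarrow> carrier ?P" using h gr_pers_subset by blast
    have "m i = \<zero>\<^bsub>M i\<^esub>" if "i \<notin> D" for i
    proof -
      interpret Mi: module R "M i" by (rule module_at)
      have "h n i = \<zero>\<^bsub>M i\<^esub>" if "n \<in> D" for n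
        using h[OF that] that \<open>i \<notin> D\<close> by (auto simp: gr_pers)
      then have "(\<Oplus>\<^bsub>M i\<^esub>n\<in>D. h n i) = (\<Oplus>\<^bsub>M i\<^esub>n\<in>D. \<zero>\<^bsub>M i\<^esub>)" by (intro Mi.finsum_cong') auto
      then show ?thesis unfolding m pers_finsum[OF hc] by simp
    qed
    moreover have "m \<in> carrier ?P" unfolding m by (rule P.finsum_closed[OF hc])
    ultimately show ?thesis using pers_carrierD by blast
  qed
  assume m: ?rhs
  define h where "h n j = (if j = n then m j else \<zero>\<^bsub>M j\<^esub>)" for n j
  have h: "h n \<in> gr ?P n" for n using m by (simp add: gr_pers h_def)
  then have hc: "h \<in> D \<rightarrow> carrier ?P" using gr_pers_subset by blast
  have "m i = (\<Oplus>\<^bsub>?P\<^esub>n\<in>D. h n) i" for i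
  proof -
    interpret Mi: module R "M i" by (rule module_at)
    show ?thesis
    proof (cases "i \<in> D")
      case True
      have "(\<Oplus>\<^bsub>M i\<^esub>n\<in>D. h n i) = m i"
        using True assms m by (intro Mi.finsum_extract[of i]) (auto simp: h_def)
      then show ?thesis by (simp add: pers_finsum[OF hc])
    next
      case False
      have "(\<Oplus>\<^bsub>M i\<^esub>n\<in>D. h n i) = (\<Oplus>\<^bsub>M i\<^esub>n\<in>D. \<zero>\<^bsub>M i\<^esub>)"
        using False by (intro Mi.finsum_cong') (auto simp: h_def)
      with m False show ?thesis by (simp add: pers_finsum[OF hc])
    qed
  qed
  then have "m = (\<Oplus>\<^bsub>?P\<^esub>n\<in>D. h n)" by (rule ext)
  with h show ?lhs by blast
qed

end

text \<open>Compares a graded product of quotients, \<open>GP\<close>, with the persistence module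
  \<open>SP\<close> of products of representatives. The common finite set of degrees in
  \<open>gprod\<close> matches finite support in \<open>SP\<close>; for unrestricted families of
  elements of the \<open>Q k\<close> there would be no such common set.\<close>

locale subquotient_family =
  fixes R :: "('r, 'z) ring_scheme" and I :: "'k set" and T :: "'k \<Rightarrow> int \<Rightarrow> ('r, 'm) module"
    and \<phi> :: "'k \<Rightarrow> int \<Rightarrow> 'm \<Rightarrow> 'm" and Z :: "'k \<Rightarrow> int \<Rightarrow> 'm set" and B :: "'k \<Rightarrow> int \<Rightarrow> 'm set"
  assumes ring: "cring R"
    and subquotient_at: "\<And>k. k \<in> I \<Longrightarrow> subquotient R (T k) (\<phi> k) (Z k) (B k)"
begin

abbreviation "W i \<equiv> prod_mod I (\<lambda>k. T k i)"
definition \<phi>_prod :: "int \<Rightarrow> ('k \<Rightarrow> 'm) \<Rightarrow> 'k \<Rightarrow> 'm" where "\<phi>_prod i w = (\<lambda>k\<in>I. \<phi> k i (w k))"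
definition Z_prod :: "int \<Rightarrow> ('k \<Rightarrow> 'm) set" where "Z_prod i = {w \<in> carrier (W i). \<forall>k\<in>I. w k \<in> Z k i}"
abbreviation "S k \<equiv> sub_pers R (T k) (\<phi> k) (Z k)"
abbreviation "Q k \<equiv> quot_pers R (T k) (\<phi> k) (Z k) (B k)"
abbreviation "SP \<equiv> sub_pers R W \<phi>_prod Z_prod"
abbreviation "GP \<equiv> gprod I Q"
definition cls :: "(int \<Rightarrow> 'k \<Rightarrow> 'm) \<Rightarrow> 'k \<Rightarrow> int \<Rightarrow> 'm set" where
  "cls w = (\<lambda>k\<in>I. \<lambda>i. B k i +>\<^bsub>T k i\<^esub> w i k)"

lemma sub_T: "k \<in> I \<Longrightarrow> subpersistence R (T k) (\<phi> k) (Z k)"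
  using subquotient_at subquotient.axioms(1) by blast

lemma pers_T: "k \<in> I \<Longrightarrow> persistence R (T k) (\<phi> k)"
  using sub_T subpersistence.axioms(1) by blast

lemmas module_T = persistence.module_at[OF pers_T]
lemmas sub_Z = subpersistence.sub_Z[OF sub_T]
lemmas sub_B = subquotient.sub_B[OF subquotient_at]

lemma module_W: "module R (W i)"
  by (intro module_prod_mod ring module_T)

lemma subpersistence_W: "subpersistence R W \<phi>_prod Z_prod"
proof (intro subpersistence.intro persistence.intro subpersistence_axioms.intro)
  have proj: "mod_hom R (W i) (T k i) (\<lambda>w. w k)" if "k \<in> I" for k i
    by (rule mod_hom_proj[where N = "\<lambda>k. T k i", OF that])
  show "mod_hom R (W i) (W (i + 1)) (\<phi>_prod i)" for i
    unfolding \<phi>_prod_def[abs_def]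
  proof (rule mod_hom_prodI)
    fix k assume k: "k \<in> I"
    show "mod_hom R (W i) (T k (i + 1)) (\<lambda>w. \<phi> k i (w k))"
      by (rule mod_hom_comp[OF proj[OF k] persistence.hom_at[OF pers_T[OF k]]])
  qed
  then have \<phi>: "\<phi>_prod i w \<in> carrier (W (i + 1))" if "w \<in> carrier (W i)" for i w
    using that by (rule mod_hom_closed)
  show "\<phi>_prod i ` Z_prod i \<subseteq> Z_prod (i + 1)" for i
  proof
    fix v assume "v \<in> \<phi>_prod i ` Z_prod i"
    then obtain w where w: "w \<in> carrier (W i)" "\<forall>k\<in>I. w k \<in> Z k i" and v: "v = \<phi>_prod i w"
      by (auto simp: Z_prod_def)
    have "v k \<in> Z k (i + 1)" if k: "k \<in> I" for k
      using subpersistence.hom_Z[OF sub_T[OF k], of i] w(2) k by (auto simp: v \<phi>_prod_def)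
    with \<phi>[OF w(1)] v show "v \<in> Z_prod (i + 1)" by (simp add: Z_prod_def)
  qed
  interpret W: module R "W i" for i by (rule module_W)
  show "submodule (Z_prod i) R (W i)" for i
  proof (rule W.submoduleI)
    have neg: "(\<ominus>\<^bsub>W i\<^esub> w) k = \<ominus>\<^bsub>T k i\<^esub> w k" if "w \<in> carrier (W i)" "k \<in> I" for w k
      by (rule mod_hom_neg[OF module_W module_T[OF that(2)] proj[OF that(2)] that(1)])
    show "\<ominus>\<^bsub>W i\<^esub> w \<in> Z_prod i" if "w \<in> Z_prod i" for w
      using that submodule_neg[OF sub_Z] W.a_inv_closed by (auto simp: Z_prod_def neg)
    show "v \<oplus>\<^bsub>W i\<^esub> w \<in> Z_prod i" if "v \<in> Z_prod i" "w \<in> Z_prod i" for v w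
      using that submodule_add[OF sub_Z] W.a_closed by (auto simp: Z_prod_def prod_mod_simps(3))
    show "a \<odot>\<^bsub>W i\<^esub> w \<in> Z_prod i" if "a \<in> carrier R" "w \<in> Z_prod i" for a w
      using that submodule_smult[OF sub_Z] W.smult_closed by (auto simp: Z_prod_def prod_mod_simps(4))
    show "\<zero>\<^bsub>W i\<^esub> \<in> Z_prod i"
      using submodule_zero[OF sub_Z] W.zero_closed by (auto simp: Z_prod_def prod_mod_simps(2))
  qed (auto simp: Z_prod_def)
qed (rule ring module_W)+

sublocale prod: subpersistence R W \<phi>_prod Z_prod
  by (rule subpersistence_W)

lemma Z_prodD: "w \<in> Z_prod i \<Longrightarrow> k \<in> I \<Longrightarrow> w k \<in> Z k i"
  by (simp add: Z_prod_def)

lemma hom_component: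
  assumes k: "k \<in> I"
  shows "mod_hom (UP R) SP (S k) (\<lambda>w i. w i k)"
proof -
  have "(\<lambda>w i. w i k) \<in> gmod_hom R SP (S k)"
    unfolding sub_pers_def
  proof (rule gmod_hom_pers[where h = "\<lambda>i v. v k", OF prod.persistence_sub subpersistence.persistence_sub[OF sub_T[OF k]]])
    show "mod_hom R ((W i)\<lparr>carrier := Z_prod i\<rparr>) ((T k i)\<lparr>carrier := Z k i\<rparr>) (\<lambda>v. v k)" for i
      using k by (intro mod_hom_restrict mod_hom_proj) (auto simp: Z_prod_def)
  qed (simp add: \<phi>_prod_def k)
  then show ?thesis by (simp add: gmod_hom_iff)
qed

lemma quot_carrier: "carrier (quot_mod ((T k i)\<lparr>carrier := Z k i\<rparr>) (B k i)) = (\<lambda>x. B k i +>\<^bsub>T k i\<^esub> x) ` Z k i"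
  by (rule quot_mod_restrict_carrier)

lemma Q_supported_iff:
  assumes "k \<in> I" "finite D"
  shows "(\<exists>h. (\<forall>n\<in>D. h n \<in> gr (Q k) n) \<and> m = (\<Oplus>\<^bsub>Q k\<^esub>n\<in>D. h n)) \<longleftrightarrow>
    (\<forall>i. m i \<in> (\<lambda>x. B k i +>\<^bsub>T k i\<^esub> x) ` Z k i) \<and> (\<forall>i. i \<notin> D \<longrightarrow> m i = B k i)"
  using persistence.pers_supported_iff[OF subquotient.persistence_quot[OF subquotient_at[OF assms(1)]] assms(2), of m]
  unfolding quot_pers_def quot_carrier quot_mod_simps(1) .

lemma GP_carrier_iff: "u \<in> carrier GP \<longleftrightarrow> u \<in> extensional I \<and> (\<exists>D. finite D \<and>
    (\<forall>k\<in>I. (\<forall>i. u k i \<in> (\<lambda>x. B k i +>\<^bsub>T k i\<^esub> x) ` Z k i) \<and> (\<forall>i. i \<notin> D \<longrightarrow> u k i = B k i)))"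
  by (simp add: gprod_def Q_supported_iff cong: conj_cong ball_cong)

text \<open>Phrased with the singleton \<open>{n}\<close> so that homogeneous elements become the
  case D = {n} of the support condition and \<open>cls_onto\<close> serves both.\<close>

lemma GP_gr_iff: "u \<in> gr GP n \<longleftrightarrow> u \<in> extensional I \<and>
    (\<forall>k\<in>I. (\<forall>i. u k i \<in> (\<lambda>x. B k i +>\<^bsub>T k i\<^esub> x) ` Z k i) \<and> (\<forall>i. i \<notin> {n} \<longrightarrow> u k i = B k i))"
proof -
  have "u k \<in> gr (Q k) n \<longleftrightarrow>
      (\<forall>i. u k i \<in> (\<lambda>x. B k i +>\<^bsub>T k i\<^esub> x) ` Z k i) \<and> (\<forall>i. i \<notin> {n} \<longrightarrow> u k i = B k i)" if k: "k \<in> I" for k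
  proof -
    have B: "B k i \<in> (\<lambda>x. B k i +>\<^bsub>T k i\<^esub> x) ` Z k i" for i
      using coset_zero[OF module_T[OF k] sub_B[OF k]] submodule_zero[OF sub_Z[OF k]] by (intro image_eqI) auto
    have "u k i \<in> (\<lambda>x. B k i +>\<^bsub>T k i\<^esub> x) ` Z k i"
      if "u k n \<in> (\<lambda>x. B k n +>\<^bsub>T k n\<^esub> x) ` Z k n" "\<forall>j. j \<noteq> n \<longrightarrow> u k j = B k j" for i
    proof (cases "i = n")
      case False
      then have "u k i = B k i" using that(2) by blast
      then show ?thesis using B[of i] by (simp only:)
    qed (use that(1) in \<open>simp only:\<close>)
    then show ?thesis
      unfolding quot_pers_def persistence.gr_pers[OF subquotient.persistence_quot[OF subquotient_at[OF k]]]
        quot_carrier quot_mod_simps(1) by blast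
  qed
  then show ?thesis by (auto simp: gprod_def PiE_iff)
qed

lemma zero_W: "k \<in> I \<Longrightarrow> \<zero>\<^bsub>W i\<^esub> k = \<zero>\<^bsub>T k i\<^esub>"
  by (rule prod_mod_simps(2))

lemma cls_zero: "k \<in> I \<Longrightarrow> w i = \<zero>\<^bsub>W i\<^esub> \<Longrightarrow> cls w k i = B k i"
  using coset_zero[OF module_T sub_B] by (simp add: cls_def zero_W)

lemma cls_mem: "k \<in> I \<Longrightarrow> w i \<in> Z_prod i \<Longrightarrow> cls w k i \<in> (\<lambda>x. B k i +>\<^bsub>T k i\<^esub> x) ` Z k i"
  by (auto simp: cls_def Z_prod_def)

text \<open>Representatives are chosen for all indices and degrees at once, and are replaced by zero
  outside \<open>D\<close>, so that the family of representatives is supported in \<open>D\<close>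
  as well.\<close>

lemma cls_onto:
  assumes u: "u \<in> extensional I" "\<And>k i. k \<in> I \<Longrightarrow> u k i \<in> (\<lambda>x. B k i +>\<^bsub>T k i\<^esub> x) ` Z k i"
    and D: "\<And>k i. k \<in> I \<Longrightarrow> i \<notin> D \<Longrightarrow> u k i = B k i"
  shows "\<exists>w. (\<forall>i. w i \<in> Z_prod i) \<and> (\<forall>i. i \<notin> D \<longrightarrow> w i = \<zero>\<^bsub>W i\<^esub>) \<and> u = cls w"
proof -
  have "\<exists>x. x \<in> Z k i \<and> u k i = B k i +>\<^bsub>T k i\<^esub> x" if "k \<in> I" for k i using u(2)[OF that, of i] by blast
  then have "\<exists>x. \<forall>k\<in>I. \<forall>i. x k i \<in> Z k i \<and> u k i = B k i +>\<^bsub>T k i\<^esub> x k i" by metis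
  then obtain x where x: "\<And>k i. k \<in> I \<Longrightarrow> x k i \<in> Z k i" "\<And>k i. k \<in> I \<Longrightarrow> u k i = B k i +>\<^bsub>T k i\<^esub> x k i"
    by blast
  define w where "w i = (if i \<in> D then (\<lambda>k\<in>I. x k i) else \<zero>\<^bsub>W i\<^esub>)" for i
  have "(\<lambda>k\<in>I. x k i) \<in> Z_prod i" for i
    using x(1) subsetD[OF submodule_subset[OF sub_Z]] by (simp add: Z_prod_def prod_mod_simps)
  then have wZ: "w i \<in> Z_prod i" for i using submodule_zero[OF prod.sub_Z] by (simp add: w_def)
  have "u = cls w"
  proof (rule extensionalityI[OF u(1)])
    show "cls w \<in> extensional I" by (simp add: cls_def)
    fix k assume k: "k \<in> I"
    show "u k = cls w k"
    proof
      fix i show "u k i = cls w k i"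
      proof (cases "i \<in> D")
        case True
        then show ?thesis using k x(2) by (simp add: cls_def w_def)
      next
        case False
        then show ?thesis using cls_zero[OF k, of w i] D[OF k] by (simp add: w_def)
      qed
    qed
  qed
  with wZ show ?thesis by (intro exI[of _ w]) (simp add: w_def)
qed

lemma SP_carrier_iff: "w \<in> carrier SP \<longleftrightarrow> (\<forall>i. w i \<in> Z_prod i) \<and> finite {i. w i \<noteq> \<zero>\<^bsub>W i\<^esub>}"
  by (simp add: sub_pers_def pers_gmodule_def)

lemma SP_gr_iff: "w \<in> gr SP n \<longleftrightarrow> (\<forall>i. w i \<in> Z_prod i) \<and> (\<forall>i. i \<notin> {n} \<longrightarrow> w i = \<zero>\<^bsub>W i\<^esub>)"
proof -
  have "w i \<in> Z_prod i" if "w n \<in> Z_prod n" "\<forall>j. j \<noteq> n \<longrightarrow> w j = \<zero>\<^bsub>W j\<^esub>" for i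
    using that submodule_zero[OF prod.sub_Z] by (cases "i = n") auto
  then show ?thesis by (auto simp: sub_pers_def pers_gmodule_def)
qed

lemma cls_carrier: "cls ` carrier SP = carrier GP"
proof (intro equalityI subsetI)
  fix u assume "u \<in> cls ` carrier SP"
  then obtain w where w: "w \<in> carrier SP" and u: "u = cls w" by blast
  have "u k i = B k i" if "k \<in> I" "i \<notin> {i. w i \<noteq> \<zero>\<^bsub>W i\<^esub>}" for k i
    unfolding u using that by (intro cls_zero) simp_all
  moreover have "u k i \<in> (\<lambda>x. B k i +>\<^bsub>T k i\<^esub> x) ` Z k i" if "k \<in> I" for k i
    unfolding u using that w unfolding SP_carrier_iff by (intro cls_mem) blast+
  moreover have "finite {i. w i \<noteq> \<zero>\<^bsub>W i\<^esub>}" using w unfolding SP_carrier_iff by (rule conjunct2)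
  moreover have "u \<in> extensional I" by (simp add: u cls_def)
  ultimately show "u \<in> carrier GP" unfolding GP_carrier_iff by blast
next
  fix u assume "u \<in> carrier GP"
  then obtain D where D: "finite D" and u: "u \<in> extensional I" "\<And>k i. k \<in> I \<Longrightarrow> u k i \<in> (\<lambda>x. B k i +>\<^bsub>T k i\<^esub> x) ` Z k i"
    "\<And>k i. k \<in> I \<Longrightarrow> i \<notin> D \<Longrightarrow> u k i = B k i" unfolding GP_carrier_iff by blast
  from cls_onto[of u D, OF u] obtain w where w: "\<forall>i. w i \<in> Z_prod i" "\<forall>i. i \<notin> D \<longrightarrow> w i = \<zero>\<^bsub>W i\<^esub>" "u = cls w" by blast
  have "finite {i. w i \<noteq> \<zero>\<^bsub>W i\<^esub>}" by (rule finite_subset[OF _ D]) (use w(2) in blast)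
  with w show "u \<in> cls ` carrier SP" by (simp add: SP_carrier_iff)
qed

lemma cls_gr: "cls ` gr SP n = gr GP n"
proof (intro equalityI subsetI)
  fix u assume "u \<in> cls ` gr SP n"
  then obtain w where w: "w \<in> gr SP n" and u: "u = cls w" by blast
  have "u k i = B k i" if "k \<in> I" "i \<notin> {n}" for k i
    using w that(2) unfolding SP_gr_iff u by (intro cls_zero[OF that(1)]) simp
  moreover have "u k i \<in> (\<lambda>x. B k i +>\<^bsub>T k i\<^esub> x) ` Z k i" if "k \<in> I" for k i
    using w unfolding SP_gr_iff u by (intro cls_mem[OF that]) simp
  moreover have "u \<in> extensional I" by (simp add: u cls_def)
  ultimately show "u \<in> gr GP n" unfolding GP_gr_iff by blast
next
  fix u assume u: "u \<in> gr GP n"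
  note u = u[unfolded GP_gr_iff]
  from u have "u k i \<in> (\<lambda>x. B k i +>\<^bsub>T k i\<^esub> x) ` Z k i" "i \<notin> {n} \<Longrightarrow> u k i = B k i" if "k \<in> I" for k i
    using that by simp_all
  from cls_onto[of u "{n}", OF conjunct1[OF u] this] obtain w
    where "(\<forall>i. w i \<in> Z_prod i) \<and> (\<forall>i. i \<notin> {n} \<longrightarrow> w i = \<zero>\<^bsub>W i\<^esub>)" "u = cls w" by blast
  then show "u \<in> cls ` gr SP n" using SP_gr_iff[of w n] by (intro image_eqI) (rule \<open>u = cls w\<close>, rule iffD2)
qed

lemma hom_cls: "mod_hom (UP R) SP GP cls"
proof (rule mod_homI)
  have comp: "mod_hom (UP R) SP (Q k) (\<lambda>w i. B k i +>\<^bsub>T k i\<^esub> w i k)" if k: "k \<in> I" for k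
  proof -
    have "mod_hom (UP R) (S k) (Q k) (\<lambda>x i. B k i +>\<^bsub>T k i\<^esub> x i)"
      using subquotient.coset_hom(1)[OF subquotient_at[OF k]] by (simp add: gmod_hom_iff)
    from mod_hom_comp[OF hom_component[OF k] this] show ?thesis .
  qed
  show "cls w \<in> carrier GP" if "w \<in> carrier SP" for w using that cls_carrier by blast
  show "cls (v \<oplus>\<^bsub>SP\<^esub> w) = cls v \<oplus>\<^bsub>GP\<^esub> cls w" if "v \<in> carrier SP" "w \<in> carrier SP" for v w
    using mod_hom_add[OF comp that] by (auto simp: cls_def gprod_def restrict_def fun_eq_iff)
  show "cls (s \<odot>\<^bsub>SP\<^esub> w) = s \<odot>\<^bsub>GP\<^esub> cls w" if "s \<in> carrier (UP R)" "w \<in> carrier SP" for s w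
    using mod_hom_smult[OF comp that] by (auto simp: cls_def gprod_def restrict_def fun_eq_iff)
qed

lemma zero_GP: "\<zero>\<^bsub>GP\<^esub> = (\<lambda>k\<in>I. B k)"
  by (simp add: gprod_def quot_pers_def pers_gmodule_def quot_mod_simps)

lemma module_SP: "module (UP R) SP"
  by (rule prod.module_sub_pers)

text \<open>\<open>GP\<close> is the image of \<open>SP\<close> under a map respecting the
  operations, so its module laws are inherited instead of being verified in
  \<open>gprod\<close>.\<close>

lemma module_GP: "module (UP R) GP"
proof (rule module_image[OF module_SP cls_carrier])
  have "\<zero>\<^bsub>SP\<^esub> i = \<zero>\<^bsub>W i\<^esub>" for i by (simp add: sub_pers_def pers_gmodule_def)
  then have "cls \<zero>\<^bsub>SP\<^esub> k i = B k i" if "k \<in> I" for k i using that by (intro cls_zero)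
  then show "cls \<zero>\<^bsub>SP\<^esub> = \<zero>\<^bsub>GP\<^esub>" unfolding zero_GP by (intro extensionalityI[of _ I]) (auto simp: cls_def)
qed (rule mod_hom_add[OF hom_cls] mod_hom_smult[OF hom_cls]; assumption)+

lemma cls_eq_iff:
  assumes "v \<in> carrier SP" "w \<in> carrier SP"
  shows "cls v = cls w \<longleftrightarrow> (\<forall>i. \<forall>k\<in>I. v i k \<ominus>\<^bsub>T k i\<^esub> w i k \<in> B k i)"
proof -
  have c: "v i k \<in> carrier (T k i)" "w i k \<in> carrier (T k i)" if "k \<in> I" for i k
    using assms Z_prodD[OF _ that] submodule_subset[OF sub_Z[OF that]] unfolding SP_carrier_iff by blast+
  have "cls v = cls w \<longleftrightarrow> (\<forall>k\<in>I. \<forall>i. B k i +>\<^bsub>T k i\<^esub> v i k = B k i +>\<^bsub>T k i\<^esub> w i k)"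
    by (auto simp: cls_def restrict_def fun_eq_iff)
  then show ?thesis using c by (auto simp: coset_eq_iff[OF module_T sub_B])
qed

lemma cls_eq_zero_iff:
  assumes "w \<in> carrier SP"
  shows "cls w = \<zero>\<^bsub>GP\<^esub> \<longleftrightarrow> (\<forall>i. \<forall>k\<in>I. w i k \<in> B k i)"
proof -
  have c: "w i k \<in> carrier (T k i)" if "k \<in> I" for i k
    using assms Z_prodD[OF _ that] submodule_subset[OF sub_Z[OF that]] unfolding SP_carrier_iff by blast
  have "cls w = \<zero>\<^bsub>GP\<^esub> \<longleftrightarrow> (\<forall>k\<in>I. \<forall>i. B k i +>\<^bsub>T k i\<^esub> w i k = B k i)"
    unfolding zero_GP by (auto simp: cls_def restrict_def fun_eq_iff)
  then show ?thesis using c by (auto simp: coset_eq_zero_iff[OF module_T sub_B])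
qed

end

section \<open>Cocycles and coboundaries\<close>

context cring
begin

lemma submodule_cocycles: "submodule (cocycles R q T) R (cochain_mod R q T)"
proof -
  have "cocycles R q T = {u \<in> carrier (cochain_mod R q T). coboundary_map q T u \<in> {\<zero>\<^bsub>cochain_mod R (Suc q) T\<^esub>}}"
    by (simp add: cocycles_def)
  also have "submodule \<dots> R (cochain_mod R q T)"
    by (rule submodule_vimage[OF module_cochain_mod module_cochain_mod mod_hom_coboundary
          module.carrier_is_submodule[OF module_cochain_mod] submodule_zero_singleton[OF module_cochain_mod]])
  finally show ?thesis .
qed

lemma submodule_coboundaries: "submodule (coboundaries R q T) R (cochain_mod R q T)"
proof (cases q)
  case 0
  then show ?thesis by (simp add: coboundaries_def submodule_zero_singleton[OF module_cochain_mod])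
next
  case (Suc k)
  then show ?thesis
    using submodule_image[OF module_cochain_mod module_cochain_mod mod_hom_coboundary
        module.carrier_is_submodule[OF module_cochain_mod], of k T] by (simp add: coboundaries_def)
qed

lemma coboundaries_subset_cocycles: "coboundaries R q T \<subseteq> cocycles R q T"
proof (cases q)
  case 0
  then show ?thesis using submodule_zero[OF submodule_cocycles, of 0 T] by (simp add: coboundaries_def)
next
  case (Suc k)
  then show ?thesis
    using mod_hom_closed[OF mod_hom_coboundary] coboundary_coboundary by (auto simp: coboundaries_def cocycles_def)
qed

lemma
  assumes le: "\<And>q c. singular_chain q T' c \<Longrightarrow> singular_chain q T c"
  shows cocycles_restrict: "(\<lambda>u. restrict u (singular_chain_set q T')) ` cocycles R q T \<subseteq> cocycles R q T'"
    and coboundaries_restrict: "(\<lambda>u. restrict u (singular_chain_set q T')) ` coboundaries R q T \<subseteq> coboundaries R q T'"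
proof -
  note hom = mod_hom_cochain_restrict[of _ T' T, OF le]
  note zero = mod_hom_zero[OF module_cochain_mod module_cochain_mod hom]
  note closed = mod_hom_closed[OF hom]
  show "(\<lambda>u. restrict u (singular_chain_set q T')) ` cocycles R q T \<subseteq> cocycles R q T'"
    using closed zero[of "Suc q"] by (auto simp: cocycles_def coboundary_restrict[of T' T, OF le])
  show "(\<lambda>u. restrict u (singular_chain_set q T')) ` coboundaries R q T \<subseteq> coboundaries R q T'"
  proof (cases q)
    case 0
    then show ?thesis using zero[of 0] by (simp add: coboundaries_def)
  next
    case (Suc k)
    then show ?thesis
      using closed by (auto simp: coboundaries_def coboundary_restrict[of T' T, OF le, symmetric])
  qed
qed

lemma subquotient_cochains:
  assumes le: "\<And>i q c. singular_chain q (T (i + 1)) c \<Longrightarrow> singular_chain q (T i) c"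
  shows "subquotient R (\<lambda>i. cochain_mod R q (T i)) (\<lambda>i u. restrict u (singular_chain_set q (T (i + 1))))
    (\<lambda>i. cocycles R q (T i)) (\<lambda>i. coboundaries R q (T i))"
proof (intro subquotient.intro subpersistence.intro persistence.intro subpersistence_axioms.intro subquotient_axioms.intro)
  show "mod_hom R (cochain_mod R q (T i)) (cochain_mod R q (T (i + 1))) (\<lambda>u. restrict u (singular_chain_set q (T (i + 1))))" for i
    by (rule mod_hom_cochain_restrict) (rule le)
  show "(\<lambda>u. restrict u (singular_chain_set q (T (i + 1)))) ` cocycles R q (T i) \<subseteq> cocycles R q (T (i + 1))" for i
    by (rule cocycles_restrict) (rule le)
  show "(\<lambda>u. restrict u (singular_chain_set q (T (i + 1)))) ` coboundaries R q (T i) \<subseteq> coboundaries R q (T (i + 1))" for i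
    by (rule coboundaries_restrict) (rule le)
qed (rule is_cring module_cochain_mod submodule_cocycles submodule_coboundaries coboundaries_subset_cocycles)+

end

section \<open>The second page\<close>

lemma (in abelian_group) minus_eq_iff:
  assumes "a \<in> carrier G" "v \<in> carrier G" "y \<in> carrier G"
  shows "a \<ominus> v = y \<longleftrightarrow> a = v \<oplus> y"
proof
  assume "a \<ominus> v = y"
  then have "v \<oplus> y = v \<oplus> (\<ominus> v \<oplus> a)" using assms by (simp add: minus_eq a_comm)
  also have "\<dots> = a" using assms by (rule_tac r_neg2)
  finally show "a = v \<oplus> y" ..
next
  assume "a = v \<oplus> y"
  then have "a \<ominus> v = \<ominus> v \<oplus> (v \<oplus> y)" using assms by (simp add: minus_eq a_comm)
  also have "\<dots> = y" using assms by (rule_tac r_neg1)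
  finally show "a \<ominus> v = y" .
qed

text \<open>Sums and inverses are formed in a record with restricted carriers. They are first moved
  to the ambient persistence module, where components can be taken term by term.\<close>

lemma (in subpersistence) sub_pers_alternating_sum:
  assumes h: "\<And>j. j \<in> J \<Longrightarrow> h j \<in> carrier (sub_pers R T \<phi> Z)"
  shows "(\<Oplus>\<^bsub>sub_pers R T \<phi> Z\<^esub>j\<in>J. sg (sub_pers R T \<phi> Z) j (h j)) i = (\<Oplus>\<^bsub>T i\<^esub>j\<in>J. sg (T i) j (h j i))"
proof -
  let ?S = "sub_pers R T \<phi> Z" and ?P = "pers_gmodule R T \<phi>"
  interpret S: module "UP R" ?S by (rule module_sub_pers)
  interpret P: module "UP R" ?P by (rule module_pers)
  interpret Ti: module R "T i" by (rule module_at)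
  have incl: "mod_hom (UP R) ?S ?P (\<lambda>x. x)" using gmod_hom_sub_pers by (simp add: gmod_hom_iff)
  have hP: "h j \<in> carrier ?P" if "j \<in> J" for j by (rule mod_hom_closed[OF incl h[OF that]])
  have sP: "sg ?P j (h j) \<in> carrier ?P" if "j \<in> J" for j using hP[OF that] by (rule P.sg_closed)
  have "(\<Oplus>\<^bsub>?S\<^esub>j\<in>J. sg ?S j (h j)) = (\<Oplus>\<^bsub>?P\<^esub>j\<in>J. sg ?S j (h j))"
    using h by (intro mod_hom_finsum[OF module_sub_pers module_pers incl]) auto
  also have "\<dots> = (\<Oplus>\<^bsub>?P\<^esub>j\<in>J. sg ?P j (h j))"
    using sg_hom[OF module_sub_pers module_pers incl h] sP by (intro P.finsum_cong') auto
  finally have "(\<Oplus>\<^bsub>?S\<^esub>j\<in>J. sg ?S j (h j)) i = (\<Oplus>\<^bsub>T i\<^esub>j\<in>J. sg ?P j (h j) i)"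
    using sP by (simp add: pers_finsum)
  also have "\<dots> = (\<Oplus>\<^bsub>T i\<^esub>j\<in>J. sg (T i) j (h j i))"
    using hP pers_carrierD by (intro Ti.finsum_cong') (auto simp: sg_def pers_inv)
  finally show ?thesis .
qed

section \<open>Cech cochains of the presheaf through families of cocycles\<close>

context cech_persistence
begin

sublocale fam: subquotient_family R "I p" "\<lambda>xs i. CC i q xs" "\<lambda>xs i u. restrict u (Ch (i + 1) q xs)"
  "\<lambda>xs i. cocycles R q (TT i xs)" "\<lambda>xs i. coboundaries R q (TT i xs)" for p q
proof (intro subquotient_family.intro lev.ring)
  show "subquotient R (\<lambda>i. CC i q xs) (\<lambda>i u. restrict u (Ch (i + 1) q xs))
    (\<lambda>i. cocycles R q (TT i xs)) (\<lambda>i. coboundaries R q (TT i xs))" for xs q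
    by (rule lev.R.subquotient_cochains) (rule chain_step)
qed

abbreviation "SP p q \<equiv> fam.SP p q"
abbreviation "GP p q \<equiv> fam.GP p q"
abbreviation "F q \<equiv> pers_presheaf R q X K f"
abbreviation "D p q \<equiv> cech_diff L A U (F q) p"

lemma W_eq: "fam.W p q i = lev.P i p q"
  by (simp add: lev.P_def)

lemma \<phi>_prod_eq: "fam.\<phi>_prod p q i w = res_P i p q w"
  by (simp add: fam.\<phi>_prod_def res_P_def)

lemma cech_cochains_eq: "cech_cochains L A U (F q) p = GP p q"
  by (simp add: cech_cochains_def pers_presheaf_def pers_cohom_eq)

lemma Z_prod_iff: "w \<in> fam.Z_prod p q i \<longleftrightarrow> w \<in> carrier (lev.P i p q) \<and> lev.dv i p q w = \<zero>\<^bsub>lev.P i p (Suc q)\<^esub>"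
proof -
  have "lev.dv i p q w = \<zero>\<^bsub>lev.P i p (Suc q)\<^esub> \<longleftrightarrow>
      (\<forall>xs\<in>I p. coboundary_map q (TT i xs) (w xs) = \<zero>\<^bsub>CC i (Suc q) xs\<^esub>)"
    by (auto simp: lev.dv_def lev.P_def prod_mod_def restrict_def fun_eq_iff)
  then show ?thesis
    using lev.P_closed[of w i p q] unfolding fam.Z_prod_def W_eq unfolding cocycles_def by auto
qed

lemma dl_Z_prod:
  assumes w: "w \<in> fam.Z_prod p q i"
  shows "lev.dl i p q w \<in> fam.Z_prod (Suc p) q i"
proof -
  have "lev.dv i (Suc p) q (lev.dl i p q w) = lev.dl i p (Suc q) (lev.dv i p q w)"
    using w by (intro lev.dl_dv[symmetric]) (simp add: Z_prod_iff)
  then show ?thesis using w lev.dl_closed lev.dl_zero by (simp add: Z_prod_iff)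
qed

lemma hom_dl_SP: "mod_hom (UP R) (SP p q) (SP (Suc p) q) (\<lambda>w i. lev.dl i p q (w i))"
proof -
  have "(\<lambda>w i. lev.dl i p q (w i)) \<in> gmod_hom R (SP p q) (SP (Suc p) q)"
    unfolding sub_pers_def
  proof (rule gmod_hom_pers[where h = "\<lambda>i. lev.dl i p q", OF fam.prod.persistence_sub fam.prod.persistence_sub])
    show "mod_hom R ((fam.W p q i)\<lparr>carrier := fam.Z_prod p q i\<rparr>)
        ((fam.W (Suc p) q i)\<lparr>carrier := fam.Z_prod (Suc p) q i\<rparr>) (lev.dl i p q)" for i
      unfolding W_eq using dl_Z_prod by (intro mod_hom_restrict lev.hom_dl) (auto simp: Z_prod_iff)
    show "lev.dl (i + 1) p q (fam.\<phi>_prod p q i w) = fam.\<phi>_prod (Suc p) q i (lev.dl i p q w)"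
      if "w \<in> carrier ((fam.W p q i)\<lparr>carrier := fam.Z_prod p q i\<rparr>)" for i w
      unfolding \<phi>_prod_eq using that by (intro res_P_dl[symmetric]) (simp add: Z_prod_iff)
  qed
  then show ?thesis by (simp add: gmod_hom_iff)
qed

lemma hom_restrict_S:
  "mod_hom (UP R) (fam.S q (omit_nth j xs)) (fam.S q xs) (\<lambda>u i. restrict (u i) (Ch i q xs))"
proof -
  have le: "singular_chain q (TT i xs) c \<Longrightarrow> singular_chain q (TT i (omit_nth j xs)) c" for q i c
    by (rule lev.chain_omit)
  have "(\<lambda>u i. restrict (u i) (Ch i q xs)) \<in> gmod_hom R (fam.S q (omit_nth j xs)) (fam.S q xs)"
    unfolding sub_pers_def
  proof (rule gmod_hom_pers[where h = "\<lambda>i u. restrict u (Ch i q xs)"])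
    show "persistence R (\<lambda>i. (CC i q ys)\<lparr>carrier := cocycles R q (TT i ys)\<rparr>) (\<lambda>i u. restrict u (Ch (i + 1) q ys))" for ys
      by (rule subpersistence.persistence_sub[OF subquotient.axioms(1)[OF lev.R.subquotient_cochains]]) (rule chain_step)
    then show "persistence R (\<lambda>i. (CC i q ys)\<lparr>carrier := cocycles R q (TT i ys)\<rparr>) (\<lambda>i u. restrict u (Ch (i + 1) q ys))" for ys .
    show "mod_hom R ((CC i q (omit_nth j xs))\<lparr>carrier := cocycles R q (TT i (omit_nth j xs))\<rparr>)
        ((CC i q xs)\<lparr>carrier := cocycles R q (TT i xs)\<rparr>) (\<lambda>u. restrict u (Ch i q xs))" for i
      by (rule mod_hom_restrict[OF lev.R.mod_hom_cochain_restrict submodule_subset[OF lev.R.submodule_cocycles]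
            lev.R.cocycles_restrict]) (rule le, assumption)+
    show "restrict (restrict u (Ch (i + 1) q (omit_nth j xs))) (Ch (i + 1) q xs) =
        restrict (restrict u (Ch i q xs)) (Ch (i + 1) q xs)" for i u
      using le[of q "i + 1"] chain_step[of q i xs] by (auto simp: restrict_def fun_eq_iff)
  qed
  then show ?thesis by (simp add: gmod_hom_iff)
qed

text \<open>Restriction of a class is the class of the restriction, and taking classes is linear.
  Hence the Cech differential of persistent cohomology is computed by the horizontal differential on
  representing cocycles.\<close>

lemma cech_diff_cls:
  assumes w: "w \<in> carrier (SP p q)"
  shows "D p q (fam.cls p q w) = fam.cls (Suc p) q (\<lambda>i. lev.dl i p q (w i))"
proof (rule extensionalityI[of _ "I (Suc p)"])
  fix xs assume xs: "xs \<in> I (Suc p)"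
  let ?S = "fam.S q xs" and ?Q = "fam.Q q xs"
  let ?coh = "\<lambda>x i. coboundaries R q (TT i xs) +>\<^bsub>CC i q xs\<^esub> x i"
  let ?r = "\<lambda>j i. restrict (w i (omit_nth j xs)) (Ch i q xs)"
  interpret sq: subquotient R "\<lambda>i. CC i q xs" "\<lambda>i u. restrict u (Ch (i + 1) q xs)"
    "\<lambda>i. cocycles R q (TT i xs)" "\<lambda>i. coboundaries R q (TT i xs)"
    by (rule fam.subquotient_at[OF xs])
  interpret S: module "UP R" ?S by (rule sq.module_sub_pers)
  interpret Q: module "UP R" ?Q by (rule sq.module_quot_pers)
  have hcoh: "mod_hom (UP R) ?S ?Q ?coh" using sq.coset_hom(1) by (simp add: gmod_hom_iff)
  have rS: "?r j \<in> carrier ?S" if "j \<le> Suc p" for j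
    by (rule mod_hom_closed[OF hom_restrict_S mod_hom_closed[OF fam.hom_component[OF omit_nth_incr[OF xs that]] w]])
  have res: "res (F q) (cover_int U (omit_nth j xs)) (cover_int U xs) (fam.cls p q w (omit_nth j xs)) = ?coh (?r j)"
    if j: "j \<le> Suc p" for j
  proof
    fix i
    note o = omit_nth_incr[OF xs j]
    have le: "singular_chain q (TT i xs) c \<Longrightarrow> singular_chain q (TT i (omit_nth j xs)) c" for q c
      by (rule lev.chain_omit)
    have wc: "w i (omit_nth j xs) \<in> carrier (CC i q (omit_nth j xs))"
      using w o unfolding fam.SP_carrier_iff Z_prod_iff by (blast intro: lev.P_closed)
    have "coset_map (CC i q xs) (coboundaries R q (TT i xs)) (\<lambda>u. restrict u (Ch i q xs))
        (coboundaries R q (TT i (omit_nth j xs)) +>\<^bsub>CC i q (omit_nth j xs)\<^esub> w i (omit_nth j xs)) = ?coh (?r j) i"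
      by (rule coset_map_coset[OF lev.R.module_cochain_mod lev.R.submodule_coboundaries lev.R.module_cochain_mod
            lev.R.submodule_coboundaries lev.R.mod_hom_cochain_restrict lev.R.coboundaries_restrict wc]) (rule le, assumption)+
    then show "res (F q) (cover_int U (omit_nth j xs)) (cover_int U xs) (fam.cls p q w (omit_nth j xs)) i = ?coh (?r j) i"
      using o by (simp add: pers_presheaf_def cohom_restr_eq fam.cls_def)
  qed
  have sec: "sec (F q) (cover_int U xs) = ?Q" by (simp add: pers_presheaf_def pers_cohom_eq)
  have "D p q (fam.cls p q w) xs = (\<Oplus>\<^bsub>sec (F q) (cover_int U xs)\<^esub>j\<in>{..Suc p}. sg (sec (F q) (cover_int U xs)) j
      (res (F q) (cover_int U (omit_nth j xs)) (cover_int U xs) (fam.cls p q w (omit_nth j xs))))"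
    unfolding sg_def using xs by (simp add: cech_diff_def Let_def)
  also have "\<dots> = (\<Oplus>\<^bsub>?Q\<^esub>j\<in>{..Suc p}. sg ?Q j
      (res (F q) (cover_int U (omit_nth j xs)) (cover_int U xs) (fam.cls p q w (omit_nth j xs))))"
    unfolding sec ..
  also have "\<dots> = (\<Oplus>\<^bsub>?Q\<^esub>j\<in>{..Suc p}. ?coh (sg ?S j (?r j)))"
  proof (intro Q.finsum_cong' refl)
    fix j assume "j \<in> {..Suc p}"
    then have j: "j \<le> Suc p" by simp
    show "sg ?Q j (res (F q) (cover_int U (omit_nth j xs)) (cover_int U xs) (fam.cls p q w (omit_nth j xs))) =
        ?coh (sg ?S j (?r j))"
      unfolding res[OF j] by (rule sg_hom[OF sq.module_sub_pers sq.module_quot_pers hcoh rS[OF j], symmetric])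
  next
    show "(\<lambda>j. ?coh (sg ?S j (?r j))) \<in> {..Suc p} \<rightarrow> carrier ?Q"
      using rS by (intro Pi_I mod_hom_closed[OF hcoh] S.sg_closed) simp
  qed
  also have "\<dots> = ?coh (\<Oplus>\<^bsub>?S\<^esub>j\<in>{..Suc p}. sg ?S j (?r j))"
    using rS by (intro mod_hom_finsum[OF sq.module_sub_pers sq.module_quot_pers hcoh, symmetric] Pi_I S.sg_closed) simp
  also have "\<dots> = (\<lambda>i. coboundaries R q (TT i xs) +>\<^bsub>CC i q xs\<^esub> lev.dl i p q (w i) xs)"
  proof
    fix i
    have "(\<Oplus>\<^bsub>?S\<^esub>j\<in>{..Suc p}. sg ?S j (?r j)) i = lev.dl i p q (w i) xs"
      using sq.sub_pers_alternating_sum[of "{..Suc p}" ?r i] rS xs by (simp add: lev.dl_def)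
    then show "?coh (\<Oplus>\<^bsub>?S\<^esub>j\<in>{..Suc p}. sg ?S j (?r j)) i =
        coboundaries R q (TT i xs) +>\<^bsub>CC i q xs\<^esub> lev.dl i p q (w i) xs" by (simp only:)
  qed
  finally show "D p q (fam.cls p q w) xs = fam.cls (Suc p) q (\<lambda>i. lev.dl i p q (w i)) xs"
    using xs by (simp add: fam.cls_def)
qed (simp_all add: cech_diff_def fam.cls_def)

lemma hom_cech_diff: "mod_hom (UP R) (GP p q) (GP (Suc p) q) (D p q)"
proof (rule mod_hom_factor[where f = "D p q", OF fam.hom_cls fam.cls_carrier _ fam.module_SP])
  show "mod_hom (UP R) (SP p q) (GP (Suc p) q) (\<lambda>w. fam.cls (Suc p) q (\<lambda>i. lev.dl i p q (w i)))"
    by (rule mod_hom_comp[OF hom_dl_SP fam.hom_cls])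
qed (rule cech_diff_cls)

text \<open>Primitives for the different tuples are chosen simultaneously. For q = 0 both sides say
  that \<open>w\<close> vanishes, as the double complex is zero in vertical degree -1.\<close>

lemma coboundary_family_iff:
  assumes w: "w \<in> carrier (lev.P i p q)"
  shows "(\<exists>y\<in>carrier (lev.C i p (int q - 1)). w = lev.ver i p (int q - 1) y) \<longleftrightarrow>
    (\<forall>xs\<in>I p. w xs \<in> coboundaries R q (TT i xs))"
proof (cases q)
  case 0
  have "w = \<zero>\<^bsub>lev.P i p q\<^esub> \<longleftrightarrow> (\<forall>xs\<in>I p. w xs = \<zero>\<^bsub>CC i q xs\<^esub>)"
    using lev.P_eqI[OF w lev.zero_P] by (auto simp: lev.P_zero)
  with 0 show ?thesis by (simp add: coboundaries_def lev.ver_def lev.C_def)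
next
  case (Suc k)
  have k: "int q - 1 = int k" using Suc by simp
  have "(\<exists>y\<in>carrier (lev.P i p k). w = lev.dv i p k y) \<longleftrightarrow>
      (\<forall>xs\<in>I p. w xs \<in> coboundary_map k (TT i xs) ` carrier (CC i k xs))"
  proof
    assume "\<exists>y\<in>carrier (lev.P i p k). w = lev.dv i p k y"
    then show "\<forall>xs\<in>I p. w xs \<in> coboundary_map k (TT i xs) ` carrier (CC i k xs)"
      using lev.P_closed by (auto simp: lev.dv_def)
  next
    assume "\<forall>xs\<in>I p. w xs \<in> coboundary_map k (TT i xs) ` carrier (CC i k xs)"
    then have "\<forall>xs\<in>I p. \<exists>y. y \<in> carrier (CC i k xs) \<and> w xs = coboundary_map k (TT i xs) y" by blast
    then obtain y where y: "\<forall>xs\<in>I p. y xs \<in> carrier (CC i k xs) \<and> w xs = coboundary_map k (TT i xs) (y xs)"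
      by (rule bchoice[THEN exE])
    then have yP: "restrict y (I p) \<in> carrier (lev.P i p k)" by (simp add: lev.P_def prod_mod_simps)
    moreover have "w = lev.dv i p k (restrict y (I p))"
    proof (rule lev.P_eqI[OF w])
      show "lev.dv i p k (restrict y (I p)) \<in> carrier (lev.P i p q)"
        using mod_hom_closed[OF lev.hom_dv yP] Suc by simp
    qed (use y in \<open>simp add: lev.dv_def\<close>)
    ultimately show "\<exists>y\<in>carrier (lev.P i p k). w = lev.dv i p k y" by blast
  qed
  then show ?thesis unfolding k lev.C_int by (simp add: lev.ver_def coboundaries_def Suc)
qed

section \<open>The second page in terms of representing cocycles\<close>

lemma total_degree: "int p + int q - int p = int q"
  by simp

abbreviation "Z2 p q i \<equiv> pdc.fp.Z i 2 (int p + int q) (int p)"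
abbreviation "B2 p q i \<equiv> pdc.fp.B i 2 (int p + int q) (int p)"

lemma hom_component_total: "mod_hom R (tot_mod (lev.C i) (int p + int q)) (lev.P i p q) (\<lambda>x. x p)"
  using mod_hom_proj[of p UNIV R "\<lambda>k. lev.C i k (int p + int q - int k)"]
  unfolding tot_mod_def total_degree lev.C_int by simp

lemma ver_int: "lev.ver i p (int q) = lev.dv i p q"
  by (simp add: lev.ver_def fun_eq_iff)

lemma C_Suc: "\<zero>\<^bsub>lev.C i p (int q + 1)\<^esub> = \<zero>\<^bsub>lev.P i p (Suc q)\<^esub>"
  by (simp add: lev.C_zero lev.nat_plus)

text \<open>The right-hand side consists of families of cocycles whose horizontal coboundary is a
  coboundary on every tuple, that is, of representatives of Cech cocycles with values in cohomology.
  The two inclusions are \<open>second_page_component\<close> and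
  \<open>second_page_lift\<close>.\<close>

lemma Z2_component:
  "(\<lambda>x. x p) ` Z2 p q i =
    {c \<in> fam.Z_prod p q i. \<forall>xs\<in>I (Suc p). lev.dl i p q c xs \<in> coboundaries R q (TT i xs)}" (is "_ = ?S")
proof (intro equalityI subsetI)
  fix c assume "c \<in> (\<lambda>x. x p) ` Z2 p q i"
  then obtain x where x: "x \<in> Z2 p q i" and c: "c = x p" by blast
  note comp = pdc.adc.second_page_component[OF x, unfolded total_degree ver_int C_Suc lev.C_int, folded c]
  have "c \<in> fam.Z_prod p q i" using comp(1,2) by (simp add: Z_prod_iff)
  moreover have "\<exists>y\<in>carrier (lev.C i (Suc p) (int q - 1)). lev.dl i p q c = lev.ver i (Suc p) (int q - 1) y"
    using comp(3) by (auto simp: lev.del_def)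
  ultimately show "c \<in> ?S" using coboundary_family_iff[OF lev.dl_closed[OF comp(1)]] by blast
next
  fix c assume c: "c \<in> ?S"
  then have cP: "c \<in> carrier (lev.P i p q)" "lev.dv i p q c = \<zero>\<^bsub>lev.P i p (Suc q)\<^esub>" by (simp_all add: Z_prod_iff)
  from c coboundary_family_iff[OF lev.dl_closed[OF cP(1)]] obtain y
    where y: "y \<in> carrier (lev.C i (Suc p) (int q - 1))" "lev.dl i p q c = lev.ver i (Suc p) (int q - 1) y" by blast
  have "\<exists>x\<in>Z2 p q i. x p = c"
    by (rule pdc.adc.second_page_lift[of c i p "int p + int q" y, unfolded total_degree ver_int C_Suc lev.C_int])
       (use cP y in \<open>simp_all add: lev.del_def\<close>)
  then show "c \<in> (\<lambda>x. x p) ` Z2 p q i" by blast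
qed

abbreviation "hor_bd i \<equiv> double_complex.hor_bd (lev.C i) (lev.del i) (lev.ver i)"

lemma hor_bd_simps:
  "hor_bd i 0 (int q) = {\<zero>\<^bsub>lev.P i 0 q\<^esub>}"
  "hor_bd i (Suc k) (int q) = lev.dl i k q ` fam.Z_prod k q i"
proof -
  have "{v \<in> carrier (lev.P i k q). lev.dv i k q v = \<zero>\<^bsub>lev.P i k (Suc q)\<^esub>} = fam.Z_prod k q i" for k
    by (auto simp: Z_prod_iff)
  then show "hor_bd i 0 (int q) = {\<zero>\<^bsub>lev.P i 0 q\<^esub>}"
    and "hor_bd i (Suc k) (int q) = lev.dl i k q ` fam.Z_prod k q i"
    unfolding double_complex.hor_bd_def[OF lev.double_complex_C] nat.case ver_int C_Suc lev.C_int
    by (simp_all add: lev.del_def)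
qed

lemma hor_bd_closed: "v \<in> hor_bd i p (int q) \<Longrightarrow> v \<in> carrier (lev.P i p q)"
  by (cases p) (auto simp: hor_bd_simps lev.zero_P Z_prod_iff intro: lev.dl_closed)

lemma B2_iff:
  assumes x: "x \<in> Z2 p q i"
  shows "x \<in> B2 p q i \<longleftrightarrow>
    (\<exists>v\<in>hor_bd i p (int q). \<forall>xs\<in>I p. x p xs \<ominus>\<^bsub>CC i q xs\<^esub> v xs \<in> coboundaries R q (TT i xs))"
proof -
  interpret P: module R "lev.P i p q" by (rule lev.module_P)
  have xp: "x p \<in> carrier (lev.P i p q)" using x Z2_component[where i = i and p = p and q = q] by (auto simp: Z_prod_iff)
  have key: "(\<exists>y\<in>carrier (lev.C i p (int q - 1)). x p = v \<oplus>\<^bsub>lev.P i p q\<^esub> lev.ver i p (int q - 1) y) \<longleftrightarrow>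
      (\<forall>xs\<in>I p. x p xs \<ominus>\<^bsub>CC i q xs\<^esub> v xs \<in> coboundaries R q (TT i xs))"
    if v: "v \<in> carrier (lev.P i p q)" for v
  proof -
    have "lev.ver i p (int q - 1) y \<in> carrier (lev.P i p q)" if "y \<in> carrier (lev.C i p (int q - 1))" for y
      using mod_hom_closed[OF pdc.adc.hom_d that] by (simp add: lev.C_int)
    then have "(\<exists>y\<in>carrier (lev.C i p (int q - 1)). x p = v \<oplus>\<^bsub>lev.P i p q\<^esub> lev.ver i p (int q - 1) y) \<longleftrightarrow>
        (\<exists>y\<in>carrier (lev.C i p (int q - 1)). x p \<ominus>\<^bsub>lev.P i p q\<^esub> v = lev.ver i p (int q - 1) y)"
      using P.minus_eq_iff[OF xp v, symmetric] by (intro bex_cong refl) simp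
    also have "\<dots> \<longleftrightarrow> (\<forall>xs\<in>I p. (x p \<ominus>\<^bsub>lev.P i p q\<^esub> v) xs \<in> coboundaries R q (TT i xs))"
      by (rule coboundary_family_iff[OF P.minus_closed[OF xp v]])
    also have "\<dots> \<longleftrightarrow> (\<forall>xs\<in>I p. x p xs \<ominus>\<^bsub>CC i q xs\<^esub> v xs \<in> coboundaries R q (TT i xs))"
    proof (intro ball_cong refl)
      fix xs assume xs: "xs \<in> I p"
      have "mod_hom R (lev.P i p q) (CC i q xs) (\<lambda>w. w xs)" unfolding lev.P_def by (rule mod_hom_proj[OF xs])
      from mod_hom_diff[OF lev.module_P lev.module_CC this xp v]
      show "(x p \<ominus>\<^bsub>lev.P i p q\<^esub> v) xs \<in> coboundaries R q (TT i xs) \<longleftrightarrow>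
          x p xs \<ominus>\<^bsub>CC i q xs\<^esub> v xs \<in> coboundaries R q (TT i xs)" by simp
    qed
    finally show ?thesis .
  qed
  show ?thesis
    unfolding pdc.adc.second_page_boundary_iff[OF x, unfolded total_degree lev.C_int]
    by (intro bex_cong refl key hor_bd_closed)
qed

text \<open>Only column \<open>p\<close> of a total cochain matters on the second page, and its
  cohomology classes form a Cech cochain.\<close>

definition second :: "nat \<Rightarrow> nat \<Rightarrow> (int \<Rightarrow> nat \<Rightarrow> 'a list \<Rightarrow> 'x chain \<Rightarrow> 'r) \<Rightarrow> 'a list \<Rightarrow> int \<Rightarrow> ('x chain \<Rightarrow> 'r) set" where
  "second p q x = fam.cls p q (\<lambda>i. x i p)"

abbreviation "SZ p q \<equiv> sub_pers R (\<lambda>i. tot_mod (lev.C i) (int p + int q)) (\<lambda>i. pdc.tot_\<phi> i (int p + int q)) (Z2 p q)"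

lemma subquotient_Z2_B2:
  "subquotient R (\<lambda>i. tot_mod (lev.C i) (int p + int q)) (\<lambda>i. pdc.tot_\<phi> i (int p + int q)) (Z2 p q) (B2 p q)"
  by (rule pdc.fp.subquotient_ZB) simp

lemma hom_Z2:
  "mod_hom R ((tot_mod (lev.C i) (int p + int q))\<lparr>carrier := Z2 p q i\<rparr>) ((fam.W p q i)\<lparr>carrier := fam.Z_prod p q i\<rparr>) (\<lambda>x. x p)"
proof (rule mod_hom_restrict)
  show "mod_hom R (tot_mod (lev.C i) (int p + int q)) (fam.W p q i) (\<lambda>x. x p)"
    unfolding W_eq by (rule hom_component_total)
  show "Z2 p q i \<subseteq> carrier (tot_mod (lev.C i) (int p + int q))"
    using pdc.adc.tot.Z_closed by blast
  show "(\<lambda>x. x p) ` Z2 p q i \<subseteq> fam.Z_prod p q i" unfolding Z2_component by blast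
qed

lemma persistence_Z2:
  "persistence R (\<lambda>i. (tot_mod (lev.C i) (int p + int q))\<lparr>carrier := Z2 p q i\<rparr>) (\<lambda>i. pdc.tot_\<phi> i (int p + int q))"
  by (rule subpersistence.persistence_sub[OF subquotient.axioms(1)[OF subquotient_Z2_B2]])

lemma hom_SZ: "mod_hom (UP R) (SZ p q) (SP p q) (\<lambda>x i. x i p)"
proof -
  have "(\<lambda>x i. x i p) \<in> gmod_hom R (SZ p q) (SP p q)"
    unfolding sub_pers_def
  proof (rule gmod_hom_pers[where h = "\<lambda>i x. x p", OF persistence_Z2 fam.prod.persistence_sub hom_Z2])
    show "pdc.tot_\<phi> i (int p + int q) x p = fam.\<phi>_prod p q i (x p)" for i x
      unfolding \<phi>_prod_eq pdc.tot_\<phi>_def total_degree by simp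
  qed
  then show ?thesis by (simp add: gmod_hom_iff)
qed

lemma hom_second: "mod_hom (UP R) (SZ p q) (GP p q) (second p q)"
  unfolding second_def[abs_def] by (rule mod_hom_comp[OF hom_SZ fam.hom_cls])

lemma cech_cocycle_iff:
  assumes w: "w \<in> carrier (SP p q)"
  shows "D p q (fam.cls p q w) = \<zero>\<^bsub>GP (Suc p) q\<^esub> \<longleftrightarrow> (\<forall>i. w i \<in> (\<lambda>x. x p) ` Z2 p q i)"
proof -
  have wi: "w i \<in> fam.Z_prod p q i" for i using w by (simp add: fam.SP_carrier_iff)
  show ?thesis
    unfolding cech_diff_cls[OF w] fam.cls_eq_zero_iff[OF mod_hom_closed[OF hom_dl_SP w]] Z2_component
    using wi by blast
qed

lemma cls_image_gker:
  assumes "V \<subseteq> carrier (SP p q)"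
  shows "fam.cls p q ` {w \<in> V. \<forall>i. w i \<in> (\<lambda>x. x p) ` Z2 p q i} =
    fam.cls p q ` V \<inter> gker (GP p q) (GP (Suc p) q) (D p q)"
  using assms cech_cocycle_iff[of _ p q] mod_hom_closed[OF fam.hom_cls, of _ p q] by (auto simp: gker_def)

text \<open>A Cech cocycle is represented by a family whose member in every degree is the column-p
  part of an element of Z_2. \<open>pers_map_image\<close> lifts such a family to one of total
  cochains with finite support.\<close>

lemma second_image:
  "second p q ` carrier (SZ p q) = gker (GP p q) (GP (Suc p) q) (D p q)"
  "second p q ` gr (SZ p q) j = gr (GP p q) j \<inter> gker (GP p q) (GP (Suc p) q) (D p q)"
proof -
  have im: "second p q ` V = fam.cls p q ` ((\<lambda>x i. x i p) ` V)" for V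
    by (simp add: second_def image_image)
  note maps = pers_map_image[where h = "\<lambda>i x. x p", OF persistence_Z2 fam.prod.persistence_sub hom_Z2, folded sub_pers_def, simplified]
  show "second p q ` carrier (SZ p q) = gker (GP p q) (GP (Suc p) q) (D p q)"
    unfolding im maps(1) cls_image_gker[OF order_refl] fam.cls_carrier by (auto simp: gker_def)
  show "second p q ` gr (SZ p q) j = gr (GP p q) j \<inter> gker (GP p q) (GP (Suc p) q) (D p q)"
    unfolding im maps(2) cls_image_gker[OF fam.prod.gr_sub_pers_subset] fam.cls_gr ..
qed

definition cech_bd :: "nat \<Rightarrow> nat \<Rightarrow> ('a list \<Rightarrow> int \<Rightarrow> ('x chain \<Rightarrow> 'r) set) set" where
  "cech_bd p q = (case p of 0 \<Rightarrow> {\<zero>\<^bsub>GP 0 q\<^esub>} | Suc k \<Rightarrow> D k q ` carrier (GP k q))"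

lemma submodule_cech_bd: "submodule (cech_bd p q) (UP R) (GP p q)"
proof (cases p)
  case 0
  then show ?thesis by (simp add: cech_bd_def submodule_zero_singleton[OF fam.module_GP])
next
  case (Suc k)
  then show ?thesis
    using submodule_image[OF fam.module_GP fam.module_GP hom_cech_diff module.carrier_is_submodule[OF fam.module_GP]]
    by (simp add: cech_bd_def)
qed

lemma SZ_Z2: "x \<in> carrier (SZ p q) \<Longrightarrow> x i \<in> Z2 p q i"
  by (simp add: sub_pers_def pers_gmodule_def)

text \<open>A Cech coboundary needs one finitely supported family of cocycles, whereas membership in
  B_2 provides a cocycle in each degree separately. The work is in collecting the separate choices
  into a finitely supported family.\<close>

lemma second_bd_iff:
  assumes x: "x \<in> carrier (SZ p q)"
  shows "second p q x \<in> cech_bd p q \<longleftrightarrow> (\<forall>i. x i \<in> B2 p q i)"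
proof -
  define w where "w i = x i p" for i
  have w: "w \<in> carrier (SP p q)" using mod_hom_closed[OF hom_SZ x] by (simp add: w_def[abs_def])
  have sec: "second p q x = fam.cls p q w" by (simp add: second_def w_def[abs_def])
  note B2 = B2_iff[OF SZ_Z2[OF x], folded w_def]
  show ?thesis
  proof (cases p)
    case 0
    have "w i xs \<ominus>\<^bsub>CC i q xs\<^esub> \<zero>\<^bsub>lev.P i p q\<^esub> xs = w i xs" if xs: "xs \<in> I p" for i xs
    proof -
      interpret CC: module R "CC i q xs" by (rule lev.module_CC)
      have "w i \<in> carrier (lev.P i p q)" using w by (simp add: fam.SP_carrier_iff Z_prod_iff)
      from lev.P_closed[OF this xs] show ?thesis by (simp add: lev.P_zero[OF xs] CC.minus_eq)
    qed
    then have "(\<forall>i. x i \<in> B2 p q i) \<longleftrightarrow> (\<forall>i. \<forall>xs\<in>I p. w i xs \<in> coboundaries R q (TT i xs))"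
      unfolding B2 using 0 by (simp add: hor_bd_simps)
    then show ?thesis unfolding sec using fam.cls_eq_zero_iff[OF w] 0 by (simp add: cech_bd_def)
  next
    case (Suc k)
    have "fam.cls p q w \<in> cech_bd p q \<longleftrightarrow> (\<exists>v\<in>carrier (SP k q). fam.cls p q w = fam.cls p q (\<lambda>i. lev.dl i k q (v i)))"
    proof -
      have "cech_bd p q = D k q ` fam.cls k q ` carrier (SP k q)" by (simp add: Suc cech_bd_def fam.cls_carrier)
      also have "\<dots> = (\<lambda>v. fam.cls p q (\<lambda>i. lev.dl i k q (v i))) ` carrier (SP k q)"
        unfolding image_image Suc by (intro image_cong refl cech_diff_cls)
      finally show ?thesis by blast
    qed
    also have "\<dots> \<longleftrightarrow> (\<exists>v\<in>carrier (SP k q). \<forall>i. \<forall>xs\<in>I p. w i xs \<ominus>\<^bsub>CC i q xs\<^esub> lev.dl i k q (v i) xs \<in> coboundaries R q (TT i xs))"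
    proof (intro bex_cong refl)
      fix v assume "v \<in> carrier (SP k q)"
      then have "(\<lambda>i. lev.dl i k q (v i)) \<in> carrier (SP p q)" using mod_hom_closed[OF hom_dl_SP] Suc by simp
      from fam.cls_eq_iff[OF w this]
      show "fam.cls p q w = fam.cls p q (\<lambda>i. lev.dl i k q (v i)) \<longleftrightarrow>
        (\<forall>i. \<forall>xs\<in>I p. w i xs \<ominus>\<^bsub>CC i q xs\<^esub> lev.dl i k q (v i) xs \<in> coboundaries R q (TT i xs))" .
    qed
    also have "\<dots> \<longleftrightarrow> (\<forall>i. \<exists>v\<in>fam.Z_prod k q i. \<forall>xs\<in>I p. w i xs \<ominus>\<^bsub>CC i q xs\<^esub> lev.dl i k q v xs \<in> coboundaries R q (TT i xs))"
      (is "_ \<longleftrightarrow> (\<forall>i. \<exists>v\<in>_. ?P i v)")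
    proof
      assume "\<exists>v\<in>carrier (SP k q). \<forall>i. ?P i (v i)"
      then obtain v where v: "v \<in> carrier (SP k q)" "\<forall>i. ?P i (v i)" ..
      show "\<forall>i. \<exists>v\<in>fam.Z_prod k q i. ?P i v"
      proof
        fix i
        have "v i \<in> fam.Z_prod k q i" using v(1) unfolding fam.SP_carrier_iff by simp
        with v(2) show "\<exists>v\<in>fam.Z_prod k q i. ?P i v" by (intro bexI[of _ "v i"]) simp_all
      qed
    next
      assume "\<forall>i. \<exists>v\<in>fam.Z_prod k q i. ?P i v"
      then have "\<forall>i. \<exists>v. v \<in> fam.Z_prod k q i \<and> ?P i v" by blast
      then obtain v where v: "\<forall>i. v i \<in> fam.Z_prod k q i \<and> ?P i (v i)" by (rule choice[THEN exE])
      \<comment> \<open>Where \<open>w\<close> vanishes the chosen preimage is replaced by 0, to get finite support.\<close>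
      define u where "u i = (if w i = \<zero>\<^bsub>lev.P i p q\<^esub> then \<zero>\<^bsub>lev.P i k q\<^esub> else v i)" for i
      have "{i. u i \<noteq> \<zero>\<^bsub>lev.P i k q\<^esub>} \<subseteq> {i. w i \<noteq> \<zero>\<^bsub>lev.P i p q\<^esub>}" by (auto simp: u_def)
      moreover have "finite {i. w i \<noteq> \<zero>\<^bsub>lev.P i p q\<^esub>}" using w unfolding fam.SP_carrier_iff unfolding W_eq by blast
      ultimately have "finite {i. u i \<noteq> \<zero>\<^bsub>lev.P i k q\<^esub>}" by (rule finite_subset)
      moreover have "u i \<in> fam.Z_prod k q i" for i using v by (simp add: u_def Z_prod_iff lev.zero_P lev.dv_zero)
      ultimately have "u \<in> carrier (SP k q)" unfolding fam.SP_carrier_iff unfolding W_eq by blast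
      moreover have "?P i (u i)" for i
      proof (cases "w i = \<zero>\<^bsub>lev.P i p q\<^esub>")
        case True
        show ?thesis
        proof
          fix xs assume xs: "xs \<in> I p"
          interpret CC: module R "CC i q xs" by (rule lev.module_CC)
          have "lev.dl i k q (u i) = \<zero>\<^bsub>lev.P i p q\<^esub>" using True Suc by (simp add: u_def lev.dl_zero)
          then have "w i xs \<ominus>\<^bsub>CC i q xs\<^esub> lev.dl i k q (u i) xs = \<zero>\<^bsub>CC i q xs\<^esub>"
            using True by (simp add: lev.P_zero[OF xs] CC.minus_eq)
          then show "w i xs \<ominus>\<^bsub>CC i q xs\<^esub> lev.dl i k q (u i) xs \<in> coboundaries R q (TT i xs)"
            using submodule_zero[OF lev.R.submodule_coboundaries] by simp
        qed
      next
        case False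
        then show ?thesis using v by (simp add: u_def)
      qed
      ultimately show "\<exists>v\<in>carrier (SP k q). \<forall>i. ?P i (v i)" by blast
    qed
    also have "\<dots> \<longleftrightarrow> (\<forall>i. x i \<in> B2 p q i)"
      unfolding B2 using Suc by (simp add: hor_bd_simps)
    finally show ?thesis unfolding sec .
  qed
qed

lemma cech_bd_subset: "cech_bd p q \<subseteq> gker (GP p q) (GP (Suc p) q) (D p q)"
proof
  fix u assume u: "u \<in> cech_bd p q"
  show "u \<in> gker (GP p q) (GP (Suc p) q) (D p q)"
  proof (cases p)
    case 0
    interpret G: module "UP R" "GP 0 q" by (rule fam.module_GP)
    show ?thesis
      using u mod_hom_zero[OF fam.module_GP fam.module_GP hom_cech_diff] by (simp add: 0 cech_bd_def gker_def)
  next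
    case (Suc k)
    then have "u \<in> D k q ` fam.cls k q ` carrier (SP k q)" using u by (simp add: cech_bd_def fam.cls_carrier)
    then obtain w where w: "w \<in> carrier (SP k q)" and uw: "u = D k q (fam.cls k q w)" by (elim imageE) simp
    note dw = mod_hom_closed[OF hom_dl_SP w]
    have u': "u = fam.cls p q (\<lambda>i. lev.dl i k q (w i))" using cech_diff_cls[OF w] by (simp add: uw Suc)
    have zero: "lev.dl i (Suc k) q (lev.dl i k q (w i)) xs \<in> coboundaries R q (TT i xs)" if "xs \<in> I (Suc (Suc k))" for i xs
      using lev.dl_dl[of "w i" i k q] w lev.P_zero[OF that] submodule_zero[OF lev.R.submodule_coboundaries]
      by (simp add: fam.SP_carrier_iff Z_prod_iff)
    have "D p q u = \<zero>\<^bsub>GP (Suc p) q\<^esub>"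
      unfolding u' Suc cech_diff_cls[OF dw] fam.cls_eq_zero_iff[OF mod_hom_closed[OF hom_dl_SP dw]]
      using zero by blast
    moreover have "u \<in> carrier (GP p q)" using mod_hom_closed[OF fam.hom_cls dw] by (simp add: u' Suc)
    ultimately show ?thesis by (simp add: gker_def)
  qed
qed

lemma cech_cohom_eq:
  "cech_cohom L A U (F q) p = gquot (gsub (GP p q) (gker (GP p q) (GP (Suc p) q) (D p q))) (cech_bd p q)"
  unfolding cech_cohom_def cech_cochains_eq cech_bd_def by (rule refl)

theorem second_page_cech:
  "gmod_iso R (pdc.fp.page 2 (int p + int q) (int p)) (cech_cohom L A U (F q) p)"
proof -
  have "gmod_iso R (quot_pers R (\<lambda>i. tot_mod (lev.C i) (int p + int q)) (\<lambda>i. pdc.tot_\<phi> i (int p + int q)) (Z2 p q) (B2 p q))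
      (gquot (gsub (GP p q) (gker (GP p q) (GP (Suc p) q) (D p q))) (cech_bd p q))"
  proof (rule subquotient.gmod_iso_gquot_quot_pers(2)[where M = "GP p q" and B' = "cech_bd p q"
        and Z' = "gker (GP p q) (GP (Suc p) q) (D p q)" and g = "second p q", OF subquotient_Z2_B2])
    show "second p q x \<in> cech_bd p q \<longleftrightarrow> (\<forall>i. x i \<in> B2 p q i)" if "x \<in> carrier (SZ p q)" for x
      using that by (rule second_bd_iff)
  qed (rule fam.module_GP submodule_cech_bd cech_bd_subset hom_second second_image)+
  then show ?thesis unfolding cech_cohom_eq pdc.fp.page_def .
qed

end

text \<open>The extended filtration is constant below 0 and empty from \<open>N\<close> on; in
  between the given inclusions apply, with \<open>K_0\<close> needed at i = 0, where the extension
  is \<open>topspace X\<close> by definition.\<close>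

lemma filt_ext_decr:
  assumes K_0: "K 0 = topspace X" and K_decr: "\<And>i. i < N \<Longrightarrow> K (Suc i) \<subseteq> K i"
  shows "filt_ext X K N (i + 1) \<subseteq> filt_ext X K N i"
proof -
  consider "i < 0" | "0 \<le> i" "int N \<le> i + 1" | "0 \<le> i" "i + 1 < int N" by linarith
  then show ?thesis
  proof cases
    case 3
    have "K (Suc (nat i)) \<subseteq> K (nat i)" using 3 by (intro K_decr) linarith
    then show ?thesis using 3 K_0 by (cases "i = 0") (auto simp: filt_ext_def nat_add_distrib)
  qed (auto simp: filt_ext_def)
qed

theorem theorem2p2:
  fixes R :: "('r, 'z) ring_scheme"
    and X :: "'x topology" and Y :: "'y topology" and f :: "'x \<Rightarrow> 'y"
    and A :: "'a set" and L :: "('a \<times> 'a) set" and U :: "'a \<Rightarrow> 'y set"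
    and K :: "nat \<Rightarrow> 'x set" and N :: nat
  assumes R: "cring R"
    and f: "continuous_map X Y f"
    and U_open: "\<And>a. a \<in> A \<Longrightarrow> openin Y (U a)"
    and U_cover: "(\<Union>a\<in>A. U a) = topspace Y"
    and U_lf: "locally_finite_family X A (\<lambda>a. {x \<in> topspace X. f x \<in> U a})"
    and L: "linear_order_on A L"
    and K_0: "K 0 = topspace X"
    and K_decr: "\<And>i. i < N \<Longrightarrow> K (Suc i) \<subseteq> K i"
    and K_N: "K N = {}"
  shows "\<exists>(E :: nat \<Rightarrow> int \<Rightarrow> int \<Rightarrow>
              (nat \<Rightarrow> 'r, int \<Rightarrow> (nat \<Rightarrow> 'a list \<Rightarrow> 'x chain \<Rightarrow> 'r) set) gmodule) d.
     spectral_sequence R E d \<and>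
     (\<forall>p q. gmod_iso R (E 2 (int p) (int q))
        (cech_cohom L A U (pers_presheaf R q X (filt_ext X K N) f) p)) \<and>
     converges_to R E (\<lambda>n. pers_cohom R n X (filt_ext X K N))"
proof -
  have "cech_level R X f A L U"
  proof (rule cech_level.intro[OF R L])
    show "openin X {x \<in> topspace X. f x \<in> U a}" if "a \<in> A" for a
      using f U_open[OF that] by (rule openin_continuous_map_preimage)
    show "\<exists>a\<in>A. f x \<in> U a" if "x \<in> topspace X" for x
      using continuous_map_image_subset_topspace[OF f] that U_cover by blast
  qed
  then interpret cech_persistence R X f A L U "filt_ext X K N"
    by (rule cech_persistence.intro) (rule filt_ext_decr[OF K_0 K_decr])
  \<comment> \<open>Written with \<open>int 2\<close> so that it matches the value at r = 2 of the
    family of pages, which is indexed through \<open>int r\<close>.\<close>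
  have "\<forall>p q. gmod_iso R (pdc.fp.page (int 2) (int p + int q) (int p))
      (cech_cohom L A U (pers_presheaf R q X (filt_ext X K N) f) p)"
    using second_page_cech by simp
  with pdc.fp.spectral_sequence_pages converges_pers_cohom show ?thesis by blast
qed

end
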